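(* Let $M$ be a compact, connected, oriented, irreducible smooth 3-manifold with boundary $\partial M=\bigsqcup_{h=1}^k B_h$, $k\ge 0$, each $B_h\cong T^2$ a torus. Let $T=\bigsqcup_{i=1}^m T_i\subseteq M$ be a JSJ decomposition of $M$ with JSJ components $M_1,\dots,M_n$, and let $\overline{G}$ be the associated decorated $1$-dimensional $\Delta$-complex. Then there are exact sequences \[ 1\to \overline{\mathrm{Diff}}^+(M,(B_h),(T_i),(M_j))\to \mathrm{Diff}^+(M,T)\to \mathrm{Aut}(\overline{G}), \] \[ 1\to \pi_0\overline{\mathrm{Diff}}^+(M,(B_h),(T_i),(M_j))\to \pi_0\mathrm{Diff}^+(M,T)\to \mathrm{Aut}(\overline{G}). \]
   Context: A 3-manifold is irreducible if every embedded 2-sphere bounds a 3-ball. It is atoroidal if every incompressible torus is boundary parallel. A compact orientable 3-manifold with (possibly empty) toroidal boundary is Seifert fibred if it decomposes into disjoint circles, each interior circle having a saturated neighbourhood equivalent to a standard fibred solid torus (the mapping torus of a rotation of $D^2$ by angle $2\pi b/a$ with $\gcd(a,b)=1$, decomposed into the circles formed by its flow lines), and each boundary circle having a trivially fibred half-disc times circle neighbourhood. A JSJ decomposition of $M$ is a minimal submanifold $T=\bigsqcup_{i=1}^m T_i\subseteq M$ ($m\ge 0$) such that each $T_i$ is an incompressible torus and each component of $M$ cut along $T$ is Seifert fibred or atoroidal. The components $M_1,\dots,M_n$ of $M$ cut along $T$ are the JSJ components. $\mathrm{Diff}^+(M)$ is the topological group of orientation-preserving diffeomorphisms of $M$ ($C^\infty$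 topology); $\mathrm{Diff}^+(M,T)=\{f\in\mathrm{Diff}^+(M)\mid f(T)=T\}$; $\mathrm{Diff}^+(M,(B_h),(T_i),(M_j))=\{f\in\mathrm{Diff}^+(M,T)\mid f(B_h)=B_h,\ f(T_i)=T_i,\ f(M_j)=M_j \text{ for all } h,i,j\}$; and $\overline{\mathrm{Diff}}^+(M,(B_h),(T_i),(M_j))$ is its subgroup of those $f$ for which $f|_{T_i}\colon T_i\to T_i$ is orientation preserving for every $i$. $G=(V,E,\alpha)$ is the undirected, not necessarily simple, vertex-decorated graph with $V=\{M_j\mid 1\le j\le n\}\cup\{*\}$ and $E=\{B_h\mid 1\le h\le k\}\cup\{T_i\mid 1\le i\le m\}$. The decoration is $\alpha(M_j)=$ the diffeomorphism class of $M_j$, and $\alpha( * )=\emptyset$. The edge $B_h$ connects $*$ to $M_j$ if $B_h$ is a boundary component of $M_j$; the edge $T_i$ connects the vertices corresponding to the components on its two sides (which may be equal, giving a loop). $\overline{G}$ is the decorated $1$-dimensional $\Delta$-complex that is the geometric realisation of $G$. An automorphism of $\overline{G}$ is an automorphism of $G$ (permutations of $V$ and $E$ preserving incidence and decoration) together with, for each loop, the information of how its two ends are mapped to the two ends of its image loop; thus there is a short exact sequence $1\to(\mathbb{Z}/2)^\ell\to\mathrm{Aut}(\overline{G})\to\mathrm{Aut}(G)\to 1$, where $\ell$ is the number of loops of $G$ and the standard generators of $(\mathbb{Z}/2)^\ell$ reverse a single loop and fix all other simplices. The first maps are induced by inclusion. For the maps to $\mathrm{Aut}(\overline{G})$: for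 each $T_i$ corresponding to a loop fix a bijection between the two orientations of the normal bundle of $T_i$ and the two orientations of the loop; a diffeomorphism then acts on $\overline{G}$ by permuting the $B_h,T_i,M_j$ and acting on orientations of loops through its action on normal orientations. *)

theory Defs
  imports "HOL-Analysis.Analysis" "HOL-Algebra.Bij" "HOL-Algebra.Coset"
begin

section \<open>Smooth manifolds with boundary\<close>

text \<open>\<open>Ck_on k S f\<close> is meant for open \<open>S\<close>.\<close>

primrec Ck_on :: "nat \<Rightarrow> 'e set \<Rightarrow> ('e::euclidean_space \<Rightarrow> 'f::real_normed_vector) \<Rightarrow> bool" where
  "Ck_on 0 S f \<longleftrightarrow> continuous_on S f"
| "Ck_on (Suc k) S f \<longleftrightarrow>
     f differentiable_on S \<and> (\<forall>v. Ck_on k S (\<lambda>x. frechet_derivative f (at x) v))"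

text \<open>On an arbitrary set (a relatively open subset of a half-space, a sphere, \<dots>) a map is smooth
  if locally it extends to a smooth map on an open subset of the ambient Euclidean space.\<close>

definition smooth_on :: "'e::euclidean_space set \<Rightarrow> ('e \<Rightarrow> 'f::real_normed_vector) \<Rightarrow> bool" where
  "smooth_on A f \<longleftrightarrow>
     (\<forall>x\<in>A. \<exists>W g. open W \<and> x \<in> W \<and> (\<forall>k. Ck_on k W g) \<and> (\<forall>y\<in>A \<inter> W. g y = f y))"

type_synonym ('a, 'e) chart = "'a set \<times> ('a \<Rightarrow> 'e)"

text \<open>The dimension of a manifold is the dimension of the model space \<open>'e\<close>. The atlas need
  not be maximal.\<close>

record ('a, 'e) mfd =
  mtop :: "'a topology"
  charts :: "('a, 'e) chart set"

abbreviation points :: "('a, 'e) mfd \<Rightarrow> 'a set" where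
  "points M \<equiv> topspace (mtop M)"

definition loc_rep :: "('a, 'e) chart \<Rightarrow> ('b, 'f) chart \<Rightarrow> ('a \<Rightarrow> 'b) \<Rightarrow> 'e \<Rightarrow> 'f" where
  "loc_rep c c' f = snd c' \<circ> f \<circ> inv_into (fst c) (snd c)"

definition loc_dom :: "('a, 'e) chart \<Rightarrow> ('b, 'f) chart \<Rightarrow> ('a \<Rightarrow> 'b) \<Rightarrow> 'e set" where
  "loc_dom c c' f = snd c ` (fst c \<inter> f -` fst c')"

text \<open>Derivative at the point \<open>x\<close> of the coordinate expression of \<open>f\<close>. It is taken within
  the domain of this expression, so that it makes sense at boundary points, too.\<close>

definition loc_deriv ::
  "('a, 'e::euclidean_space) chart \<Rightarrow> ('b, 'f::euclidean_space) chart \<Rightarrow> ('a \<Rightarrow> 'b) \<Rightarrow> 'a \<Rightarrow> 'e \<Rightarrow> 'f"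
where
  "loc_deriv c c' f x = frechet_derivative (loc_rep c c' f) (at (snd c x) within loc_dom c c' f)"

definition is_chart :: "'a topology \<Rightarrow> ('a, 'e::euclidean_space) chart \<Rightarrow> bool" where
  "is_chart X c \<longleftrightarrow> openin X (fst c) \<and>
     homeomorphic_map (subtopology X (fst c)) (top_of_set (snd c ` fst c)) (snd c) \<and>
     (open (snd c ` fst c) \<or>
      (\<exists>u. u \<noteq> 0 \<and> openin (top_of_set {x. 0 \<le> u \<bullet> x}) (snd c ` fst c)))"

definition manifold :: "('a, 'e::euclidean_space) mfd \<Rightarrow> bool" where
  "manifold M \<longleftrightarrow> Hausdorff_space (mtop M) \<and> second_countable (mtop M) \<and>
     (\<forall>c\<in>charts M. is_chart (mtop M) c) \<and> \<Union> (fst ` charts M) = points M \<and>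
     (\<forall>c\<in>charts M. \<forall>c'\<in>charts M. smooth_on (loc_dom c c' (\<lambda>x. x)) (loc_rep c c' (\<lambda>x. x)))"

definition boundary :: "('a, 'e::euclidean_space) mfd \<Rightarrow> 'a set" where
  "boundary M = {x. \<exists>c\<in>charts M. x \<in> fst c \<and> snd c x \<notin> interior (snd c ` fst c)}"

definition eucl :: "('e::euclidean_space, 'e) mfd" where
  "eucl = \<lparr>mtop = euclidean, charts = {(UNIV, \<lambda>x. x)}\<rparr>"

text \<open>Smoothness of a map between arbitrary subsets of manifolds: near each point of \<open>A\<close> the
  coordinate expression of \<open>f\<close> on \<open>A\<close> extends to a smooth map. The image of a compact manifold
  under a diffeomorphism (in this sense) onto a subset is precisely the image of a smooth
  embedding; so for instance \<open>S \<subseteq> M\<close> is a smoothly embedded sphere iff it is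
  diffeomorphic to the unit sphere in Euclidean space.\<close>

definition smooth_map ::
  "('a, 'e::euclidean_space) mfd \<Rightarrow> 'a set \<Rightarrow> ('b, 'f::euclidean_space) mfd \<Rightarrow> ('a \<Rightarrow> 'b) \<Rightarrow> bool"
where
  "smooth_map M A M' f \<longleftrightarrow> A \<subseteq> points M \<and>
     (\<forall>x\<in>A. \<exists>c\<in>charts M. \<exists>c'\<in>charts M'. \<exists>W. openin (mtop M) W \<and> x \<in> W \<and> W \<subseteq> fst c \<and>
        f ` (A \<inter> W) \<subseteq> fst c' \<and> smooth_on (snd c ` (A \<inter> W)) (loc_rep c c' f))"

definition diffeo ::
  "('a, 'e::euclidean_space) mfd \<Rightarrow> 'a set \<Rightarrow> ('b, 'f::euclidean_space) mfd \<Rightarrow> 'b set \<Rightarrow> ('a \<Rightarrow> 'b) \<Rightarrow> bool"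
where
  "diffeo M A M' A' f \<longleftrightarrow> bij_betw f A A' \<and> smooth_map M A M' f \<and> smooth_map M' A' M (inv_into A f)"


section \<open>Orientations\<close>

definition orientation_preserving_wrt :: "('a, real^'n) chart set \<Rightarrow> ('a \<Rightarrow> 'a) \<Rightarrow> bool" where
  "orientation_preserving_wrt A f \<longleftrightarrow>
     (\<forall>c\<in>A. \<forall>c'\<in>A. \<forall>x\<in>fst c. f x \<in> fst c' \<longrightarrow> 0 < det (matrix (loc_deriv c c' f x)))"

text \<open>An oriented manifold is one whose atlas consists of positively oriented charts.\<close>

definition oriented_manifold :: "('a, real^'n) mfd \<Rightarrow> bool" where
  "oriented_manifold M \<longleftrightarrow> manifold M \<and> orientation_preserving_wrt (charts M) (\<lambda>x. x)"

text \<open>An orientation of an embedded closed surface \<open>S\<close>, given by an oriented atlas of \<open>S\<close>.\<close>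

definition surface_orientation :: "('a, real^'n) mfd \<Rightarrow> 'a set \<Rightarrow> ('a, real^2) chart set \<Rightarrow> bool" where
  "surface_orientation M S A \<longleftrightarrow>
     (\<forall>c\<in>A. openin (subtopology (mtop M) S) (fst c) \<and> open (snd c ` fst c) \<and>
        diffeo M (fst c) eucl (snd c ` fst c) (snd c)) \<and>
     \<Union> (fst ` A) = S \<and> orientation_preserving_wrt A (\<lambda>x. x)"

text \<open>For connected \<open>S\<close> the choice of the orientation does not matter.\<close>

definition preserves_surface_orientation :: "('a, real^'n) mfd \<Rightarrow> 'a set \<Rightarrow> ('a \<Rightarrow> 'a) \<Rightarrow> bool" where
  "preserves_surface_orientation M S f \<longleftrightarrow>
     f ` S = S \<and> (\<exists>A. surface_orientation M S A \<and> orientation_preserving_wrt A f)"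

text \<open>A tangent vector of \<open>M\<close> at \<open>x\<close> is written as \<open>(x, c, v)\<close>, where \<open>v\<close> is its
  coordinate vector with respect to a chart \<open>c\<close> around \<open>x\<close>; a set of tangent vectors is a set of such
  triples that is closed under change of charts. \<open>push M f\<close> is the image of such a set under
  the differential of \<open>f\<close>.\<close>

type_synonym ('a, 'e) tangent = "'a \<times> ('a, 'e) chart \<times> 'e"

definition push :: "('a, 'e::euclidean_space) mfd \<Rightarrow> ('a \<Rightarrow> 'a) \<Rightarrow> ('a, 'e) tangent set \<Rightarrow> ('a, 'e) tangent set"
where
  "push M f P = {(f x, c', loc_deriv c c' f x v) | x c v c'.
      (x, c, v) \<in> P \<and> c' \<in> charts M \<and> f x \<in> fst c'}"

text \<open>Coordinates of the tangent space of the submanifold \<open>S\<close> at \<open>x\<close>.\<close>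

definition tangent_coords :: "'a set \<Rightarrow> ('a, 'e::euclidean_space) chart \<Rightarrow> 'a \<Rightarrow> 'e set" where
  "tangent_coords S c x = {v. \<exists>\<gamma>::real \<Rightarrow> 'a. \<gamma> 0 = x \<and> range \<gamma> \<subseteq> S \<inter> fst c \<and>
      ((snd c \<circ> \<gamma>) has_vector_derivative v) (at 0)}"

text \<open>An orientation of the normal bundle \<open>TM|S / TS\<close> of a surface \<open>S\<close> in the interior of
  \<open>M\<close> selects continuously in \<open>x \<in> S\<close> one of the two rays of the normal line at \<open>x\<close>. It is
  represented by the set \<open>P\<close> of all tangent vectors of \<open>M\<close> at points of \<open>S\<close> that represent
  an element of the selected open ray; \<open>n\<close> is a local normal field that generates the rays.\<close>

definition normal_orientation ::
  "('a, 'e::euclidean_space) mfd \<Rightarrow> 'a set \<Rightarrow> ('a, 'e) tangent set \<Rightarrow> bool"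
where
  "normal_orientation M S P \<longleftrightarrow>
     P \<subseteq> {(x, c, v). x \<in> S \<and> c \<in> charts M \<and> x \<in> fst c} \<and>
     push M (\<lambda>x. x) P \<subseteq> P \<and>
     (\<forall>c\<in>charts M. \<forall>x\<in>S \<inter> fst c. \<exists>W n. openin (mtop M) W \<and> x \<in> W \<and> W \<subseteq> fst c \<and>
        continuous_map (subtopology (mtop M) (S \<inter> W)) euclidean n \<and>
        (\<forall>y\<in>S \<inter> W. n y \<notin> tangent_coords S c y \<and>
           {v. (y, c, v) \<in> P} = {t + a *\<^sub>R n y | t a. t \<in> tangent_coords S c y \<and> 0 < a}))"


section \<open>Three-manifold topology\<close>

text \<open>In the following a set \<open>C\<close> of points of \<open>M\<close> is a union of components of \<open>M\<close>, considered as a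
  manifold in its own right.\<close>

definition irreducible_mfd :: "('a, real^3) mfd \<Rightarrow> bool" where
  "irreducible_mfd M \<longleftrightarrow>
     (\<forall>S h. diffeo eucl (sphere (0::real^3) 1) M S h \<longrightarrow>
        (\<exists>B g. diffeo eucl (cball (0::real^3) 1) M B g \<and> g ` sphere 0 1 = S))"

abbreviation std_circle :: "complex set" where "std_circle \<equiv> sphere 0 1"
abbreviation std_disc :: "complex set" where "std_disc \<equiv> cball 0 1"
abbreviation std_torus :: "(complex \<times> complex) set" where "std_torus \<equiv> std_circle \<times> std_circle"

definition is_torus :: "('a, 'e::euclidean_space) mfd \<Rightarrow> 'a set \<Rightarrow> bool" where
  "is_torus M S \<longleftrightarrow> (\<exists>h. diffeo eucl std_torus M S h)"

text \<open>An incompressible torus lies in the interior and has no compressing discs.\<close>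

definition incompressible_torus :: "('a, real^3) mfd \<Rightarrow> 'a set \<Rightarrow> 'a set \<Rightarrow> bool" where
  "incompressible_torus M C S \<longleftrightarrow> is_torus M S \<and> S \<subseteq> C - boundary M \<and>
     (\<forall>D h. diffeo eucl std_disc M D h \<and> D \<subseteq> C \<and> D \<inter> S = h ` std_circle \<longrightarrow>
        (\<exists>D' h'. diffeo eucl std_disc M D' h' \<and> D' \<subseteq> S \<and> h' ` std_circle = h ` std_circle))"

definition boundary_components :: "('a, 'e::euclidean_space) mfd \<Rightarrow> 'a set set" where
  "boundary_components M = connected_components_of (subtopology (mtop M) (boundary M))"

definition boundary_parallel :: "('a, real^3) mfd \<Rightarrow> 'a set \<Rightarrow> 'a set \<Rightarrow> bool" where
  "boundary_parallel M C S \<longleftrightarrow>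
     (\<exists>P h. P \<subseteq> C \<and> diffeo eucl (std_torus \<times> {0..1::real}) M P h \<and>
        h ` (std_torus \<times> {0}) = S \<and> h ` (std_torus \<times> {1}) \<in> boundary_components M)"

definition atoroidal :: "('a, real^3) mfd \<Rightarrow> 'a set \<Rightarrow> bool" where
  "atoroidal M C \<longleftrightarrow> (\<forall>S. incompressible_torus M C S \<longrightarrow> boundary_parallel M C S)"

text \<open>The mapping torus of the rotation \<open>\<rho>\<close> of the disc by the angle \<open>\<theta> = 2 \<pi> b / a\<close>, i.e. the quotient
  of \<open>D\<^sup>2 \<times> \<real>\<close> by \<open>(z, t) \<sim> (\<rho> z, t - 1)\<close>, is identified with \<open>S\<^sup>1 \<times> D\<^sup>2\<close> by
  \<open>[z, t] \<mapsto> (exp (2 \<pi> i t), exp (i \<theta> t) z)\<close>. The flow lines are the images of \<open>{z} \<times> \<real>\<close>.\<close>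

definition solid_torus_fibres :: "int \<Rightarrow> int \<Rightarrow> (complex \<times> complex) set set" where
  "solid_torus_fibres a b =
     {range (\<lambda>t::real. (cis (2 * pi * t), cis (2 * pi * of_int b / of_int a * t) * z)) | z. z \<in> std_disc}"

definition half_disc :: "complex set" where
  "half_disc = {z \<in> std_disc. 0 \<le> Im z}"

text \<open>\<open>c\<close> has a neighbourhood in \<open>C\<close> that is a union of members of \<open>F\<close> and is equivalent to
  the model \<open>P\<close> with its decomposition \<open>Q\<close> into circles.\<close>

definition fibred_nbhd ::
  "('a, real^3) mfd \<Rightarrow> 'a set \<Rightarrow> 'a set set \<Rightarrow> 'a set \<Rightarrow> 'p::euclidean_space set \<Rightarrow> 'p set set \<Rightarrow> bool"
where
  "fibred_nbhd M C F c P Q \<longleftrightarrow>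
     (\<exists>U W h. openin (mtop M) U \<and> c \<subseteq> U \<and> U \<subseteq> W \<and> W \<subseteq> C \<and> diffeo eucl P M W h \<and>
        (\<forall>q\<in>Q. h ` q \<in> F))"

text \<open>Only applied to compact orientable \<open>C\<close> with toroidal boundary.\<close>

definition seifert_fibred :: "('a, real^3) mfd \<Rightarrow> 'a set \<Rightarrow> bool" where
  "seifert_fibred M C \<longleftrightarrow>
     (\<exists>F. \<Union> F = C \<and> pairwise disjnt F \<and>
        (\<forall>c\<in>F. \<exists>h. diffeo eucl std_circle M c h) \<and>
        (\<forall>c\<in>F.
           c \<inter> boundary M = {} \<and>
             (\<exists>a b. 0 < a \<and> coprime a b \<and>
                fibred_nbhd M C F c (std_circle \<times> std_disc) (solid_torus_fibres a b)) \<or>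
           c \<subseteq> boundary M \<and>
             fibred_nbhd M C F c (half_disc \<times> std_circle) {{z} \<times> std_circle | z. z \<in> half_disc}))"

text \<open>\<open>N\<close>, together with the regluing map \<open>q\<close>, is \<open>M\<close> cut along the closed two-sided surface \<open>T\<close> in
  the interior of \<open>M\<close>. This determines \<open>(N, q)\<close> up to a unique diffeomorphism over \<open>M\<close>.\<close>

definition cut_along ::
  "('a, 'e::euclidean_space) mfd \<Rightarrow> 'a set \<Rightarrow> ('b, 'e) mfd \<Rightarrow> ('b \<Rightarrow> 'a) \<Rightarrow> bool"
where
  "cut_along M T N q \<longleftrightarrow> manifold N \<and> compact_space (mtop N) \<and>
     smooth_map N (points N) M q \<and> q ` points N = points M \<and>
     diffeo N (points N - q -` T) M (points M - T) q \<and>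
     (\<forall>x\<in>T. card {y \<in> points N. q y = x} = 2) \<and>
     points N \<inter> q -` T \<subseteq> boundary N \<and>
     (\<forall>y\<in>points N. \<exists>W. openin (mtop N) W \<and> y \<in> W \<and> diffeo N W M (q ` W) q)"

abbreviation components_mfd :: "('a, 'e) mfd \<Rightarrow> 'a set set" where
  "components_mfd M \<equiv> connected_components_of (mtop M)"

text \<open>A system of tori \<open>\<T>\<close> stands for the submanifold \<open>\<Union> \<T>\<close>, of which it is the set of
  components. The type \<open>'a \<times> bool\<close> is large enough to carry \<open>M\<close> cut along two-sided surfaces.\<close>

definition jsj_cutting_system :: "('a, real^3) mfd \<Rightarrow> 'a set set \<Rightarrow> bool" where
  "jsj_cutting_system M \<T> \<longleftrightarrow> finite \<T> \<and> pairwise disjnt \<T> \<and>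
     (\<forall>S\<in>\<T>. incompressible_torus M (points M) S) \<and>
     (\<exists>(N :: ('a \<times> bool, real^3) mfd) q. cut_along M (\<Union>\<T>) N q \<and>
        (\<forall>C\<in>components_mfd N. seifert_fibred N C \<or> atoroidal N C))"

definition jsj_decomposition :: "('a, real^3) mfd \<Rightarrow> 'a set set \<Rightarrow> bool" where
  "jsj_decomposition M \<T> \<longleftrightarrow>
     jsj_cutting_system M \<T> \<and> (\<forall>\<T>'. \<T>' \<subset> \<T> \<longrightarrow> \<not> jsj_cutting_system M \<T>')"


section \<open>Diffeomorphism groups\<close>

text \<open>Self-maps of \<open>M\<close> are extensional functions, so that equality of diffeomorphisms is
  equality of functions.\<close>

definition Diff :: "('a, 'e::euclidean_space) mfd \<Rightarrow> ('a \<Rightarrow> 'a) set" where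
  "Diff M = {f \<in> extensional (points M). diffeo M (points M) M (points M) f}"

definition Diff_plus :: "('a, real^'n) mfd \<Rightarrow> ('a \<Rightarrow> 'a) set" where
  "Diff_plus M = {f \<in> Diff M. orientation_preserving_wrt (charts M) f}"

definition Diff_plus_rel :: "('a, real^'n) mfd \<Rightarrow> 'a set \<Rightarrow> ('a \<Rightarrow> 'a) set" where
  "Diff_plus_rel M T = {f \<in> Diff_plus M. f ` T = T}"

text \<open>\<open>q ` C\<close> is the piece of \<open>M\<close> given by the component \<open>C\<close> of the cut manifold.\<close>

definition Diff_plus_fix ::
  "('a, real^'n) mfd \<Rightarrow> 'a set set \<Rightarrow> ('b, real^'n) mfd \<Rightarrow> ('b \<Rightarrow> 'a) \<Rightarrow> ('a \<Rightarrow> 'a) set"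
where
  "Diff_plus_fix M \<T> N q = {f \<in> Diff_plus_rel M (\<Union>\<T>).
     (\<forall>B\<in>boundary_components M. f ` B = B) \<and> (\<forall>S\<in>\<T>. f ` S = S) \<and>
     (\<forall>C\<in>components_mfd N. f ` (q ` C) = q ` C)}"

definition Diff_plus_bar ::
  "('a, real^'n) mfd \<Rightarrow> 'a set set \<Rightarrow> ('b, real^'n) mfd \<Rightarrow> ('b \<Rightarrow> 'a) \<Rightarrow> ('a \<Rightarrow> 'a) set"
where
  "Diff_plus_bar M \<T> N q =
     {f \<in> Diff_plus_fix M \<T> N q. \<forall>S\<in>\<T>. preserves_surface_orientation M S f}"

definition diff_group :: "('a, 'e) mfd \<Rightarrow> ('a \<Rightarrow> 'a) set \<Rightarrow> ('a \<Rightarrow> 'a) monoid" where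
  "diff_group M H = (BijGroup (points M))\<lparr>carrier := H\<rparr>"

text \<open>Iterated directional derivatives within \<open>S\<close>.\<close>

primrec iter_deriv :: "'e list \<Rightarrow> 'e set \<Rightarrow> ('e::euclidean_space \<Rightarrow> 'f::real_normed_vector) \<Rightarrow> 'e \<Rightarrow> 'f" where
  "iter_deriv [] S F = F"
| "iter_deriv (v # vs) S F = (\<lambda>x. frechet_derivative (iter_deriv vs S F) (at x within S) v)"

text \<open>The subbasic neighbourhoods of the (weak Whitney) \<open>C\<^sup>\<infinity>\<close> topology: \<open>g\<close> is close to \<open>f\<close> if on
  the compact set \<open>K\<close> the partial derivatives of order \<open>\<le> r\<close> of the coordinate
  expressions are uniformly close.\<close>

definition Cinf_nbhd ::
  "('a, 'e::euclidean_space) mfd \<Rightarrow> ('a \<Rightarrow> 'a) \<Rightarrow> ('a, 'e) chart \<Rightarrow> ('a, 'e) chart \<Rightarrow> 'a set \<Rightarrow> nat \<Rightarrow> real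
     \<Rightarrow> ('a \<Rightarrow> 'a) set"
where
  "Cinf_nbhd M f c c' K r \<epsilon> = {g \<in> Diff M. g ` K \<subseteq> fst c' \<and>
     (\<forall>vs x. set vs \<subseteq> Basis \<and> length vs \<le> r \<and> x \<in> snd c ` K \<longrightarrow>
        norm (iter_deriv vs (loc_dom c c' g) (loc_rep c c' g) x
            - iter_deriv vs (loc_dom c c' f) (loc_rep c c' f) x) < \<epsilon>)}"

definition Cinf_topology :: "('a, 'e::euclidean_space) mfd \<Rightarrow> ('a \<Rightarrow> 'a) topology" where
  "Cinf_topology M = topology_generated_by
     {Cinf_nbhd M f c c' K r \<epsilon> | f c c' K r \<epsilon>.
        f \<in> Diff M \<and> c \<in> charts M \<and> c' \<in> charts M \<and> compactin (mtop M) K \<and>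
        K \<subseteq> fst c \<and> f ` K \<subseteq> fst c' \<and> 0 < \<epsilon>}"

definition diff_topology :: "('a, 'e::euclidean_space) mfd \<Rightarrow> ('a \<Rightarrow> 'a) set \<Rightarrow> ('a \<Rightarrow> 'a) topology" where
  "diff_topology M H = subtopology (Cinf_topology M) H"

text \<open>In a topological group the set of products of two path components is again a path component.\<close>

definition pi0_group :: "'g topology \<Rightarrow> 'g monoid \<Rightarrow> 'g set monoid" where
  "pi0_group X G = \<lparr>carrier = path_components_of X, mult = set_mult G,
      one = path_component_of_set X (one G)\<rparr>"

text \<open>The maps on \<open>\<pi>\<^sub>0\<close> induced by a continuous map into the space \<open>Y\<close>, and by a map that is
  constant on path components (into a discrete group), respectively.\<close>

definition pi0_map :: "'h topology \<Rightarrow> ('g \<Rightarrow> 'h) \<Rightarrow> 'g set \<Rightarrow> 'h set" where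
  "pi0_map Y \<phi> P = (THE Q. Q \<in> path_components_of Y \<and> \<phi> ` P \<subseteq> Q)"

definition pi0_discrete_map :: "('g \<Rightarrow> 'h) \<Rightarrow> 'g set \<Rightarrow> 'h" where
  "pi0_discrete_map \<phi> P = the_elem (\<phi> ` P)"


section \<open>The decorated graph and its automorphisms\<close>

text \<open>An edge has one (for a loop) or two endpoints.\<close>

record ('v, 'e, 'd) dec_graph =
  verts :: "'v set"
  edges :: "'e set"
  ends :: "'e \<Rightarrow> 'v set"
  decor :: "'v \<Rightarrow> 'd"

definition loops :: "('v, 'e, 'd) dec_graph \<Rightarrow> 'e set" where
  "loops G = {e \<in> edges G. card (ends G e) = 1}"

text \<open>The pairs \<open>(e, True)\<close> and \<open>(e, False)\<close> are the two orientations of the loop \<open>e\<close>; each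
  corresponds to one of the two ends of \<open>e\<close>, namely its initial one.\<close>

definition loop_orientations :: "('v, 'e, 'd) dec_graph \<Rightarrow> ('e \<times> bool) set" where
  "loop_orientations G = loops G \<times> UNIV"

text \<open>Automorphisms of the realisation: a permutation of the vertices, one of the edges and
  one of the oriented loops.\<close>

definition Aut_real ::
  "('v, 'e, 'd) dec_graph \<Rightarrow> (('v \<Rightarrow> 'v) \<times> ('e \<Rightarrow> 'e) \<times> ('e \<times> bool \<Rightarrow> 'e \<times> bool)) monoid"
where
  "Aut_real G =
     (BijGroup (verts G) \<times>\<times> BijGroup (edges G) \<times>\<times> BijGroup (loop_orientations G))
       \<lparr>carrier := {(\<sigma>, \<tau>, \<rho>).
          \<sigma> \<in> Bij (verts G) \<and> \<tau> \<in> Bij (edges G) \<and> \<rho> \<in> Bij (loop_orientations G) \<and>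
          (\<forall>v\<in>verts G. decor G (\<sigma> v) = decor G v) \<and>
          (\<forall>e\<in>edges G. ends G (\<tau> e) = \<sigma> ` ends G e) \<and>
          (\<forall>(e, s)\<in>loop_orientations G. fst (\<rho> (e, s)) = \<tau> e)}\<rparr>"

text \<open>The vertex \<open>*\<close> is \<open>None\<close>. The diffeomorphism class of a component \<open>C\<close> of the cut manifold \<open>N\<close> is
  represented by the set of all subsets of \<open>N\<close> diffeomorphic to \<open>C\<close>, which is
  nonempty. A torus \<open>e\<close> (in \<open>\<T>\<close> or in the boundary) is incident to \<open>C\<close> iff it is the image of a
  boundary component of \<open>C\<close>.\<close>

definition jsj_graph ::
  "('a, real^3) mfd \<Rightarrow> 'a set set \<Rightarrow> ('b, real^3) mfd \<Rightarrow> ('b \<Rightarrow> 'a) \<Rightarrow>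
     ('b set option, 'a set, 'b set set) dec_graph"
where
  "jsj_graph M \<T> N q = \<lparr>
     verts = insert None (Some ` components_mfd N),
     edges = boundary_components M \<union> \<T>,
     ends = (\<lambda>e. {v. v = None \<and> e \<in> boundary_components M} \<union>
                 {Some C | C. C \<in> components_mfd N \<and> (\<exists>S\<in>boundary_components N. S \<subseteq> C \<and> q ` S = e)}),
     decor = (\<lambda>v. case v of None \<Rightarrow> {}
                   | Some C \<Rightarrow> {C'. C' \<subseteq> points N \<and> (\<exists>h. diffeo N C N C' h)})\<rparr>"

text \<open>The chosen bijections between the orientations of the loops and the normal orientations of
  the corresponding tori.\<close>

definition loop_normal_orientations ::
  "('a, real^3) mfd \<Rightarrow> ('v, 'a set, 'd) dec_graph \<Rightarrow> ('a set \<Rightarrow> bool \<Rightarrow> ('a, real^3) tangent set) \<Rightarrow> bool"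
where
  "loop_normal_orientations M G \<beta> \<longleftrightarrow>
     (\<forall>e\<in>loops G. bij_betw (\<beta> e) UNIV {P. normal_orientation M e P})"

definition graph_action ::
  "('a, real^3) mfd \<Rightarrow> 'a set set \<Rightarrow> ('b, real^3) mfd \<Rightarrow> ('b \<Rightarrow> 'a) \<Rightarrow>
     ('a set \<Rightarrow> bool \<Rightarrow> ('a, real^3) tangent set) \<Rightarrow> ('a \<Rightarrow> 'a) \<Rightarrow>
     ('b set option \<Rightarrow> 'b set option) \<times> ('a set \<Rightarrow> 'a set) \<times> ('a set \<times> bool \<Rightarrow> 'a set \<times> bool)"
where
  "graph_action M \<T> N q \<beta> f = (let G = jsj_graph M \<T> N q in
     (\<lambda>v\<in>verts G. map_option (\<lambda>C. THE C'. C' \<in> components_mfd N \<and> q ` C' = f ` (q ` C)) v,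
      \<lambda>e\<in>edges G. f ` e,
      \<lambda>(e, s)\<in>loop_orientations G. (f ` e, THE s'. \<beta> (f ` e) s' = push M f (\<beta> e s))))"


section \<open>Exact sequences\<close>

text \<open>Exactness of \<open>1 \<rightarrow> A \<rightarrow> B \<rightarrow> C\<close>; the library's \<open>exact_seq\<close> requires all groups to
  have elements of the same type.\<close>

definition left_exact ::
  "('a, 'm) monoid_scheme \<Rightarrow> ('a \<Rightarrow> 'b) \<Rightarrow> ('b, 'n) monoid_scheme \<Rightarrow> ('b \<Rightarrow> 'c) \<Rightarrow> ('c, 'k) monoid_scheme \<Rightarrow> bool"
where
  "left_exact A i B p C \<longleftrightarrow> group_hom A B i \<and> group_hom B C p \<and>
     inj_on i (carrier A) \<and> i ` carrier A = kernel B C p"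

end

theory Submission
  imports Defs
begin

text \<open>A diffeomorphism of \<open>M\<close> preserving the tori lifts through the regluing map to the cut manifold; hence it
  permutes pieces, tori and boundary components compatibly with incidence, and it moves normal orientations
  by its differential. This is a homomorphism to the automorphism group of the graph. An element of its
  kernel fixes all pieces, tori and boundary components. It also preserves a normal orientation of every
  torus: for loops by definition, and for the other tori because it fixes the piece on one side, which
  distinguishes the normal vectors pointing into that piece. In coordinates, an orientation of a surface corresponds
  to the normal orientation given by the cross product of a positive tangent frame; as the diffeomorphism preserves the
  orientation of \<open>M\<close>, it preserves a normal orientation of a torus iff it preserves an orientation
  of the torus. So the kernel is the group in question.

  For the second sequence it suffices that the action is constant along paths of diffeomorphisms: images of points move
  continuously, which settles the permutations, and the differential at a point depends continuously on
  the diffeomorphism, so that a pushed forward normal orientation is locally constant. Exactness on path components is then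
  formal, since the kernel is a union of path components.\<close>

text \<open>Charts may be modelled on half-spaces, so derivatives at boundary points are taken
  within the chart image; on relatively open parts of half-spaces they are still unique, which
  carries the usual calculus over. The regluing map is two-to-one over the tori, so a diffeomorphism
  is lifted over their complement and extended by limits: a half-ball stays connected when boundary
  points are removed, hence the lift cannot oscillate between the two preimages. The conormal fields
  and surface charts of the tori are extracted from half-space charts of the cut manifold, whose
  boundary covers them. The smooth topology is generated by bounds on iterated coordinate
  derivatives over compact sets. To avoid formulas for higher derivatives of a composite, continuity
  of translations is proved with families whose derivatives are jointly continuous in parameter and
  point, by induction on the order; the tautological family, parametrised by the diffeomorphisms
  themselves, links such families with the topology.\<close>

section \<open>Calculus on relatively open subsets of half-spaces\<close>

text \<open>For \<open>u = 0\<close> this says that \<open>U\<close> is open.\<close>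

definition halfopen :: "'e::euclidean_space set \<Rightarrow> bool" where
  "halfopen U \<longleftrightarrow> (\<exists>u. openin (top_of_set {x. 0 \<le> u \<bullet> x}) U)"

lemma open_halfopen: "open U \<Longrightarrow> halfopen U"
  unfolding halfopen_def by (rule exI[of _ 0]) simp

lemma halfopen_openin: "halfopen U \<Longrightarrow> openin (top_of_set U) S \<Longrightarrow> halfopen S"
  unfolding halfopen_def using openin_trans by blast

lemma halfopen_ball:
  assumes "openin (top_of_set {x. 0 \<le> u \<bullet> x}) U" "x \<in> U"
  obtains r where "0 < r" "ball x r \<inter> {x. 0 \<le> u \<bullet> x} \<subseteq> U"
  using assms unfolding openin_contains_ball by blast

text \<open>One of the two directions \<open>i\<close> and \<open>- i\<close> does not decrease the
  inner product with \<open>u\<close>, so short steps along it stay in the half-space. Such points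
  in each basis direction are what makes derivatives within the set unique.\<close>

lemma halfopen_segment:
  assumes "halfopen U" "x \<in> U" "0 < e"
  shows "\<exists>d. 0 < \<bar>d\<bar> \<and> \<bar>d\<bar> < e \<and> x + d *\<^sub>R i \<in> U"
proof -
  obtain u where u: "openin (top_of_set {x. 0 \<le> u \<bullet> x}) U" using assms halfopen_def by blast
  obtain r where r: "0 < r" "ball x r \<inter> {x. 0 \<le> u \<bullet> x} \<subseteq> U" using halfopen_ball[OF u assms(2)] .
  have ux: "0 \<le> u \<bullet> x" using openin_imp_subset[OF u] assms(2) by auto
  \<comment> \<open>The second bound keeps the displacement shorter than \<open>r\<close>; adding 1
    to the norm avoids a division by zero when \<open>i = 0\<close>.\<close>
  define s where "s = min (e/2) (r / (2 * (norm i + 1)))"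
  have ni: "0 < 2 * (norm i + 1)" by (simp add: add_nonneg_pos)
  have s: "0 < s" "s < e" using assms(3) r(1) ni unfolding s_def by auto
  have "s * norm i \<le> r / (2 * (norm i + 1)) * norm i" unfolding s_def by (intro mult_right_mono) auto
  also have "\<dots> < r"
  proof -
    have "norm i < 2 * (norm i + 1)" using norm_ge_zero[of i] by argo
    then have "r * norm i < r * (2 * (norm i + 1))" by (rule mult_strict_left_mono) (rule r(1))
    then show ?thesis using ni by (simp add: field_simps)
  qed
  finally have sr: "s * norm i < r" .
  define d where "d = (if 0 \<le> u \<bullet> i then s else - s)"
  have "0 \<le> d * (u \<bullet> i)" unfolding d_def using s(1) by (auto simp: mult_nonneg_nonneg zero_le_mult_iff)
  then have "0 \<le> u \<bullet> (x + d *\<^sub>R i)" using ux by (simp add: inner_add_right)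
  moreover have "x + d *\<^sub>R i \<in> ball x r" using sr s(1) by (auto simp: dist_norm d_def)
  ultimately have "x + d *\<^sub>R i \<in> U" using r(2) by blast
  then show ?thesis using s by (intro exI[of _ d]) (auto simp: d_def)
qed

lemma halfopen_derivative_unique:
  assumes "halfopen U" "x \<in> U" "(f has_derivative D) (at x within U)" "(f has_derivative D') (at x within U)"
  shows "D = D'"
  by (rule frechet_derivative_unique_within[OF assms(3,4)]) (use halfopen_segment[OF assms(1,2)] in blast)

lemma halfopen_frechet_derivative:
  assumes "halfopen U" "x \<in> U" "(f has_derivative D) (at x within U)"
  shows "frechet_derivative f (at x within U) = D"
  using assms halfopen_derivative_unique frechet_derivative_works differentiable_def by metis

lemma at_within_openin:
  assumes "openin (top_of_set U) S" "x \<in> S"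
  shows "at x within S = at x within U"
proof -
  obtain T where T: "open T" "S = U \<inter> T" using assms(1) openin_open by blast
  show ?thesis by (rule at_within_nhd[of x T]) (use T assms(2) in auto)
qed

lemma has_derivative_local_cong:
  assumes "open W" "x \<in> W" "x \<in> U" "\<And>z. z \<in> W \<inter> U \<Longrightarrow> f z = g z"
  shows "(f has_derivative D) (at x within U) \<longleftrightarrow> (g has_derivative D) (at x within U)"
proof -
  obtain d where d: "0 < d" "ball x d \<subseteq> W" using openE[OF assms(1,2)] .
  have e: "f z = g z" if "z \<in> U" "dist z x < d" for z
    using assms(4) d(2) that by (auto simp: dist_commute)
  show ?thesis
  proof
    assume "(f has_derivative D) (at x within U)"
    then show "(g has_derivative D) (at x within U)"
      by (rule has_derivative_transform_within[OF _ d(1) assms(3)]) (rule e)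
  next
    assume "(g has_derivative D) (at x within U)"
    then show "(f has_derivative D) (at x within U)"
      by (rule has_derivative_transform_within[OF _ d(1) assms(3)]) (rule e[symmetric])
  qed
qed

lemma differentiable_local_cong:
  assumes "open W" "x \<in> W" "x \<in> U" "\<And>z. z \<in> W \<inter> U \<Longrightarrow> f z = g z"
  shows "f differentiable (at x within U) \<longleftrightarrow> g differentiable (at x within U)"
  unfolding differentiable_def using has_derivative_local_cong[OF assms] by simp

lemma frechet_derivative_local_cong:
  assumes "open W" "x \<in> W" "x \<in> U" "\<And>z. z \<in> W \<inter> U \<Longrightarrow> f z = g z"
  shows "frechet_derivative f (at x within U) = frechet_derivative g (at x within U)"
  unfolding frechet_derivative_def using has_derivative_local_cong[OF assms] by simp

section \<open>Families of maps that depend continuously on a parameter\<close>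

text \<open>Convergence along this filter is joint convergence in parameter and point; intersecting
  with \<open>U\<close> makes it one-sided at boundary points.\<close>

definition germ_filter :: "'i filter \<Rightarrow> 'e::euclidean_space set \<Rightarrow> 'e \<Rightarrow> ('i \<times> 'e) filter" where
  "germ_filter F U p = F \<times>\<^sub>F inf (nhds p) (principal U)"

lemma eventually_germ_filter:
  "eventually P (germ_filter F U p) \<longleftrightarrow>
    (\<exists>Q W. eventually Q F \<and> open W \<and> p \<in> W \<and> (\<forall>i y. Q i \<longrightarrow> y \<in> W \<inter> U \<longrightarrow> P (i, y)))"
proof
  assume "eventually P (germ_filter F U p)"
  then obtain Q R where "eventually Q F" "eventually R (inf (nhds p) (principal U))"
     "\<And>i y. Q i \<Longrightarrow> R y \<Longrightarrow> P (i, y)"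
    unfolding germ_filter_def eventually_prod_filter by blast
  moreover then obtain W where "open W" "p \<in> W" "\<And>y. y \<in> W \<inter> U \<Longrightarrow> R y"
    unfolding eventually_inf_principal eventually_nhds by auto
  ultimately show "\<exists>Q W. eventually Q F \<and> open W \<and> p \<in> W \<and> (\<forall>i y. Q i \<longrightarrow> y \<in> W \<inter> U \<longrightarrow> P (i, y))" by blast
next
  assume "\<exists>Q W. eventually Q F \<and> open W \<and> p \<in> W \<and> (\<forall>i y. Q i \<longrightarrow> y \<in> W \<inter> U \<longrightarrow> P (i, y))"
  then obtain Q W where *: "eventually Q F" "open W" "p \<in> W" "\<And>i y. Q i \<Longrightarrow> y \<in> W \<inter> U \<Longrightarrow> P (i, y)" by blast
  have "eventually (\<lambda>y. y \<in> W \<inter> U) (inf (nhds p) (principal U))"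
    unfolding eventually_inf_principal eventually_nhds using * by blast
  then show "eventually P (germ_filter F U p)"
    unfolding germ_filter_def eventually_prod_filter using * by blast
qed

text \<open>\<open>Ck_germ k F i0 U p u\<close>: near \<open>p\<close> the members \<open>u i\<close> of the family are \<open>C\<^sup>k\<close> on \<open>U\<close>, and their
  derivatives of order \<open>\<le> k\<close> are jointly continuous in parameter and point at \<open>(i0, p)\<close>, where
  \<open>F\<close> is the neighbourhood filter of the parameter \<open>i0\<close>. For a one-point parameter space this is just
  the \<open>C\<^sup>k\<close> condition.\<close>

primrec Ck_germ :: "nat \<Rightarrow> 'i filter \<Rightarrow> 'i \<Rightarrow> 'e::euclidean_space set \<Rightarrow> 'e \<Rightarrow> ('i \<Rightarrow> 'e \<Rightarrow> 'f::real_normed_vector) \<Rightarrow> bool" where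
  "Ck_germ 0 F i0 U p u \<longleftrightarrow> ((\<lambda>z. u (fst z) (snd z)) \<longlongrightarrow> u i0 p) (germ_filter F U p)"
| "Ck_germ (Suc k) F i0 U p u \<longleftrightarrow> ((\<lambda>z. u (fst z) (snd z)) \<longlongrightarrow> u i0 p) (germ_filter F U p) \<and>
     (\<forall>\<^sub>F (i, y) in germ_filter F U p. u i differentiable (at y within U)) \<and>
     (\<forall>v. Ck_germ k F i0 U p (\<lambda>i y. frechet_derivative (u i) (at y within U) v))"

lemma Ck_germ_tendsto: "Ck_germ k F i0 U p u \<Longrightarrow> ((\<lambda>z. u (fst z) (snd z)) \<longlongrightarrow> u i0 p) (germ_filter F U p)"
  by (cases k) auto

lemma Ck_germ_SucD: "Ck_germ (Suc k) F i0 U p u \<Longrightarrow> Ck_germ k F i0 U p u"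
proof (induction k arbitrary: u)
  case 0
  then show ?case by simp
next
  case (Suc k)
  then have "\<And>v. Ck_germ (Suc k) F i0 U p (\<lambda>i y. frechet_derivative (u i) (at y within U) v)" by auto
  with Suc.IH have "\<And>v. Ck_germ k F i0 U p (\<lambda>i y. frechet_derivative (u i) (at y within U) v)" by blast
  with Suc.prems show ?case by simp
qed

lemma eventually_germ_filter_set: "\<forall>\<^sub>F z in germ_filter F U p. snd z \<in> U"
  unfolding eventually_germ_filter by (intro exI[of _ "\<lambda>_. True"] exI[of _ UNIV]) auto

lemma linear_Basis_expand:
  fixes D :: "'v::euclidean_space \<Rightarrow> 'w::real_normed_vector"
  assumes "bounded_linear D"
  shows "D v = (\<Sum>b\<in>Basis. (v \<bullet> b) *\<^sub>R D b)"
proof -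
  have "D (\<Sum>b\<in>Basis. (v \<bullet> b) *\<^sub>R b) = (\<Sum>b\<in>Basis. (v \<bullet> b) *\<^sub>R D b)"
    using assms by (simp add: linear_sum bounded_linear.linear linear_scale)
  then show ?thesis by (simp add: euclidean_representation)
qed

text \<open>Carrying the parameter along turns the substitution of one family into another into a
  map between germ filters, so that limits compose.\<close>

lemma filterlim_germ_filter:
  assumes "((\<lambda>z. u (fst z) (snd z)) \<longlongrightarrow> q) (germ_filter F U p)" "\<forall>\<^sub>F (i, y) in germ_filter F U p. u i y \<in> V"
  shows "filterlim (\<lambda>z. (fst z, u (fst z) (snd z))) (germ_filter F V q) (germ_filter F U p)"
proof -
  have "filterlim fst F (germ_filter F U p)" unfolding germ_filter_def by (rule filterlim_fst)
  moreover have "filterlim (\<lambda>z. u (fst z) (snd z)) (inf (nhds q) (principal V)) (germ_filter F U p)"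
    using assms by (auto simp: filterlim_inf filterlim_principal case_prod_unfold)
  ultimately show ?thesis unfolding germ_filter_def[of F V q]
    by (rule filterlim_Pair)
qed

text \<open>The assumption makes \<open>i0\<close> visible to \<open>F\<close>: whatever holds near
  \<open>(i0, p)\<close> can be evaluated at that very pair. Neighbourhood filters have this
  property, punctured ones do not.\<close>

context
  fixes F :: "'i filter" and i0 :: 'i
  assumes F0: "principal {i0} \<le> F"
begin

lemma germ_filter_at: "eventually P (germ_filter F U p) \<Longrightarrow> p \<in> U \<Longrightarrow> P (i0, p)"
  unfolding eventually_germ_filter using F0 by (auto simp: le_filter_def eventually_principal)

lemma Ck_germ_cong_aux:
  assumes "\<forall>\<^sub>F (i, y) in germ_filter F U p. u i y = u' i y" "p \<in> U" "Ck_germ k F i0 U p u"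
  shows "Ck_germ k F i0 U p u'"
  using assms(1,3)
proof (induction k arbitrary: u u')
  case 0
  have "u i0 p = u' i0 p" using germ_filter_at[OF 0(1) assms(2)] by simp
  moreover have "\<forall>\<^sub>F z in germ_filter F U p. u (fst z) (snd z) = u' (fst z) (snd z)"
    using 0(1) by (auto simp: case_prod_unfold)
  ultimately show ?case using 0(2) by (simp add: tendsto_cong)
next
  case (Suc k)
  have e: "u i0 p = u' i0 p" using germ_filter_at[OF Suc(2) assms(2)] by simp
  have "\<forall>\<^sub>F z in germ_filter F U p. u (fst z) (snd z) = u' (fst z) (snd z)"
    using Suc(2) by (auto simp: case_prod_unfold)
  then have t: "((\<lambda>z. u' (fst z) (snd z)) \<longlongrightarrow> u' i0 p) (germ_filter F U p)"
    using Suc(3) e by (simp add: tendsto_cong)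
  \<comment> \<open>Equality at a single point says nothing about derivatives. Here it holds on a
    relatively open set for each admissible parameter, so the derivatives agree there as
    well.\<close>
  obtain Q W where QW: "eventually Q F" "open W" "p \<in> W" "\<And>i y. Q i \<Longrightarrow> y \<in> W \<inter> U \<Longrightarrow> u i y = u' i y"
    using Suc(2) unfolding eventually_germ_filter by auto
  have ev: "\<forall>\<^sub>F z in germ_filter F U p. Q (fst z) \<and> snd z \<in> W \<inter> U"
    unfolding eventually_germ_filter using QW by auto
  have d: "\<forall>\<^sub>F (i, y) in germ_filter F U p. u' i differentiable (at y within U)"
  proof -
    have "\<forall>\<^sub>F (i, y) in germ_filter F U p. u i differentiable (at y within U)" using Suc(3) by simp
    with ev show ?thesis
    proof eventually_elim
      case (elim z)
      then show ?case using differentiable_local_cong[OF QW(2), of "snd z" U "u (fst z)" "u' (fst z)"] QW(4) by (auto simp: case_prod_unfold)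
    qed
  qed
  have "Ck_germ k F i0 U p (\<lambda>i y. frechet_derivative (u' i) (at y within U) v)" for v
  proof (rule Suc.IH)
    show "Ck_germ k F i0 U p (\<lambda>i y. frechet_derivative (u i) (at y within U) v)" using Suc(3) by simp
    show "\<forall>\<^sub>F (i, y) in germ_filter F U p. frechet_derivative (u i) (at y within U) v = frechet_derivative (u' i) (at y within U) v"
      using ev
    proof eventually_elim
      case (elim z)
      then show ?case using frechet_derivative_local_cong[OF QW(2), of "snd z" U "u (fst z)" "u' (fst z)"] QW(4) by (auto simp: case_prod_unfold)
    qed
  qed
  then show ?case using t d by simp
qed

lemma Ck_germ_cong:
  assumes "\<forall>\<^sub>F (i, y) in germ_filter F U p. u i y = u' i y" "p \<in> U"
  shows "Ck_germ k F i0 U p u \<longleftrightarrow> Ck_germ k F i0 U p u'"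
proof -
  have "\<forall>\<^sub>F (i, y) in germ_filter F U p. u' i y = u i y" using assms(1) by (simp add: eq_commute)
  then show ?thesis using Ck_germ_cong_aux assms by blast
qed

text \<open>Uniqueness of derivatives on \<open>U\<close> lets any derivative formula
  \<open>D\<close> replace \<open>frechet_derivative\<close>. Each closure property below then
  reduces to one differentiation rule and the induction hypothesis.\<close>

lemma Ck_germ_SucI:
  assumes U: "halfopen U" and p: "p \<in> U"
    and t: "((\<lambda>z. u (fst z) (snd z)) \<longlongrightarrow> u i0 p) (germ_filter F U p)"
    and d: "\<forall>\<^sub>F (i, y) in germ_filter F U p. (u i has_derivative D i y) (at y within U)"
    and k: "\<And>v. Ck_germ k F i0 U p (\<lambda>i y. D i y v)"
  shows "Ck_germ (Suc k) F i0 U p u"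
proof -
  have "\<forall>\<^sub>F (i, y) in germ_filter F U p. u i differentiable (at y within U)"
    using d by eventually_elim (auto simp: differentiable_def)
  moreover have "Ck_germ k F i0 U p (\<lambda>i y. frechet_derivative (u i) (at y within U) v)" for v
  proof (rule Ck_germ_cong_aux[OF _ p k[of v]])
    show "\<forall>\<^sub>F (i, y) in germ_filter F U p. D i y v = frechet_derivative (u i) (at y within U) v"
      using d eventually_germ_filter_set
      by eventually_elim (auto simp: halfopen_frechet_derivative[OF U])
  qed
  ultimately show ?thesis using t by simp
qed

lemma Ck_germ_SucE:
  assumes "Ck_germ (Suc k) F i0 U p u"
  shows "\<forall>\<^sub>F (i, y) in germ_filter F U p. (u i has_derivative frechet_derivative (u i) (at y within U)) (at y within U)"
  using assms by (auto simp: frechet_derivative_works elim: eventually_mono)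

lemma Ck_germ_const: "halfopen U \<Longrightarrow> p \<in> U \<Longrightarrow> Ck_germ k F i0 U p (\<lambda>_ _. c)"
proof (induction k arbitrary: c)
  case 0
  then show ?case by (simp add: case_prod_unfold)
next
  case (Suc k)
  show ?case
    by (rule Ck_germ_SucI[where D = "\<lambda>_ _ _. 0"]) (use Suc in \<open>auto simp: case_prod_unfold\<close>)
qed

lemma Ck_germ_linear:
  assumes h: "bounded_linear h" and U: "halfopen U" and p: "p \<in> U"
  shows "Ck_germ k F i0 U p u \<Longrightarrow> Ck_germ k F i0 U p (\<lambda>i y. h (u i y))"
proof (induction k arbitrary: u)
  case 0
  then show ?case using bounded_linear.tendsto[OF h] by simp
next
  case (Suc k)
  show ?case
  proof (rule Ck_germ_SucI[OF U p])
    show "((\<lambda>z. h (u (fst z) (snd z))) \<longlongrightarrow> h (u i0 p)) (germ_filter F U p)"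
      using bounded_linear.tendsto[OF h Ck_germ_tendsto[OF Suc(2)]] by (simp add: case_prod_unfold)
    show "\<forall>\<^sub>F (i, y) in germ_filter F U p. ((\<lambda>y. h (u i y)) has_derivative (\<lambda>v. h (frechet_derivative (u i) (at y within U) v))) (at y within U)"
      using Ck_germ_SucE[OF Suc(2)] by eventually_elim (auto intro!: bounded_linear.has_derivative[OF h])
    show "Ck_germ k F i0 U p (\<lambda>i y. h (frechet_derivative (u i) (at y within U) v))" for v
      using Suc by simp
  qed
qed

lemma Ck_germ_add:
  assumes U: "halfopen U" and p: "p \<in> U"
  shows "Ck_germ k F i0 U p u \<Longrightarrow> Ck_germ k F i0 U p w \<Longrightarrow> Ck_germ k F i0 U p (\<lambda>i y. u i y + w i y)"
proof (induction k arbitrary: u w)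
  case 0
  then show ?case by (simp add: tendsto_add)
next
  case (Suc k)
  show ?case
  proof (rule Ck_germ_SucI[OF U p])
    show "((\<lambda>z. u (fst z) (snd z) + w (fst z) (snd z)) \<longlongrightarrow> u i0 p + w i0 p) (germ_filter F U p)"
      using tendsto_add[OF Ck_germ_tendsto[OF Suc(2)] Ck_germ_tendsto[OF Suc(3)]] by (simp add: case_prod_unfold)
    show "\<forall>\<^sub>F (i, y) in germ_filter F U p. ((\<lambda>y. u i y + w i y) has_derivative
        (\<lambda>v. frechet_derivative (u i) (at y within U) v + frechet_derivative (w i) (at y within U) v)) (at y within U)"
      using Ck_germ_SucE[OF Suc(2)] Ck_germ_SucE[OF Suc(3)] by eventually_elim (auto intro!: has_derivative_add)
    show "Ck_germ k F i0 U p (\<lambda>i y. frechet_derivative (u i) (at y within U) v + frechet_derivative (w i) (at y within U) v)" for v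
      using Suc by simp
  qed
qed

lemma Ck_germ_sum:
  assumes U: "halfopen U" and p: "p \<in> U" and "finite A" and "\<And>a. a \<in> A \<Longrightarrow> Ck_germ k F i0 U p (u a)"
  shows "Ck_germ k F i0 U p (\<lambda>i y. \<Sum>a\<in>A. u a i y)"
  using assms(3,4) by (induction A rule: finite_induct) (auto intro!: Ck_germ_add[OF U p] Ck_germ_const[OF U p])

lemma Ck_germ_scaleR:
  assumes U: "halfopen U" and p: "p \<in> U"
  shows "Ck_germ k F i0 U p a \<Longrightarrow> Ck_germ k F i0 U p w \<Longrightarrow> Ck_germ k F i0 U p (\<lambda>i y. a i y *\<^sub>R w i y)"
proof (induction k arbitrary: a w)
  case 0
  then show ?case by (simp add: tendsto_scaleR)
next
  case (Suc k)
  let ?a = "\<lambda>i y. frechet_derivative (a i) (at y within U)" and ?w = "\<lambda>i y. frechet_derivative (w i) (at y within U)"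
  show ?case
  proof (rule Ck_germ_SucI[OF U p])
    show "((\<lambda>z. a (fst z) (snd z) *\<^sub>R w (fst z) (snd z)) \<longlongrightarrow> a i0 p *\<^sub>R w i0 p) (germ_filter F U p)"
      using tendsto_scaleR[OF Ck_germ_tendsto[OF Suc(2)] Ck_germ_tendsto[OF Suc(3)]] by (simp add: case_prod_unfold)
    show "\<forall>\<^sub>F (i, y) in germ_filter F U p. ((\<lambda>y. a i y *\<^sub>R w i y) has_derivative
        (\<lambda>v. a i y *\<^sub>R ?w i y v + ?a i y v *\<^sub>R w i y)) (at y within U)"
      using Ck_germ_SucE[OF Suc(2)] Ck_germ_SucE[OF Suc(3)] by eventually_elim (auto intro!: has_derivative_scaleR)
    show "Ck_germ k F i0 U p (\<lambda>i y. a i y *\<^sub>R ?w i y v + ?a i y v *\<^sub>R w i y)" for v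
      by (intro Ck_germ_add[OF U p] Suc.IH) (use Suc(2,3) in \<open>auto dest: Ck_germ_SucD simp del: Ck_germ.simps\<close>, use Suc(2,3) in auto)
  qed
qed

text \<open>The induction is on the order with the outer family arbitrary. The derivative of the
  outer family enters only through its partial derivatives \<open>?w i (u i y) b\<close>, to which
  the induction hypothesis applies again; the resulting sums of products are covered by the
  preceding lemmas.\<close>

lemma Ck_germ_compose:
  fixes u :: "'i \<Rightarrow> 'e::euclidean_space \<Rightarrow> 'v::euclidean_space" and w :: "'i \<Rightarrow> 'v \<Rightarrow> 'w::real_normed_vector"
  assumes U: "halfopen U" and p: "p \<in> U" and V: "halfopen V"
    and ev: "\<forall>\<^sub>F (i, y) in germ_filter F U p. u i y \<in> V"
  shows "Ck_germ k F i0 U p u \<Longrightarrow> Ck_germ k F i0 V (u i0 p) w \<Longrightarrow> Ck_germ k F i0 U p (\<lambda>i y. w i (u i y))"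
proof (induction k arbitrary: w)
  case 0
  have "filterlim (\<lambda>z. (fst z, u (fst z) (snd z))) (germ_filter F V (u i0 p)) (germ_filter F U p)"
    by (rule filterlim_germ_filter[OF Ck_germ_tendsto[OF 0(1)] ev])
  from filterlim_compose[OF Ck_germ_tendsto[OF 0(2)] this] show ?case by (simp add: case_prod_unfold)
next
  case (Suc k)
  let ?u = "\<lambda>i y. frechet_derivative (u i) (at y within U)" and ?w = "\<lambda>i y. frechet_derivative (w i) (at y within V)"
  have fl: "filterlim (\<lambda>z. (fst z, u (fst z) (snd z))) (germ_filter F V (u i0 p)) (germ_filter F U p)"
    by (rule filterlim_germ_filter[OF Ck_germ_tendsto[OF Suc(2)] ev])
  have dw: "\<forall>\<^sub>F z in germ_filter F U p. (w (fst z) has_derivative ?w (fst z) (u (fst z) (snd z))) (at (u (fst z) (snd z)) within V)"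
    using filterlim_iff[THEN iffD1, rule_format, OF fl Ck_germ_SucE[OF Suc(3)]] by (simp add: case_prod_unfold)
  obtain Q W where QW: "eventually Q F" "open W" "p \<in> W" "\<And>i y. Q i \<Longrightarrow> y \<in> W \<inter> U \<Longrightarrow> u i y \<in> V"
    using ev unfolding eventually_germ_filter by auto
  have ev2: "\<forall>\<^sub>F z in germ_filter F U p. Q (fst z) \<and> snd z \<in> W \<inter> U"
    unfolding eventually_germ_filter using QW by auto
  show ?case
  proof (rule Ck_germ_SucI[OF U p])
    show "((\<lambda>z. w (fst z) (u (fst z) (snd z))) \<longlongrightarrow> w i0 (u i0 p)) (germ_filter F U p)"
      using filterlim_compose[OF Ck_germ_tendsto[OF Suc(3)] fl] by (simp add: case_prod_unfold)
    show "\<forall>\<^sub>F (i, y) in germ_filter F U p. ((\<lambda>y. w i (u i y)) has_derivative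
        (\<lambda>v. \<Sum>b\<in>Basis. (?u i y v \<bullet> b) *\<^sub>R ?w i (u i y) b)) (at y within U)"
      using Ck_germ_SucE[OF Suc(2)] dw ev2
    proof eventually_elim
      case (elim z)
      obtain i y where z: "z = (i, y)" by (cases z)
      have y: "y \<in> W \<inter> U" "Q i" using elim z by auto
      have du: "(u i has_derivative ?u i y) (at y within W \<inter> U)"
        using elim z by (auto intro: has_derivative_subset)
      have "(w i has_derivative ?w i (u i y)) (at (u i y) within u i ` (W \<inter> U))"
        by (rule has_derivative_subset[where s = V]) (use elim z QW(4) y in auto)
      from diff_chain_within[OF du this]
      have "((\<lambda>y. w i (u i y)) has_derivative (\<lambda>v. ?w i (u i y) (?u i y v))) (at y within W \<inter> U)"
        by (simp add: o_def)
      moreover have "at y within W \<inter> U = at y within U"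
        using QW(2) y by (intro at_within_nhd[of _ W]) auto
      moreover have "bounded_linear (?w i (u i y))" using elim z has_derivative_bounded_linear by auto
      ultimately show ?case using z by (simp add: linear_Basis_expand[of "?w i (u i y)" "?u i y _", symmetric])
    qed
    show "Ck_germ k F i0 U p (\<lambda>i y. \<Sum>b\<in>Basis. (?u i y v \<bullet> b) *\<^sub>R ?w i (u i y) b)" for v
    proof (intro Ck_germ_sum[OF U p] Ck_germ_scaleR[OF U p])
      fix b :: 'v assume "b \<in> Basis"
      show "Ck_germ k F i0 U p (\<lambda>i y. ?u i y v \<bullet> b)"
        by (rule Ck_germ_linear[OF bounded_linear_inner_left U p]) (use Suc(2) in simp)
      show "Ck_germ k F i0 U p (\<lambda>i y. ?w i (u i y) b)"
        by (rule Suc.IH[OF Ck_germ_SucD[OF Suc(2)]]) (use Suc(3) in simp)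
    qed simp
  qed
qed

end

abbreviation Ck_at :: "nat \<Rightarrow> 'e::euclidean_space set \<Rightarrow> 'e \<Rightarrow> ('e \<Rightarrow> 'f::real_normed_vector) \<Rightarrow> bool" where
  "Ck_at k U p f \<equiv> Ck_germ k (principal {()}) () U p (\<lambda>_. f)"

lemma eventually_germ_filter_unit:
  "eventually P (germ_filter (principal {()}) U p) \<longleftrightarrow> (\<exists>W. open W \<and> p \<in> W \<and> (\<forall>y\<in>W \<inter> U. P ((), y)))"
proof
  assume "eventually P (germ_filter (principal {()}) U p)"
  then show "\<exists>W. open W \<and> p \<in> W \<and> (\<forall>y\<in>W \<inter> U. P ((), y))"
    unfolding eventually_germ_filter eventually_principal by blast
next
  assume "\<exists>W. open W \<and> p \<in> W \<and> (\<forall>y\<in>W \<inter> U. P ((), y))"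
  then obtain W where "open W" "p \<in> W" "\<forall>y\<in>W \<inter> U. P ((), y)" by blast
  then show "eventually P (germ_filter (principal {()}) U p)"
    unfolding eventually_germ_filter eventually_principal
    by (intro exI[of _ "\<lambda>_. True"] exI[of _ W]) auto
qed

lemma tendsto_germ_filter_unit:
  "((\<lambda>z. f (snd z)) \<longlongrightarrow> l) (germ_filter (principal {()}) U p) \<longleftrightarrow> (f \<longlongrightarrow> l) (inf (nhds p) (principal U))"
proof -
  have *: "eventually (\<lambda>z. Q (f (snd z))) (germ_filter (principal {()}) U p) \<longleftrightarrow> eventually (\<lambda>y. Q (f y)) (inf (nhds p) (principal U))" for Q
    unfolding eventually_germ_filter_unit eventually_inf_principal eventually_nhds by auto
  show ?thesis unfolding tendsto_def using *[of "\<lambda>x. x \<in> S" for S] by simp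
qed

text \<open>Lets fixed functions be composed with varying families over the same parameter
  filter.\<close>

lemma Ck_germ_family:
  assumes U: "halfopen U" and p: "p \<in> U"
  shows "Ck_at k U p f \<Longrightarrow> Ck_germ k F i0 U p (\<lambda>_. f)"
proof (induction k arbitrary: f)
  case 0
  have "filterlim snd (inf (nhds p) (principal U)) (germ_filter F U p)" unfolding germ_filter_def by (rule filterlim_snd)
  moreover have "(f \<longlongrightarrow> f p) (inf (nhds p) (principal U))" using 0 tendsto_germ_filter_unit by fastforce
  ultimately show ?case using filterlim_compose by fastforce
next
  case (Suc k)
  have "filterlim snd (inf (nhds p) (principal U)) (germ_filter F U p)" unfolding germ_filter_def by (rule filterlim_snd)
  moreover have "(f \<longlongrightarrow> f p) (inf (nhds p) (principal U))" using Suc(2) tendsto_germ_filter_unit[of f] by simp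
  ultimately have "((\<lambda>z. f (snd z)) \<longlongrightarrow> f p) (germ_filter F U p)" using filterlim_compose by fastforce
  moreover have "\<forall>\<^sub>F (i, y) in germ_filter F U p. f differentiable (at y within U)"
  proof -
    obtain W where "open W" "p \<in> W" "\<forall>y\<in>W \<inter> U. f differentiable (at y within U)"
      using Suc(2) eventually_germ_filter_unit[of "\<lambda>(i, y). f differentiable (at y within U)"] by auto
    then show ?thesis unfolding eventually_germ_filter
      by (intro exI[of _ "\<lambda>_. True"] exI[of _ W]) auto
  qed
  ultimately show ?case using Suc by simp
qed

text \<open>Derivatives within the larger set \<open>V\<close> also serve within \<open>U\<close>,
  and they are the only ones because \<open>U\<close> is half-open. Inclusion matters near
  \<open>p\<close> alone, hence the neighbourhood \<open>W\<close>.\<close>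

lemma Ck_germ_subset:
  assumes F0: "principal {i0} \<le> F"
    and U: "halfopen U" and p: "p \<in> U" and W: "open W" "p \<in> W" "U \<inter> W \<subseteq> V"
  shows "Ck_germ k F i0 V p u \<Longrightarrow> Ck_germ k F i0 U p u"
proof (induction k arbitrary: u)
  have ev: "eventually P (germ_filter F U p)" if PV: "eventually P (germ_filter F V p)" for P
  proof -
    obtain Q O1 where "eventually Q F" "open O1" "p \<in> O1" "\<And>i y. Q i \<Longrightarrow> y \<in> O1 \<inter> V \<Longrightarrow> P (i, y)"
      using PV unfolding eventually_germ_filter by blast
    then show ?thesis unfolding eventually_germ_filter using W
      by (intro exI[of _ Q] exI[of _ "O1 \<inter> W"]) (auto simp: subset_iff)
  qed
  then have le: "germ_filter F U p \<le> germ_filter F V p" by (simp add: le_filter_def)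
  {
    case 0
    then show ?case using tendsto_mono[OF le] by simp
  next
    case (Suc k)
    have evW: "\<forall>\<^sub>F z in germ_filter F U p. snd z \<in> U \<inter> W"
      unfolding eventually_germ_filter using W by (intro exI[of _ "\<lambda>_. True"] exI[of _ W]) auto
    show ?case
    proof (rule Ck_germ_SucI[OF F0 U p, where D = "\<lambda>i y. frechet_derivative (u i) (at y within V)"])
      show "((\<lambda>z. u (fst z) (snd z)) \<longlongrightarrow> u i0 p) (germ_filter F U p)"
        using tendsto_mono[OF le Ck_germ_tendsto[OF Suc(2)]] .
      show "\<forall>\<^sub>F (i, y) in germ_filter F U p. (u i has_derivative frechet_derivative (u i) (at y within V)) (at y within U)"
        using ev[OF Ck_germ_SucE[OF F0 Suc(2)]] evW
      proof eventually_elim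
        case (elim z)
        obtain i y where z: "z = (i, y)" by (cases z)
        have "(u i has_derivative frechet_derivative (u i) (at y within V)) (at y within U \<inter> W)"
          using elim z W(3) by (auto intro: has_derivative_subset)
        moreover have "at y within U \<inter> W = at y within U"
          using elim z W by (intro at_within_nhd[of _ W]) auto
        ultimately show ?case using z by simp
      qed
      show "Ck_germ k F i0 U p (\<lambda>i y. frechet_derivative (u i) (at y within V) v)" for v
        using Suc by simp
    qed
  }
qed

text \<open>On open sets \<open>Ck_on\<close> is the germ condition at every point for the one-point
  parameter space. Closure of smooth functions under composition and restriction is inherited
  through this equivalence.\<close>

lemma Ck_on_iff: "open S \<Longrightarrow> Ck_on k S f \<longleftrightarrow> (\<forall>p\<in>S. Ck_at k S p f)"
proof (induction k arbitrary: f)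
  case 0
  show ?case
    by (simp add: tendsto_germ_filter_unit continuous_on_def flip: tendsto_at_within_iff_tendsto_nhds)
next
  case (Suc k)
  note hS = open_halfopen[OF Suc(2)]
  have e: "frechet_derivative f (at x) = frechet_derivative f (at x within S)" if "x \<in> S" for x
    using at_within_open[OF that Suc(2)] by simp
  have c: "Ck_at k S p (\<lambda>x. frechet_derivative f (at x) v) \<longleftrightarrow> Ck_at k S p (\<lambda>x. frechet_derivative f (at x within S) v)" if "p \<in> S" for p v
    by (rule Ck_germ_cong[OF order_refl _ that])
      (unfold eventually_germ_filter_unit, use e that Suc(2) in \<open>auto intro!: exI[of _ S]\<close>)
  have d: "f differentiable_on S \<longleftrightarrow> (\<forall>p\<in>S. ((\<lambda>z. f (snd z)) \<longlongrightarrow> f p) (germ_filter (principal {()}) S p) \<and>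
      (\<forall>\<^sub>F (i, y) in germ_filter (principal {()}) S p. f differentiable (at y within S)))" (is "?L \<longleftrightarrow> ?R")
  proof
    assume L: ?L
    then have "continuous_on S f" by (rule differentiable_imp_continuous_on)
    then show ?R using L Suc(2)
      by (auto simp: tendsto_germ_filter_unit continuous_on_def eventually_germ_filter_unit differentiable_on_def
            simp flip: tendsto_at_within_iff_tendsto_nhds intro!: exI[of _ S])
  next
    assume R: ?R
    show ?L unfolding differentiable_on_def
    proof
      fix p assume p: "p \<in> S"
      with R have "\<forall>\<^sub>F (i, y) in germ_filter (principal {()}) S p. f differentiable (at y within S)" by blast
      from germ_filter_at[OF order_refl this p] show "f differentiable at p within S" by simp
    qed
  qed
  show ?case using d c Suc by auto
qed

section \<open>Smooth functions on open sets and on arbitrary sets\<close>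

lemma Ck_on_subset:
  assumes "open S" "open S'" "S' \<subseteq> S" "Ck_on k S f" shows "Ck_on k S' f"
  unfolding Ck_on_iff[OF assms(2)]
proof
  fix p assume p: "p \<in> S'"
  show "Ck_at k S' p f"
    by (rule Ck_germ_subset[OF order_refl open_halfopen[OF assms(2)] p assms(2) p, where V = S])
      (use assms p Ck_on_iff[OF assms(1)] in auto)
qed

lemma Ck_on_compose:
  fixes f :: "'e::euclidean_space \<Rightarrow> 'v::euclidean_space"
  assumes S: "open S" and V: "open V" and f: "Ck_on k S f" and g: "Ck_on k V g" and fS: "f ` S \<subseteq> V"
  shows "Ck_on k S (\<lambda>x. g (f x))"
  unfolding Ck_on_iff[OF S]
proof
  fix p assume p: "p \<in> S"
  show "Ck_at k S p (\<lambda>x. g (f x))"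
  proof (rule Ck_germ_compose[OF order_refl open_halfopen[OF S] p open_halfopen[OF V], where u = "\<lambda>_. f" and w = "\<lambda>_. g"])
    show "\<forall>\<^sub>F (i, y) in germ_filter (principal {()}) S p. f y \<in> V"
      unfolding eventually_germ_filter_unit using fS p S by (intro exI[of _ S]) auto
    show "Ck_at k S p f" using f p Ck_on_iff[OF S] by blast
    show "Ck_germ k (principal {()}) () V (f p) (\<lambda>_. g)" using g p fS Ck_on_iff[OF V] by blast
  qed
qed

lemma Ck_on_const: "Ck_on k S (\<lambda>_. c)"
  by (induction k arbitrary: c) (auto simp: frechet_derivative_const)

lemma Ck_on_linear: "bounded_linear h \<Longrightarrow> Ck_on k S h"
proof (cases k)
  case (Suc l)
  assume h: "bounded_linear h"
  have "frechet_derivative h (at x) = h" for x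
    by (metis bounded_linear_imp_has_derivative frechet_derivative_at h)
  then show ?thesis using Suc h Ck_on_const
    by (auto simp: differentiable_on_def bounded_linear_imp_differentiable)
qed (simp add: linear_continuous_on)

lemma smooth_onE:
  assumes "smooth_on A f" "x \<in> A"
  obtains W g where "open W" "x \<in> W" "\<forall>k. Ck_on k W g" "\<forall>y\<in>A \<inter> W. g y = f y"
proof -
  have "\<exists>W g. open W \<and> x \<in> W \<and> (\<forall>k. Ck_on k W g) \<and> (\<forall>y\<in>A \<inter> W. g y = f y)"
    using assms unfolding smooth_on_def by (rule bspec)
  then show thesis using that by auto
qed

lemma smooth_onI:
  assumes "\<And>x. x \<in> A \<Longrightarrow> \<exists>W g. open W \<and> x \<in> W \<and> (\<forall>k. Ck_on k W g) \<and> (\<forall>y\<in>A \<inter> W. g y = f y)"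
  shows "smooth_on A f"
  unfolding smooth_on_def using assms by (rule ballI)

lemma smooth_on_subset:
  assumes "smooth_on A f" "B \<subseteq> A"
  shows "smooth_on B f"
proof (rule smooth_onI)
  fix x assume "x \<in> B"
  then have "x \<in> A" using assms(2) by blast
  then obtain W g where "open W" "x \<in> W" "\<forall>k. Ck_on k W g" "\<forall>y\<in>A \<inter> W. g y = f y"
    by (rule smooth_onE[OF assms(1)])
  then show "\<exists>W g. open W \<and> x \<in> W \<and> (\<forall>k. Ck_on k W g) \<and> (\<forall>y\<in>B \<inter> W. g y = f y)"
    using assms(2) by (intro exI[of _ W] exI[of _ g]) auto
qed

lemma smooth_on_cong:
  assumes "\<And>x. x \<in> A \<Longrightarrow> f x = g x"
  shows "smooth_on A f \<longleftrightarrow> smooth_on A g"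
  unfolding smooth_on_def using assms by (intro ball_cong refl arg_cong[where f = Ex] ext) auto

lemma smooth_on_linear: "bounded_linear h \<Longrightarrow> smooth_on A h"
  by (intro smooth_onI exI[of _ UNIV] exI[of _ h]) (auto intro: Ck_on_linear)

lemma smooth_on_local:
  assumes "\<And>x. x \<in> A \<Longrightarrow> \<exists>V. open V \<and> x \<in> V \<and> smooth_on (A \<inter> V) f"
  shows "smooth_on A f"
  unfolding smooth_on_def
proof
  fix x assume x: "x \<in> A"
  obtain V where V: "open V" "x \<in> V" "smooth_on (A \<inter> V) f" using assms[OF x] by blast
  have "x \<in> A \<inter> V" using x V by blast
  then obtain W g where W: "open W" "x \<in> W" "\<forall>k. Ck_on k W g" "\<forall>y\<in>A \<inter> V \<inter> W. g y = f y"
    by (rule smooth_onE[OF V(3)])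
  have "\<forall>k. Ck_on k (W \<inter> V) g" using Ck_on_subset[of W "W \<inter> V"] W V by auto
  then show "\<exists>W g. open W \<and> x \<in> W \<and> (\<forall>k. Ck_on k W g) \<and> (\<forall>y\<in>A \<inter> W. g y = f y)"
    using W V by (intro exI[of _ "W \<inter> V"] exI[of _ g]) auto
qed

lemma smooth_on_imp_continuous_on:
  assumes "smooth_on A f" shows "continuous_on A f"
  unfolding continuous_on_eq_continuous_within
proof
  fix x assume x: "x \<in> A"
  obtain W g where W: "open W" "x \<in> W" "\<forall>k. Ck_on k W g" "\<forall>y\<in>A \<inter> W. g y = f y"
    by (rule smooth_onE[OF assms x])
  have "continuous_on (A \<inter> W) g" using spec[OF W(3), of 0] by (auto intro: continuous_on_subset)
  then have "continuous_on (A \<inter> W) f" using W(4) continuous_on_cong[of "A \<inter> W" "A \<inter> W" g f] by auto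
  then have "continuous (at x within A \<inter> W) f" using x W by (auto simp: continuous_on_eq_continuous_within)
  moreover have "at x within A \<inter> W = at x within A" using W by (intro at_within_nhd[of _ W]) auto
  ultimately show "continuous (at x within A) f" by simp
qed

text \<open>The local extension of \<open>f\<close> may leave the domain of the extension of
  \<open>g\<close>; restricting to a preimage under the extension of \<open>f\<close> repairs
  this.\<close>

lemma smooth_on_compose:
  fixes f :: "'e::euclidean_space \<Rightarrow> 'v::euclidean_space"
  assumes f: "smooth_on A f" and g: "smooth_on B g" and fA: "f ` A \<subseteq> B"
  shows "smooth_on A (\<lambda>x. g (f x))"
  unfolding smooth_on_def
proof
  fix x assume x: "x \<in> A"
  obtain W f' where W: "open W" "x \<in> W" "\<forall>k. Ck_on k W f'" "\<forall>y\<in>A \<inter> W. f' y = f y"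
    by (rule smooth_onE[OF f x])
  have fx: "f x \<in> B" using fA x by blast
  obtain V g' where V: "open V" "f x \<in> V" "\<forall>k. Ck_on k V g'" "\<forall>y\<in>B \<inter> V. g' y = g y"
    by (rule smooth_onE[OF g fx])
  have "continuous_on W f'" using spec[OF W(3), of 0] by simp
  then have o: "open (W \<inter> f' -` V)" using continuous_open_preimage W V by blast
  have "Ck_on k (W \<inter> f' -` V) (\<lambda>x. g' (f' x))" for k
    by (rule Ck_on_compose[OF o V(1) Ck_on_subset[OF W(1) o _ spec[OF W(3)]] spec[OF V(3)]]) auto
  moreover have "x \<in> W \<inter> f' -` V" using W(2,4) V(2) x by auto
  moreover have "g' (f' y) = g (f y)" if "y \<in> A" "y \<in> W" "f' y \<in> V" for y
  proof -
    have "f' y = f y" using W(4) that by auto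
    then show ?thesis using V(4) that fA by auto
  qed
  ultimately show "\<exists>W h. open W \<and> x \<in> W \<and> (\<forall>k. Ck_on k W h) \<and> (\<forall>y\<in>A \<inter> W. h y = g (f y))"
    using o by (intro exI[of _ "W \<inter> f' -` V"] exI[of _ "\<lambda>x. g' (f' x)"]) blast
qed

text \<open>The derivatives of a local extension agree with those within \<open>U\<close>, since
  derivatives within a half-open set are unique.\<close>

lemma smooth_on_imp_Ck_at:
  assumes f: "smooth_on U f" and U: "halfopen U" and p: "p \<in> U"
  shows "Ck_at k U p f"
proof -
  obtain W g where W: "open W" "p \<in> W" "\<forall>k. Ck_on k W g" "\<forall>y\<in>U \<inter> W. g y = f y"
    by (rule smooth_onE[OF f p])
  have "Ck_at k W p g" using W Ck_on_iff by blast
  then have "Ck_at k U p g" by (rule Ck_germ_subset[OF order_refl U p W(1,2), rotated -1]) auto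
  then show ?thesis
    by (rule Ck_germ_cong_aux[OF order_refl _ p, rotated -1])
       (unfold eventually_germ_filter_unit, use W in \<open>auto intro!: exI[of _ W]\<close>)
qed

lemma smooth_on_has_derivative:
  assumes "smooth_on U f" "halfopen U" "x \<in> U"
  shows "(f has_derivative frechet_derivative f (at x within U)) (at x within U)"
proof -
  have "Ck_at (Suc 0) U x f" using smooth_on_imp_Ck_at[OF assms] .
  from germ_filter_at[OF order_refl Ck_germ_SucE[OF order_refl this] assms(3)]
  show ?thesis by simp
qed

lemma smooth_on_continuous_derivative:
  assumes "smooth_on U f" "halfopen U"
  shows "continuous_on U (\<lambda>x. frechet_derivative f (at x within U) v)"
  unfolding continuous_on_def
proof
  fix x assume "x \<in> U"
  then have "Ck_at (Suc 0) U x f" using smooth_on_imp_Ck_at[OF assms] by blast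
  then have "((\<lambda>x. frechet_derivative f (at x within U) v) \<longlongrightarrow> frechet_derivative f (at x within U) v) (inf (nhds x) (principal U))"
    by (subst tendsto_germ_filter_unit[of "\<lambda>x. frechet_derivative f (at x within U) v", symmetric]) simp
  then show "((\<lambda>x. frechet_derivative f (at x within U) v) \<longlongrightarrow> frechet_derivative f (at x within U) v) (at x within U)"
    using tendsto_at_within_iff_tendsto_nhds[of "\<lambda>x. frechet_derivative f (at x within U) v" x U] by blast
qed

text \<open>The head of the list in \<open>iter_deriv\<close> is the last derivative taken, whereas
  \<open>Ck_germ\<close> recurses on the first; splitting lists at the end reconciles the
  two.\<close>

lemma iter_deriv_snoc:
  "iter_deriv (vs @ [v]) U f = iter_deriv vs U (\<lambda>x. frechet_derivative f (at x within U) v)"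
  by (induction vs) auto

text \<open>Allows the domains \<open>loc_dom c c' g\<close>, which vary with \<open>g\<close>, to
  be replaced by the fixed chart image.\<close>

lemma iter_deriv_openin:
  assumes "openin (top_of_set U) S"
  shows "x \<in> S \<Longrightarrow> iter_deriv vs S f x = iter_deriv vs U f x"
proof (induction vs arbitrary: x)
  case (Cons v vs)
  obtain W where W: "open W" "S = U \<inter> W" using assms openin_open by blast
  have "frechet_derivative (iter_deriv vs S f) (at x within S) = frechet_derivative (iter_deriv vs U f) (at x within S)"
    by (rule frechet_derivative_local_cong[of UNIV]) (use Cons in auto)
  then show ?case using at_within_openin[OF assms Cons(2)] by simp
qed simp

lemma Ck_germ_iter_deriv:
  "Ck_germ k F i0 U p u \<Longrightarrow> length vs \<le> k \<Longrightarrow>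
    ((\<lambda>z. iter_deriv vs U (u (fst z)) (snd z)) \<longlongrightarrow> iter_deriv vs U (u i0) p) (germ_filter F U p)"
proof (induction k arbitrary: u vs)
  case (Suc k)
  show ?case
  proof (cases vs rule: rev_cases)
    case Nil
    then show ?thesis using Ck_germ_tendsto[OF Suc(2)] by simp
  next
    case (snoc ws v)
    then show ?thesis using Suc.IH[of "\<lambda>i y. frechet_derivative (u i) (at y within U) v" ws] Suc(2,3) by (simp add: iter_deriv_snoc)
  qed
qed simp

lemma Ck_at_derivative: "Ck_at (Suc k) U p f \<Longrightarrow> Ck_at k U p (\<lambda>x. frechet_derivative f (at x within U) v)"
  by simp

text \<open>The way back from the data that the smooth topology controls, namely iterated
  derivatives in basis directions. Differentiability comes from the smoothness of the individual
  members, and linearity of the derivative extends the control from basis vectors to all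
  directions.\<close>

lemma Ck_germI_iter_deriv:
  fixes u :: "'i \<Rightarrow> 'e::euclidean_space \<Rightarrow> 'f::real_normed_vector"
  assumes F0: "principal {i0} \<le> F" and U: "halfopen U" and p: "p \<in> U"
  shows "(\<forall>\<^sub>F z in germ_filter F U p. \<forall>l. Ck_at l U (snd z) (u (fst z))) \<Longrightarrow>
    (\<And>vs. set vs \<subseteq> Basis \<Longrightarrow> length vs \<le> k \<Longrightarrow>
      ((\<lambda>z. iter_deriv vs U (u (fst z)) (snd z)) \<longlongrightarrow> iter_deriv vs U (u i0) p) (germ_filter F U p)) \<Longrightarrow>
    Ck_germ k F i0 U p u"
proof (induction k arbitrary: u)
  case 0
  from 0(2)[of "[]"] show ?case by simp
next
  case (Suc k)
  let ?D = "\<lambda>b i y. frechet_derivative (u i) (at y within U) b"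
  have b: "Ck_germ k F i0 U p (?D b)" if "b \<in> Basis" for b
  proof (rule Suc.IH)
    show "\<forall>\<^sub>F z in germ_filter F U p. \<forall>l. Ck_at l U (snd z) (?D b (fst z))"
      using Suc(2) by eventually_elim (use Ck_at_derivative in blast)
    show "((\<lambda>z. iter_deriv vs U (?D b (fst z)) (snd z)) \<longlongrightarrow> iter_deriv vs U (?D b i0) p) (germ_filter F U p)"
      if "set vs \<subseteq> Basis" "length vs \<le> k" for vs
      using Suc(3)[of "vs @ [b]"] that \<open>b \<in> Basis\<close> by (simp add: iter_deriv_snoc)
  qed
  show ?case
  proof (rule Ck_germ_SucI[OF F0 U p])
    show "((\<lambda>z. u (fst z) (snd z)) \<longlongrightarrow> u i0 p) (germ_filter F U p)" using Suc(3)[of "[]"] by simp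
    show "\<forall>\<^sub>F (i, y) in germ_filter F U p. (u i has_derivative (\<lambda>v. \<Sum>b\<in>Basis. (v \<bullet> b) *\<^sub>R ?D b i y)) (at y within U)"
      using Suc(2) eventually_germ_filter_set
    proof eventually_elim
      case (elim z)
      obtain i y where z: "z = (i, y)" by (cases z)
      have "Ck_at (Suc 0) U y (u i)" using elim z by auto
      from germ_filter_at[OF order_refl Ck_germ_SucE[OF order_refl this]]
      have d: "(u i has_derivative frechet_derivative (u i) (at y within U)) (at y within U)" using elim z by simp
      then have "frechet_derivative (u i) (at y within U) = (\<lambda>v. \<Sum>b\<in>Basis. (v \<bullet> b) *\<^sub>R ?D b i y)"
        using linear_Basis_expand[OF has_derivative_bounded_linear[OF d]] by blast
      then show ?case using d z by simp
    qed
    show "Ck_germ k F i0 U p (\<lambda>i y. \<Sum>b\<in>Basis. (v \<bullet> b) *\<^sub>R ?D b i y)" for v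
      by (intro Ck_germ_sum[OF F0 U p] Ck_germ_scaleR[OF F0 U p] Ck_germ_const[OF F0 U p] b) auto
  qed
qed

section \<open>Smooth maps between manifolds\<close>

abbreviation cimg :: "('a, 'e) chart \<Rightarrow> 'e set" where "cimg c \<equiv> snd c ` fst c"
abbreviation cinv :: "('a, 'e) chart \<Rightarrow> 'e \<Rightarrow> 'a" where "cinv c \<equiv> inv_into (fst c) (snd c)"

lemma manifold_chart: "manifold M \<Longrightarrow> c \<in> charts M \<Longrightarrow> is_chart (mtop M) c"
  by (simp add: manifold_def)

lemma chart_openin: "is_chart X c \<Longrightarrow> openin X (fst c)"
  by (simp add: is_chart_def)

lemma chart_topspace: "is_chart X c \<Longrightarrow> topspace (subtopology X (fst c)) = fst c"
  by (simp add: Int_absorb1 openin_subset[OF chart_openin])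

lemma chart_homeomorphic:
  "is_chart X c \<Longrightarrow> homeomorphic_map (subtopology X (fst c)) (top_of_set (cimg c)) (snd c)"
  by (simp add: is_chart_def)

lemma chart_inj:
  assumes "is_chart X c"
  shows "inj_on (snd c) (fst c)"
  using homeomorphic_imp_injective_map[OF chart_homeomorphic[OF assms]] unfolding chart_topspace[OF assms] .

lemma chart_halfopen: "is_chart X c \<Longrightarrow> halfopen (cimg c)"
  unfolding is_chart_def by (elim conjE disjE) (rule open_halfopen, assumption, unfold halfopen_def, blast)

lemma cinv_simps [simp]:
  assumes "is_chart X c"
  shows "x \<in> fst c \<Longrightarrow> cinv c (snd c x) = x"
  using chart_inj[OF assms] by (rule inv_into_f_f)

lemma chart_open_image:
  assumes "is_chart X c" "openin X V" "V \<subseteq> fst c"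
  shows "openin (top_of_set (cimg c)) (snd c ` V)"
proof -
  have "open_map (subtopology X (fst c)) (top_of_set (cimg c)) (snd c)"
    by (rule homeomorphic_imp_open_map[OF chart_homeomorphic[OF assms(1)]])
  moreover have "openin (subtopology X (fst c)) V"
    using assms openin_open_subtopology[OF chart_openin[OF assms(1)]] by simp
  ultimately show ?thesis unfolding open_map_def by blast
qed

lemma chart_continuous:
  assumes "is_chart X c"
  shows "continuous_map (subtopology X (fst c)) euclidean (snd c)"
  by (rule continuous_map_into_fulltopology[OF homeomorphic_imp_continuous_map[OF chart_homeomorphic[OF assms]]])

lemma chart_preimage:
  assumes "is_chart X c" "open V"
  shows "openin X {x \<in> fst c. snd c x \<in> V}"
proof -
  have "openin (subtopology X (fst c)) {x \<in> topspace (subtopology X (fst c)). snd c x \<in> V}"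
    using openin_continuous_map_preimage[OF chart_continuous[OF assms(1)]] assms(2) by simp
  then show ?thesis unfolding chart_topspace[OF assms(1)] by (rule openin_trans_full[OF _ chart_openin[OF assms(1)]])
qed

lemma cinv_continuous:
  assumes "is_chart X c"
  shows "continuous_map (top_of_set (cimg c)) X (cinv c)"
  unfolding continuous_map_def
proof safe
  fix x assume "x \<in> topspace (top_of_set (cimg c))"
  then have "cinv c x \<in> fst c" by (auto intro: inv_into_into)
  then show "cinv c x \<in> topspace X" using chart_openin[OF assms] openin_subset by blast
next
  fix U assume U: "openin X U"
  have "{x \<in> topspace (top_of_set (cimg c)). cinv c x \<in> U} = snd c ` (U \<inter> fst c)"
    using cinv_simps[OF assms] by (auto simp: image_iff)
  then show "openin (top_of_set (cimg c)) {x \<in> topspace (top_of_set (cimg c)). cinv c x \<in> U}"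
    using chart_open_image[OF assms, of "U \<inter> fst c"] U chart_openin[OF assms] by auto
qed

lemma point_chart:
  assumes "manifold M" "x \<in> points M"
  obtains c where "c \<in> charts M" "x \<in> fst c"
  using assms unfolding manifold_def by blast

lemma chart_points: "manifold M \<Longrightarrow> c \<in> charts M \<Longrightarrow> fst c \<subseteq> points M"
  by (rule openin_subset[OF chart_openin[OF manifold_chart]])

lemma smooth_map_subset_points: "smooth_map M A M' f \<Longrightarrow> A \<subseteq> points M"
  by (simp add: smooth_map_def)

lemma smooth_mapE:
  assumes "smooth_map M A M' f" "x \<in> A"
  obtains c c' W where "c \<in> charts M" "c' \<in> charts M'" "openin (mtop M) W" "x \<in> W" "W \<subseteq> fst c"
    "f ` (A \<inter> W) \<subseteq> fst c'" "smooth_on (snd c ` (A \<inter> W)) (loc_rep c c' f)"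
  using assms unfolding smooth_map_def by blast

lemma smooth_mapI:
  assumes "A \<subseteq> points M"
    and "\<And>x. x \<in> A \<Longrightarrow> \<exists>c\<in>charts M. \<exists>c'\<in>charts M'. \<exists>W. openin (mtop M) W \<and> x \<in> W \<and> W \<subseteq> fst c \<and>
        f ` (A \<inter> W) \<subseteq> fst c' \<and> smooth_on (snd c ` (A \<inter> W)) (loc_rep c c' f)"
  shows "smooth_map M A M' f"
  unfolding smooth_map_def using assms by blast

lemma loc_rep_at: "is_chart X c \<Longrightarrow> x \<in> fst c \<Longrightarrow> loc_rep c c' f (snd c x) = snd c' (f x)"
  by (simp add: loc_rep_def)

text \<open>\<open>smooth_map\<close> provides one suitable pair of charts near each point.
  Composing with transition maps on both sides gives smoothness in every pair.\<close>

lemma smooth_map_rep: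
  fixes f :: "'a \<Rightarrow> 'b"
  assumes M: "manifold M" and M': "manifold M'" and f: "smooth_map M A M' f"
    and c: "c \<in> charts M" and c': "c' \<in> charts M'"
  shows "smooth_on (snd c ` (A \<inter> fst c \<inter> f -` fst c')) (loc_rep c c' f)"
proof (rule smooth_on_local)
  let ?D = "snd c ` (A \<inter> fst c \<inter> f -` fst c')"
  note ic = manifold_chart[OF M c] and ic' = manifold_chart[OF M' c']
  fix p assume "p \<in> ?D"
  then obtain x where x: "p = snd c x" "x \<in> A" "x \<in> fst c" "f x \<in> fst c'" by blast
  obtain c1 c1' W where W: "c1 \<in> charts M" "c1' \<in> charts M'" "openin (mtop M) W" "x \<in> W" "W \<subseteq> fst c1"
    "f ` (A \<inter> W) \<subseteq> fst c1'" "smooth_on (snd c1 ` (A \<inter> W)) (loc_rep c1 c1' f)"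
    using smooth_mapE[OF f x(2)] by blast
  note i1 = manifold_chart[OF M W(1)] and i1' = manifold_chart[OF M' W(2)]
  have "openin (top_of_set (cimg c)) (snd c ` (W \<inter> fst c))"
    using chart_open_image[OF ic] W(3) chart_openin[OF ic] by blast
  \<comment> \<open>\<open>V\<close> expresses membership in \<open>W\<close> in the coordinates of
    \<open>c\<close>.\<close>
  then obtain V where V: "open V" "snd c ` (W \<inter> fst c) = cimg c \<inter> V" unfolding openin_open by blast
  let ?B = "snd c ` (A \<inter> W \<inter> fst c \<inter> f -` fst c')"
  have DB: "?D \<inter> V \<subseteq> ?B"
  proof
    fix z assume "z \<in> ?D \<inter> V"
    then obtain y where y: "z = snd c y" "y \<in> A" "y \<in> fst c" "f y \<in> fst c'" "z \<in> V" by blast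
    then have "z \<in> snd c ` (W \<inter> fst c)" using V by blast
    then have "y \<in> W" using y chart_inj[OF ic] by (auto dest: inj_onD)
    then show "z \<in> ?B" using y by blast
  qed
  have 1: "smooth_on ?B (loc_rep c c1 (\<lambda>x. x))"
    by (rule smooth_on_subset[of "loc_dom c c1 (\<lambda>x. x)"])
       (use M c W in \<open>auto simp: manifold_def loc_dom_def\<close>)
  have 2: "loc_rep c c1 (\<lambda>x. x) ` ?B \<subseteq> snd c1 ` (A \<inter> W)"
    using ic by (auto simp: loc_rep_at)
  have 3: "smooth_on ?B (\<lambda>z. loc_rep c1 c1' f (loc_rep c c1 (\<lambda>x. x) z))"
    by (rule smooth_on_compose[OF 1 W(7) 2])
  have 4: "smooth_on (loc_dom c1' c' (\<lambda>x. x)) (loc_rep c1' c' (\<lambda>x. x))"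
    using M' W c' by (auto simp: manifold_def)
  have 5: "(\<lambda>z. loc_rep c1 c1' f (loc_rep c c1 (\<lambda>x. x) z)) ` ?B \<subseteq> loc_dom c1' c' (\<lambda>x. x)"
    using W(5,6) ic i1 by (auto simp: loc_rep_at loc_dom_def subset_iff intro!: imageI)
  have 6: "smooth_on ?B (\<lambda>z. loc_rep c1' c' (\<lambda>x. x) (loc_rep c1 c1' f (loc_rep c c1 (\<lambda>x. x) z)))"
    by (rule smooth_on_compose[OF 3 4 5])
  have "smooth_on ?B (loc_rep c c' f)"
  proof (rule smooth_on_cong[THEN iffD1, OF _ 6])
    fix z assume "z \<in> ?B"
    then obtain y where y: "z = snd c y" "y \<in> A" "y \<in> fst c" "f y \<in> fst c'" "y \<in> W" by blast
    then have "y \<in> fst c1" "f y \<in> fst c1'" using W(5,6) by auto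
    then show "loc_rep c1' c' (\<lambda>x. x) (loc_rep c1 c1' f (loc_rep c c1 (\<lambda>x. x) z)) = loc_rep c c' f z"
      using y ic i1 i1' by (simp add: loc_rep_at)
  qed
  then have "smooth_on (?D \<inter> V) (loc_rep c c' f)" using smooth_on_subset DB by blast
  moreover have "p \<in> V" using x W V by blast
  ultimately show "\<exists>V. open V \<and> p \<in> V \<and> smooth_on (?D \<inter> V) (loc_rep c c' f)" using V by blast
qed

lemma smooth_map_continuous:
  fixes f :: "'a \<Rightarrow> 'b"
  assumes M: "manifold M" and M': "manifold M'" and f: "smooth_map M A M' f"
  shows "continuous_map (subtopology (mtop M) A) (mtop M') f"
  unfolding continuous_map_eq_topcontinuous_at topcontinuous_at_def
proof (intro ballI conjI allI impI)
  have A: "A \<subseteq> points M" by (rule smooth_map_subset_points[OF f])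
  fix x assume x0: "x \<in> topspace (subtopology (mtop M) A)"
  then show "x \<in> topspace (subtopology (mtop M) A)" .
  from x0 have x: "x \<in> A" by simp
  show "f \<in> topspace (subtopology (mtop M) A) \<rightarrow> points M'"
  proof
    fix y assume "y \<in> topspace (subtopology (mtop M) A)"
    then have "y \<in> A" by simp
    from smooth_mapE[OF f this] obtain c' W where "c' \<in> charts M'" "y \<in> W" "f ` (A \<inter> W) \<subseteq> fst c'" by metis
    then show "f y \<in> points M'" using chart_points[OF M'] \<open>y \<in> A\<close> by blast
  qed
  fix V assume V: "openin (mtop M') V \<and> f x \<in> V"
  obtain c c' W where W: "c \<in> charts M" "c' \<in> charts M'" "openin (mtop M) W" "x \<in> W" "W \<subseteq> fst c"
    "f ` (A \<inter> W) \<subseteq> fst c'" "smooth_on (snd c ` (A \<inter> W)) (loc_rep c c' f)"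
    using smooth_mapE[OF f x] by blast
  note ic = manifold_chart[OF M W(1)] and ic' = manifold_chart[OF M' W(2)]
  have "openin (top_of_set (cimg c')) (snd c' ` (V \<inter> fst c'))"
    using chart_open_image[OF ic'] V chart_openin[OF ic'] by blast
  then obtain V1 where V1: "open V1" "snd c' ` (V \<inter> fst c') = cimg c' \<inter> V1" unfolding openin_open by blast
  have "openin (top_of_set (snd c ` (A \<inter> W))) (snd c ` (A \<inter> W) \<inter> loc_rep c c' f -` V1)"
    using smooth_on_imp_continuous_on[OF W(7)] V1(1) continuous_openin_preimage_gen by blast
  then obtain V2 where V2: "open V2" "snd c ` (A \<inter> W) \<inter> loc_rep c c' f -` V1 = snd c ` (A \<inter> W) \<inter> V2"
    unfolding openin_open by blast
  let ?U = "A \<inter> (W \<inter> {y \<in> fst c. snd c y \<in> V2})"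
  have "openin (subtopology (mtop M) A) ?U"
    using chart_preimage[OF ic V2(1)] W(3) by (simp add: openin_subtopology_Int2 openin_Int)
  moreover have "x \<in> ?U"
  proof -
    have "f x \<in> V \<inter> fst c'" using V W x by blast
    then have "loc_rep c c' f (snd c x) \<in> V1" using V1(2) loc_rep_at[OF ic] W x by blast
    then have "snd c x \<in> V2" using V2 W x by blast
    then show ?thesis using x W by blast
  qed
  moreover have "f y \<in> V" if y: "y \<in> ?U" for y
  proof -
    have "snd c y \<in> snd c ` (A \<inter> W) \<inter> V2" using y by blast
    then have "loc_rep c c' f (snd c y) \<in> V1" using V2(2) by blast
    then have "snd c' (f y) \<in> V1" using y loc_rep_at[OF ic, of y c' f] by simp
    moreover have "f y \<in> fst c'" using W y by blast
    ultimately have "snd c' (f y) \<in> snd c' ` (V \<inter> fst c')" using V1(2) by blast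
    then show "f y \<in> V" using chart_inj[OF ic'] \<open>f y \<in> fst c'\<close> by (auto dest: inj_onD)
  qed
  ultimately show "\<exists>U. openin (subtopology (mtop M) A) U \<and> x \<in> U \<and> (\<forall>y\<in>U. f y \<in> V)" by blast
qed

lemma continuous_map_nbhd:
  assumes "continuous_map (subtopology X A) Y f" "x \<in> A" "A \<subseteq> topspace X" "openin Y V" "f x \<in> V"
  obtains W where "openin X W" "x \<in> W" "f ` (A \<inter> W) \<subseteq> V"
proof -
  have "openin (subtopology X A) {y \<in> topspace (subtopology X A). f y \<in> V}"
    using assms(1,4) openin_continuous_map_preimage by blast
  then obtain W where "openin X W" "{y \<in> topspace (subtopology X A). f y \<in> V} = W \<inter> A"
    unfolding openin_subtopology by blast
  then show thesis using that[of W] assms by auto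
qed

lemma smooth_map_compose:
  fixes f :: "'a \<Rightarrow> 'b" and g :: "'b \<Rightarrow> 'c"
  assumes M: "manifold M" and M': "manifold M'" and M'': "manifold M''"
    and f: "smooth_map M A M' f" and g: "smooth_map M' B M'' g" and fA: "f ` A \<subseteq> B"
  shows "smooth_map M A M'' (\<lambda>x. g (f x))"
proof (rule smooth_mapI)
  show A: "A \<subseteq> points M" by (rule smooth_map_subset_points[OF f])
  have B: "B \<subseteq> points M'" by (rule smooth_map_subset_points[OF g])
  have "f \<in> topspace (subtopology (mtop M) A) \<rightarrow> B" using fA by auto
  then have "continuous_map (subtopology (mtop M) A) (subtopology (mtop M') B) f"
    using smooth_map_continuous[OF M M' f] by (simp add: continuous_map_in_subtopology image_subset_iff_funcset)
  from continuous_map_compose[OF this smooth_map_continuous[OF M' M'' g]]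
  have gf: "continuous_map (subtopology (mtop M) A) (mtop M'') (\<lambda>x. g (f x))" by (simp add: o_def)
  fix x assume x: "x \<in> A"
  obtain c where c: "c \<in> charts M" "x \<in> fst c" using point_chart[OF M] x A by blast
  obtain c' where c': "c' \<in> charts M'" "f x \<in> fst c'" using point_chart[OF M', of "f x"] x fA B by blast
  have "g (f x) \<in> points M''" using continuous_map_image_subset_topspace[OF gf] x A by auto
  then obtain c'' where c'': "c'' \<in> charts M''" "g (f x) \<in> fst c''" using point_chart[OF M''] by blast
  note ic = manifold_chart[OF M c(1)] and ic' = manifold_chart[OF M' c'(1)] and ic'' = manifold_chart[OF M'' c''(1)]
  obtain W1 where W1: "openin (mtop M) W1" "x \<in> W1" "f ` (A \<inter> W1) \<subseteq> fst c'"
    using continuous_map_nbhd[OF smooth_map_continuous[OF M M' f] x A chart_openin[OF ic'] c'(2)] by blast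
  obtain W2 where W2: "openin (mtop M) W2" "x \<in> W2" "(\<lambda>x. g (f x)) ` (A \<inter> W2) \<subseteq> fst c''"
    using continuous_map_nbhd[OF gf x A chart_openin[OF ic''] c''(2)] by blast
  let ?W = "W1 \<inter> W2 \<inter> fst c"
  have 1: "openin (mtop M) ?W" using W1 W2 chart_openin[OF ic] by blast
  have 2: "smooth_on (snd c ` (A \<inter> ?W)) (loc_rep c c' f)"
    by (rule smooth_on_subset[OF smooth_map_rep[OF M M' f c(1) c'(1)]]) (use W1 in blast)
  have 3: "smooth_on (snd c ` (A \<inter> ?W)) (\<lambda>z. loc_rep c' c'' g (loc_rep c c' f z))"
    by (rule smooth_on_compose[OF 2 smooth_map_rep[OF M' M'' g c'(1) c''(1)]])
      (use W1 W2 fA ic in \<open>auto simp: loc_rep_at image_subset_iff intro!: imageI\<close>)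
  have 4: "smooth_on (snd c ` (A \<inter> ?W)) (loc_rep c c'' (\<lambda>x. g (f x)))"
  proof (rule smooth_on_cong[THEN iffD1, OF _ 3])
    fix z assume "z \<in> snd c ` (A \<inter> ?W)"
    then obtain y where y: "z = snd c y" "y \<in> A" "y \<in> ?W" by blast
    then have "f y \<in> fst c'" using W1 by blast
    then show "loc_rep c' c'' g (loc_rep c c' f z) = loc_rep c c'' (\<lambda>x. g (f x)) z"
      using y ic ic' by (simp add: loc_rep_at)
  qed
  show "\<exists>c\<in>charts M. \<exists>c''\<in>charts M''. \<exists>W. openin (mtop M) W \<and> x \<in> W \<and> W \<subseteq> fst c \<and>
        (\<lambda>x. g (f x)) ` (A \<inter> W) \<subseteq> fst c'' \<and> smooth_on (snd c ` (A \<inter> W)) (loc_rep c c'' (\<lambda>x. g (f x)))"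
    using 1 4 c c'' W1(2) W2(2,3) by (intro bexI[of _ c] bexI[of _ c''] exI[of _ ?W]) blast+
qed

lemma smooth_map_subset: "smooth_map M A M' f \<Longrightarrow> B \<subseteq> A \<Longrightarrow> smooth_map M B M' f"
proof (rule smooth_mapI)
  assume f: "smooth_map M A M' f" and B: "B \<subseteq> A"
  show "B \<subseteq> points M" using smooth_map_subset_points[OF f] B by blast
  fix x assume "x \<in> B"
  then have "x \<in> A" using B by blast
  from smooth_mapE[OF f this] obtain c c' W where W: "c \<in> charts M" "c' \<in> charts M'" "openin (mtop M) W" "x \<in> W" "W \<subseteq> fst c"
    "f ` (A \<inter> W) \<subseteq> fst c'" "smooth_on (snd c ` (A \<inter> W)) (loc_rep c c' f)" .
  have "smooth_on (snd c ` (B \<inter> W)) (loc_rep c c' f)"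
    by (rule smooth_on_subset[OF W(7)]) (use B in blast)
  then show "\<exists>c\<in>charts M. \<exists>c'\<in>charts M'. \<exists>W. openin (mtop M) W \<and> x \<in> W \<and> W \<subseteq> fst c \<and>
        f ` (B \<inter> W) \<subseteq> fst c' \<and> smooth_on (snd c ` (B \<inter> W)) (loc_rep c c' f)"
    using W B by (intro bexI[of _ c] bexI[of _ c'] exI[of _ W]) blast+
qed

lemma smooth_map_local:
  assumes "\<And>x. x \<in> A \<Longrightarrow> \<exists>V. openin (mtop M) V \<and> x \<in> V \<and> smooth_map M (A \<inter> V) M' f"
  shows "smooth_map M A M' f"
proof (rule smooth_mapI)
  show "A \<subseteq> points M" using assms openin_subset by blast
  fix x assume x: "x \<in> A"
  obtain V where V: "openin (mtop M) V" "x \<in> V" "smooth_map M (A \<inter> V) M' f" using assms[OF x] by blast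
  have "x \<in> A \<inter> V" using x V by blast
  from smooth_mapE[OF V(3) this] obtain c c' W where W: "c \<in> charts M" "c' \<in> charts M'" "openin (mtop M) W" "x \<in> W" "W \<subseteq> fst c"
    "f ` (A \<inter> V \<inter> W) \<subseteq> fst c'" "smooth_on (snd c ` (A \<inter> V \<inter> W)) (loc_rep c c' f)" .
  then show "\<exists>c\<in>charts M. \<exists>c'\<in>charts M'. \<exists>W. openin (mtop M) W \<and> x \<in> W \<and> W \<subseteq> fst c \<and>
        f ` (A \<inter> W) \<subseteq> fst c' \<and> smooth_on (snd c ` (A \<inter> W)) (loc_rep c c' f)"
    using V by (intro bexI[of _ c] bexI[of _ c'] exI[of _ "V \<inter> W"]) (auto simp: Int_assoc)
qed

lemma smooth_map_cong_imp:
  assumes M: "manifold M" and f: "smooth_map M A M' f" and eq: "\<And>x. x \<in> A \<Longrightarrow> f x = g x"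
  shows "smooth_map M A M' g"
proof (rule smooth_mapI)
  show "A \<subseteq> points M" by (rule smooth_map_subset_points[OF f])
  fix x assume x: "x \<in> A"
  from smooth_mapE[OF f x] obtain c c' W where W: "c \<in> charts M" "c' \<in> charts M'" "openin (mtop M) W" "x \<in> W" "W \<subseteq> fst c"
    "f ` (A \<inter> W) \<subseteq> fst c'" "smooth_on (snd c ` (A \<inter> W)) (loc_rep c c' f)" .
  note ic = manifold_chart[OF M W(1)]
  have "smooth_on (snd c ` (A \<inter> W)) (loc_rep c c' g)"
    by (rule smooth_on_cong[THEN iffD1, OF _ W(7)]) (use W(5) eq ic in \<open>auto simp: loc_rep_at subset_iff\<close>)
  moreover have "g ` (A \<inter> W) \<subseteq> fst c'" using W(6) eq by auto
  ultimately show "\<exists>c\<in>charts M. \<exists>c'\<in>charts M'. \<exists>W. openin (mtop M) W \<and> x \<in> W \<and> W \<subseteq> fst c \<and>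
        g ` (A \<inter> W) \<subseteq> fst c' \<and> smooth_on (snd c ` (A \<inter> W)) (loc_rep c c' g)"
    using W by (intro bexI[of _ c] bexI[of _ c'] exI[of _ W]) blast+
qed

lemma eucl_simps [simp]: "mtop eucl = euclidean" "charts eucl = {(UNIV, \<lambda>x. x)}"
  by (simp_all add: eucl_def)

lemma eucl_cinv [simp]: "inv_into UNIV (\<lambda>x. x) = (\<lambda>x. x)"
  using inv_into_f_f[of "\<lambda>x. x" UNIV] by (auto simp: fun_eq_iff)

lemma manifold_eucl: "manifold (eucl :: ('e::euclidean_space, 'e) mfd)"
proof -
  have "is_chart (euclidean :: 'e topology) (UNIV, \<lambda>x. x)"
    unfolding is_chart_def using homeomorphic_map_id[of "euclidean :: 'e topology" euclidean] by (simp add: id_def)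
  moreover have "smooth_on UNIV (\<lambda>x::'e. x)" using smooth_on_linear bounded_linear_ident by blast
  moreover have "second_countable (euclidean :: 'e topology)"
  proof -
    obtain B :: "'e set set" where B: "countable B" "topological_basis B"
      using ex_countable_basis by blast
    then show ?thesis unfolding second_countable_def
      by (intro exI[of _ B]) (metis open_openin topological_basis_def topological_basis_open topological_basisE)
  qed
  ultimately show ?thesis
    by (simp add: manifold_def loc_rep_def loc_dom_def o_def)
qed

lemma smooth_map_ident: "manifold M \<Longrightarrow> A \<subseteq> points M \<Longrightarrow> smooth_map M A M (\<lambda>x. x)"
proof (rule smooth_mapI)
  assume M: "manifold M" and A: "A \<subseteq> points M"
  fix x assume "x \<in> A"
  then obtain c where c: "c \<in> charts M" "x \<in> fst c" using point_chart[OF M] A by blast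
  note ic = manifold_chart[OF M c(1)]
  have "smooth_on (snd c ` (A \<inter> fst c)) (loc_rep c c (\<lambda>x. x))"
    by (rule smooth_on_cong[THEN iffD1, OF _ smooth_on_linear[OF bounded_linear_ident]])
      (use ic in \<open>auto simp: loc_rep_at\<close>)
  then show "\<exists>c\<in>charts M. \<exists>c'\<in>charts M. \<exists>W. openin (mtop M) W \<and> x \<in> W \<and> W \<subseteq> fst c \<and>
        (\<lambda>x. x) ` (A \<inter> W) \<subseteq> fst c' \<and> smooth_on (snd c ` (A \<inter> W)) (loc_rep c c' (\<lambda>x. x))"
    using c chart_openin[OF ic] by (intro bexI[of _ c] exI[of _ "fst c"]) auto
qed

lemma smooth_map_chart:
  assumes M: "manifold M" and c: "c \<in> charts M"
  shows "smooth_map M (fst c) eucl (snd c)"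
  unfolding smooth_map_def
proof (intro conjI ballI)
  note ic = manifold_chart[OF M c]
  show "fst c \<subseteq> points M" by (rule chart_points[OF assms])
  fix x assume x: "x \<in> fst c"
  have s: "smooth_on (cimg c) (loc_rep c (UNIV, \<lambda>x. x) (snd c))"
    by (rule smooth_on_cong[THEN iffD1, OF _ smooth_on_linear[OF bounded_linear_ident]])
      (use ic in \<open>auto simp: loc_rep_def\<close>)
  show "\<exists>ca\<in>charts M. \<exists>c'\<in>charts eucl. \<exists>W. openin (mtop M) W \<and> x \<in> W \<and> W \<subseteq> fst ca \<and>
        snd c ` (fst c \<inter> W) \<subseteq> fst c' \<and> smooth_on (snd ca ` (fst c \<inter> W)) (loc_rep ca c' (snd c))"
    using s x c chart_openin[OF ic] by (intro bexI[of _ c] bexI[of _ "(UNIV, \<lambda>x. x)"] exI[of _ "fst c"]) auto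
qed

lemma smooth_map_cinv:
  assumes M: "manifold M" and c: "c \<in> charts M"
  shows "smooth_map eucl (cimg c) M (cinv c)"
  unfolding smooth_map_def
proof (intro conjI ballI)
  note ic = manifold_chart[OF M c]
  show "cimg c \<subseteq> points eucl" by simp
  fix p assume p: "p \<in> cimg c"
  have s: "smooth_on (cimg c) (loc_rep (UNIV, \<lambda>x. x) c (cinv c))"
    by (rule smooth_on_cong[THEN iffD1, OF _ smooth_on_linear[OF bounded_linear_ident]])
      (auto simp: loc_rep_def f_inv_into_f)
  show "\<exists>ca\<in>charts eucl. \<exists>c'\<in>charts M. \<exists>W. openin (mtop eucl) W \<and> p \<in> W \<and> W \<subseteq> fst ca \<and>
        cinv c ` (cimg c \<inter> W) \<subseteq> fst c' \<and> smooth_on (snd ca ` (cimg c \<inter> W)) (loc_rep ca c' (cinv c))"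
    using s c by (intro bexI[of _ c] bexI[of _ "(UNIV, \<lambda>x. x)"] exI[of _ UNIV]) (auto simp: inv_into_into)
qed

lemma smooth_map_eucl:
  assumes "smooth_on A f"
  shows "smooth_map eucl A eucl f"
  using assms unfolding smooth_map_def by (auto simp: loc_rep_def o_def intro!: exI[of _ UNIV])

section \<open>Derivatives in charts\<close>

lemma smooth_map_openin_dom:
  fixes f :: "'a \<Rightarrow> 'b"
  assumes M: "manifold M" and M': "manifold M'" and f: "smooth_map M A M' f" and A: "openin (mtop M) A"
    and c: "c \<in> charts M" and c': "c' \<in> charts M'"
  shows "openin (mtop M) (A \<inter> fst c \<inter> f -` fst c')"
    and "openin (top_of_set (cimg c)) (snd c ` (A \<inter> fst c \<inter> f -` fst c'))"
proof -
  note ic = manifold_chart[OF M c] and ic' = manifold_chart[OF M' c']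
  have "openin (subtopology (mtop M) A) {x \<in> topspace (subtopology (mtop M) A). f x \<in> fst c'}"
    using openin_continuous_map_preimage[OF smooth_map_continuous[OF M M' f] chart_openin[OF ic']] .
  then have "openin (mtop M) {x \<in> topspace (subtopology (mtop M) A). f x \<in> fst c'}"
    using A openin_trans_full by blast
  moreover have "{x \<in> topspace (subtopology (mtop M) A). f x \<in> fst c'} \<inter> fst c = A \<inter> fst c \<inter> f -` fst c'"
    using openin_subset[OF A] by auto
  ultimately show 1: "openin (mtop M) (A \<inter> fst c \<inter> f -` fst c')" using chart_openin[OF ic] by (metis openin_Int)
  show "openin (top_of_set (cimg c)) (snd c ` (A \<inter> fst c \<inter> f -` fst c'))"
    by (rule chart_open_image[OF ic 1]) blast
qed

text \<open>\<open>f\<close> is arbitrary outside \<open>A\<close>, so \<open>loc_dom\<close> may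
  contain points about which nothing is known. It still lies between a relative neighbourhood of the
  point and the chart image, hence the filters coincide.\<close>

lemma loc_deriv_within:
  fixes f :: "'a \<Rightarrow> 'b"
  assumes M: "manifold M" and M': "manifold M'" and f: "smooth_map M A M' f" and A: "openin (mtop M) A"
    and c: "c \<in> charts M" and c': "c' \<in> charts M'" and x: "x \<in> A" "x \<in> fst c" "f x \<in> fst c'"
  shows "at (snd c x) within loc_dom c c' f = at (snd c x) within cimg c"
    and "at (snd c x) within snd c ` (A \<inter> fst c \<inter> f -` fst c') = at (snd c x) within cimg c"
proof -
  let ?S = "snd c ` (A \<inter> fst c \<inter> f -` fst c')"
  note o = smooth_map_openin_dom(2)[OF M M' f A c c']
  have p: "snd c x \<in> ?S" using x by blast
  show "at (snd c x) within ?S = at (snd c x) within cimg c" by (rule at_within_openin[OF o p])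
  obtain T where T: "open T" "?S = cimg c \<inter> T" using o openin_open by blast
  have "?S \<subseteq> loc_dom c c' f" "loc_dom c c' f \<subseteq> cimg c" unfolding loc_dom_def by blast+
  then show "at (snd c x) within loc_dom c c' f = at (snd c x) within cimg c"
    using T p by (intro at_within_nhd[of _ T]) blast+
qed

lemma loc_deriv_has_derivative:
  fixes f :: "'a \<Rightarrow> 'b"
  assumes M: "manifold M" and M': "manifold M'" and f: "smooth_map M A M' f" and A: "openin (mtop M) A"
    and c: "c \<in> charts M" and c': "c' \<in> charts M'" and x: "x \<in> A" "x \<in> fst c" "f x \<in> fst c'"
  shows "(loc_rep c c' f has_derivative loc_deriv c c' f x) (at (snd c x) within cimg c)"
proof -
  let ?S = "snd c ` (A \<inter> fst c \<inter> f -` fst c')"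
  note o = smooth_map_openin_dom(2)[OF M M' f A c c'] and w = loc_deriv_within[OF assms]
  have "(loc_rep c c' f has_derivative frechet_derivative (loc_rep c c' f) (at (snd c x) within ?S)) (at (snd c x) within ?S)"
    by (rule smooth_on_has_derivative[OF smooth_map_rep[OF M M' f c c'] halfopen_openin[OF chart_halfopen[OF manifold_chart[OF M c]] o]])
      (use x in blast)
  then show ?thesis unfolding loc_deriv_def using w by simp
qed

lemma loc_deriv_unique:
  fixes f :: "'a \<Rightarrow> 'b"
  assumes M: "manifold M" and M': "manifold M'" and f: "smooth_map M A M' f" and A: "openin (mtop M) A"
    and c: "c \<in> charts M" and c': "c' \<in> charts M'" and x: "x \<in> A" "x \<in> fst c" "f x \<in> fst c'"
    and D: "(loc_rep c c' f has_derivative D) (at (snd c x) within cimg c)"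
  shows "loc_deriv c c' f x = D"
  by (rule halfopen_derivative_unique[OF chart_halfopen[OF manifold_chart[OF M c]] _ loc_deriv_has_derivative[OF assms(1-9)] D])
    (use x in blast)

lemma loc_deriv_linear:
  fixes f :: "'a \<Rightarrow> 'b"
  assumes M: "manifold M" and M': "manifold M'" and f: "smooth_map M A M' f" and A: "openin (mtop M) A"
    and c: "c \<in> charts M" and c': "c' \<in> charts M'" and x: "x \<in> A" "x \<in> fst c" "f x \<in> fst c'"
  shows "bounded_linear (loc_deriv c c' f x)"
  using loc_deriv_has_derivative[OF assms] has_derivative_bounded_linear by blast

lemma loc_deriv_compose:
  fixes f :: "'a \<Rightarrow> 'b" and g :: "'b \<Rightarrow> 'c"
  assumes M: "manifold M" and M': "manifold M'" and M'': "manifold M''"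
    and f: "smooth_map M A M' f" and A: "openin (mtop M) A"
    and g: "smooth_map M' B M'' g" and B: "openin (mtop M') B" and fA: "f ` A \<subseteq> B"
    and c: "c \<in> charts M" and c': "c' \<in> charts M'" and c'': "c'' \<in> charts M''"
    and x: "x \<in> A" "x \<in> fst c" "f x \<in> fst c'" "g (f x) \<in> fst c''"
  shows "loc_deriv c c'' (\<lambda>x. g (f x)) x = (\<lambda>v. loc_deriv c' c'' g (f x) (loc_deriv c c' f x v))"
proof (rule loc_deriv_unique[OF M M'' smooth_map_compose[OF M M' M'' f g fA] A c c'' x(1,2,4)])
  note ic = manifold_chart[OF M c] and ic' = manifold_chart[OF M' c']
  let ?S = "snd c ` (A \<inter> fst c \<inter> f -` fst c')"
  have p: "snd c x \<in> ?S" using x by blast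
  have 1: "(loc_rep c c' f has_derivative loc_deriv c c' f x) (at (snd c x) within ?S)"
    using loc_deriv_has_derivative[OF M M' f A c c' x(1-3)] by (rule has_derivative_subset) blast
  have fx: "f x \<in> B" using x fA by blast
  have 2: "(loc_rep c' c'' g has_derivative loc_deriv c' c'' g (f x)) (at (loc_rep c c' f (snd c x)) within loc_rep c c' f ` ?S)"
    unfolding loc_rep_at[OF ic x(2)]
    by (rule has_derivative_subset[OF loc_deriv_has_derivative[OF M' M'' g B c' c'' fx x(3,4)]])
      (use ic in \<open>auto simp: loc_rep_at\<close>)
  have "((\<lambda>z. loc_rep c' c'' g (loc_rep c c' f z)) has_derivative (\<lambda>v. loc_deriv c' c'' g (f x) (loc_deriv c c' f x v))) (at (snd c x) within ?S)"
    using diff_chain_within[OF 1 2] by (simp add: o_def)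
  then have "(loc_rep c c'' (\<lambda>x. g (f x)) has_derivative (\<lambda>v. loc_deriv c' c'' g (f x) (loc_deriv c c' f x v))) (at (snd c x) within ?S)"
    by (rule has_derivative_local_cong[THEN iffD1, OF open_UNIV _ p, rotated -1])
      (use ic ic' in \<open>auto simp: loc_rep_at\<close>)
  then show "(loc_rep c c'' (\<lambda>x. g (f x)) has_derivative (\<lambda>v. loc_deriv c' c'' g (f x) (loc_deriv c c' f x v))) (at (snd c x) within cimg c)"
    using loc_deriv_within(2)[OF M M' f A c c' x(1-3)] by simp
qed

lemma loc_deriv_ident:
  assumes M: "manifold M" and c: "c \<in> charts M" and x: "x \<in> fst c"
  shows "loc_deriv c c (\<lambda>x. x) x = (\<lambda>v. v)"
proof (rule loc_deriv_unique[OF M M smooth_map_ident[OF M order_refl] openin_topspace c c _ x x])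
  note ic = manifold_chart[OF M c]
  show "x \<in> points M" using chart_points[OF M c] x by blast
  show "(loc_rep c c (\<lambda>x. x) has_derivative (\<lambda>v. v)) (at (snd c x) within cimg c)"
    by (rule has_derivative_local_cong[THEN iffD1, OF open_UNIV _ _ _ has_derivative_ident])
      (use ic x in \<open>auto simp: loc_rep_at\<close>)
qed

lemma loc_deriv_cong:
  fixes f :: "'a \<Rightarrow> 'b"
  assumes M: "manifold M" and M': "manifold M'" and f: "smooth_map M A M' f" and A: "openin (mtop M) A"
    and c: "c \<in> charts M" and c': "c' \<in> charts M'" and x: "x \<in> A" "x \<in> fst c" "f x \<in> fst c'"
    and eq: "\<And>x. x \<in> A \<Longrightarrow> f x = g x"
  shows "loc_deriv c c' f x = loc_deriv c c' g x"
proof (rule sym, rule loc_deriv_unique[OF M M' smooth_map_cong_imp[OF M f eq] A c c' x(1,2)])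
  note ic = manifold_chart[OF M c]
  let ?S = "snd c ` (A \<inter> fst c \<inter> f -` fst c')"
  show "g x \<in> fst c'" using eq x by auto
  have p: "snd c x \<in> ?S" using x by blast
  have "(loc_rep c c' f has_derivative loc_deriv c c' f x) (at (snd c x) within ?S)"
    using loc_deriv_has_derivative[OF M M' f A c c' x] by (rule has_derivative_subset) blast
  then have "(loc_rep c c' g has_derivative loc_deriv c c' f x) (at (snd c x) within ?S)"
    by (rule has_derivative_local_cong[THEN iffD1, OF open_UNIV _ p, rotated -1])
      (use ic eq in \<open>auto simp: loc_rep_at\<close>)
  then show "(loc_rep c c' g has_derivative loc_deriv c c' f x) (at (snd c x) within cimg c)"
    using loc_deriv_within(2)[OF M M' f A c c' x] by simp
qed auto

lemma loc_deriv_continuous: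
  fixes f :: "'a \<Rightarrow> 'b"
  assumes M: "manifold M" and M': "manifold M'" and f: "smooth_map M A M' f" and A: "openin (mtop M) A"
    and c: "c \<in> charts M" and c': "c' \<in> charts M'"
  shows "continuous_map (subtopology (mtop M) (A \<inter> fst c \<inter> f -` fst c')) euclidean (\<lambda>x. loc_deriv c c' f x v)"
proof -
  let ?B = "A \<inter> fst c \<inter> f -` fst c'"
  note ic = manifold_chart[OF M c]
  have h: "halfopen (snd c ` ?B)"
    using halfopen_openin[OF chart_halfopen[OF ic] smooth_map_openin_dom(2)[OF assms]] .
  have "continuous_map (subtopology (mtop M) ?B) euclidean (snd c)"
    using chart_continuous[OF ic] by (rule continuous_map_from_subtopology_mono) blast
  then have "continuous_map (subtopology (mtop M) ?B) (top_of_set (snd c ` ?B)) (snd c)"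
    by (auto simp: continuous_map_in_subtopology)
  moreover have "continuous_map (top_of_set (snd c ` ?B)) euclidean (\<lambda>p. frechet_derivative (loc_rep c c' f) (at p within snd c ` ?B) v)"
    using smooth_on_continuous_derivative[OF smooth_map_rep[OF M M' f c c'] h] by simp
  ultimately have "continuous_map (subtopology (mtop M) ?B) euclidean ((\<lambda>p. frechet_derivative (loc_rep c c' f) (at p within snd c ` ?B) v) \<circ> snd c)"
    by (rule continuous_map_compose)
  then show ?thesis
  proof (rule continuous_map_eq)
    fix x assume "x \<in> topspace (subtopology (mtop M) ?B)"
    then have "x \<in> A" "x \<in> fst c" "f x \<in> fst c'" by auto
    from loc_deriv_within[OF assms this]
    show "((\<lambda>p. frechet_derivative (loc_rep c c' f) (at p within snd c ` ?B) v) \<circ> snd c) x = loc_deriv c c' f x v"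
      by (simp add: loc_deriv_def)
  qed
qed

lemma loc_deriv_curve:
  fixes f :: "'a \<Rightarrow> 'b" and \<gamma> :: "real \<Rightarrow> 'a"
  assumes M: "manifold M" and M': "manifold M'" and f: "smooth_map M A M' f" and A: "openin (mtop M) A"
    and c: "c \<in> charts M" and c': "c' \<in> charts M'" and x: "x \<in> A" "x \<in> fst c" "f x \<in> fst c'"
    and \<gamma>: "\<gamma> 0 = x" "\<gamma> ` I \<subseteq> fst c" "0 \<in> I" "((\<lambda>t. snd c (\<gamma> t)) has_vector_derivative v) (at 0 within I)"
  shows "((\<lambda>t. snd c' (f (\<gamma> t))) has_vector_derivative loc_deriv c c' f x v) (at 0 within I)"
proof -
  note ic = manifold_chart[OF M c]
  have 1: "((\<lambda>t. snd c (\<gamma> t)) has_derivative (\<lambda>t. t *\<^sub>R v)) (at 0 within I)"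
    using \<gamma>(4) by (simp add: has_vector_derivative_def)
  have 2: "(loc_rep c c' f has_derivative loc_deriv c c' f x) (at (snd c (\<gamma> 0)) within (\<lambda>t. snd c (\<gamma> t)) ` I)"
    unfolding \<gamma>(1) by (rule has_derivative_subset[OF loc_deriv_has_derivative[OF assms(1-9)]]) (use \<gamma>(2) in blast)
  have l: "bounded_linear (loc_deriv c c' f x)" by (rule loc_deriv_linear[OF assms(1-9)])
  have "((\<lambda>t. loc_rep c c' f (snd c (\<gamma> t))) has_derivative (\<lambda>t. t *\<^sub>R loc_deriv c c' f x v)) (at 0 within I)"
    using diff_chain_within[OF 1 2] by (simp add: o_def linear_scale[OF bounded_linear.linear[OF l]])
  then have "((\<lambda>t. snd c' (f (\<gamma> t))) has_derivative (\<lambda>t. t *\<^sub>R loc_deriv c c' f x v)) (at 0 within I)"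
    by (rule has_derivative_local_cong[THEN iffD1, OF open_UNIV _ \<gamma>(3), rotated -1])
      (use \<gamma>(2) ic in \<open>auto simp: loc_rep_at image_subset_iff\<close>)
  then show ?thesis by (simp add: has_vector_derivative_def)
qed

section \<open>The boundary\<close>

text \<open>Invariance of domain in coordinates, which is why both manifolds have the same model
  space. It makes the boundary independent of charts and invariant under diffeomorphisms.\<close>

lemma smooth_inj_interior:
  fixes M :: "('a, 'e::euclidean_space) mfd" and M' :: "('b, 'e) mfd"
  assumes M: "manifold M" and M': "manifold M'" and f: "smooth_map M A M' f" and A: "openin (mtop M) A"
    and inj: "inj_on f A"
    and c: "c \<in> charts M" and c': "c' \<in> charts M'" and x: "x \<in> A" "x \<in> fst c" "f x \<in> fst c'"
    and int: "snd c x \<in> interior (cimg c)"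
  shows "snd c' (f x) \<in> interior (cimg c')"
proof -
  note ic = manifold_chart[OF M c] and ic' = manifold_chart[OF M' c']
  let ?B = "A \<inter> fst c \<inter> f -` fst c'"
  obtain T where T: "open T" "snd c ` ?B = cimg c \<inter> T"
    using smooth_map_openin_dom(2)[OF M M' f A c c'] unfolding openin_open by (elim exE conjE)
  let ?S = "snd c ` ?B \<inter> interior (cimg c)"
  have "?S = T \<inter> interior (cimg c)" unfolding T(2) using interior_subset[of "cimg c"] by blast
  then have o: "open ?S" using T(1) by auto
  have "continuous_on ?S (loc_rep c c' f)"
    using smooth_on_imp_continuous_on[OF smooth_map_rep[OF M M' f c c']] by (rule continuous_on_subset) blast
  moreover have "inj_on (loc_rep c c' f) ?S"
  proof (rule inj_onI)
    fix a b assume "a \<in> ?S" "b \<in> ?S" and ab: "loc_rep c c' f a = loc_rep c c' f b"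
    then obtain y z where y: "a = snd c y" "y \<in> ?B" and z: "b = snd c z" "z \<in> ?B" by blast
    have "snd c' (f y) = snd c' (f z)"
      using ab y z loc_rep_at[OF ic, of y c' f] loc_rep_at[OF ic, of z c' f] by simp
    then have "f y = f z" using inj_onD[OF chart_inj[OF ic']] y z by blast
    then have "y = z" using inj_onD[OF inj] y z by blast
    then show "a = b" using y z by simp
  qed
  ultimately have "open (loc_rep c c' f ` ?S)" by (intro invariance_of_domain[OF _ o])
  moreover have "loc_rep c c' f ` ?S \<subseteq> cimg c'"
  proof safe
    fix y assume "y \<in> A" "y \<in> fst c" "f y \<in> fst c'"
    then show "loc_rep c c' f (snd c y) \<in> cimg c'" using loc_rep_at[OF ic, of y c' f] by simp
  qed
  moreover have "snd c' (f x) \<in> loc_rep c c' f ` ?S"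
    by (rule image_eqI[where x = "snd c x"]) (use x int loc_rep_at[OF ic x(2), of c' f] in auto)
  ultimately show ?thesis by (intro interiorI)
qed

lemma boundary_iff:
  assumes M: "manifold M" and c: "c \<in> charts M" and x: "x \<in> fst c"
  shows "x \<in> boundary M \<longleftrightarrow> snd c x \<notin> interior (cimg c)"
proof
  assume "x \<in> boundary M"
  then obtain c1 where c1: "c1 \<in> charts M" "x \<in> fst c1" "snd c1 x \<notin> interior (cimg c1)"
    unfolding boundary_def by blast
  have "x \<in> points M" using chart_points[OF M c] x by blast
  then show "snd c x \<notin> interior (cimg c)"
    using smooth_inj_interior[OF M M smooth_map_ident[OF M order_refl] openin_topspace _ c c1(1) _ x c1(2)] c1(3) by auto
qed (use c x in \<open>auto simp: boundary_def\<close>)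

lemma boundary_subset: "manifold M \<Longrightarrow> boundary M \<subseteq> points M"
  using chart_points unfolding boundary_def by blast

lemma closedin_boundary:
  assumes M: "manifold M"
  shows "closedin (mtop M) (boundary M)"
  unfolding closedin_def
proof
  show "boundary M \<subseteq> points M" by (rule boundary_subset[OF M])
  show "openin (mtop M) (points M - boundary M)"
  proof (subst openin_subopen, intro ballI)
    fix x assume x: "x \<in> points M - boundary M"
    then obtain c where c: "c \<in> charts M" "x \<in> fst c" using point_chart[OF M] by blast
    let ?T = "{y \<in> fst c. snd c y \<in> interior (cimg c)}"
    have "openin (mtop M) ?T" by (rule chart_preimage[OF manifold_chart[OF M c(1)]]) simp
    moreover have "x \<in> ?T" using boundary_iff[OF M c] x c by blast
    moreover have "?T \<subseteq> points M - boundary M" using boundary_iff[OF M c(1)] chart_points[OF M c(1)] by blast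
    ultimately show "\<exists>T. openin (mtop M) T \<and> x \<in> T \<and> T \<subseteq> points M - boundary M" by blast
  qed
qed

text \<open>Stated for mutually inverse maps between open sets, so that it covers global
  diffeomorphisms as well as the regluing map over the complement of the cutting surface.\<close>

lemma boundary_smooth_inverse:
  fixes M :: "('a, 'e::euclidean_space) mfd" and M' :: "('b, 'e) mfd"
  assumes M: "manifold M" and M': "manifold M'" and f: "smooth_map M A M' f" and A: "openin (mtop M) A"
    and g: "smooth_map M' B M g" and B: "openin (mtop M') B"
    and fA: "f ` A \<subseteq> B" and gB: "g ` B \<subseteq> A" and gf: "\<And>x. x \<in> A \<Longrightarrow> g (f x) = x" and fg: "\<And>y. y \<in> B \<Longrightarrow> f (g y) = y"
    and x: "x \<in> A"
  shows "f x \<in> boundary M' \<longleftrightarrow> x \<in> boundary M"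
proof -
  have fx: "f x \<in> B" using x fA by blast
  obtain c where c: "c \<in> charts M" "x \<in> fst c" using point_chart[OF M] x openin_subset[OF A] by blast
  obtain c' where c': "c' \<in> charts M'" "f x \<in> fst c'" using point_chart[OF M'] fx openin_subset[OF B] by blast
  have "inj_on f A" using gf by (metis inj_onI)
  from smooth_inj_interior[OF M M' f A this c(1) c'(1) x c(2) c'(2)]
  have 1: "snd c x \<in> interior (cimg c) \<Longrightarrow> snd c' (f x) \<in> interior (cimg c')" .
  have "inj_on g B" using fg by (metis inj_onI)
  from smooth_inj_interior[OF M' M g B this c'(1) c(1) fx c'(2)]
  have 2: "snd c' (f x) \<in> interior (cimg c') \<Longrightarrow> snd c x \<in> interior (cimg c)" using gf[OF x] c(2) by simp
  show ?thesis using 1 2 boundary_iff[OF M c] boundary_iff[OF M' c'] by blast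
qed

definition half_chart :: "('a, 'e::euclidean_space) chart \<Rightarrow> 'e \<Rightarrow> bool" where
  "half_chart d u \<longleftrightarrow> u \<noteq> 0 \<and> openin (top_of_set {x. 0 \<le> u \<bullet> x}) (cimg d)"

lemma half_chart_nonneg: "half_chart d u \<Longrightarrow> x \<in> fst d \<Longrightarrow> 0 \<le> u \<bullet> snd d x"
  unfolding half_chart_def using openin_imp_subset by blast

lemma half_chart_interior:
  assumes "half_chart d u" "x \<in> fst d"
  shows "snd d x \<in> interior (cimg d) \<longleftrightarrow> u \<bullet> snd d x \<noteq> 0"
proof
  assume "snd d x \<in> interior (cimg d)"
  then obtain r where r: "0 < r" "ball (snd d x) r \<subseteq> cimg d" unfolding mem_interior by blast
  have u: "u \<noteq> 0" using assms half_chart_def by blast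
  \<comment> \<open>A step of length \<open>r / 2\<close> against the inner normal stays in the ball
    and lowers the product with \<open>u\<close>.\<close>
  let ?t = "r / (2 * norm u)"
  have "snd d x - ?t *\<^sub>R u \<in> ball (snd d x) r" using r u by (simp add: dist_norm)
  then have "snd d x - ?t *\<^sub>R u \<in> cimg d" using r by blast
  then obtain y where "y \<in> fst d" "snd d y = snd d x - ?t *\<^sub>R u" by auto
  then have "0 \<le> u \<bullet> (snd d x - ?t *\<^sub>R u)" using half_chart_nonneg[OF assms(1)] by metis
  then have "?t * (u \<bullet> u) \<le> u \<bullet> snd d x" by (simp add: inner_diff_right)
  moreover have "0 < ?t * (u \<bullet> u)" using r u by simp
  ultimately show "u \<bullet> snd d x \<noteq> 0" by linarith
next
  assume "u \<bullet> snd d x \<noteq> 0"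
  then have pos: "0 < u \<bullet> snd d x" using half_chart_nonneg[OF assms] by linarith
  have "openin (top_of_set {x. 0 \<le> u \<bullet> x}) (cimg d)" using assms(1) by (simp add: half_chart_def)
  then obtain T where T: "open T" "cimg d = {x. 0 \<le> u \<bullet> x} \<inter> T" unfolding openin_open by (elim exE conjE)
  have "open (T \<inter> {x. 0 < u \<bullet> x})" using T(1) open_halfspace_gt[of 0 u] by (auto simp: inner_commute)
  moreover have "T \<inter> {x. 0 < u \<bullet> x} \<subseteq> cimg d" using T(2) by auto
  moreover have "snd d x \<in> T \<inter> {x. 0 < u \<bullet> x}" using pos imageI[OF assms(2), of "snd d"] unfolding T(2) by simp
  ultimately show "snd d x \<in> interior (cimg d)" by (intro interiorI)
qed

lemma half_chart_boundary:
  assumes "manifold M" "d \<in> charts M" "half_chart d u" "x \<in> fst d"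
  shows "x \<in> boundary M \<longleftrightarrow> u \<bullet> snd d x = 0"
  using boundary_iff[OF assms(1,2,4)] half_chart_interior[OF assms(3,4)] by blast

lemma boundary_half_chart:
  assumes "manifold M" "x \<in> boundary M"
  obtains d u where "d \<in> charts M" "x \<in> fst d" "half_chart d u" "u \<bullet> snd d x = 0"
proof -
  obtain d where d: "d \<in> charts M" "x \<in> fst d" "snd d x \<notin> interior (cimg d)"
    using assms(2) unfolding boundary_def by blast
  have "\<not> open (cimg d)" using d interior_open by blast
  moreover have "open (cimg d) \<or> (\<exists>u. u \<noteq> 0 \<and> openin (top_of_set {x. 0 \<le> u \<bullet> x}) (cimg d))"
    using manifold_chart[OF assms(1) d(1)] unfolding is_chart_def by (elim conjE)
  ultimately obtain u where u: "half_chart d u" unfolding half_chart_def by (elim disjE exE) (simp, blast)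
  then have "u \<bullet> snd d x = 0" using half_chart_interior[OF u d(2)] d(3) by simp
  with u show thesis using that d(1,2) by simp
qed

section \<open>Diffeomorphisms\<close>

text \<open>An explicit inverse \<open>g\<close> replaces the \<open>inv_into\<close> of the
  definition, with which it agrees on \<open>B\<close>.\<close>

lemma diffeoI:
  fixes f :: "'a \<Rightarrow> 'b"
  assumes M: "manifold M" and M': "manifold M'"
    and "smooth_map M A M' f" and g: "smooth_map M' B M g"
    and fA: "\<And>x. x \<in> A \<Longrightarrow> f x \<in> B" and gB: "\<And>y. y \<in> B \<Longrightarrow> g y \<in> A"
    and gf: "\<And>x. x \<in> A \<Longrightarrow> g (f x) = x" and fg: "\<And>y. y \<in> B \<Longrightarrow> f (g y) = y"
  shows "diffeo M A M' B f"
proof -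
  have b: "bij_betw f A B" by (rule bij_betw_byWitness[of A g f B]) (use assms in auto)
  have "g y = inv_into A f y" if "y \<in> B" for y
    using inv_into_f_f[OF bij_betw_imp_inj_on[OF b] gB[OF that]] fg[OF that] by simp
  then have "smooth_map M' B M (inv_into A f)" by (rule smooth_map_cong_imp[OF M' g])
  then show ?thesis using assms b by (simp add: diffeo_def)
qed

lemma diffeoD:
  assumes "diffeo M A M' B f"
  shows "smooth_map M A M' f" "smooth_map M' B M (inv_into A f)" "f ` A = B" "inj_on f A" "inv_into A f ` B = A"
    "\<And>x. x \<in> A \<Longrightarrow> inv_into A f (f x) = x" "\<And>y. y \<in> B \<Longrightarrow> f (inv_into A f y) = y"
    "\<And>x. x \<in> A \<Longrightarrow> f x \<in> B" "\<And>y. y \<in> B \<Longrightarrow> inv_into A f y \<in> A"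
  using assms unfolding diffeo_def bij_betw_def
  by (auto simp: inv_into_into f_inv_into_f inv_into_image_cancel image_iff)

lemma diffeo_compose:
  fixes f :: "'a \<Rightarrow> 'b" and g :: "'b \<Rightarrow> 'c"
  assumes M: "manifold M" and M': "manifold M'" and M'': "manifold M''"
    and f: "diffeo M A M' B f" and g: "diffeo M' B M'' C g"
  shows "diffeo M A M'' C (\<lambda>x. g (f x))"
proof (rule diffeoI[OF M M'' _ smooth_map_compose[OF M'' M' M diffeoD(2)[OF g] diffeoD(2)[OF f]]])
  show "smooth_map M A M'' (\<lambda>x. g (f x))"
    by (rule smooth_map_compose[OF M M' M'' diffeoD(1)[OF f] diffeoD(1)[OF g]]) (simp add: diffeoD(3)[OF f])
qed (use diffeoD[OF f] diffeoD[OF g] in auto)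

lemma diffeo_inverse:
  fixes f :: "'a \<Rightarrow> 'b"
  assumes M: "manifold M" and M': "manifold M'" and f: "diffeo M A M' B f"
  shows "diffeo M' B M A (inv_into A f)"
  by (rule diffeoI[OF M' M diffeoD(2)[OF f] diffeoD(1)[OF f]]) (use diffeoD[OF f] in auto)

lemma diffeo_restrict:
  fixes f :: "'a \<Rightarrow> 'b"
  assumes M: "manifold M" and M': "manifold M'" and f: "diffeo M A M' B f" and "A' \<subseteq> A"
  shows "diffeo M A' M' (f ` A') f"
  by (rule diffeoI[OF M M' smooth_map_subset[OF diffeoD(1)[OF f] assms(4)] smooth_map_subset[OF diffeoD(2)[OF f]]])
    (use diffeoD[OF f] assms(4) in auto)

lemma diffeo_ident: "manifold M \<Longrightarrow> A \<subseteq> points M \<Longrightarrow> diffeo M A M A (\<lambda>x. x)"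
  by (rule diffeoI[OF _ _ smooth_map_ident smooth_map_ident]) auto

lemma Diff_Bij: "f \<in> Diff M \<Longrightarrow> f \<in> Bij (points M)"
  by (simp add: Diff_def Bij_def diffeo_def)

lemma Diff_extensional: "f \<in> Diff M \<Longrightarrow> f \<in> extensional (points M)"
  by (simp add: Diff_def)

lemma Diff_diffeo: "f \<in> Diff M \<Longrightarrow> diffeo M (points M) M (points M) f"
  by (simp add: Diff_def)

lemma Diff_smooth: "f \<in> Diff M \<Longrightarrow> smooth_map M (points M) M f"
  by (simp add: Diff_def diffeo_def)

lemma Diff_in: "f \<in> Diff M \<Longrightarrow> x \<in> points M \<Longrightarrow> f x \<in> points M"
  using diffeoD(8)[OF Diff_diffeo] .

text \<open>The inverse as an extensional function, as equality in the permutation group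
  requires.\<close>

definition Dinv :: "('a, 'e) mfd \<Rightarrow> ('a \<Rightarrow> 'a) \<Rightarrow> 'a \<Rightarrow> 'a" where
  "Dinv M f = (\<lambda>x\<in>points M. inv_into (points M) f x)"

lemma restrict_Diff:
  assumes "manifold M" "diffeo M (points M) M (points M) f"
  shows "restrict f (points M) \<in> Diff M"
proof -
  have "diffeo M (points M) M (points M) (restrict f (points M))"
    by (rule diffeoI[OF assms(1) assms(1) smooth_map_cong_imp[OF assms(1) diffeoD(1)[OF assms(2)]] diffeoD(2)[OF assms(2)]])
      (use diffeoD[OF assms(2)] in auto)
  then show ?thesis by (simp add: Diff_def)
qed

lemma Dinv_Diff: "manifold M \<Longrightarrow> f \<in> Diff M \<Longrightarrow> Dinv M f \<in> Diff M"
  unfolding Dinv_def by (intro restrict_Diff diffeo_inverse Diff_diffeo)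

lemma Dinv_simps:
  assumes "f \<in> Diff M" "x \<in> points M"
  shows "Dinv M f (f x) = x" "f (Dinv M f x) = x" "Dinv M f x \<in> points M"
  using diffeoD[OF Diff_diffeo[OF assms(1)]] assms(2) by (auto simp: Dinv_def)

lemma Diff_compose:
  assumes "manifold M" "f \<in> Diff M" "g \<in> Diff M"
  shows "compose (points M) f g \<in> Diff M"
  unfolding compose_def
  by (rule restrict_Diff[OF assms(1) diffeo_compose[OF assms(1,1,1) Diff_diffeo[OF assms(3)] Diff_diffeo[OF assms(2)]]])

lemma Diff_ident: "manifold M \<Longrightarrow> (\<lambda>x\<in>points M. x) \<in> Diff M"
  by (intro restrict_Diff diffeo_ident) auto

lemma Dinv_image:
  assumes "f \<in> Diff M" "A \<subseteq> points M"
  shows "Dinv M f ` f ` A = A" "f ` Dinv M f ` A = A"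
proof -
  have "(\<lambda>x. Dinv M f (f x)) ` A = (\<lambda>x. x) ` A" "(\<lambda>x. f (Dinv M f x)) ` A = (\<lambda>x. x) ` A"
    using assms by (auto simp: Dinv_simps subset_iff intro!: image_cong)
  then show "Dinv M f ` f ` A = A" "f ` Dinv M f ` A = A" by (simp_all add: image_image)
qed

lemma Diff_homeomorphic:
  assumes "manifold M" "f \<in> Diff M"
  shows "homeomorphic_map (mtop M) (mtop M) f"
proof -
  have "continuous_map (mtop M) (mtop M) f" "continuous_map (mtop M) (mtop M) (Dinv M f)"
    using smooth_map_continuous[OF assms(1,1) Diff_smooth[OF assms(2)]]
      smooth_map_continuous[OF assms(1,1) Diff_smooth[OF Dinv_Diff[OF assms]]] by simp_all
  then have "homeomorphic_maps (mtop M) (mtop M) f (Dinv M f)"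
    unfolding homeomorphic_maps_def using Dinv_simps[OF assms(2)] by auto
  then show ?thesis using homeomorphic_map_maps by blast
qed

lemma BijGroup_inv: "f \<in> Diff M \<Longrightarrow> inv\<^bsub>BijGroup (points M)\<^esub> f = Dinv M f"
  using inv_BijGroup[OF Diff_Bij] by (simp add: Dinv_def)

lemma subgroup_DiffI:
  assumes M: "manifold M" and H: "H \<subseteq> Diff M" and one: "(\<lambda>x\<in>points M. x) \<in> H"
    and mult: "\<And>f g. f \<in> H \<Longrightarrow> g \<in> H \<Longrightarrow> compose (points M) f g \<in> H"
    and inverse: "\<And>f. f \<in> H \<Longrightarrow> Dinv M f \<in> H"
  shows "subgroup H (BijGroup (points M))"
proof
  show "H \<subseteq> carrier (BijGroup (points M))" using H Diff_Bij by (auto simp: BijGroup_def)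
  show "\<one>\<^bsub>BijGroup (points M)\<^esub> \<in> H" using one by (simp add: BijGroup_def)
  fix f assume f: "f \<in> H"
  then show "inv\<^bsub>BijGroup (points M)\<^esub> f \<in> H" using inverse H BijGroup_inv by (metis subsetD)
  fix g assume g: "g \<in> H"
  have "f \<in> Bij (points M)" "g \<in> Bij (points M)" using H f g Diff_Bij[of _ M] by auto
  then show "f \<otimes>\<^bsub>BijGroup (points M)\<^esub> g \<in> H" using mult[OF f g] by (simp add: BijGroup_def)
qed

lemma loc_deriv_Diff_compose:
  assumes M: "manifold M" and f: "f \<in> Diff M" and g: "g \<in> Diff M"
    and c: "c \<in> charts M" and c': "c' \<in> charts M" and c'': "c'' \<in> charts M"
    and x: "x \<in> fst c" "g x \<in> fst c'" "f (g x) \<in> fst c''"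
  shows "loc_deriv c c'' (compose (points M) f g) x = (\<lambda>v. loc_deriv c' c'' f (g x) (loc_deriv c c' g x v))"
proof -
  have px: "x \<in> points M" using chart_points[OF M c] x by blast
  have gP: "g ` points M \<subseteq> points M" using Diff_in[OF g] by blast
  have "loc_deriv c c'' (\<lambda>x. f (g x)) x = loc_deriv c c'' (compose (points M) f g) x"
    by (rule loc_deriv_cong[OF M M smooth_map_compose[OF M M M Diff_smooth[OF g] Diff_smooth[OF f] gP] openin_topspace c c'' px x(1,3)])
      (simp add: compose_def)
  then show ?thesis
    using loc_deriv_compose[OF M M M Diff_smooth[OF g] openin_topspace Diff_smooth[OF f] openin_topspace gP c c' c'' px x] by simp
qed

lemma loc_deriv_Diff_ident:
  assumes M: "manifold M" and c: "c \<in> charts M" and c': "c' \<in> charts M" and x: "x \<in> fst c" "x \<in> fst c'"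
  shows "loc_deriv c c' (\<lambda>x\<in>points M. x) x = loc_deriv c c' (\<lambda>x. x) x"
proof -
  have px: "x \<in> points M" using chart_points[OF M c] x by blast
  show ?thesis
    by (rule loc_deriv_cong[OF M M smooth_map_ident[OF M order_refl] openin_topspace c c' px x, symmetric]) simp
qed

lemma loc_deriv_Diff_linear:
  assumes M: "manifold M" and f: "f \<in> Diff M" and c: "c \<in> charts M" and c': "c' \<in> charts M" and x: "x \<in> fst c" "f x \<in> fst c'"
  shows "bounded_linear (loc_deriv c c' f x)"
  by (rule loc_deriv_linear[OF M M Diff_smooth[OF f] openin_topspace c c' _ x]) (use chart_points[OF M c] x in blast)

lemma loc_deriv_Dinv:
  assumes M: "manifold M" and f: "f \<in> Diff M" and c: "c \<in> charts M" and c': "c' \<in> charts M" and x: "x \<in> fst c" "f x \<in> fst c'"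
  shows "loc_deriv c' c (Dinv M f) (f x) (loc_deriv c c' f x v) = v"
    and "loc_deriv c c' f x (loc_deriv c' c (Dinv M f) (f x) v) = v"
proof -
  have px: "x \<in> points M" using chart_points[OF M c] x by blast
  note gf = Dinv_simps(1)[OF f px]
  have "compose (points M) (Dinv M f) f = (\<lambda>x\<in>points M. x)"
    using Dinv_simps[OF f] by (auto simp: compose_def)
  then have "(\<lambda>v. loc_deriv c' c (Dinv M f) (f x) (loc_deriv c c' f x v)) = (\<lambda>v. v)"
    using loc_deriv_Diff_compose[OF M Dinv_Diff[OF M f] f c c' c x] loc_deriv_Diff_ident[OF M c c x(1,1)]
      loc_deriv_ident[OF M c x(1)] gf x(1) by simp
  then show "loc_deriv c' c (Dinv M f) (f x) (loc_deriv c c' f x v) = v" by (rule fun_cong)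
  have "compose (points M) f (Dinv M f) = (\<lambda>x\<in>points M. x)"
    using Dinv_simps[OF f] by (auto simp: compose_def)
  then have "(\<lambda>v. loc_deriv c c' f x (loc_deriv c' c (Dinv M f) (f x) v)) = (\<lambda>v. v)"
    using loc_deriv_Diff_compose[OF M f Dinv_Diff[OF M f] c' c c' x(2)] loc_deriv_Diff_ident[OF M c' c' x(2,2)]
      loc_deriv_ident[OF M c' x(2)] gf x by simp
  then show "loc_deriv c c' f x (loc_deriv c' c (Dinv M f) (f x) v) = v" by (rule fun_cong)
qed

lemma det_matrix_compose:
  fixes A B :: "real^'n \<Rightarrow> real^'n"
  assumes "bounded_linear A" "bounded_linear B"
  shows "det (matrix (\<lambda>v. A (B v))) = det (matrix A) * det (matrix B)"
  using matrix_compose[OF assms(2,1)[THEN bounded_linear.linear]] by (simp add: o_def det_mul)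

text \<open>An intermediate chart around \<open>g x\<close> splits the Jacobian determinant into two
  positive factors.\<close>

lemma Diff_plus_compose:
  assumes M: "manifold M" and f: "f \<in> Diff_plus M" and g: "g \<in> Diff_plus M"
  shows "compose (points M) f g \<in> Diff_plus M"
proof -
  have fD: "f \<in> Diff M" and gD: "g \<in> Diff M" using f g by (simp_all add: Diff_plus_def)
  have "0 < det (matrix (loc_deriv c c'' (compose (points M) f g) x))"
    if c: "c \<in> charts M" "c'' \<in> charts M" and x: "x \<in> fst c" "compose (points M) f g x \<in> fst c''" for c c'' x
  proof -
    have px: "x \<in> points M" using chart_points[OF M c(1)] x by blast
    then have fgx: "f (g x) \<in> fst c''" using x(2) by (simp add: compose_def)
    obtain c' where c': "c' \<in> charts M" "g x \<in> fst c'" using point_chart[OF M Diff_in[OF gD px]] .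
    have "0 < det (matrix (loc_deriv c c' g x))" "0 < det (matrix (loc_deriv c' c'' f (g x)))"
      using f g c c' x fgx by (auto simp: Diff_plus_def orientation_preserving_wrt_def)
    then show ?thesis
      unfolding loc_deriv_Diff_compose[OF M fD gD c(1) c'(1) c(2) x(1) c'(2) fgx]
      using det_matrix_compose loc_deriv_Diff_linear[OF M fD c'(1) c(2) c'(2) fgx] loc_deriv_Diff_linear[OF M gD c(1) c'(1) x(1) c'(2)]
      by (metis mult_pos_pos)
  qed
  then show ?thesis using Diff_compose[OF M fD gD] by (auto simp: Diff_plus_def orientation_preserving_wrt_def)
qed

text \<open>The determinants of a differential and of its inverse multiply to 1, so they have the
  same sign.\<close>

lemma Diff_plus_Dinv:
  assumes M: "manifold M" and f: "f \<in> Diff_plus M"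
  shows "Dinv M f \<in> Diff_plus M"
proof -
  have fD: "f \<in> Diff M" using f by (simp add: Diff_plus_def)
  note gD = Dinv_Diff[OF M fD]
  have "0 < det (matrix (loc_deriv c' c (Dinv M f) y))"
    if c: "c' \<in> charts M" "c \<in> charts M" and y: "y \<in> fst c'" "Dinv M f y \<in> fst c" for c c' y
  proof -
    let ?x = "Dinv M f y"
    have py: "y \<in> points M" using chart_points[OF M c(1)] y by blast
    have fx: "f ?x = y" using Dinv_simps(2)[OF fD py] .
    have "0 < det (matrix (loc_deriv c c' f ?x))"
      using f c y fx by (auto simp: Diff_plus_def orientation_preserving_wrt_def)
    moreover have "det (matrix (loc_deriv c' c (Dinv M f) y)) * det (matrix (loc_deriv c c' f ?x)) = 1"
    proof -
      have "(\<lambda>v. loc_deriv c' c (Dinv M f) y (loc_deriv c c' f ?x v)) = id"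
        using loc_deriv_Dinv(1)[OF M fD c(2,1) y(2)] fx y(1) by auto
      then show ?thesis
        using det_matrix_compose[of "loc_deriv c' c (Dinv M f) y" "loc_deriv c c' f ?x"]
          loc_deriv_Diff_linear[OF M gD c y] loc_deriv_Diff_linear[OF M fD c(2,1) y(2)] fx y(1)
        by (simp add: matrix_id_mat_1)
    qed
    ultimately show ?thesis by (metis zero_less_mult_pos2 zero_less_one)
  qed
  then show ?thesis using gD by (auto simp: Diff_plus_def orientation_preserving_wrt_def)
qed

lemma Diff_plus_ident:
  assumes "oriented_manifold M"
  shows "(\<lambda>x\<in>points M. x) \<in> Diff_plus M"
proof -
  have M: "manifold M" using assms by (simp add: oriented_manifold_def)
  have "0 < det (matrix (loc_deriv c c' (\<lambda>x\<in>points M. x) x))"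
    if c: "c \<in> charts M" "c' \<in> charts M" and x: "x \<in> fst c" "(\<lambda>x\<in>points M. x) x \<in> fst c'" for c c' x
  proof -
    have "x \<in> points M" using chart_points[OF M c(1)] x by blast
    then have x': "x \<in> fst c'" using x(2) by simp
    show ?thesis unfolding loc_deriv_Diff_ident[OF M c x(1) x']
      using assms c x x' by (auto simp: oriented_manifold_def orientation_preserving_wrt_def)
  qed
  then show ?thesis using Diff_ident[OF M] by (auto simp: Diff_plus_def orientation_preserving_wrt_def)
qed

section \<open>Tangent vectors of curves\<close>

text \<open>With \<open>I = UNIV\<close> these are the tangent vectors of \<open>S\<close>; with
  \<open>I = {0..}\<close> they are one-sided derivatives, which can tell the two sides of a
  hypersurface apart.\<close>

definition curve_coords :: "real set \<Rightarrow> 'a set \<Rightarrow> ('a, 'e::euclidean_space) chart \<Rightarrow> 'a \<Rightarrow> 'e set" where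
  "curve_coords I S c x = {v. \<exists>\<gamma>. \<gamma> 0 = x \<and> \<gamma> ` I \<subseteq> S \<inter> fst c \<and>
      ((\<lambda>t. snd c (\<gamma> t)) has_vector_derivative v) (at 0 within I)}"

lemma tangent_coords_eq: "tangent_coords S c x = curve_coords UNIV S c x"
  by (simp add: tangent_coords_def curve_coords_def o_def)

text \<open>A curve that is known to lie in \<open>S\<close> for small times is made constant at the
  other times, which leaves its derivative at 0 unchanged.\<close>

lemma curve_coordsI:
  assumes "\<gamma> 0 = x" "0 \<in> I" "x \<in> S \<inter> fst c" "open J" "0 \<in> J" "\<gamma> ` (I \<inter> J) \<subseteq> S \<inter> fst c"
    "((\<lambda>t. snd c (\<gamma> t)) has_vector_derivative v) (at 0 within I)"
  shows "v \<in> curve_coords I S c x"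
proof -
  define \<delta> where "\<delta> t = (if t \<in> J then \<gamma> t else x)" for t
  have "((\<lambda>t. snd c (\<delta> t)) has_vector_derivative v) (at 0 within I)"
    using assms(7) unfolding has_vector_derivative_def
    by (rule has_derivative_local_cong[THEN iffD1, OF assms(4,5,2), rotated -1]) (simp add: \<delta>_def)
  moreover have "\<delta> 0 = x" "\<delta> ` I \<subseteq> S \<inter> fst c" using assms by (auto simp: \<delta>_def)
  ultimately show ?thesis unfolding curve_coords_def by blast
qed

text \<open>Differentiability of the coordinate expression makes the curve itself continuous at
  0.\<close>

lemma curve_nbhd:
  assumes c: "is_chart X c" and \<gamma>: "\<gamma> ` I \<subseteq> fst c" "0 \<in> I" "((\<lambda>t. snd c (\<gamma> t)) has_vector_derivative v) (at 0 within I)"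
    and V: "openin X V" "\<gamma> 0 \<in> V"
  obtains J where "open J" "0 \<in> J" "\<gamma> ` (I \<inter> J) \<subseteq> V"
proof -
  have "openin (top_of_set (cimg c)) (snd c ` (V \<inter> fst c))"
    by (rule chart_open_image[OF c]) (use V chart_openin[OF c] in blast)+
  then obtain T where T: "open T" "snd c ` (V \<inter> fst c) = cimg c \<inter> T" unfolding openin_open by (elim exE conjE)
  have "((\<lambda>t. snd c (\<gamma> t)) \<longlongrightarrow> snd c (\<gamma> 0)) (at 0 within I)"
    using has_vector_derivative_continuous[OF \<gamma>(3)] by (simp add: continuous_within)
  moreover have "snd c (\<gamma> 0) \<in> T"
  proof -
    have "\<gamma> 0 \<in> V \<inter> fst c" using V(2) \<gamma>(1,2) by blast
    then have "snd c (\<gamma> 0) \<in> cimg c \<inter> T" unfolding T(2)[symmetric] by (rule imageI)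
    then show ?thesis by blast
  qed
  ultimately have "\<forall>\<^sub>F t in at 0 within I. snd c (\<gamma> t) \<in> T" using T(1) topological_tendstoD by blast
  then obtain J where J: "open J" "0 \<in> J" "\<And>t. t \<in> J \<Longrightarrow> t \<noteq> 0 \<Longrightarrow> t \<in> I \<Longrightarrow> snd c (\<gamma> t) \<in> T"
    unfolding eventually_at_topological by blast
  have "\<gamma> t \<in> V" if "t \<in> I \<inter> J" for t
  proof (cases "t = 0")
    case False
    then have "snd c (\<gamma> t) \<in> cimg c \<inter> T" using J(3) that \<gamma>(1) by blast
    then have "snd c (\<gamma> t) \<in> snd c ` (V \<inter> fst c)" unfolding T(2) .
    then obtain y where y: "y \<in> V" "y \<in> fst c" "snd c (\<gamma> t) = snd c y" by blast
    have "\<gamma> t \<in> fst c" using that \<gamma>(1) by blast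
    then show ?thesis using inj_onD[OF chart_inj[OF c] y(3)] y by simp
  qed (use V in simp)
  then show thesis using that J by blast
qed

lemma curve_coords_smooth:
  fixes f :: "'a \<Rightarrow> 'b"
  assumes M: "manifold M" and M': "manifold M'" and f: "smooth_map M A M' f" and A: "openin (mtop M) A"
    and c: "c \<in> charts M" and c': "c' \<in> charts M'" and x: "x \<in> A" "x \<in> fst c" "f x \<in> fst c'"
    and fS: "f ` (S \<inter> A) \<subseteq> S'" and I: "0 \<in> I" and v: "v \<in> curve_coords I S c x"
  shows "loc_deriv c c' f x v \<in> curve_coords I S' c' (f x)"
proof -
  obtain \<gamma> where \<gamma>: "\<gamma> 0 = x" "\<gamma> ` I \<subseteq> S \<inter> fst c" "((\<lambda>t. snd c (\<gamma> t)) has_vector_derivative v) (at 0 within I)"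
    using v unfolding curve_coords_def by blast
  have 1: "\<gamma> ` I \<subseteq> fst c" using \<gamma>(2) by blast
  have 2: "\<gamma> 0 \<in> A \<inter> fst c \<inter> f -` fst c'" using \<gamma>(1) x by blast
  obtain J where J: "open J" "0 \<in> J" "\<gamma> ` (I \<inter> J) \<subseteq> A \<inter> fst c \<inter> f -` fst c'"
    by (rule curve_nbhd[OF manifold_chart[OF M c] 1 I \<gamma>(3) smooth_map_openin_dom(1)[OF M M' f A c c'] 2])
  show ?thesis
  proof (rule curve_coordsI[of "\<lambda>t. f (\<gamma> t)", OF _ I _ J(1,2)])
    show "((\<lambda>t. snd c' (f (\<gamma> t))) has_vector_derivative loc_deriv c c' f x v) (at 0 within I)"
      by (rule loc_deriv_curve[OF M M' f A c c' x \<gamma>(1) 1 I \<gamma>(3)])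
    show "(\<lambda>t. f (\<gamma> t)) ` (I \<inter> J) \<subseteq> S' \<inter> fst c'"
      using J(3) \<gamma>(2) fS by blast
    have "x \<in> S" using \<gamma> I by blast
    then show "f x \<in> S' \<inter> fst c'" using fS x by blast
  qed (simp add: \<gamma>)
qed

lemma curve_coords_Diff:
  assumes M: "manifold M" and f: "f \<in> Diff M" and S: "S \<subseteq> points M" and I: "0 \<in> I"
    and c: "c \<in> charts M" and c': "c' \<in> charts M" and x: "x \<in> fst c" "f x \<in> fst c'"
  shows "loc_deriv c c' f x v \<in> curve_coords I (f ` S) c' (f x) \<longleftrightarrow> v \<in> curve_coords I S c x"
proof
  have px: "x \<in> points M" using chart_points[OF M c] x by blast
  show "v \<in> curve_coords I S c x \<Longrightarrow> loc_deriv c c' f x v \<in> curve_coords I (f ` S) c' (f x)"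
    by (rule curve_coords_smooth[OF M M Diff_smooth[OF f] openin_topspace c c' px x _ I]) auto
  assume v: "loc_deriv c c' f x v \<in> curve_coords I (f ` S) c' (f x)"
  have gx: "Dinv M f (f x) = x" by (rule Dinv_simps(1)[OF f px])
  have "loc_deriv c' c (Dinv M f) (f x) (loc_deriv c c' f x v) \<in> curve_coords I S c (Dinv M f (f x))"
    by (rule curve_coords_smooth[OF M M Diff_smooth[OF Dinv_Diff[OF M f]] openin_topspace c' c Diff_in[OF f px] x(2) _ _ I v])
      (use gx x Dinv_simps(1)[OF f] S in auto)
  then show "v \<in> curve_coords I S c x" using gx loc_deriv_Dinv(1)[OF M f c c' x] by simp
qed

section \<open>Groups of path components\<close>

lemma path_component_of_image:
  assumes "path_component_of X x y" "continuous_map X Y f"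
  shows "path_component_of Y (f x) (f y)"
proof -
  obtain \<gamma> where "pathin X \<gamma>" "\<gamma> 0 = x" "\<gamma> 1 = y" using assms(1) unfolding path_component_of_def by blast
  then show ?thesis unfolding path_component_of_def
    by (intro exI[of _ "f \<circ> \<gamma>"]) (use pathin_compose[OF _ assms(2)] in auto)
qed

lemma path_component_set_eq:
  assumes "path_component_of X x y"
  shows "path_component_of_set X x = path_component_of_set X y"
  using assms path_component_of_equiv[of X x y] by simp

lemma path_component_mem: "x \<in> topspace X \<Longrightarrow> x \<in> path_component_of_set X x"
  by (simp add: path_component_of_refl)

text \<open>The initial segment of the path, rescaled to the unit interval.\<close>

lemma path_component_of_pathin:
  assumes \<gamma>: "pathin X \<gamma>" and t: "t \<in> {0..1}"
  shows "path_component_of X (\<gamma> 0) (\<gamma> t)"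
proof -
  have "(\<lambda>s. s * t) ` {0..1} \<subseteq> {0..1}" using t by (auto simp: mult_le_one)
  then have "continuous_map (top_of_set {0..1}) (top_of_set {0..1}) (\<lambda>s. s * t)"
    by (auto simp: continuous_map_in_subtopology intro!: continuous_intros)
  from continuous_map_compose[OF this \<gamma>[unfolded pathin_def]]
  have "pathin X (\<lambda>s. \<gamma> (s * t))" by (simp add: pathin_def o_def)
  then show ?thesis unfolding path_component_of_def by (intro exI[of _ "\<lambda>s. \<gamma> (s * t)"]) simp
qed

text \<open>Continuity of left and right translations lets a path be multiplied by a fixed element
  on either side; products of path components are handled by moving one factor at a time.\<close>

locale translation_group = group G for G :: "'g monoid" (structure) +
  fixes X :: "'g topology"
  assumes top: "topspace X = carrier G"
    and left: "\<And>g. g \<in> carrier G \<Longrightarrow> continuous_map X X (\<lambda>x. g \<otimes> x)"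
    and right: "\<And>g. g \<in> carrier G \<Longrightarrow> continuous_map X X (\<lambda>x. x \<otimes> g)"
begin

abbreviation "pc f \<equiv> path_component_of_set X f"

lemma pc_carrier: "carrier (pi0_group X G) = pc ` carrier G"
  by (simp add: pi0_group_def path_components_of_def top)

lemma pc_mem: "f' \<in> pc f \<Longrightarrow> f' \<in> carrier G"
  using path_component_of_subset_topspace[of X f] top by auto

text \<open>To reach a product of two nearby elements, move the second factor with \<open>f\<close>
  fixed, then the first. Conversely, an element of the component of \<open>f \<otimes> g\<close> is
  translated back by the inverse of \<open>g\<close>.\<close>

lemma pc_mult:
  assumes f: "f \<in> carrier G" and g: "g \<in> carrier G"
  shows "pc f <#> pc g = pc (f \<otimes> g)"
proof
  show "pc f <#> pc g \<subseteq> pc (f \<otimes> g)"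
  proof
    fix h assume "h \<in> pc f <#> pc g"
    then obtain f' g' where fg: "f' \<in> pc f" "g' \<in> pc g" "h = f' \<otimes> g'" unfolding set_mult_def by blast
    have "path_component_of X (f \<otimes> g) (f \<otimes> g')"
      using path_component_of_image[OF _ left[OF f], of g g'] fg by simp
    moreover have "path_component_of X (f \<otimes> g') (f' \<otimes> g')"
      using path_component_of_image[OF _ right[OF pc_mem[OF fg(2)]], of f f'] fg by simp
    ultimately show "h \<in> pc (f \<otimes> g)" using fg(3) path_component_of_trans by fastforce
  qed
  show "pc (f \<otimes> g) \<subseteq> pc f <#> pc g"
  proof
    fix h assume h: "h \<in> pc (f \<otimes> g)"
    have hc: "h \<in> carrier G" by (rule pc_mem[OF h])
    have "path_component_of X (f \<otimes> g \<otimes> inv g) (h \<otimes> inv g)"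
      using path_component_of_image[OF _ right[of "inv g"], of "f \<otimes> g" h] h g by simp
    then have "h \<otimes> inv g \<in> pc f" using f g by (simp add: m_assoc)
    moreover have "g \<in> pc g" by (rule path_component_mem) (simp add: top g)
    ultimately have "h \<otimes> inv g \<otimes> g \<in> pc f <#> pc g" unfolding set_mult_def by blast
    then show "h \<in> pc f <#> pc g" using hc g by (simp add: m_assoc)
  qed
qed

lemma pi0_mult: "f \<in> carrier G \<Longrightarrow> g \<in> carrier G \<Longrightarrow> pc f \<otimes>\<^bsub>pi0_group X G\<^esub> pc g = pc (f \<otimes> g)"
  using pc_mult by (simp add: pi0_group_def)

lemma pi0_one: "\<one>\<^bsub>pi0_group X G\<^esub> = pc \<one>"
  by (simp add: pi0_group_def)

lemma group_pi0: "group (pi0_group X G)"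
proof (rule groupI)
  show "\<one>\<^bsub>pi0_group X G\<^esub> \<in> carrier (pi0_group X G)" by (simp add: pc_carrier pi0_one)
  fix a assume "a \<in> carrier (pi0_group X G)"
  then obtain f where f: "f \<in> carrier G" "a = pc f" unfolding pc_carrier by blast
  show "\<one>\<^bsub>pi0_group X G\<^esub> \<otimes>\<^bsub>pi0_group X G\<^esub> a = a" using f pi0_mult[OF one_closed f(1)] by (simp add: pi0_one)
  show "\<exists>y\<in>carrier (pi0_group X G). y \<otimes>\<^bsub>pi0_group X G\<^esub> a = \<one>\<^bsub>pi0_group X G\<^esub>"
    unfolding pc_carrier using f pi0_mult[of "inv f" f] by (intro bexI[of _ "pc (inv f)"]) (auto simp: pi0_one)
  fix b assume "b \<in> carrier (pi0_group X G)"
  then obtain g where g: "g \<in> carrier G" "b = pc g" unfolding pc_carrier by blast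
  show "a \<otimes>\<^bsub>pi0_group X G\<^esub> b \<in> carrier (pi0_group X G)" using f g pi0_mult by (auto simp: pc_carrier)
  fix d assume "d \<in> carrier (pi0_group X G)"
  then obtain h where h: "h \<in> carrier G" "d = pc h" unfolding pc_carrier by blast
  show "a \<otimes>\<^bsub>pi0_group X G\<^esub> b \<otimes>\<^bsub>pi0_group X G\<^esub> d = a \<otimes>\<^bsub>pi0_group X G\<^esub> (b \<otimes>\<^bsub>pi0_group X G\<^esub> d)"
    using f g h pi0_mult by (simp add: m_assoc)
qed

lemma translation_subgroup:
  assumes H: "subgroup H G"
  shows "translation_group (G\<lparr>carrier := H\<rparr>) (subtopology X H)"
proof -
  interpret H: group "G\<lparr>carrier := H\<rparr>" using subgroup.subgroup_is_group[OF H] is_group by blast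
  have HG: "H \<subseteq> carrier G" using subgroup.subset[OF H] .
  show ?thesis
  proof
    show "topspace (subtopology X H) = carrier (G\<lparr>carrier := H\<rparr>)" using HG top by auto
    fix g assume "g \<in> carrier (G\<lparr>carrier := H\<rparr>)"
    then have g: "g \<in> H" "g \<in> carrier G" using HG by auto
    show "continuous_map (subtopology X H) (subtopology X H) (\<lambda>x. g \<otimes>\<^bsub>G\<lparr>carrier := H\<rparr>\<^esub> x)"
      using continuous_map_from_subtopology[OF left[OF g(2)]] subgroup.m_closed[OF H g(1)]
      by (auto simp: continuous_map_in_subtopology)
    show "continuous_map (subtopology X H) (subtopology X H) (\<lambda>x. x \<otimes>\<^bsub>G\<lparr>carrier := H\<rparr>\<^esub> g)"
      using continuous_map_from_subtopology[OF right[OF g(2)]] subgroup.m_closed[OF H _ g(1)]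
      by (auto simp: continuous_map_in_subtopology)
  qed
qed

lemma pi0_left_exact:
  assumes exact: "left_exact (G\<lparr>carrier := H\<rparr>) (\<lambda>f. f) G act A"
    and H: "subgroup H G"
    and const: "\<And>f g. path_component_of X f g \<Longrightarrow> act f = act g"
  shows "left_exact (pi0_group (subtopology X H) (G\<lparr>carrier := H\<rparr>)) (pi0_map X (\<lambda>f. f)) (pi0_group X G) (pi0_discrete_map act) A"
proof -
  let ?Y = "subtopology X H" and ?H = "G\<lparr>carrier := H\<rparr>"
  interpret H: translation_group ?H ?Y by (rule translation_subgroup[OF H])
  have HG: "H \<subseteq> carrier G" using subgroup.subset[OF H] .
  have act: "group_hom G A act" and ker: "H = kernel G A act"
    using exact by (simp_all add: left_exact_def)
  have A: "group A" using act by (simp add: group_hom_def)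
  have acth: "act \<in> hom G A" using act by (simp add: group_hom_def group_hom_axioms_def)
  have map: "pi0_map X (\<lambda>f. f) (H.pc f) = pc f" if f: "f \<in> H" for f
    unfolding pi0_map_def
  proof (rule the_equality)
    have "f \<in> carrier G" using f HG by blast
    moreover have "H.pc f \<subseteq> pc f"
      using path_component_of_image[of ?Y f _ X "\<lambda>x. x"] continuous_map_from_subtopology[OF continuous_map_id[unfolded id_def]] by auto
    ultimately show "pc f \<in> path_components_of X \<and> (\<lambda>f. f) ` H.pc f \<subseteq> pc f"
      using top by (auto simp: path_components_of_def)
    fix Q assume Q: "Q \<in> path_components_of X \<and> (\<lambda>f. f) ` H.pc f \<subseteq> Q"
    then obtain g where g: "Q = pc g" by (auto simp: path_components_of_def)
    have "f \<in> H.pc f" by (rule path_component_mem) (use f HG in \<open>auto simp: top\<close>)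
    then have "path_component_of X g f" using Q g by auto
    then show "Q = pc f" using path_component_set_eq[of X g f] g by simp
  qed
  have dmap: "pi0_discrete_map act (pc f) = act f" if f: "f \<in> carrier G" for f
  proof -
    have "f \<in> pc f" by (rule path_component_mem) (simp add: top f)
    moreover have "act f' = act f" if "f' \<in> pc f" for f' using const[of f f'] that by simp
    ultimately have "act ` pc f = {act f}" by blast
    then show ?thesis by (simp add: pi0_discrete_map_def)
  qed
  show ?thesis unfolding left_exact_def
  proof (intro conjI)
    show "group_hom (pi0_group ?Y ?H) (pi0_group X G) (pi0_map X (\<lambda>f. f))"
    proof (intro group_hom.intro group_hom_axioms.intro H.group_pi0 group_pi0 homI)
      fix a assume "a \<in> carrier (pi0_group ?Y ?H)"
      then obtain f where f: "f \<in> H" "a = H.pc f" unfolding H.pc_carrier by auto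
      show "pi0_map X (\<lambda>f. f) a \<in> carrier (pi0_group X G)" using f HG map by (auto simp: pc_carrier)
      fix b assume "b \<in> carrier (pi0_group ?Y ?H)"
      then obtain g where g: "g \<in> H" "b = H.pc g" unfolding H.pc_carrier by auto
      have fg: "f \<otimes> g \<in> H" using subgroup.m_closed[OF H f(1) g(1)] .
      have "a \<otimes>\<^bsub>pi0_group ?Y ?H\<^esub> b = H.pc (f \<otimes> g)" using H.pi0_mult[of f g] f g by simp
      then show "pi0_map X (\<lambda>f. f) (a \<otimes>\<^bsub>pi0_group ?Y ?H\<^esub> b) = pi0_map X (\<lambda>f. f) a \<otimes>\<^bsub>pi0_group X G\<^esub> pi0_map X (\<lambda>f. f) b"
        using map[OF fg] map[OF f(1)] map[OF g(1)] pi0_mult[OF subsetD[OF HG f(1)] subsetD[OF HG g(1)]]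
        by (simp add: f(2) g(2))
    qed
    show "group_hom (pi0_group X G) A (pi0_discrete_map act)"
    proof (intro group_hom.intro group_hom_axioms.intro group_pi0 A homI)
      fix a assume "a \<in> carrier (pi0_group X G)"
      then obtain f where f: "f \<in> carrier G" "a = pc f" unfolding pc_carrier by auto
      show "pi0_discrete_map act a \<in> carrier A" using f dmap hom_in_carrier[OF acth] by simp
      fix b assume "b \<in> carrier (pi0_group X G)"
      then obtain g where g: "g \<in> carrier G" "b = pc g" unfolding pc_carrier by auto
      show "pi0_discrete_map act (a \<otimes>\<^bsub>pi0_group X G\<^esub> b) = pi0_discrete_map act a \<otimes>\<^bsub>A\<^esub> pi0_discrete_map act b"
        using f g dmap pi0_mult[of f g] hom_mult[OF acth f(1) g(1)] by simp
    qed
    show "inj_on (pi0_map X (\<lambda>f. f)) (carrier (pi0_group ?Y ?H))"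
    proof (rule inj_onI)
      fix a b assume "a \<in> carrier (pi0_group ?Y ?H)" "b \<in> carrier (pi0_group ?Y ?H)"
        and eq: "pi0_map X (\<lambda>f. f) a = pi0_map X (\<lambda>f. f) b"
      then obtain f g where f: "f \<in> H" "a = H.pc f" and g: "g \<in> H" "b = H.pc g" unfolding H.pc_carrier by auto
      have "pc f = pc g" using eq map[OF f(1)] map[OF g(1)] f g by simp
      moreover have "g \<in> pc g" by (rule path_component_mem) (use g HG in \<open>auto simp: top\<close>)
      ultimately have "path_component_of X f g" by auto
      then obtain \<gamma> where \<gamma>: "pathin X \<gamma>" "\<gamma> 0 = f" "\<gamma> 1 = g" unfolding path_component_of_def by blast
      \<comment> \<open>Injectivity on components: \<open>act\<close> is constant along the path, so
        a path that starts in the kernel never leaves it.\<close>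
      have "\<gamma> t \<in> H" if t: "t \<in> {0..1}" for t
      proof -
        have p: "path_component_of X f (\<gamma> t)" using path_component_of_pathin[OF \<gamma>(1) t] \<gamma>(2) by simp
        have "act f = \<one>\<^bsub>A\<^esub>" using f ker by (auto simp: kernel_def)
        then have "act (\<gamma> t) = \<one>\<^bsub>A\<^esub>" using const[OF p] by simp
        moreover have "\<gamma> t \<in> carrier G" using pc_mem[of "\<gamma> t" f] p by simp
        ultimately show ?thesis using ker by (simp add: kernel_def)
      qed
      then have "pathin ?Y \<gamma>" using \<gamma>(1) by (auto simp: pathin_subtopology)
      then have "path_component_of ?Y f g" unfolding path_component_of_def using \<gamma>(2,3) by (intro exI[of _ \<gamma>]) simp
      then show "a = b" using path_component_set_eq[of ?Y f g] f g by simp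
    qed
    show "pi0_map X (\<lambda>f. f) ` carrier (pi0_group ?Y ?H) = kernel (pi0_group X G) A (pi0_discrete_map act)"
    proof -
      have "pi0_map X (\<lambda>f. f) ` carrier (pi0_group ?Y ?H) = pc ` H"
        unfolding H.pc_carrier image_image using map by (intro image_cong) auto
      moreover have "kernel (pi0_group X G) A (pi0_discrete_map act) = pc ` H"
        unfolding kernel_def pc_carrier using ker dmap HG by (auto simp: kernel_def)
      ultimately show ?thesis by simp
    qed
  qed
qed

end

section \<open>Continuity of translations in the smooth topology\<close>

lemma Cinf_nbhd_self: "f \<in> Diff M \<Longrightarrow> f ` K \<subseteq> fst c' \<Longrightarrow> 0 < \<epsilon> \<Longrightarrow> f \<in> Cinf_nbhd M f c c' K r \<epsilon>"
  by (simp add: Cinf_nbhd_def)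

lemma Cinf_nbhd_openin:
  assumes "f \<in> Diff M" "c \<in> charts M" "c' \<in> charts M" "compactin (mtop M) K" "K \<subseteq> fst c" "f ` K \<subseteq> fst c'" "0 < \<epsilon>"
  shows "openin (Cinf_topology M) (Cinf_nbhd M f c c' K r \<epsilon>)"
  unfolding Cinf_topology_def by (rule topology_generated_by_Basis) (use assms in blast)

lemma topspace_Cinf:
  assumes M: "manifold M" and ne: "x0 \<in> points M"
  shows "topspace (Cinf_topology M) = Diff M"
proof
  show "topspace (Cinf_topology M) \<subseteq> Diff M"
    unfolding Cinf_topology_def topology_generated_by_topspace by (intro Union_least) (auto simp: Cinf_nbhd_def)
  obtain c where c: "c \<in> charts M" using point_chart[OF M ne] by blast
  show "Diff M \<subseteq> topspace (Cinf_topology M)"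
  proof
    fix f assume f: "f \<in> Diff M"
    \<comment> \<open>For an empty compact set the conditions are void, so this neighbourhood
      consists of all diffeomorphisms. The point \<open>x0\<close> guarantees that there is a chart
      to name it with.\<close>
    have "openin (Cinf_topology M) (Cinf_nbhd M f c c {} 0 1)" by (rule Cinf_nbhd_openin) (use f c in auto)
    moreover have "f \<in> Cinf_nbhd M f c c {} 0 1" using f by (intro Cinf_nbhd_self) auto
    ultimately show "f \<in> topspace (Cinf_topology M)" using openin_subset by blast
  qed
qed

lemma Diff_loc_dom:
  assumes M: "manifold M" and f: "f \<in> Diff M" and c: "c \<in> charts M" and c': "c' \<in> charts M"
  shows "openin (top_of_set (cimg c)) (loc_dom c c' f)" "smooth_on (loc_dom c c' f) (loc_rep c c' f)"
proof -
  have "points M \<inter> fst c \<inter> f -` fst c' = fst c \<inter> f -` fst c'" using chart_points[OF M c] by blast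
  then show "openin (top_of_set (cimg c)) (loc_dom c c' f)" "smooth_on (loc_dom c c' f) (loc_rep c c' f)"
    using smooth_map_openin_dom(2)[OF M M Diff_smooth[OF f] openin_topspace c c'] smooth_map_rep[OF M M Diff_smooth[OF f] c c']
    by (simp_all add: loc_dom_def)
qed

lemma Diff_Ck_at:
  assumes M: "manifold M" and f: "f \<in> Diff M" and c: "c \<in> charts M" and c': "c' \<in> charts M" and y: "y \<in> loc_dom c c' f"
  shows "Ck_at k (cimg c) y (loc_rep c c' f)"
proof -
  note o = Diff_loc_dom(1)[OF M f c c'] and h = chart_halfopen[OF manifold_chart[OF M c]]
  obtain T where T: "open T" "loc_dom c c' f = cimg c \<inter> T" using o unfolding openin_open by (elim exE conjE)
  have "Ck_at k (loc_dom c c' f) y (loc_rep c c' f)"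
    by (rule smooth_on_imp_Ck_at[OF Diff_loc_dom(2)[OF M f c c'] halfopen_openin[OF h o] y])
  then show ?thesis
    by (rule Ck_germ_subset[OF order_refl h _ T(1), rotated -1]) (use y T(2) in auto)
qed

text \<open>Near \<open>x\<close> the members are diffeomorphisms whose derivatives of all orders
  are jointly continuous in parameter and point. The notion refers to one pair of charts, so that
  compositions can be chained through an intermediate chart.\<close>

definition Cinf_family :: "'i filter \<Rightarrow> 'i \<Rightarrow> ('a, 'e::euclidean_space) mfd \<Rightarrow> ('a, 'e) chart \<Rightarrow> ('a, 'e) chart \<Rightarrow> ('i \<Rightarrow> 'a \<Rightarrow> 'a) \<Rightarrow> 'a \<Rightarrow> bool" where
  "Cinf_family F i0 M c c' f x \<longleftrightarrow> c \<in> charts M \<and> c' \<in> charts M \<and> x \<in> fst c \<and> f i0 x \<in> fst c' \<and>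
     (\<forall>\<^sub>F z in germ_filter F (cimg c) (snd c x). f (fst z) \<in> Diff M \<and> snd z \<in> loc_dom c c' (f (fst z))) \<and>
     (\<forall>k. Ck_germ k F i0 (cimg c) (snd c x) (\<lambda>i. loc_rep c c' (f i)))"

lemma Cinf_family_const:
  assumes M: "manifold M" and f: "f \<in> Diff M" and c: "c \<in> charts M" "c' \<in> charts M" and x: "x \<in> fst c" "f x \<in> fst c'"
  shows "Cinf_family F i0 M c c' (\<lambda>_. f) x"
proof -
  note h = chart_halfopen[OF manifold_chart[OF M c(1)]]
  have p: "snd c x \<in> loc_dom c c' f" using x by (auto simp: loc_dom_def)
  obtain T where T: "open T" "loc_dom c c' f = cimg c \<inter> T"
    using Diff_loc_dom(1)[OF M f c] unfolding openin_open by (elim exE conjE)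
  have "\<forall>\<^sub>F z in germ_filter F (cimg c) (snd c x). f \<in> Diff M \<and> snd z \<in> loc_dom c c' f"
    unfolding eventually_germ_filter using T p f by (intro exI[of _ "\<lambda>_. True"] exI[of _ T]) auto
  moreover have "Ck_germ k F i0 (cimg c) (snd c x) (\<lambda>_. loc_rep c c' f)" for k
    by (rule Ck_germ_family[OF h _ Diff_Ck_at[OF M f c p]]) (use x in blast)
  ultimately show ?thesis using c x by (simp add: Cinf_family_def)
qed

text \<open>The chart \<open>c1\<close> around \<open>f i0 x\<close> is kept fixed. For nearby
  parameters and points the inner map still lands in it, so there the local expression of the
  composite is the composite of the local expressions.\<close>

lemma Cinf_family_compose:
  assumes M: "manifold M" and F0: "principal {i0} \<le> F"
    and f: "Cinf_family F i0 M c c1 f x" and g: "Cinf_family F i0 M c1 c' g (f i0 x)"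
  shows "Cinf_family F i0 M c c' (\<lambda>i. compose (points M) (g i) (f i)) x"
proof -
  have c: "c \<in> charts M" "c1 \<in> charts M" "c' \<in> charts M" and x: "x \<in> fst c" "f i0 x \<in> fst c1" "g i0 (f i0 x) \<in> fst c'"
    using f g by (auto simp: Cinf_family_def)
  note ic = manifold_chart[OF M c(1)] and i1 = manifold_chart[OF M c(2)]
  note h = chart_halfopen[OF ic] and h1 = chart_halfopen[OF i1]
  have p: "snd c x \<in> cimg c" using x by blast
  have px: "x \<in> points M" using chart_points[OF M c(1)] x by blast
  let ?G = "germ_filter F (cimg c) (snd c x)"
  have fe: "\<forall>\<^sub>F z in ?G. f (fst z) \<in> Diff M \<and> snd z \<in> loc_dom c c1 (f (fst z))" using f by (simp add: Cinf_family_def)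
  have rep: "loc_rep c c1 (f i) y \<in> cimg c1 \<and> cinv c y \<in> points M \<and> f i (cinv c y) \<in> fst c1 \<and> snd c1 (f i (cinv c y)) = loc_rep c c1 (f i) y \<and> snd c (cinv c y) = y \<and> cinv c y \<in> fst c"
    if y: "y \<in> loc_dom c c1 (f i)" for i y
  proof -
    obtain x' where x': "y = snd c x'" "x' \<in> fst c" "f i x' \<in> fst c1" using y by (auto simp: loc_dom_def)
    have "cinv c y = x'" using x' ic by simp
    then show ?thesis using x' loc_rep_at[OF ic x'(2), of c1 "f i"] chart_points[OF M c(1)] by auto
  qed
  have V: "\<forall>\<^sub>F (i, y) in ?G. loc_rep c c1 (f i) y \<in> cimg c1"
    using fe by eventually_elim (use rep in auto)
  have rp: "loc_rep c c1 (f i0) (snd c x) = snd c1 (f i0 x)" using loc_rep_at[OF ic x(1)] .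
  have C: "Ck_germ k F i0 (cimg c) (snd c x) (\<lambda>i. loc_rep c c1 (f i))" for k using f by (simp add: Cinf_family_def)
  have "filterlim (\<lambda>z. (fst z, loc_rep c c1 (f (fst z)) (snd z))) (germ_filter F (cimg c1) (snd c1 (f i0 x))) ?G"
    unfolding rp[symmetric] by (rule filterlim_germ_filter[OF Ck_germ_tendsto[OF C[of 0]] V])
  moreover have "\<forall>\<^sub>F z in germ_filter F (cimg c1) (snd c1 (f i0 x)). g (fst z) \<in> Diff M \<and> snd z \<in> loc_dom c1 c' (g (fst z))"
    using g by (simp add: Cinf_family_def)
  ultimately have ge: "\<forall>\<^sub>F z in ?G. g (fst z) \<in> Diff M \<and> loc_rep c c1 (f (fst z)) (snd z) \<in> loc_dom c1 c' (g (fst z))"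
    unfolding filterlim_iff by fastforce
  have 1: "\<forall>\<^sub>F z in ?G. compose (points M) (g (fst z)) (f (fst z)) \<in> Diff M \<and> snd z \<in> loc_dom c c' (compose (points M) (g (fst z)) (f (fst z)))"
    using fe ge
  proof eventually_elim
    case (elim z)
    obtain i y where z: "z = (i, y)" by (cases z)
    have r: "loc_rep c c1 (f i) y \<in> cimg c1" "cinv c y \<in> points M" "f i (cinv c y) \<in> fst c1" "snd c1 (f i (cinv c y)) = loc_rep c c1 (f i) y"
      "snd c (cinv c y) = y" "cinv c y \<in> fst c"
      using rep[of y i] elim z by auto
    have "snd c1 (f i (cinv c y)) \<in> loc_dom c1 c' (g i)" using elim z r(4) by simp
    then obtain x' where x': "x' \<in> fst c1" "g i x' \<in> fst c'" "snd c1 (f i (cinv c y)) = snd c1 x'" by (auto simp: loc_dom_def)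
    have "f i (cinv c y) = x'" by (rule inj_onD[OF chart_inj[OF i1] x'(3) r(3) x'(1)])
    then have "compose (points M) (g i) (f i) (cinv c y) \<in> fst c'" using x' r(2) by (simp add: compose_def)
    then have "y \<in> loc_dom c c' (compose (points M) (g i) (f i))" unfolding loc_dom_def
      by (intro image_eqI[where x = "cinv c y"]) (use r in auto)
    then show ?case using Diff_compose[OF M] elim z by simp
  qed
  have 2: "Ck_germ k F i0 (cimg c) (snd c x) (\<lambda>i. loc_rep c c' (compose (points M) (g i) (f i)))" for k
  proof (rule Ck_germ_cong_aux[OF F0 _ p])
    have "Ck_germ k F i0 (cimg c1) (loc_rep c c1 (f i0) (snd c x)) (\<lambda>i. loc_rep c1 c' (g i))"
      unfolding rp using g by (simp add: Cinf_family_def)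
    then show "Ck_germ k F i0 (cimg c) (snd c x) (\<lambda>i y. loc_rep c1 c' (g i) (loc_rep c c1 (f i) y))"
      by (rule Ck_germ_compose[OF F0 h p h1 V C])
    show "\<forall>\<^sub>F (i, y) in ?G. loc_rep c1 c' (g i) (loc_rep c c1 (f i) y) = loc_rep c c' (compose (points M) (g i) (f i)) y"
      using fe
    proof eventually_elim
      case (elim z)
      obtain i y where z: "z = (i, y)" by (cases z)
      have r: "loc_rep c c1 (f i) y \<in> cimg c1" "cinv c y \<in> points M" "f i (cinv c y) \<in> fst c1" "snd c1 (f i (cinv c y)) = loc_rep c c1 (f i) y"
        "snd c (cinv c y) = y" "cinv c y \<in> fst c"
        using rep[of y i] elim z by auto
      have "loc_rep c1 c' (g i) (loc_rep c c1 (f i) y) = snd c' (g i (f i (cinv c y)))"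
        using loc_rep_at[OF i1 r(3), of c' "g i"] r(4) by simp
      also have "\<dots> = loc_rep c c' (compose (points M) (g i) (f i)) y"
        using loc_rep_at[OF ic r(6), of c' "compose (points M) (g i) (f i)"] r(2,5) by (simp add: compose_def)
      finally show ?case using z by simp
    qed
  qed
  have "compose (points M) (g i0) (f i0) x \<in> fst c'" using x px by (simp add: compose_def)
  then show ?thesis using 1 2 c x by (simp add: Cinf_family_def)
qed

lemma principal_nhdsin: "x \<in> topspace X \<Longrightarrow> principal {x} \<le> nhdsin X x"
  by (auto simp: le_filter_def eventually_principal eventually_nhdsin)

text \<open>The preimage of a small closed half-ball. A compact set that is also a neighbourhood
  turns the conditions of \<open>Cinf_nbhd\<close> into control near \<open>x\<close>.\<close>

lemma compact_chart_nbhd: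
  assumes M: "manifold M" and c: "c \<in> charts M" and V: "openin (mtop M) V" "V \<subseteq> fst c" "x \<in> V"
  obtains K W where "compactin (mtop M) K" "K \<subseteq> V" "open W" "snd c x \<in> W" "W \<inter> cimg c \<subseteq> snd c ` K"
proof -
  note ic = manifold_chart[OF M c]
  obtain u where u: "openin (top_of_set {x. 0 \<le> u \<bullet> x}) (cimg c)" using chart_halfopen[OF ic] unfolding halfopen_def by blast
  have o: "openin (top_of_set {x. 0 \<le> u \<bullet> x}) (snd c ` V)"
    using openin_trans[OF chart_open_image[OF ic V(1,2)] u] .
  then obtain r where r: "0 < r" "cball (snd c x) r \<inter> {x. 0 \<le> u \<bullet> x} \<subseteq> snd c ` V"
    using V(3) unfolding openin_contains_cball by blast
  let ?C = "cball (snd c x) r \<inter> {x. 0 \<le> u \<bullet> x}"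
  have "closed {x. 0 \<le> u \<bullet> x}" using closed_halfspace_ge[of 0 u] by simp
  then have "compact ?C" by (intro compact_Int_closed compact_cball)
  moreover have CV: "?C \<subseteq> cimg c" using r(2) V(2) by blast
  ultimately have "compactin (top_of_set (cimg c)) ?C" by (simp add: compactin_subtopology)
  then have "compactin (mtop M) (cinv c ` ?C)" by (rule image_compactin[OF _ cinv_continuous[OF ic]])
  moreover have "cinv c ` ?C \<subseteq> V"
  proof
    fix y assume "y \<in> cinv c ` ?C"
    then obtain z where z: "z \<in> ?C" "y = cinv c z" by blast
    then obtain w where w: "w \<in> V" "z = snd c w" using r(2) by blast
    then have "cinv c z = w" using ic V(2) by auto
    then show "y \<in> V" using w z by simp
  qed
  moreover have "ball (snd c x) r \<inter> cimg c \<subseteq> snd c ` cinv c ` ?C"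
  proof
    fix z assume z: "z \<in> ball (snd c x) r \<inter> cimg c"
    then have "z \<in> ?C" using openin_imp_subset[OF u] by auto
    moreover have "snd c (cinv c z) = z" using z by (simp add: f_inv_into_f)
    ultimately show "z \<in> snd c ` cinv c ` ?C" by (metis imageI)
  qed
  ultimately show thesis using that[of "cinv c ` ?C" "ball (snd c x) r"] r(1) by simp
qed

text \<open>The tautological family, parametrised by the diffeomorphisms themselves. It translates
  the smooth topology into the language of families; the translations are composed from it and
  constant families.\<close>

lemma Cinf_family_ident:
  assumes M: "manifold M" and f: "f0 \<in> Diff M" and c: "c \<in> charts M" "c' \<in> charts M" and x: "x \<in> fst c" "f0 x \<in> fst c'"
  shows "Cinf_family (nhdsin (Cinf_topology M) f0) f0 M c c' (\<lambda>f. f) x"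
proof -
  note ic = manifold_chart[OF M c(1)]
  note h = chart_halfopen[OF ic]
  have px: "x \<in> points M" using chart_points[OF M c(1)] x by blast
  let ?X = "Cinf_topology M"
  let ?F = "nhdsin ?X f0"
  let ?G = "germ_filter ?F (cimg c) (snd c x)"
  have F0: "principal {f0} \<le> ?F" by (rule principal_nhdsin) (simp add: topspace_Cinf[OF M px] f)
  have p: "snd c x \<in> cimg c" using x by blast
  let ?V = "points M \<inter> fst c \<inter> f0 -` fst c'"
  have V: "openin (mtop M) ?V" by (rule smooth_map_openin_dom(1)[OF M M Diff_smooth[OF f] openin_topspace c])
  have xV: "x \<in> ?V" using px x by blast
  obtain K W where K: "compactin (mtop M) K" "K \<subseteq> ?V" "open W" "snd c x \<in> W" "W \<inter> cimg c \<subseteq> snd c ` K"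
    by (rule compact_chart_nbhd[OF M c(1) V _ xV]) blast+
  \<comment> \<open>Membership in \<open>Cinf_nbhd\<close> gives estimates uniform over the compact
    set \<open>K\<close>, hence for all \<open>y\<close> in \<open>W\<close>; this yields joint
    rather than pointwise closeness.\<close>
  have main: "\<forall>\<^sub>F z in ?G. fst z \<in> Diff M \<and> snd z \<in> loc_dom c c' (fst z) \<and> snd z \<in> loc_dom c c' f0 \<and>
      (\<forall>vs. set vs \<subseteq> Basis \<and> length vs \<le> r \<longrightarrow> norm (iter_deriv vs (cimg c) (loc_rep c c' (fst z)) (snd z) - iter_deriv vs (cimg c) (loc_rep c c' f0) (snd z)) < \<epsilon>)"
    if e: "0 < \<epsilon>" for r and \<epsilon> :: real
    unfolding eventually_germ_filter
  proof (intro exI conjI allI impI)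
    let ?N = "Cinf_nbhd M f0 c c' K r \<epsilon>"
    have "openin ?X ?N" by (rule Cinf_nbhd_openin[OF f c K(1) _ _ e]) (use K(2) in blast)+
    moreover have "f0 \<in> ?N" by (rule Cinf_nbhd_self[OF f _ e]) (use K(2) in blast)
    ultimately show "\<forall>\<^sub>F g in ?F. g \<in> ?N" unfolding eventually_nhdsin by blast
    show "open W" "snd c x \<in> W" by (rule K)+
    fix g y assume g: "g \<in> ?N" and y: "y \<in> W \<inter> cimg c"
    show gD: "fst (g, y) \<in> Diff M" using g by (simp add: Cinf_nbhd_def)
    obtain w where w: "w \<in> K" "y = snd c w" using y K(5) by blast
    have wV: "w \<in> fst c" "f0 w \<in> fst c'" using w(1) K(2) by blast+
    have "g w \<in> fst c'" using g w(1) by (auto simp: Cinf_nbhd_def)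
    then show yg: "snd (g, y) \<in> loc_dom c c' (fst (g, y))" using w(2) wV by (simp add: loc_dom_def)
    show y0: "snd (g, y) \<in> loc_dom c c' f0" using w(2) wV by (simp add: loc_dom_def)
    fix vs :: "'b list" assume vs: "set vs \<subseteq> Basis \<and> length vs \<le> r"
    have "norm (iter_deriv vs (loc_dom c c' g) (loc_rep c c' g) y - iter_deriv vs (loc_dom c c' f0) (loc_rep c c' f0) y) < \<epsilon>"
      using g vs w by (auto simp: Cinf_nbhd_def)
    then show "norm (iter_deriv vs (cimg c) (loc_rep c c' (fst (g, y))) (snd (g, y)) - iter_deriv vs (cimg c) (loc_rep c c' f0) (snd (g, y))) < \<epsilon>"
      using iter_deriv_openin[OF Diff_loc_dom(1)[OF M _ c], of g y vs "loc_rep c c' g"]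
        iter_deriv_openin[OF Diff_loc_dom(1)[OF M f c], of y vs "loc_rep c c' f0"] gD yg y0 by simp
  qed
  have 1: "\<forall>\<^sub>F z in ?G. fst z \<in> Diff M \<and> snd z \<in> loc_dom c c' (fst z)"
    by (rule eventually_mono[OF main[OF zero_less_one, of 0]]) simp
  have 2: "Ck_germ k ?F f0 (cimg c) (snd c x) (\<lambda>f. loc_rep c c' f)" for k
  proof (rule Ck_germI_iter_deriv[OF F0 h p])
    show "\<forall>\<^sub>F z in ?G. \<forall>l. Ck_at l (cimg c) (snd z) (loc_rep c c' (fst z))"
      using 1 by eventually_elim (use Diff_Ck_at[OF M _ c] in blast)
    fix vs :: "'b list" assume vs: "set vs \<subseteq> Basis" "length vs \<le> k"
    let ?L = "iter_deriv vs (cimg c) (loc_rep c c' f0) (snd c x)"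
    have "Ck_germ (length vs) ?F f0 (cimg c) (snd c x) (\<lambda>_. loc_rep c c' f0)"
      using Cinf_family_const[OF M f c x, of ?F f0] by (simp add: Cinf_family_def)
    from Ck_germ_iter_deriv[OF this order_refl]
    have t: "((\<lambda>z. iter_deriv vs (cimg c) (loc_rep c c' f0) (snd z)) \<longlongrightarrow> ?L) ?G" .
    show "((\<lambda>z. iter_deriv vs (cimg c) (loc_rep c c' (fst z)) (snd z)) \<longlongrightarrow> ?L) ?G"
      unfolding tendsto_iff
    proof (intro allI impI)
      fix e :: real assume "0 < e"
      \<comment> \<open>One half bounds the difference from \<open>f0\<close> at the same point, the
        other the variation of the derivative of \<open>f0\<close> from point to point.\<close>
      then have e: "0 < e/2" by simp
      have "\<forall>\<^sub>F z in ?G. dist (iter_deriv vs (cimg c) (loc_rep c c' f0) (snd z)) ?L < e/2"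
        using t e unfolding tendsto_iff by blast
      with main[OF e, of k] show "\<forall>\<^sub>F z in ?G. dist (iter_deriv vs (cimg c) (loc_rep c c' (fst z)) (snd z)) ?L < e"
      proof eventually_elim
        case (elim z)
        then have "dist (iter_deriv vs (cimg c) (loc_rep c c' (fst z)) (snd z)) (iter_deriv vs (cimg c) (loc_rep c c' f0) (snd z)) < e/2"
          using vs by (simp add: dist_norm)
        with elim show ?case
          using dist_triangle[of "iter_deriv vs (cimg c) (loc_rep c c' (fst z)) (snd z)" ?L "iter_deriv vs (cimg c) (loc_rep c c' f0) (snd z)"]
          by linarith
      qed
    qed
  qed
  show ?thesis using 1 2 c x by (simp add: Cinf_family_def)
qed

text \<open>The centre \<open>h\<close> of the neighbourhood may differ from \<open>T i0\<close>.
  The strict inequalities that hold at \<open>T i0\<close> persist near each point of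
  \<open>K\<close> for nearby parameters, and compactness of \<open>K\<close> leaves finitely many
  conditions on the parameter.\<close>

lemma eventually_Cinf_nbhd:
  assumes M: "manifold M" and F0: "principal {i0} \<le> F" and T0: "T i0 \<in> Cinf_nbhd M h c c' K r \<epsilon>"
    and h: "h \<in> Diff M" and c: "c \<in> charts M" "c' \<in> charts M" and K: "compactin (mtop M) K" "K \<subseteq> fst c" "h ` K \<subseteq> fst c'"
    and fam: "\<And>x. x \<in> K \<Longrightarrow> Cinf_family F i0 M c c' T x"
    and TD: "\<forall>\<^sub>F i in F. T i \<in> Diff M"
  shows "\<forall>\<^sub>F i in F. T i \<in> Cinf_nbhd M h c c' K r \<epsilon>"
proof -
  note ic = manifold_chart[OF M c(1)]
  let ?L = "{vs :: 'b list. set vs \<subseteq> Basis \<and> length vs \<le> r}"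
  have fin: "finite ?L" by (rule finite_lists_length_le) simp
  let ?P = "\<lambda>z. T (fst z) \<in> Diff M \<and> snd z \<in> loc_dom c c' (T (fst z)) \<and> snd z \<in> loc_dom c c' h \<and>
      (\<forall>vs\<in>?L. norm (iter_deriv vs (cimg c) (loc_rep c c' (T (fst z))) (snd z) - iter_deriv vs (cimg c) (loc_rep c c' h) (snd z)) < \<epsilon>)"
  have "\<exists>Q W. eventually Q F \<and> open W \<and> snd c x \<in> W \<and> (\<forall>i y. Q i \<longrightarrow> y \<in> W \<inter> cimg c \<longrightarrow> ?P (i, y))" if x: "x \<in> K" for x
  proof -
    have xc: "x \<in> fst c" "h x \<in> fst c'" using x K by auto
    let ?G = "germ_filter F (cimg c) (snd c x)"
    note fx = fam[OF x] and hx = Cinf_family_const[OF M h c xc, of F i0]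
    have T0x: "snd c x \<in> loc_dom c c' (T i0)" "snd c x \<in> loc_dom c c' h" "T i0 \<in> Diff M"
      using fx xc T0 by (auto simp: Cinf_family_def loc_dom_def Cinf_nbhd_def)
    have "\<forall>\<^sub>F z in ?G. \<forall>vs\<in>?L. norm (iter_deriv vs (cimg c) (loc_rep c c' (T (fst z))) (snd z) - iter_deriv vs (cimg c) (loc_rep c c' h) (snd z)) < \<epsilon>"
    proof (rule eventually_ball_finite[OF fin], intro ballI)
      fix vs assume vs: "vs \<in> ?L"
      have "((\<lambda>z. iter_deriv vs (cimg c) (loc_rep c c' (T (fst z))) (snd z)) \<longlongrightarrow> iter_deriv vs (cimg c) (loc_rep c c' (T i0)) (snd c x)) ?G"
        by (rule Ck_germ_iter_deriv[OF _ order_refl]) (use fx in \<open>simp add: Cinf_family_def\<close>)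
      moreover have "((\<lambda>z. iter_deriv vs (cimg c) (loc_rep c c' h) (snd z)) \<longlongrightarrow> iter_deriv vs (cimg c) (loc_rep c c' h) (snd c x)) ?G"
        using Ck_germ_iter_deriv[OF _ order_refl, of "vs" F i0 "cimg c" "snd c x" "\<lambda>_. loc_rep c c' h"] hx by (simp add: Cinf_family_def)
      ultimately have t: "((\<lambda>z. norm (iter_deriv vs (cimg c) (loc_rep c c' (T (fst z))) (snd z) - iter_deriv vs (cimg c) (loc_rep c c' h) (snd z)))
          \<longlongrightarrow> norm (iter_deriv vs (cimg c) (loc_rep c c' (T i0)) (snd c x) - iter_deriv vs (cimg c) (loc_rep c c' h) (snd c x))) ?G"
        by (intro tendsto_norm tendsto_diff)
      have "norm (iter_deriv vs (loc_dom c c' (T i0)) (loc_rep c c' (T i0)) (snd c x) - iter_deriv vs (loc_dom c c' h) (loc_rep c c' h) (snd c x)) < \<epsilon>"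
        using T0 vs x by (auto simp: Cinf_nbhd_def)
      then have "norm (iter_deriv vs (cimg c) (loc_rep c c' (T i0)) (snd c x) - iter_deriv vs (cimg c) (loc_rep c c' h) (snd c x)) < \<epsilon>"
        using iter_deriv_openin[OF Diff_loc_dom(1)[OF M T0x(3) c] T0x(1), of vs "loc_rep c c' (T i0)"]
          iter_deriv_openin[OF Diff_loc_dom(1)[OF M h c] T0x(2), of vs "loc_rep c c' h"] by simp
      then show "\<forall>\<^sub>F z in ?G. norm (iter_deriv vs (cimg c) (loc_rep c c' (T (fst z))) (snd z) - iter_deriv vs (cimg c) (loc_rep c c' h) (snd z)) < \<epsilon>"
        by (rule order_tendstoD(2)[OF t])
    qed
    moreover have "\<forall>\<^sub>F z in ?G. T (fst z) \<in> Diff M \<and> snd z \<in> loc_dom c c' (T (fst z))" using fx by (simp add: Cinf_family_def)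
    moreover have "\<forall>\<^sub>F z in ?G. h \<in> Diff M \<and> snd z \<in> loc_dom c c' h" using hx by (simp add: Cinf_family_def)
    ultimately have "eventually ?P ?G" by eventually_elim simp
    then show ?thesis unfolding eventually_germ_filter .
  qed
  note ex = this
  \<comment> \<open>The parameter condition and the coordinate neighbourhood are chosen as functions
    of the point, so that the cover of \<open>K\<close> is indexed by points.\<close>
  define R where "R x Q W \<longleftrightarrow> eventually Q F \<and> open W \<and> snd c x \<in> W \<and> (\<forall>i y. Q i \<longrightarrow> y \<in> W \<inter> cimg c \<longrightarrow> ?P (i, y))" for x Q W
  define Q where "Q x = (SOME Q. \<exists>W. R x Q W)" for x
  define W where "W x = (SOME W. R x (Q x) W)" for x
  have "R x (Q x) (W x)" if "x \<in> K" for x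
  proof -
    have "\<exists>Q W. R x Q W" using ex[OF that] unfolding R_def .
    then have "\<exists>W. R x (Q x) W" unfolding Q_def by (rule someI_ex)
    then show ?thesis unfolding W_def by (rule someI_ex)
  qed
  then have QW: "\<And>x. x \<in> K \<Longrightarrow> eventually (Q x) F" "\<And>x. x \<in> K \<Longrightarrow> open (W x)" "\<And>x. x \<in> K \<Longrightarrow> snd c x \<in> W x"
    "\<And>x i y. x \<in> K \<Longrightarrow> Q x i \<Longrightarrow> y \<in> W x \<inter> cimg c \<Longrightarrow> ?P (i, y)" unfolding R_def by (elim meta_allE meta_impE conjE; simp)+
  let ?U = "\<lambda>x. {y \<in> fst c. snd c y \<in> W x}"
  have oU: "openin (mtop M) U" if "U \<in> ?U ` K" for U using that chart_preimage[OF ic QW(2)] by (elim imageE) simp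
  have cU: "K \<subseteq> \<Union> (?U ` K)" using QW(3) K(2) by (auto simp: subset_iff)
  obtain \<F> where \<F>: "finite \<F>" "\<F> \<subseteq> ?U ` K" "K \<subseteq> \<Union> \<F>"
    using compactinD[OF K(1), of "?U ` K", OF oU cU] by (metis (lifting))
  obtain K0 where K0: "K0 \<subseteq> K" "finite K0" "\<F> = ?U ` K0" using finite_subset_image[OF \<F>(1,2)] by metis
  have "\<forall>\<^sub>F i in F. \<forall>x\<in>K0. Q x i" by (rule eventually_ball_finite[OF K0(2)]) (use QW(1) K0(1) in blast)
  then show ?thesis using TD
  proof eventually_elim
    case (elim i)
    have P: "?P (i, snd c x)" if x: "x \<in> K" for x
    proof -
      have "x \<in> \<Union> (?U ` K0)" using \<F>(3) x unfolding K0(3) by blast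
      then obtain x0 where x0: "x0 \<in> K0" "x \<in> ?U x0" by blast
      then have x0': "x0 \<in> K" "Q x0 i" "snd c x \<in> W x0 \<inter> cimg c" using elim(1) K0(1) by blast+
      show ?thesis by (rule QW(4)[OF x0'])
    qed
    have 1: "T i ` K \<subseteq> fst c'"
    proof
      fix y assume "y \<in> T i ` K"
      then obtain x where x: "x \<in> K" "y = T i x" by blast
      have "snd c x \<in> loc_dom c c' (T i)" using P[OF x(1)] by simp
      then obtain x' where x': "x' \<in> fst c" "T i x' \<in> fst c'" "snd c x = snd c x'" by (auto simp: loc_dom_def)
      have "x = x'" using inj_onD[OF chart_inj[OF ic] x'(3)] x x' K(2) by blast
      then show "y \<in> fst c'" using x x' by simp
    qed
    have 2: "norm (iter_deriv vs (loc_dom c c' (T i)) (loc_rep c c' (T i)) y - iter_deriv vs (loc_dom c c' h) (loc_rep c c' h) y) < \<epsilon>"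
      if vs: "set vs \<subseteq> Basis" "length vs \<le> r" and y: "y \<in> snd c ` K" for vs y
    proof -
      obtain x where x: "x \<in> K" "y = snd c x" using y by blast
      have vs': "vs \<in> ?L" using vs by simp
      note Px = P[OF x(1)]
      have "norm (iter_deriv vs (cimg c) (loc_rep c c' (T i)) y - iter_deriv vs (cimg c) (loc_rep c c' h) y) < \<epsilon>"
        using Px vs' x by auto
      moreover have "y \<in> loc_dom c c' (T i)" "y \<in> loc_dom c c' h" using Px x by auto
      ultimately show ?thesis
        using iter_deriv_openin[OF Diff_loc_dom(1)[OF M elim(2) c], of y vs "loc_rep c c' (T i)"]
          iter_deriv_openin[OF Diff_loc_dom(1)[OF M h c], of y vs "loc_rep c c' h"] by simp
    qed
    show ?case using elim(2) 1 2 by (auto simp: Cinf_nbhd_def)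
  qed
qed

lemma Cinf_continuous_mapI:
  assumes M: "manifold M" and ne: "x0 \<in> points M" and TD: "\<And>f. f \<in> Diff M \<Longrightarrow> T f \<in> Diff M"
    and fam: "\<And>f0 c c' x. f0 \<in> Diff M \<Longrightarrow> c \<in> charts M \<Longrightarrow> c' \<in> charts M \<Longrightarrow> x \<in> fst c \<Longrightarrow> T f0 x \<in> fst c' \<Longrightarrow>
      Cinf_family (nhdsin (Cinf_topology M) f0) f0 M c c' T x"
  shows "continuous_map (Cinf_topology M) (Cinf_topology M) T"
proof -
  let ?X = "Cinf_topology M"
  let ?B = "{Cinf_nbhd M f c c' K r \<epsilon> | f c c' K r \<epsilon>.
        f \<in> Diff M \<and> c \<in> charts M \<and> c' \<in> charts M \<and> compactin (mtop M) K \<and> K \<subseteq> fst c \<and> f ` K \<subseteq> fst c' \<and> 0 < \<epsilon>}"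
  note top = topspace_Cinf[OF M ne]
  have "continuous_map ?X (topology_generated_by ?B) T"
  proof (rule continuous_on_generated_topo)
    fix U assume "U \<in> ?B"
    then obtain h c c' K r \<epsilon> where U: "U = Cinf_nbhd M h c c' K r \<epsilon>" and h: "h \<in> Diff M" "c \<in> charts M" "c' \<in> charts M"
      "compactin (mtop M) K" "K \<subseteq> fst c" "h ` K \<subseteq> fst c'" "0 < \<epsilon>" by (elim CollectE exE conjE)
    show "openin ?X (T -` U \<inter> topspace ?X)"
    proof (subst openin_subopen, intro ballI)
      fix f0 assume f0: "f0 \<in> T -` U \<inter> topspace ?X"
      then have f0D: "f0 \<in> Diff M" using top by blast
      have T0: "T f0 \<in> Cinf_nbhd M h c c' K r \<epsilon>" using f0 U by blast
      have F0: "principal {f0} \<le> nhdsin ?X f0" by (rule principal_nhdsin) (use f0 in blast)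
      have "\<forall>\<^sub>F f in nhdsin ?X f0. f \<in> Diff M"
        unfolding eventually_nhdsin top[symmetric] using f0 openin_topspace by blast
      then have ev: "\<forall>\<^sub>F f in nhdsin ?X f0. T f \<in> Diff M" by (rule eventually_mono) (rule TD)
      have "\<forall>\<^sub>F f in nhdsin ?X f0. T f \<in> U" unfolding U
      proof (rule eventually_Cinf_nbhd[OF M F0 T0 h(1-6) _ ev])
        fix x assume x: "x \<in> K"
        have "T f0 x \<in> fst c'" using T0 x by (auto simp: Cinf_nbhd_def)
        then show "Cinf_family (nhdsin ?X f0) f0 M c c' T x" using fam[OF f0D h(2,3)] x h(5) by blast
      qed
      then have "\<exists>S. openin ?X S \<and> f0 \<in> S \<and> (\<forall>f\<in>S. T f \<in> U)" unfolding eventually_nhdsin using f0 by simp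
      then obtain S where S: "openin ?X S" "f0 \<in> S" "\<forall>f\<in>S. T f \<in> U" by (elim exE conjE)
      have "S \<subseteq> T -` U \<inter> topspace ?X" using S(3) openin_subset[OF S(1)] by blast
      with S show "\<exists>S. openin ?X S \<and> f0 \<in> S \<and> S \<subseteq> T -` U \<inter> topspace ?X" by (intro exI[of _ S] conjI)
    qed
  next
    have "\<Union> ?B = topspace ?X" unfolding Cinf_topology_def by (rule topology_generated_by_topspace[symmetric])
    moreover have "T ` topspace ?X \<subseteq> topspace ?X" unfolding top using TD by blast
    ultimately show "T ` topspace ?X \<subseteq> \<Union> ?B" by simp
  qed
  then show ?thesis by (simp add: Cinf_topology_def)
qed

text \<open>Each translation is the composite of the tautological family with a constant
  one.\<close>

lemma Cinf_translation_continuous: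
  assumes M: "manifold M" and ne: "x0 \<in> points M" and h: "h \<in> Diff M"
  shows "continuous_map (Cinf_topology M) (Cinf_topology M) (\<lambda>f. compose (points M) h f)"
    and "continuous_map (Cinf_topology M) (Cinf_topology M) (\<lambda>f. compose (points M) f h)"
proof -
  let ?X = "Cinf_topology M"
  have F0: "principal {f0} \<le> nhdsin ?X f0" if "f0 \<in> Diff M" for f0
    by (rule principal_nhdsin) (simp add: topspace_Cinf[OF M ne] that)
  show "continuous_map ?X ?X (\<lambda>f. compose (points M) h f)"
  proof (rule Cinf_continuous_mapI[OF M ne Diff_compose[OF M h]])
    fix f0 c c' x assume f0: "f0 \<in> Diff M" and c: "c \<in> charts M" "c' \<in> charts M" and x: "x \<in> fst c" "compose (points M) h f0 x \<in> fst c'"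
    have px: "x \<in> points M" using chart_points[OF M c(1)] x by blast
    obtain c1 where c1: "c1 \<in> charts M" "f0 x \<in> fst c1" using point_chart[OF M Diff_in[OF f0 px]] .
    have hx: "h (f0 x) \<in> fst c'" using x px by (simp add: compose_def)
    show "Cinf_family (nhdsin ?X f0) f0 M c c' (compose (points M) h) x"
      by (rule Cinf_family_compose[where f = "\<lambda>f. f" and g = "\<lambda>_. h" and ?i0.0 = f0, OF M F0[OF f0] Cinf_family_ident[OF M f0 c(1) c1(1) x(1) c1(2)] Cinf_family_const[OF M h c1(1) c(2) c1(2) hx]])
  qed
  show "continuous_map ?X ?X (\<lambda>f. compose (points M) f h)"
  proof (rule Cinf_continuous_mapI[OF M ne Diff_compose[OF M _ h]])
    fix f0 c c' x assume f0: "f0 \<in> Diff M" and c: "c \<in> charts M" "c' \<in> charts M" and x: "x \<in> fst c" "compose (points M) f0 h x \<in> fst c'"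
    have px: "x \<in> points M" using chart_points[OF M c(1)] x by blast
    obtain c1 where c1: "c1 \<in> charts M" "h x \<in> fst c1" using point_chart[OF M Diff_in[OF h px]] .
    have hx: "f0 (h x) \<in> fst c'" using x px by (simp add: compose_def)
    show "Cinf_family (nhdsin ?X f0) f0 M c c' (\<lambda>f. compose (points M) f h) x"
      by (rule Cinf_family_compose[where f = "\<lambda>_. h" and g = "\<lambda>f. f" and ?i0.0 = f0, OF M F0[OF f0] Cinf_family_const[OF M h c(1) c1(1) x(1) c1(2)] Cinf_family_ident[OF M f0 c1(1) c(2) c1(2) hx]])
  qed auto
qed

text \<open>The tautological family restricted to the slice over a single point: joint continuity
  specialises to continuity of the value and of the first derivative in the diffeomorphism.\<close>

lemma Cinf_derivative_tendsto:
  assumes M: "manifold M" and f0: "f0 \<in> Diff M" and c: "c \<in> charts M" "c' \<in> charts M" and x: "x \<in> fst c" "f0 x \<in> fst c'"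
  shows "\<forall>\<^sub>F f in nhdsin (Cinf_topology M) f0. f \<in> Diff M \<and> f x \<in> fst c'"
    and "((\<lambda>f. snd c' (f x)) \<longlongrightarrow> snd c' (f0 x)) (nhdsin (Cinf_topology M) f0)"
    and "((\<lambda>f. loc_deriv c c' f x v) \<longlongrightarrow> loc_deriv c c' f0 x v) (nhdsin (Cinf_topology M) f0)"
proof -
  let ?F = "nhdsin (Cinf_topology M) f0"
  let ?G = "germ_filter ?F (cimg c) (snd c x)"
  note ic = manifold_chart[OF M c(1)]
  have px: "x \<in> points M" using chart_points[OF M c(1)] x by blast
  have fam: "Cinf_family ?F f0 M c c' (\<lambda>f. f) x" by (rule Cinf_family_ident[OF M f0 c x])
  have at: "eventually (\<lambda>f. P (f, snd c x)) ?F" if P: "eventually P ?G" for P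
  proof -
    obtain Q W where "eventually Q ?F" "snd c x \<in> W" "\<And>i y. Q i \<Longrightarrow> y \<in> W \<inter> cimg c \<Longrightarrow> P (i, y)"
      using P unfolding eventually_germ_filter by blast
    then show ?thesis using x(1) by (auto elim!: eventually_mono)
  qed
  have lim: "filterlim (\<lambda>f. (f, snd c x)) ?G ?F" unfolding filterlim_iff using at by blast
  have "\<forall>\<^sub>F f in ?F. f \<in> Diff M \<and> snd c x \<in> loc_dom c c' f"
    using at[of "\<lambda>z. fst z \<in> Diff M \<and> snd z \<in> loc_dom c c' (fst z)"] fam by (simp add: Cinf_family_def)
  then show ev: "\<forall>\<^sub>F f in ?F. f \<in> Diff M \<and> f x \<in> fst c'"
  proof eventually_elim
    case (elim f)
    then obtain x' where x': "x' \<in> fst c" "f x' \<in> fst c'" "snd c x = snd c x'" by (auto simp: loc_dom_def)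
    have "x = x'" by (rule inj_onD[OF chart_inj[OF ic] x'(3) x(1) x'(1)])
    then show ?case using elim x' by simp
  qed
  have C: "Ck_germ (Suc 0) ?F f0 (cimg c) (snd c x) (\<lambda>f. loc_rep c c' f)" using fam by (simp add: Cinf_family_def)
  have "((\<lambda>f. loc_rep c c' f (snd c x)) \<longlongrightarrow> loc_rep c c' f0 (snd c x)) ?F"
    using filterlim_compose[OF Ck_germ_tendsto[OF C] lim] by simp
  then show "((\<lambda>f. snd c' (f x)) \<longlongrightarrow> snd c' (f0 x)) ?F" by (simp add: loc_rep_at[OF ic x(1)])
  have "((\<lambda>z. frechet_derivative (loc_rep c c' (fst z)) (at (snd z) within cimg c) v) \<longlongrightarrow>
      frechet_derivative (loc_rep c c' f0) (at (snd c x) within cimg c) v) ?G" using C by simp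
  from filterlim_compose[OF this lim]
  have t: "((\<lambda>f. frechet_derivative (loc_rep c c' f) (at (snd c x) within cimg c) v) \<longlongrightarrow>
      frechet_derivative (loc_rep c c' f0) (at (snd c x) within cimg c) v) ?F" by simp
  have eq: "loc_deriv c c' f x v = frechet_derivative (loc_rep c c' f) (at (snd c x) within cimg c) v"
    if "f \<in> Diff M" "f x \<in> fst c'" for f
    using loc_deriv_within(1)[OF M M Diff_smooth[OF that(1)] openin_topspace c px x(1) that(2)] by (simp add: loc_deriv_def)
  have "((\<lambda>f. loc_deriv c c' f x v) \<longlongrightarrow> frechet_derivative (loc_rep c c' f0) (at (snd c x) within cimg c) v) ?F"
    by (rule tendsto_cong[THEN iffD2, OF _ t]) (use ev in \<open>eventually_elim, simp add: eq\<close>)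
  then show "((\<lambda>f. loc_deriv c c' f x v) \<longlongrightarrow> loc_deriv c c' f0 x v) ?F" using eq[OF f0 x(2)] by simp
qed

lemma Cinf_evaluation_continuous:
  assumes M: "manifold M" and x: "x \<in> points M"
  shows "continuous_map (Cinf_topology M) (mtop M) (\<lambda>f. f x)"
  unfolding continuous_map_eq_topcontinuous_at topcontinuous_at_def
proof (intro ballI conjI allI impI)
  have top: "topspace (Cinf_topology M) = Diff M" by (rule topspace_Cinf[OF M x])
  show "(\<lambda>f. f x) \<in> topspace (Cinf_topology M) \<rightarrow> points M" using Diff_in[of _ M] x top by auto
  fix f0 assume f0: "f0 \<in> topspace (Cinf_topology M)"
  then show "f0 \<in> topspace (Cinf_topology M)" .
  have f0D: "f0 \<in> Diff M" using f0 top by simp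
  fix V assume V: "openin (mtop M) V \<and> f0 x \<in> V"
  obtain c where c: "c \<in> charts M" "x \<in> fst c" using point_chart[OF M x] .
  obtain c' where c': "c' \<in> charts M" "f0 x \<in> fst c'" using point_chart[OF M Diff_in[OF f0D x]] .
  note ic' = manifold_chart[OF M c'(1)]
  have "openin (top_of_set (cimg c')) (snd c' ` (V \<inter> fst c'))"
    by (rule chart_open_image[OF ic']) (use V chart_openin[OF ic'] in auto)
  then obtain T where T: "open T" "snd c' ` (V \<inter> fst c') = cimg c' \<inter> T" unfolding openin_open by (elim exE conjE)
  have "snd c' (f0 x) \<in> snd c' ` (V \<inter> fst c')" using V c' by blast
  then have "snd c' (f0 x) \<in> T" unfolding T(2) by blast
  with Cinf_derivative_tendsto(2)[OF M f0D c(1) c'(1) c(2) c'(2)] T(1)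
  have "\<forall>\<^sub>F f in nhdsin (Cinf_topology M) f0. snd c' (f x) \<in> T" by (rule topological_tendstoD)
  with Cinf_derivative_tendsto(1)[OF M f0D c(1) c'(1) c(2) c'(2)]
  have "\<forall>\<^sub>F f in nhdsin (Cinf_topology M) f0. f x \<in> V"
  proof eventually_elim
    case (elim f)
    then have "snd c' (f x) \<in> cimg c' \<inter> T" by blast
    then have "snd c' (f x) \<in> snd c' ` (V \<inter> fst c')" unfolding T(2) .
    then obtain y where y: "y \<in> V" "y \<in> fst c'" "snd c' (f x) = snd c' y" by blast
    have "f x = y" by (rule inj_onD[OF chart_inj[OF ic'] y(3) _ y(2)]) (use elim in blast)
    then show ?case using y by simp
  qed
  then show "\<exists>U. openin (Cinf_topology M) U \<and> f0 \<in> U \<and> (\<forall>f\<in>U. f x \<in> V)"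
    unfolding eventually_nhdsin using f0 by simp
qed

section \<open>Cutting along a surface\<close>

lemma connectedin_subset_closed:
  assumes "connectedin X S" "closedin X A" "closedin X B" "S \<subseteq> A \<union> B" "A \<inter> B = {}" "x \<in> S" "x \<in> A"
  shows "S \<subseteq> A"
proof (rule ccontr)
  assume "\<not> S \<subseteq> A"
  then have "B \<inter> S \<noteq> {}" using assms(4) by blast
  moreover have "A \<inter> S \<noteq> {}" using assms(6,7) by blast
  moreover have "A \<inter> B \<inter> S = {}" using assms(5) by simp
  ultimately show False using assms(1-4) unfolding connectedin_closedin by (elim conjE) meson
qed

lemma connectedin_subset_open:
  assumes "connectedin X S" "openin X A" "openin X B" "S \<subseteq> A \<union> B" "A \<inter> B = {}" "x \<in> S" "x \<in> A"
  shows "S \<subseteq> A"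
proof (rule ccontr)
  assume "\<not> S \<subseteq> A"
  then have "B \<inter> S \<noteq> {}" using assms(4) by blast
  moreover have "A \<inter> S \<noteq> {}" using assms(6,7) by blast
  moreover have "A \<inter> B \<inter> S = {}" using assms(5) by simp
  ultimately show False using assms(1-4) unfolding connectedin by (elim conjE) meson
qed

lemma component_at:
  assumes "x \<in> topspace X"
  obtains C where "C \<in> connected_components_of X" "x \<in> C"
  using assms Union_connected_components_of[of X] by blast

text \<open>In coordinates \<open>W\<close> is a ball or a half-ball. Removing boundary points
  leaves a set between a convex open set and its closure, which is therefore connected. The boundary
  part is convex or empty.\<close>

lemma chart_half_ball:
  fixes M :: "('a, 'e::euclidean_space) mfd"
  assumes M: "manifold M" and V: "openin (mtop M) V" "x \<in> V"
  obtains W where "openin (mtop M) W" "x \<in> W" "W \<subseteq> V"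
    "\<And>B. B \<subseteq> boundary M \<Longrightarrow> connectedin (mtop M) (W - B) \<and> W - B \<noteq> {}"
    "connectedin (mtop M) (W \<inter> boundary M)"
proof -
  have px: "x \<in> points M" using openin_subset[OF V(1)] V(2) by blast
  obtain d where d: "d \<in> charts M" "x \<in> fst d" using point_chart[OF M px] .
  note id = manifold_chart[OF M d(1)]
  have oV: "openin (top_of_set (cimg d)) (snd d ` (V \<inter> fst d))"
    by (rule chart_open_image[OF id]) (use V(1) chart_openin[OF id] in auto)
  let ?p = "snd d x"
  have pV: "?p \<in> snd d ` (V \<inter> fst d)" using V(2) d(2) by blast
  text \<open>\<open>u = 0\<close> in the case of an open chart domain.\<close>
  obtain r u where r: "0 < r" "ball ?p r \<inter> cimg d \<subseteq> snd d ` (V \<inter> fst d)" "ball ?p r \<inter> cimg d = ball ?p r \<inter> {z. 0 \<le> u \<bullet> z}"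
    and u: "u = 0 \<and> open (cimg d) \<or> half_chart d u"
  proof (cases "open (cimg d)")
    case True
    then have "open (snd d ` (V \<inter> fst d))" using oV openin_open_eq by blast
    then obtain r where r: "0 < r" "ball ?p r \<subseteq> snd d ` (V \<inter> fst d)" using pV openE by blast
    then have "ball ?p r \<subseteq> cimg d" by blast
    then show thesis using that[of r 0] r True by auto
  next
    case False
    then obtain u where u: "half_chart d u" using id unfolding is_chart_def half_chart_def by (elim conjE disjE) (simp, blast)
    then have o: "openin (top_of_set {z. 0 \<le> u \<bullet> z}) (cimg d)" by (simp add: half_chart_def)
    then have "openin (top_of_set {z. 0 \<le> u \<bullet> z}) (snd d ` (V \<inter> fst d))" using oV openin_trans by blast
    then obtain r where r: "0 < r" "ball ?p r \<inter> {z. 0 \<le> u \<bullet> z} \<subseteq> snd d ` (V \<inter> fst d)"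
      using pV unfolding openin_contains_ball by blast
    moreover have "snd d ` (V \<inter> fst d) \<subseteq> cimg d" by blast
    ultimately have "ball ?p r \<inter> cimg d = ball ?p r \<inter> {z. 0 \<le> u \<bullet> z}" using openin_imp_subset[OF o] by blast
    then show thesis using that[of r u] r u by auto
  qed
  let ?W = "{y \<in> fst d. snd d y \<in> ball ?p r}"
  let ?B = "ball ?p r \<inter> {z. 0 \<le> u \<bullet> z}"
  let ?C = "if u = 0 then ball ?p r else ball ?p r \<inter> {z. 0 < u \<bullet> z}"
  have Wimg: "snd d ` ?W = ?B" unfolding r(3)[symmetric] by blast
  have CB: "?C \<subseteq> ?B" by auto
  have C: "convex ?C" using convex_halfspace_gt[of 0 u] by (auto simp: convex_Int)
  have clos: "?B \<subseteq> closure ?C"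
  proof
    fix z assume z: "z \<in> ?B"
    show "z \<in> closure ?C"
    proof (cases "u = 0")
      case True
      then have "z \<in> ?C" using z by simp
      then show ?thesis using closure_subset[of ?C] by blast
    next
      case False
      have "\<exists>y\<in>?C. dist y z < e" if e: "0 < e" for e
      proof -
        \<comment> \<open>Pushing \<open>z\<close> inward along \<open>u\<close> reaches the open
          half-space; the two bounds keep the displacement below \<open>e\<close> and the new point
          inside the ball.\<close>
        define t where "t = min (e/2) ((r - dist ?p z)/2) / norm u"
        have s: "0 < min (e/2) ((r - dist ?p z)/2)" using e z by auto
        have t: "0 < t" "t * norm u < e" "t * norm u < r - dist ?p z" unfolding t_def using s False by (auto simp: min_less_iff_disj)
        have "dist (z + t *\<^sub>R u) z = t * norm u" using t(1) by (simp add: dist_norm)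
        moreover have "0 < u \<bullet> (z + t *\<^sub>R u)" using z t(1) False by (simp add: inner_add_right add_nonneg_pos)
        moreover have "dist ?p (z + t *\<^sub>R u) < r"
          using dist_triangle[of ?p "z + t *\<^sub>R u" z] t(1,3) by (simp add: dist_norm)
        ultimately show ?thesis using t(2) False by (intro bexI[of _ "z + t *\<^sub>R u"]) auto
      qed
      then show ?thesis unfolding closure_approachable by blast
    qed
  qed
  have Cne: "?C \<noteq> {}"
  proof
    assume "?C = {}"
    then have e: "closure ?C = {}" by simp
    have "?p \<in> ?B"
    proof -
      have "?p \<in> ball ?p r \<inter> cimg d" using r(1) d(2) by simp
      then show ?thesis unfolding r(3) .
    qed
    then have "?p \<in> closure ?C" by (rule subsetD[OF clos])
    then show False unfolding e by (rule emptyE)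
  qed
  have conn: "connectedin (mtop M) (cinv d ` D)" if "D \<subseteq> cimg d" "connected D" for D
    by (rule connectedin_continuous_map_image[OF cinv_continuous[OF id]]) (use that in \<open>simp add: connectedin_subtopology\<close>)
  have preim: "?W \<inter> Y = cinv d ` snd d ` (?W \<inter> Y)" for Y
  proof -
    have "(\<lambda>y. cinv d (snd d y)) ` (?W \<inter> Y) = (\<lambda>y. y) ` (?W \<inter> Y)" by (rule image_cong) (use id in auto)
    then show ?thesis by (simp add: image_image)
  qed
  have int: "y \<notin> boundary M" if y: "y \<in> ?W" "snd d y \<in> ?C" for y
  proof -
    have "snd d y \<in> interior (cimg d)"
      using u
    proof
      assume "u = 0 \<and> open (cimg d)"
      then show ?thesis using y by (simp add: interior_open)
    next
      assume h: "half_chart d u"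
      then have "u \<noteq> 0" by (simp add: half_chart_def)
      then show ?thesis using half_chart_interior[OF h, of y] y by auto
    qed
    then show ?thesis using boundary_iff[OF M d(1), of y] y by simp
  qed
  show thesis
  proof (rule that[of ?W])
    show "openin (mtop M) ?W" by (rule chart_preimage[OF id]) simp
    show "x \<in> ?W" using r(1) d(2) by simp
    show "?W \<subseteq> V"
    proof
      fix y assume y: "y \<in> ?W"
      then have "snd d y \<in> snd d ` (V \<inter> fst d)" using r(2) by blast
      then obtain y' where y': "y' \<in> V" "y' \<in> fst d" "snd d y = snd d y'" by blast
      have "y = y'" by (rule inj_onD[OF chart_inj[OF id] y'(3) _ y'(2)]) (use y in blast)
      then show "y \<in> V" using y' by simp
    qed
    show "connectedin (mtop M) (?W - B) \<and> ?W - B \<noteq> {}" if B: "B \<subseteq> boundary M" for B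
    proof -
      let ?D = "snd d ` (?W \<inter> - B)"
      have DB: "?D \<subseteq> ?B" using Wimg by blast
      have CD: "?C \<subseteq> ?D"
      proof
        fix z assume z: "z \<in> ?C"
        then have "z \<in> snd d ` ?W" unfolding Wimg using CB by blast
        then obtain y where y: "y \<in> ?W" "z = snd d y" by blast
        then have "y \<notin> B" using int[of y] z B by blast
        then show "z \<in> ?D" using y by blast
      qed
      have "connected ?D"
        by (rule connected_intermediate_closure[OF convex_connected[OF C] CD]) (use DB clos in blast)
      then have "connectedin (mtop M) (cinv d ` ?D)" by (rule conn[rotated]) blast
      moreover have "?W - B = cinv d ` ?D" using preim[of "- B"] by (simp add: Diff_eq)
      moreover have "?D \<noteq> {}" using CD Cne by blast
      ultimately show ?thesis by simp
    qed
    show "connectedin (mtop M) (?W \<inter> boundary M)"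
    proof -
      let ?D = "snd d ` (?W \<inter> boundary M)"
      have "connected ?D"
      using u
      proof
        assume uu: "u = 0 \<and> open (cimg d)"
        have "?W \<inter> boundary M = {}" using int uu by auto
        then have "?D = {}" by simp
        then show ?thesis by (metis connected_empty)
      next
        assume h: "half_chart d u"
        have "?D = ball ?p r \<inter> {z. u \<bullet> z = 0}"
        proof
          show "?D \<subseteq> ball ?p r \<inter> {z. u \<bullet> z = 0}" using half_chart_boundary[OF M d(1) h] by auto
          show "ball ?p r \<inter> {z. u \<bullet> z = 0} \<subseteq> ?D"
          proof
            fix z assume z: "z \<in> ball ?p r \<inter> {z. u \<bullet> z = 0}"
            then have "z \<in> snd d ` ?W" unfolding Wimg by auto
            then obtain y where y: "y \<in> ?W" "z = snd d y" by blast
            then have "y \<in> boundary M" using half_chart_boundary[OF M d(1) h, of y] z by auto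
            then show "z \<in> ?D" using y by blast
          qed
        qed
        moreover have "convex (ball ?p r \<inter> {z. u \<bullet> z = 0})" by (intro convex_Int convex_ball convex_hyperplane)
        ultimately show ?thesis using convex_connected by simp
      qed
      then have "connectedin (mtop M) (cinv d ` ?D)" by (rule conn[rotated]) blast
      then show ?thesis using preim[of "boundary M"] by simp
    qed
  qed
qed

lemma diffeo_homeomorphic_map:
  fixes L :: "('c, 'd::euclidean_space) mfd"
  assumes L: "manifold L" and g: "diffeo L (points L) L (points L) g"
  shows "homeomorphic_map (mtop L) (mtop L) g"
proof -
  have "continuous_map (mtop L) (mtop L) g" "continuous_map (mtop L) (mtop L) (inv_into (points L) g)"
    using smooth_map_continuous[OF L L diffeoD(1)[OF g]] smooth_map_continuous[OF L L diffeoD(2)[OF g]] by simp_all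
  then have "homeomorphic_maps (mtop L) (mtop L) g (inv_into (points L) g)"
    unfolding homeomorphic_maps_def using diffeoD(6,7)[OF g] by simp
  then show ?thesis using homeomorphic_map_maps by blast
qed

locale cut_manifold =
  fixes M :: "('a, 'e::euclidean_space) mfd" and T :: "'a set" and N :: "('b, 'e) mfd" and q :: "'b \<Rightarrow> 'a"
  assumes M: "manifold M" and T: "closedin (mtop M) T" and Tb: "T \<inter> boundary M = {}" and cut: "cut_along M T N q"
begin

lemma N: "manifold N" and compact_N: "compact_space (mtop N)" and q_smooth: "smooth_map N (points N) M q"
  and q_surj: "q ` points N = points M" and q_diffeo: "diffeo N (points N - q -` T) M (points M - T) q"
  and q_card: "x \<in> T \<Longrightarrow> card {y \<in> points N. q y = x} = 2"
  and q_boundary: "points N \<inter> q -` T \<subseteq> boundary N"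
  using cut by (auto simp: cut_along_def)

lemma q_local: "y \<in> points N \<Longrightarrow> \<exists>W. openin (mtop N) W \<and> y \<in> W \<and> diffeo N W M (q ` W) q"
  using cut by (simp add: cut_along_def)

lemma Hausdorff_N: "Hausdorff_space (mtop N)" and Hausdorff_M: "Hausdorff_space (mtop M)"
  using N M by (simp_all add: manifold_def)

lemma T_points: "T \<subseteq> points M" using closedin_subset[OF T] .

lemma q_in: "y \<in> points N \<Longrightarrow> q y \<in> points M"
  using q_surj by blast

lemma q_cont: "continuous_map (mtop N) (mtop M) q"
  using smooth_map_continuous[OF N M q_smooth] by simp

definition N0 where "N0 = points N - q -` T"
definition M0 where "M0 = points M - T"
definition qi where "qi = inv_into N0 q"

lemma N0_iff: "y \<in> N0 \<longleftrightarrow> y \<in> points N \<and> q y \<notin> T"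
  by (simp add: N0_def)

lemma M0_iff: "x \<in> M0 \<longleftrightarrow> x \<in> points M \<and> x \<notin> T"
  by (simp add: M0_def)

lemma q0: "diffeo N N0 M M0 q"
  using q_diffeo by (simp add: N0_def M0_def)

lemma qi_simps: "y \<in> N0 \<Longrightarrow> qi (q y) = y" "x \<in> M0 \<Longrightarrow> q (qi x) = x" "x \<in> M0 \<Longrightarrow> qi x \<in> N0" "y \<in> N0 \<Longrightarrow> q y \<in> M0"
  using diffeoD(6-9)[OF q0] by (simp_all add: qi_def)

lemma qi_smooth: "smooth_map M M0 N qi"
  unfolding qi_def by (rule diffeoD(2)[OF q0])

lemma q0_smooth: "smooth_map N N0 M q" by (rule diffeoD(1)[OF q0])

lemma open_M0: "openin (mtop M) M0"
  unfolding M0_def using T by (simp add: closedin_def)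

lemma open_N0: "openin (mtop N) N0"
proof -
  have "N0 = {y \<in> points N. q y \<in> M0}" using q_in by (auto simp: N0_def M0_def)
  then show ?thesis using openin_continuous_map_preimage[OF q_cont open_M0] by simp
qed

text \<open>Over \<open>T\<close> all points of \<open>N\<close> are boundary points by the
  definition of cutting, and off \<open>T\<close> the map \<open>q\<close> is a diffeomorphism
  between open sets.\<close>

lemma boundary_off_T:
  assumes "y \<in> points N"
  shows "y \<in> boundary N \<longleftrightarrow> q y \<in> T \<or> q y \<in> boundary M"
proof (cases "q y \<in> T")
  case True
  then show ?thesis using q_boundary assms by blast
next
  case False
  then have y: "y \<in> N0" using assms by (simp add: N0_def)
  have "q y \<in> boundary M \<longleftrightarrow> y \<in> boundary N"
    by (rule boundary_smooth_inverse[OF N M q0_smooth open_N0 qi_smooth open_M0 _ _ _ _ y]) (use qi_simps in auto)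
  then show ?thesis using False by simp
qed

lemma closed_q: "closed_map (mtop N) (mtop M) q"
  by (rule T1_Spaces.continuous_imp_closed_map[OF q_cont compact_N Hausdorff_M])

text \<open>For a closed map the preimages of small neighbourhoods shrink to the fibre;
  \<open>q\<close> is closed since \<open>N\<close> is compact and \<open>M\<close> is
  Hausdorff.\<close>

lemma fibre_nbhd:
  assumes "openin (mtop N) V" "x \<in> points M" "{y \<in> points N. q y = x} \<subseteq> V"
  obtains Y where "openin (mtop M) Y" "x \<in> Y" "\<And>y. y \<in> points N \<Longrightarrow> q y \<in> Y \<Longrightarrow> y \<in> V"
proof -
  have "\<exists>Y. openin (mtop M) Y \<and> x \<in> Y \<and> {y \<in> points N. q y \<in> Y} \<subseteq> V"
    using closed_q assms unfolding closed_map_fibre_neighbourhood by blast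
  then show thesis using that by blast
qed

lemma fibre_pair:
  assumes "x \<in> T"
  obtains y1 y2 where "y1 \<noteq> y2" "{y \<in> points N. q y = x} = {y1, y2}" "y1 \<in> points N" "y2 \<in> points N" "q y1 = x" "q y2 = x"
proof -
  obtain y1 y2 where y: "{y \<in> points N. q y = x} = {y1, y2}" "y1 \<noteq> y2" using q_card[OF assms] unfolding card_2_iff by (elim exE conjE)
  have "y1 \<in> {y \<in> points N. q y = x}" "y2 \<in> {y \<in> points N. q y = x}" by (simp_all add: y(1))
  then show thesis using that[OF y(2,1)] by simp
qed

lemma separate_fibre:
  assumes x: "x \<in> T"
  obtains y1 y2 V1 V2 where "y1 \<noteq> y2" "{y \<in> points N. q y = x} = {y1, y2}" "y1 \<in> points N" "y2 \<in> points N" "q y1 = x" "q y2 = x"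
    "openin (mtop N) V1" "openin (mtop N) V2" "y1 \<in> V1" "y2 \<in> V2" "V1 \<inter> V2 = {}"
proof -
  obtain y1 y2 where y: "y1 \<noteq> y2" "{y \<in> points N. q y = x} = {y1, y2}" "y1 \<in> points N" "y2 \<in> points N" "q y1 = x" "q y2 = x"
    using fibre_pair[OF x] .
  obtain V1 V2 where "openin (mtop N) V1" "openin (mtop N) V2" "y1 \<in> V1" "y2 \<in> V2" "disjnt V1 V2"
    using Hausdorff_N y(1,3,4) unfolding Hausdorff_space_def by metis
  then show thesis using that[OF y, of V1 V2] by (simp add: disjnt_def)
qed

section \<open>Lifting diffeomorphisms to the cut manifold\<close>

lemma dense_N0: "points N \<subseteq> Abstract_Topology.closure_of (mtop N) N0"
proof
  fix y assume y: "y \<in> points N"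
  show "y \<in> Abstract_Topology.closure_of (mtop N) N0"
    unfolding in_closure_of
  proof (intro conjI allI impI)
    fix V assume V: "y \<in> V \<and> openin (mtop N) V"
    then obtain W where W: "openin (mtop N) W" "W \<subseteq> V" "\<And>B. B \<subseteq> boundary N \<Longrightarrow> connectedin (mtop N) (W - B) \<and> W - B \<noteq> {}"
      using chart_half_ball[OF N, of V y] by metis
    then obtain z where "z \<in> W - (points N \<inter> q -` T)" using q_boundary by blast
    then show "\<exists>z. z \<in> N0 \<and> z \<in> V" using W(2) openin_subset[OF W(1)] by (intro exI[of _ z]) (auto simp: N0_def)
  qed (rule y)
qed

lemma eq_on_dense:
  assumes "Hausdorff_space Y" "continuous_map (mtop N) Y g" "continuous_map (mtop N) Y h" "\<And>y. y \<in> N0 \<Longrightarrow> g y = h y" "y \<in> points N"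
  shows "g y = h y"
  by (rule forall_in_closure_of_eq[OF _ assms(1-4)]) (use dense_N0 assms(5) in auto)

lemma punctured_half_ball:
  assumes "openin (mtop N) V" "y \<in> V"
  obtains W where "openin (mtop N) W" "y \<in> W" "W \<subseteq> V" "connectedin (mtop N) (W \<inter> N0)" "W \<inter> N0 \<noteq> {}" "connectedin (mtop N) W"
proof -
  obtain W where W: "openin (mtop N) W" "y \<in> W" "W \<subseteq> V" and *: "\<And>B. B \<subseteq> boundary N \<Longrightarrow> connectedin (mtop N) (W - B) \<and> W - B \<noteq> {}"
    using chart_half_ball[OF N assms] by metis
  have "W - (points N \<inter> q -` T) = W \<inter> N0" using openin_subset[OF W(1)] by (auto simp: N0_def)
  then show thesis using that[OF W] *[OF q_boundary] *[of "{}"] by simp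
qed

text \<open>Near a point over \<open>T\<close> the set \<open>N0\<close> is connected, hence its image under \<open>f\<close> stays on one side of \<open>T\<close>.\<close>

lemma lift_exists:
  assumes f: "f \<in> Diff M" and fT: "f ` T = T"
  obtains g where "continuous_map (mtop N) (mtop N) g" "\<And>y. y \<in> points N \<Longrightarrow> q (g y) = f (q y)"
proof -
  have fM0: "f x \<in> M0" if "x \<in> M0" for x
  proof -
    have px: "x \<in> points M" "x \<notin> T" using that by (simp_all add: M0_iff)
    have "f x \<notin> T"
    proof
      assume "f x \<in> T"
      then obtain y where y: "y \<in> T" "f x = f y" using fT by blast
      then have "x = y" using Dinv_simps(1)[OF f] px T_points by (metis subsetD)
      then show False using px y by simp
    qed
    then show ?thesis using Diff_in[OF f px(1)] by (simp add: M0_iff)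
  qed
  define g0 where "g0 y = qi (f (q y))" for y
  have g0: "g0 y \<in> N0" "q (g0 y) = f (q y)" if "y \<in> N0" for y
    using qi_simps fM0 that by (simp_all add: g0_def)
  have "smooth_map N N0 M (\<lambda>y. f (q y))"
    by (rule smooth_map_compose[OF N M M q0_smooth smooth_map_subset[OF Diff_smooth[OF f], of M0]]) (use qi_simps in \<open>auto simp: M0_iff\<close>)
  then have "smooth_map N N0 N g0" unfolding g0_def
    by (rule smooth_map_compose[OF N M N _ qi_smooth]) (use qi_simps fM0 in auto)
  then have cont: "continuous_map (subtopology (mtop N) N0) (mtop N) g0" by (rule smooth_map_continuous[OF N N])
  have fq: "continuous_map (mtop N) (mtop M) (\<lambda>y. f (q y))"
    using continuous_map_compose[OF q_cont homeomorphic_imp_continuous_map[OF Diff_homeomorphic[OF M f]]] by (simp add: o_def)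
  \<comment> \<open>Near \<open>t\<close> the values of \<open>g0\<close> are close to the two
    points over \<open>f (q t)\<close>. On a connected punctured half-ball they stay close to one of
    them, and shrinking its neighbourhood gives the limit.\<close>
  have lim: "\<exists>l. limitin (mtop N) g0 l (atin_within (mtop N) t N0)" if t: "t \<in> points N - N0" for t
  proof -
    have tT: "f (q t) \<in> T" using t fT by (auto simp: N0_def)
    obtain y1 y2 V1 V2 where y: "y1 \<noteq> y2" "{y \<in> points N. q y = f (q t)} = {y1, y2}" "y1 \<in> points N" "y2 \<in> points N"
        "q y1 = f (q t)" "q y2 = f (q t)"
      and V: "openin (mtop N) V1" "openin (mtop N) V2" "y1 \<in> V1" "y2 \<in> V2" "V1 \<inter> V2 = {}"
      using separate_fibre[OF tT] .
    have near: "\<exists>W. openin (mtop N) W \<and> t \<in> W \<and> (\<forall>z\<in>W \<inter> N0. g0 z \<in> A)"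
      if A: "openin (mtop N) A" "y1 \<in> A" "y2 \<in> A" for A
    proof -
      have "{y \<in> points N. q y = f (q t)} \<subseteq> A" unfolding y(2) using A by simp
      then obtain Y where Y: "openin (mtop M) Y" "f (q t) \<in> Y" "\<And>y. y \<in> points N \<Longrightarrow> q y \<in> Y \<Longrightarrow> y \<in> A"
        using fibre_nbhd[OF A(1)] tT T_points by blast
      let ?W = "{z \<in> points N. f (q z) \<in> Y}"
      have "openin (mtop N) ?W" using openin_continuous_map_preimage[OF fq Y(1)] .
      moreover have "g0 z \<in> A" if "z \<in> ?W \<inter> N0" for z using Y(3)[of "g0 z"] g0[of z] that by (auto simp: N0_iff)
      ultimately show ?thesis using Y(2) t by blast
    qed
    obtain W where W: "openin (mtop N) W" "t \<in> W" "\<forall>z\<in>W \<inter> N0. g0 z \<in> V1 \<union> V2"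
      using near[of "V1 \<union> V2"] V by (auto intro: openin_Un)
    obtain W' where W': "openin (mtop N) W'" "t \<in> W'" "W' \<subseteq> W" "connectedin (mtop N) (W' \<inter> N0)"
      using punctured_half_ball[OF W(1,2)] by metis
    have "connectedin (subtopology (mtop N) N0) (W' \<inter> N0)" using W'(4) by (simp add: connectedin_subtopology)
    then have conn: "connectedin (mtop N) (g0 ` (W' \<inter> N0))" by (rule connectedin_continuous_map_image[OF cont])
    have sub: "g0 ` (W' \<inter> N0) \<subseteq> V1 \<union> V2" using W(3) W'(3) by blast
    have one: "\<exists>l. limitin (mtop N) g0 l (atin_within (mtop N) t N0)"
      if ab: "a \<in> points N" "b \<in> points N" "{a, b} = {y1, y2}" "openin (mtop N) Va" "openin (mtop N) Vb" "a \<in> Va" "b \<in> Vb" "Va \<inter> Vb = {}"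
        and gV: "g0 ` (W' \<inter> N0) \<subseteq> Va" for a b Va Vb
    proof (intro exI[of _ a])
      show "limitin (mtop N) g0 a (atin_within (mtop N) t N0)"
        unfolding limitin_def
      proof (intro conjI allI impI ab(1))
        fix U assume U: "openin (mtop N) U \<and> a \<in> U"
        \<comment> \<open>\<open>Vb\<close> is kept at full size so that the union still contains
          the whole fibre, as \<open>near\<close> requires; the values in \<open>Vb\<close> are then
          excluded by \<open>gV\<close>.\<close>
        have "openin (mtop N) ((Va \<inter> U) \<union> Vb)" using U ab by (intro openin_Un openin_Int) auto
        moreover have "y1 \<in> (Va \<inter> U) \<union> Vb" "y2 \<in> (Va \<inter> U) \<union> Vb" using ab(3,6,7) U by (auto simp: doubleton_eq_iff)
        ultimately obtain R where R: "openin (mtop N) R" "t \<in> R" "\<forall>z\<in>R \<inter> N0. g0 z \<in> (Va \<inter> U) \<union> Vb" using near by blast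
        have "g0 z \<in> U" if "z \<in> R \<inter> W'" "z \<in> N0" for z
        proof -
          have "g0 z \<in> (Va \<inter> U) \<union> Vb" "g0 z \<in> Va" using R(3) gV that by auto
          then show ?thesis using ab(8) by blast
        qed
        then show "\<forall>\<^sub>F z in atin_within (mtop N) t N0. g0 z \<in> U"
          unfolding eventually_atin_within using R(1,2) W'(1,2) by (intro disjI2 exI[of _ "R \<inter> W'"]) auto
      qed
    qed
    show ?thesis
    proof (cases "g0 ` (W' \<inter> N0) \<subseteq> V1")
      case True
      show ?thesis by (rule one[OF y(3,4) refl V(1-5) True])
    next
      case False
      then obtain z where z: "z \<in> g0 ` (W' \<inter> N0)" "z \<in> V2" using sub by blast
      have "g0 ` (W' \<inter> N0) \<subseteq> V2"
        by (rule connectedin_subset_open[OF conn V(2,1) _ _ z]) (use sub V(5) in auto)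
      then show ?thesis using one[OF y(4,3) _ V(2,1,4,3)] V(5) by (simp add: insert_commute Int_commute)
    qed
  qed
  have "N0 \<subseteq> points N" by (auto simp: N0_def)
  \<comment> \<open>In a regular space, limits at each missing point yield a continuous extension
    from a dense subset.\<close>
  from continuous_map_extension_pointwise_alt[OF compact_Hausdorff_imp_regular_space[OF compact_N Hausdorff_N] this dense_N0 cont lim]
  obtain g where "continuous_map (subtopology (mtop N) (points N)) (mtop N) g" and gg: "\<And>y. y \<in> N0 \<Longrightarrow> g y = g0 y" by metis
  then have g: "continuous_map (mtop N) (mtop N) g" by simp
  have qg: "continuous_map (mtop N) (mtop M) (\<lambda>y. q (g y))" using continuous_map_compose[OF g q_cont] by (simp add: o_def)
  have "q (g y) = f (q y)" if "y \<in> points N" for y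
    by (rule eq_on_dense[OF Hausdorff_M qg fq _ that]) (use gg g0 in simp)
  with g show thesis using that by blast
qed

text \<open>Locally \<open>g\<close> is \<open>q\<close> followed by \<open>f\<close> and a local
  inverse of \<open>q\<close>; continuity of \<open>g\<close> determines which sheet the inverse has
  to use.\<close>

lemma lift_smooth:
  assumes f: "f \<in> Diff M" and g: "continuous_map (mtop N) (mtop N) g" and qg: "\<And>y. y \<in> points N \<Longrightarrow> q (g y) = f (q y)"
  shows "smooth_map N (points N) N g"
proof (rule smooth_map_local)
  fix y assume y: "y \<in> points N"
  have gy: "g y \<in> points N" using continuous_map_image_subset_topspace[OF g] y by blast
  obtain W where W: "openin (mtop N) W" "g y \<in> W" "diffeo N W M (q ` W) q" using q_local[OF gy] by blast
  let ?V = "{z \<in> points N. g z \<in> W}"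
  have oV: "openin (mtop N) ?V" by (rule openin_continuous_map_preimage[OF g W(1)])
  have "smooth_map N ?V M (\<lambda>z. f (q z))"
    by (rule smooth_map_compose[OF N M M smooth_map_subset[OF q_smooth] Diff_smooth[OF f]]) (use q_in in auto)
  then have "smooth_map N ?V N (\<lambda>z. inv_into W q (f (q z)))"
  proof (rule smooth_map_compose[OF N M N _ diffeoD(2)[OF W(3)]])
    show "(\<lambda>z. f (q z)) ` ?V \<subseteq> q ` W"
    proof
      fix x assume "x \<in> (\<lambda>z. f (q z)) ` ?V"
      then obtain z where "z \<in> points N" "g z \<in> W" "x = f (q z)" by blast
      then show "x \<in> q ` W" using qg[of z] by (intro image_eqI[of _ _ "g z"]) auto
    qed
  qed
  then have "smooth_map N ?V N g"
    by (rule smooth_map_cong_imp[OF N]) (use qg diffeoD(6)[OF W(3)] in \<open>auto simp flip: qg\<close>)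
  moreover have "points N \<inter> ?V = ?V" by blast
  ultimately show "\<exists>V. openin (mtop N) V \<and> y \<in> V \<and> smooth_map N (points N \<inter> V) N g"
    using oV W(2) y by (intro exI[of _ ?V]) simp
qed

text \<open>The lifts of \<open>f\<close> and of its inverse are mutually inverse over the
  complement of \<open>T\<close>, where \<open>q\<close> is injective, and hence everywhere by
  density.\<close>

lemma lift_diffeo:
  assumes f: "f \<in> Diff M" and fT: "f ` T = T"
  obtains g where "diffeo N (points N) N (points N) g" "\<And>y. y \<in> points N \<Longrightarrow> q (g y) = f (q y)"
proof -
  note fi = Dinv_Diff[OF M f]
  have fiT: "Dinv M f ` T = T" using Dinv_image(1)[OF f T_points] fT by simp
  obtain g where g: "continuous_map (mtop N) (mtop N) g" "\<And>y. y \<in> points N \<Longrightarrow> q (g y) = f (q y)"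
    using lift_exists[OF f fT] by blast
  obtain h where h: "continuous_map (mtop N) (mtop N) h" "\<And>y. y \<in> points N \<Longrightarrow> q (h y) = Dinv M f (q y)"
    using lift_exists[OF fi fiT] by blast
  have gN: "g y \<in> points N" and hN: "h y \<in> points N" if "y \<in> points N" for y
    using continuous_map_image_subset_topspace[OF g(1)] continuous_map_image_subset_topspace[OF h(1)] that by blast+
  have id: "continuous_map (mtop N) (mtop N) (\<lambda>y. y)" using continuous_map_id[of "mtop N"] by (simp add: id_def)
  have hg: "h (g y) = y" if "y \<in> points N" for y
  proof (rule eq_on_dense[OF Hausdorff_N _ id _ that])
    show "continuous_map (mtop N) (mtop N) (\<lambda>y. h (g y))" using continuous_map_compose[OF g(1) h(1)] by (simp add: o_def)
    fix z assume z: "z \<in> N0"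
    then have zN: "z \<in> points N" by (simp add: N0_iff)
    have e: "q (h (g z)) = q z" using h(2)[OF gN[OF zN]] g(2)[OF zN] Dinv_simps(1)[OF f q_in[OF zN]] by simp
    have "h (g z) \<in> N0" using z hN[OF gN[OF zN]] e by (simp add: N0_iff)
    then show "h (g z) = z" using qi_simps(1) z e by metis
  qed
  have gh: "g (h y) = y" if "y \<in> points N" for y
  proof (rule eq_on_dense[OF Hausdorff_N _ id _ that])
    show "continuous_map (mtop N) (mtop N) (\<lambda>y. g (h y))" using continuous_map_compose[OF h(1) g(1)] by (simp add: o_def)
    fix z assume z: "z \<in> N0"
    then have zN: "z \<in> points N" by (simp add: N0_iff)
    have e: "q (g (h z)) = q z" using g(2)[OF hN[OF zN]] h(2)[OF zN] Dinv_simps(2)[OF f q_in[OF zN]] by simp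
    have "g (h z) \<in> N0" using z gN[OF hN[OF zN]] e by (simp add: N0_iff)
    then show "g (h z) = z" using qi_simps(1) z e by metis
  qed
  have "diffeo N (points N) N (points N) g"
    by (rule diffeoI[OF N N lift_smooth[OF f g] lift_smooth[OF fi h] gN hN hg gh])
  then show thesis using that g(2) by blast
qed

section \<open>Components and boundary components of the cut manifold\<close>

lemma component_meets_N0:
  assumes "C \<in> components_mfd N"
  obtains y where "y \<in> C" "y \<in> N0"
proof -
  obtain z where z: "z \<in> C" using nonempty_connected_components_of[OF assms] by blast
  then have "z \<in> points N" using connected_components_of_subset[OF assms] by blast
  then obtain W where W: "z \<in> W" "W \<inter> N0 \<noteq> {}" "connectedin (mtop N) W"
    using punctured_half_ball[OF openin_topspace] by metis
  have "W \<subseteq> C" by (rule connected_components_of_maximal[OF assms W(3)]) (use z W(1) in \<open>auto simp: disjnt_def\<close>)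
  then show thesis using that W(2) by blast
qed

text \<open>Points of \<open>N0\<close> are determined by their images, and every component contains
  one. So the pieces in \<open>M\<close> identify the components of \<open>N\<close>, although
  adjacent pieces meet along tori.\<close>

lemma component_image_inj:
  assumes C: "C \<in> components_mfd N" "C' \<in> components_mfd N" and eq: "q ` C = q ` C'"
  shows "C = C'"
proof -
  obtain y where y: "y \<in> C" "y \<in> N0" using component_meets_N0[OF C(1)] .
  have "q y \<in> q ` C'" using y(1) unfolding eq[symmetric] by blast
  then obtain y' where y': "y' \<in> C'" "q y = q y'" by blast
  have "y' \<in> points N" using connected_components_of_subset[OF C(2)] y' by blast
  then have "y' \<in> N0" using y y' by (simp add: N0_iff)
  then have "y = y'" using qi_simps(1) y(2) y'(2) by metis
  then have "C \<inter> C' \<noteq> {}" using y y' by blast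
  then show ?thesis using connected_components_of_overlap[OF C] by simp
qed

lemma lift_component:
  assumes g: "diffeo N (points N) N (points N) g" and qg: "\<And>y. y \<in> points N \<Longrightarrow> q (g y) = f (q y)" and C: "C \<in> components_mfd N"
  shows "g ` C \<in> components_mfd N" "q ` g ` C = f ` q ` C"
proof -
  note hom = diffeo_homeomorphic_map[OF N g]
  show "g ` C \<in> components_mfd N" using homeomorphic_map_connected_components_of[OF hom] C by blast
  have "(\<lambda>y. q (g y)) ` C = (\<lambda>y. f (q y)) ` C"
    by (rule image_cong) (use qg connected_components_of_subset[OF C] in auto)
  then show "q ` g ` C = f ` q ` C" by (simp add: image_image)
qed

lemma Diff_boundary_components:
  fixes L :: "('c, 'd::euclidean_space) mfd"
  assumes L: "manifold L" and g: "diffeo L (points L) L (points L) g" and S: "S \<in> boundary_components L"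
  shows "g ` S \<in> boundary_components L"
proof -
  let ?h = "inv_into (points L) g"
  note hom = diffeo_homeomorphic_map[OF L g]
  have b: "g x \<in> boundary L \<longleftrightarrow> x \<in> boundary L" if "x \<in> points L" for x
    by (rule boundary_smooth_inverse[OF L L diffeoD(1)[OF g] openin_topspace diffeoD(2)[OF g] openin_topspace _ _ _ _ that])
      (use diffeoD[OF g] in auto)
  have sub: "boundary L \<subseteq> points L" by (rule boundary_subset[OF L])
  have "g ` (points L \<inter> boundary L) = points L \<inter> boundary L"
  proof
    show "g ` (points L \<inter> boundary L) \<subseteq> points L \<inter> boundary L" using b diffeoD(8)[OF g] by auto
    show "points L \<inter> boundary L \<subseteq> g ` (points L \<inter> boundary L)"
    proof
      fix y assume y: "y \<in> points L \<inter> boundary L"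
      then have "?h y \<in> points L" "g (?h y) = y" using diffeoD(7,9)[OF g] by auto
      then show "y \<in> g ` (points L \<inter> boundary L)" using b[of "?h y"] y by (intro image_eqI[of _ _ "?h y"]) auto
    qed
  qed
  then have "homeomorphic_map (subtopology (mtop L) (boundary L)) (subtopology (mtop L) (boundary L)) g"
    by (rule homeomorphic_map_subtopologies[OF hom])
  from homeomorphic_map_connected_components_of[OF this] S show ?thesis
    unfolding boundary_components_def by blast
qed

lemma boundary_component_props:
  fixes L :: "('c, 'd::euclidean_space) mfd"
  assumes L: "manifold L" and S: "S \<in> boundary_components L"
  shows "S \<subseteq> boundary L" "connectedin (mtop L) S" "closedin (mtop L) S" "S \<noteq> {}"
proof -
  have S': "S \<in> connected_components_of (subtopology (mtop L) (boundary L))" using S by (simp add: boundary_components_def)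
  show "S \<subseteq> boundary L" using connected_components_of_subset[OF S'] by simp
  show "connectedin (mtop L) S" using connectedin_connected_components_of[OF S'] by (simp add: connectedin_subtopology)
  show "closedin (mtop L) S" using closedin_connected_components_of[OF S'] closedin_boundary[OF L] closedin_trans_full by blast
  show "S \<noteq> {}" by (rule nonempty_connected_components_of[OF S'])
qed

lemma boundary_component_maximal:
  fixes L :: "('c, 'd::euclidean_space) mfd"
  assumes S: "S \<in> boundary_components L" and E: "connectedin (mtop L) E" "E \<subseteq> boundary L" "x \<in> S" "x \<in> E"
  shows "E \<subseteq> S"
proof -
  have "connectedin (subtopology (mtop L) (boundary L)) E" using E by (simp add: connectedin_subtopology)
  moreover have "\<not> disjnt S E" using E by (auto simp: disjnt_def)
  ultimately show ?thesis using connected_components_of_maximal[of S "subtopology (mtop L) (boundary L)" E] S by (simp add: boundary_components_def)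
qed

lemma boundary_component_at:
  fixes L :: "('c, 'd::euclidean_space) mfd"
  assumes "manifold L" "x \<in> boundary L"
  obtains S where "S \<in> boundary_components L" "x \<in> S"
proof -
  have "x \<in> topspace (subtopology (mtop L) (boundary L))" using assms boundary_subset[OF assms(1)] by auto
  then show thesis using component_at that unfolding boundary_components_def by metis
qed

text \<open>Near the other preimage \<open>c\<close> of \<open>q y\<close> the map \<open>q\<close>
  is injective, so of the two preimages of a nearby point of \<open>T\<close> at most one lies
  there; the other must lie in \<open>V\<close>.\<close>

lemma q_onto_near:
  assumes y: "y \<in> points N" "q y \<in> T" and V: "openin (mtop N) V" "y \<in> V"
  obtains Y where "openin (mtop M) Y" "q y \<in> Y" "\<And>x. x \<in> T \<Longrightarrow> x \<in> Y \<Longrightarrow> \<exists>z\<in>V. q z = x"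
proof -
  obtain a b Va Vb where ab: "a \<noteq> b" "{z \<in> points N. q z = q y} = {a, b}" "a \<in> points N" "b \<in> points N" "q a = q y" "q b = q y"
    and Vab: "openin (mtop N) Va" "openin (mtop N) Vb" "a \<in> Va" "b \<in> Vb" "Va \<inter> Vb = {}"
    using separate_fibre[OF y(2)] .
  have "y \<in> {z \<in> points N. q z = q y}" using y by simp
  then have "y = a \<or> y = b" unfolding ab(2) by simp
  then obtain c V1 V2 where c: "{z \<in> points N. q z = q y} = {y, c}" "c \<in> points N"
    "openin (mtop N) V1" "openin (mtop N) V2" "y \<in> V1" "c \<in> V2" "V1 \<inter> V2 = {}"
  proof (elim disjE)
    assume e: "y = a"
    have "{z \<in> points N. q z = q y} = {y, b}" using ab(2) by (simp only: e)
    moreover have "y \<in> Va" using Vab(3) by (simp only: e)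
    ultimately show thesis using that ab(4) Vab(1,2,4,5) by blast
  next
    assume e: "y = b"
    have "{z \<in> points N. q z = q y} = {y, a}" using ab(2) unfolding e by (subst insert_commute)
    moreover have "y \<in> Vb" using Vab(4) by (simp only: e)
    moreover have "Vb \<inter> Va = {}" using Vab(5) by (simp only: Int_commute)
    ultimately show thesis using that ab(3) Vab(1,2,3) by blast
  qed
  obtain W where W: "openin (mtop N) W" "c \<in> W" "diffeo N W M (q ` W) q" using q_local[OF c(2)] by blast
  let ?A = "V \<inter> V1" and ?B = "W \<inter> V2"
  have "openin (mtop N) (?A \<union> ?B)" using V(1) c(3,4) W(1) by (intro openin_Un openin_Int)
  moreover have "{z \<in> points N. q z = q y} \<subseteq> ?A \<union> ?B" unfolding c(1) using V(2) c(5,6) W(2) by blast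
  ultimately obtain Y where Y: "openin (mtop M) Y" "q y \<in> Y" "\<And>z. z \<in> points N \<Longrightarrow> q z \<in> Y \<Longrightarrow> z \<in> ?A \<union> ?B"
    using fibre_nbhd[of "?A \<union> ?B" "q y"] q_in[OF y(1)] by blast
  show thesis
  proof (rule that[OF Y(1,2)])
    fix x assume x: "x \<in> T" "x \<in> Y"
    obtain z1 z2 where z: "z1 \<noteq> z2" "z1 \<in> points N" "z2 \<in> points N" "q z1 = x" "q z2 = x" using fibre_pair[OF x(1)] by metis
    have "z1 \<in> ?A \<union> ?B" "z2 \<in> ?A \<union> ?B" using Y(3) z x by auto
    moreover have "\<not> (z1 \<in> W \<and> z2 \<in> W)" using inj_onD[OF diffeoD(4)[OF W(3)], of z1 z2] z by auto
    ultimately have "z1 \<in> V \<or> z2 \<in> V" by blast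
    then show "\<exists>z\<in>V. q z = x" using z by blast
  qed
qed

text \<open>The image is closed since \<open>q\<close> is a closed map, and open in \<open>S\<close>
  by \<open>q_onto_near\<close>; connectedness of \<open>S\<close> makes it all of
  \<open>S\<close>.\<close>

lemma boundary_component_over_T:
  assumes S: "closedin (mtop M) S" "closedin (mtop M) (T - S)" "connectedin (mtop M) S" "S \<subseteq> T"
    and S': "S' \<in> boundary_components N" "y \<in> S'" "q y \<in> S"
  shows "q ` S' = S"
proof -
  note P = boundary_component_props[OF N S'(1)]
  have bN: "boundary N \<subseteq> points N" by (rule boundary_subset[OF N])
  let ?A = "{y \<in> points N. q y \<in> S}" and ?B = "{y \<in> points N. q y \<in> (T - S) \<union> boundary M}"
  have cA: "closedin (mtop N) ?A" by (rule closedin_continuous_map_preimage[OF q_cont S(1)])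
  have cB: "closedin (mtop N) ?B" by (rule closedin_continuous_map_preimage[OF q_cont closedin_Un[OF S(2) closedin_boundary[OF M]]])
  have "S' \<subseteq> ?A \<union> ?B" using P(1) bN boundary_off_T by blast
  moreover have "?A \<inter> ?B = {}" using S(4) Tb by blast
  moreover have "y \<in> ?A" using S' P(1) bN by blast
  ultimately have S'A: "S' \<subseteq> ?A" using connectedin_subset_closed[OF P(2) cA cB _ _ S'(2)] by blast
  then have sub: "q ` S' \<subseteq> S" by blast
  have cl: "closedin (subtopology (mtop M) S) (q ` S')"
    using closed_q P(3) sub by (simp add: closed_map_def closedin_subset_topspace)
  have op: "openin (subtopology (mtop M) S) (q ` S')"
  proof (subst openin_subopen, intro ballI)
    fix x assume "x \<in> q ` S'"
    then obtain z where z: "z \<in> S'" "x = q z" by blast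
    have zN: "z \<in> points N" "q z \<in> T" using z S'A S(4) by auto
    obtain W where W: "openin (mtop N) W" "z \<in> W" "connectedin (mtop N) (W \<inter> boundary N)"
      using chart_half_ball[OF N openin_topspace zN(1)] by metis
    have "z \<in> boundary N" using z P(1) by blast
    then have WS: "W \<inter> boundary N \<subseteq> S'" using boundary_component_maximal[OF S'(1) W(3) _ z(1)] W(2) by blast
    obtain Y where Y: "openin (mtop M) Y" "q z \<in> Y" "\<And>x. x \<in> T \<Longrightarrow> x \<in> Y \<Longrightarrow> \<exists>z\<in>W. q z = x"
      using q_onto_near[OF zN W(1,2)] by blast
    have "S \<inter> Y \<subseteq> q ` S'"
    proof
      fix x' assume x': "x' \<in> S \<inter> Y"
      then obtain w where w: "w \<in> W" "q w = x'" using Y(3)[of x'] S(4) by blast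
      have "w \<in> points N" using openin_subset[OF W(1)] w by blast
      then have "w \<in> boundary N" using q_boundary w x' S(4) by blast
      then show "x' \<in> q ` S'" using WS w by blast
    qed
    moreover have "openin (subtopology (mtop M) S) (S \<inter> Y)" using Y(1) by (simp add: openin_subtopology_Int2)
    moreover have "x \<in> S \<inter> Y" using Y(2) z sub by blast
    ultimately show "\<exists>U. openin (subtopology (mtop M) S) U \<and> x \<in> U \<and> U \<subseteq> q ` S'" by blast
  qed
  have "connected_space (subtopology (mtop M) S)" using S(3) by (simp add: connectedin_def)
  then have "q ` S' = {} \<or> q ` S' = topspace (subtopology (mtop M) S)" using op cl unfolding connected_space_clopen_in by blast
  moreover have "q ` S' \<noteq> {}" using S'(2) by blast
  moreover have "topspace (subtopology (mtop M) S) = S" using S(1) closedin_subset[OF S(1)] by (simp add: Int_absorb1)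
  ultimately show ?thesis by simp
qed

text \<open>Over \<open>boundary M\<close> the map \<open>q\<close> is invertible. A boundary
  component of \<open>N\<close> cannot pass from there to \<open>T\<close>, as the preimages of the
  two are disjoint and closed.\<close>

lemma boundary_component_lift:
  assumes B: "B \<in> boundary_components M"
  obtains S' where "S' \<in> boundary_components N" "q ` S' = B"
proof -
  note P = boundary_component_props[OF M B]
  have bN: "boundary N \<subseteq> points N" by (rule boundary_subset[OF N])
  have BM0: "B \<subseteq> M0" using P(1) Tb boundary_subset[OF M] by (auto simp: M0_def)
  have "connectedin (subtopology (mtop M) M0) B" using P(2) BM0 by (simp add: connectedin_subtopology)
  then have E: "connectedin (mtop N) (qi ` B)" by (rule connectedin_continuous_map_image[OF smooth_map_continuous[OF M N qi_smooth]])
  have Eb: "qi ` B \<subseteq> boundary N"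
  proof
    fix y assume "y \<in> qi ` B"
    then obtain x where x: "x \<in> B" "y = qi x" by blast
    then have "q y = x" "y \<in> points N" using qi_simps BM0 by (auto simp: N0_iff)
    then show "y \<in> boundary N" using boundary_off_T[of y] x P(1) by auto
  qed
  obtain x where x: "x \<in> B" using P(4) by blast
  obtain S' where S': "S' \<in> boundary_components N" "qi x \<in> S'" using boundary_component_at[OF N, of "qi x"] Eb x by blast
  note P' = boundary_component_props[OF N S'(1)]
  have ES: "qi ` B \<subseteq> S'" using boundary_component_maximal[OF S'(1) E Eb S'(2)] x by blast
  let ?A = "{y \<in> points N. q y \<in> boundary M}" and ?B = "{y \<in> points N. q y \<in> T}"
  have cA: "closedin (mtop N) ?A" by (rule closedin_continuous_map_preimage[OF q_cont closedin_boundary[OF M]])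
  have cB: "closedin (mtop N) ?B" by (rule closedin_continuous_map_preimage[OF q_cont T])
  have "S' \<subseteq> ?A \<union> ?B" using P'(1) bN boundary_off_T by blast
  moreover have "?A \<inter> ?B = {}" using Tb by blast
  moreover have "qi x \<in> ?A"
  proof -
    have "x \<in> M0" "x \<in> boundary M" using x BM0 P(1) by blast+
    then show ?thesis using qi_simps(2,3)[of x] by (simp add: N0_iff)
  qed
  ultimately have S'A: "S' \<subseteq> ?A" using connectedin_subset_closed[OF P'(2) cA cB _ _ S'(2)] by blast
  have "connectedin (mtop M) (q ` S')" by (rule connectedin_continuous_map_image[OF q_cont P'(2)])
  moreover have "q ` S' \<subseteq> boundary M" using S'A by blast
  moreover have "x \<in> q ` S'" using S'(2) qi_simps(2) BM0 x by (metis image_eqI subsetD)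
  ultimately have "q ` S' \<subseteq> B" using boundary_component_maximal[OF B _ _ x] by blast
  moreover have "B \<subseteq> q ` S'"
  proof
    fix z assume z: "z \<in> B"
    then have "qi z \<in> S'" "q (qi z) = z" using ES qi_simps(2) BM0 by auto
    then show "z \<in> q ` S'" by (metis imageI)
  qed
  ultimately show thesis using that S'(1) by blast
qed

end

section \<open>Normal orientations under diffeomorphisms\<close>

lemma pushI:
  "(x, c, v) \<in> P \<Longrightarrow> c' \<in> charts M \<Longrightarrow> f x \<in> fst c' \<Longrightarrow> (f x, c', loc_deriv c c' f x v) \<in> push M f P"
  unfolding push_def by blast

lemma pushE:
  assumes "t \<in> push M f P"
  obtains x c v c' where "t = (f x, c', loc_deriv c c' f x v)" "(x, c, v) \<in> P" "c' \<in> charts M" "f x \<in> fst c'"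
  using assms unfolding push_def by blast

definition tvecs :: "('a, 'e::euclidean_space) mfd \<Rightarrow> 'a set \<Rightarrow> ('a, 'e) tangent set" where
  "tvecs M S = {(x, c, v). x \<in> S \<and> c \<in> charts M \<and> x \<in> fst c}"

lemma tvecsD:
  assumes "P \<subseteq> tvecs M S" "(x, c, v) \<in> P"
  shows "x \<in> S" "c \<in> charts M" "x \<in> fst c"
  using assms by (auto simp: tvecs_def)

lemma normal_orientation_tvecs: "normal_orientation M S P \<Longrightarrow> P \<subseteq> tvecs M S"
  by (simp add: normal_orientation_def tvecs_def)

lemma normal_orientation_push: "normal_orientation M S P \<Longrightarrow> push M (\<lambda>x. x) P \<subseteq> P"
  by (simp add: normal_orientation_def)

lemma normal_orientation_chart_change:
  assumes "normal_orientation M S P" "(x, c, v) \<in> P" "c' \<in> charts M" "x \<in> fst c'"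
  shows "(x, c', loc_deriv c c' (\<lambda>x. x) x v) \<in> P"
  using normal_orientation_push[OF assms(1)] pushI[OF assms(2,3), of "\<lambda>x. x"] assms(4) by blast

lemma normal_orientationE:
  assumes "normal_orientation M S P" "x \<in> S" "c \<in> charts M" "x \<in> fst c"
  obtains W n where "openin (mtop M) W" "x \<in> W" "W \<subseteq> fst c" "continuous_map (subtopology (mtop M) (S \<inter> W)) euclidean n"
    "\<forall>y\<in>S \<inter> W. n y \<notin> tangent_coords S c y"
    "\<forall>y\<in>S \<inter> W. {v. (y, c, v) \<in> P} = {t + a *\<^sub>R n y | t a. t \<in> tangent_coords S c y \<and> 0 < a}"
proof -
  have "\<forall>c\<in>charts M. \<forall>x\<in>S \<inter> fst c. \<exists>W n. openin (mtop M) W \<and> x \<in> W \<and> W \<subseteq> fst c \<and>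
        continuous_map (subtopology (mtop M) (S \<inter> W)) euclidean n \<and>
        (\<forall>y\<in>S \<inter> W. n y \<notin> tangent_coords S c y \<and>
           {v. (y, c, v) \<in> P} = {t + a *\<^sub>R n y | t a. t \<in> tangent_coords S c y \<and> 0 < a})"
    using assms(1) unfolding normal_orientation_def by (elim conjE)
  from bspec[OF bspec[OF this assms(3)], of x] assms(2,4)
  obtain W n where W: "openin (mtop M) W" "x \<in> W" "W \<subseteq> fst c" "continuous_map (subtopology (mtop M) (S \<inter> W)) euclidean n"
    and n: "\<forall>y\<in>S \<inter> W. n y \<notin> tangent_coords S c y \<and>
           {v. (y, c, v) \<in> P} = {t + a *\<^sub>R n y | t a. t \<in> tangent_coords S c y \<and> 0 < a}" by auto
  show thesis
    by (rule that[OF W]) (rule ballI, drule bspec[OF n], elim conjE, assumption)+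
qed

text \<open>\<open>push\<close> uses all charts around the image point, so an intermediate chart can
  be inserted or removed in the chain rule.\<close>

lemma push_compose:
  assumes M: "manifold M" and f: "f \<in> Diff M" and g: "g \<in> Diff M" and P: "P \<subseteq> tvecs M S"
  shows "push M (compose (points M) f g) P = push M f (push M g P)"
proof
  show "push M (compose (points M) f g) P \<subseteq> push M f (push M g P)"
  proof
    fix t assume "t \<in> push M (compose (points M) f g) P"
    then obtain x c v c' where t: "t = (compose (points M) f g x, c', loc_deriv c c' (compose (points M) f g) x v)"
      "(x, c, v) \<in> P" "c' \<in> charts M" "compose (points M) f g x \<in> fst c'" by (rule pushE)
    note xc = tvecsD[OF P t(2)]
    have px: "x \<in> points M" using chart_points[OF M xc(2)] xc(3) by blast
    then have fg: "compose (points M) f g x = f (g x)" by (simp add: compose_def)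
    obtain c1 where c1: "c1 \<in> charts M" "g x \<in> fst c1" using point_chart[OF M Diff_in[OF g px]] .
    have "loc_deriv c c' (compose (points M) f g) x v = loc_deriv c1 c' f (g x) (loc_deriv c c1 g x v)"
      using loc_deriv_Diff_compose[OF M f g xc(2) c1(1) t(3) xc(3) c1(2)] t(4) fg by simp
    moreover have "(f (g x), c', loc_deriv c1 c' f (g x) (loc_deriv c c1 g x v)) \<in> push M f (push M g P)"
      by (intro pushI t(2,3) c1) (use t(4) fg in simp)
    ultimately show "t \<in> push M f (push M g P)" using t(1) fg by simp
  qed
  show "push M f (push M g P) \<subseteq> push M (compose (points M) f g) P"
  proof
    fix t assume "t \<in> push M f (push M g P)"
    then obtain y c1 w c' where t: "t = (f y, c', loc_deriv c1 c' f y w)" "(y, c1, w) \<in> push M g P" "c' \<in> charts M" "f y \<in> fst c'"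
      by (rule pushE)
    from t(2) obtain x c v c2 where s: "(y, c1, w) = (g x, c2, loc_deriv c c2 g x v)" "(x, c, v) \<in> P" "c2 \<in> charts M" "g x \<in> fst c2"
      by (rule pushE)
    have s': "y = g x" "c1 = c2" "w = loc_deriv c c2 g x v" using s(1) by simp_all
    note xc = tvecsD[OF P s(2)]
    have px: "x \<in> points M" using chart_points[OF M xc(2)] xc(3) by blast
    then have fg: "compose (points M) f g x = f (g x)" by (simp add: compose_def)
    have "loc_deriv c c' (compose (points M) f g) x v = loc_deriv c2 c' f (g x) (loc_deriv c c2 g x v)"
      using loc_deriv_Diff_compose[OF M f g xc(2) s(3) t(3) xc(3) s(4)] t(4) s' by simp
    then have "t = (compose (points M) f g x, c', loc_deriv c c' (compose (points M) f g) x v)" using t(1) s' fg by simp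
    then show "t \<in> push M (compose (points M) f g) P" using pushI[OF s(2) t(3), of "compose (points M) f g"] t(4) s' fg by simp
  qed
qed

lemma push_restrict_ident:
  assumes M: "manifold M" and P: "normal_orientation M S P"
  shows "push M (\<lambda>x\<in>points M. x) P = P"
proof
  note PM = normal_orientation_tvecs[OF P]
  show "push M (\<lambda>x\<in>points M. x) P \<subseteq> P"
  proof
    fix t assume "t \<in> push M (\<lambda>x\<in>points M. x) P"
    then obtain x c v c' where t: "t = ((\<lambda>x\<in>points M. x) x, c', loc_deriv c c' (\<lambda>x\<in>points M. x) x v)" "(x, c, v) \<in> P" "c' \<in> charts M"
      "(\<lambda>x\<in>points M. x) x \<in> fst c'" by (rule pushE)
    note xc = tvecsD[OF PM t(2)]
    have px: "x \<in> points M" using chart_points[OF M xc(2)] xc(3) by blast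
    then have x': "x \<in> fst c'" using t(4) by simp
    show "t \<in> P" using normal_orientation_chart_change[OF P t(2,3) x'] loc_deriv_Diff_ident[OF M xc(2) t(3) xc(3) x'] t(1) px by simp
  qed
  show "P \<subseteq> push M (\<lambda>x\<in>points M. x) P"
  proof
    fix t assume t: "t \<in> P"
    obtain x c v where tt: "t = (x, c, v)" by (cases t)
    note xc = tvecsD[OF PM t[unfolded tt]]
    have px: "x \<in> points M" using chart_points[OF M xc(2)] xc(3) by blast
    have "((\<lambda>x\<in>points M. x) x, c, loc_deriv c c (\<lambda>x\<in>points M. x) x v) \<in> push M (\<lambda>x\<in>points M. x) P"
      by (rule pushI) (use t tt xc px in auto)
    then show "t \<in> push M (\<lambda>x\<in>points M. x) P"
      using loc_deriv_Diff_ident[OF M xc(2,2,3,3)] loc_deriv_ident[OF M xc(2,3)] px tt by simp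
  qed
qed

text \<open>The differential maps the tangent vectors of \<open>S\<close> onto those of the image
  surface, so it carries a local normal field with its open half-spaces to another one.\<close>

lemma push_normal_orientation:
  assumes M: "manifold M" and f: "f \<in> Diff M" and S: "S \<subseteq> points M" and P: "normal_orientation M S P"
  shows "normal_orientation M (f ` S) (push M f P)"
  unfolding normal_orientation_def
proof (intro conjI ballI)
  note PM = normal_orientation_tvecs[OF P] and g = Dinv_Diff[OF M f]
  show "push M f P \<subseteq> {(x, c, v). x \<in> f ` S \<and> c \<in> charts M \<and> x \<in> fst c}"
  proof
    fix t assume "t \<in> push M f P"
    then obtain x c v c' where t: "t = (f x, c', loc_deriv c c' f x v)" "(x, c, v) \<in> P" "c' \<in> charts M" "f x \<in> fst c'" by (rule pushE)
    then show "t \<in> {(x, c, v). x \<in> f ` S \<and> c \<in> charts M \<and> x \<in> fst c}" using tvecsD[OF PM t(2)] by simp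
  qed
  have idD: "(\<lambda>x\<in>points M. x) \<in> Diff M" by (rule Diff_ident[OF M])
  show "push M (\<lambda>x. x) (push M f P) \<subseteq> push M f P"
  proof
    fix t assume "t \<in> push M (\<lambda>x. x) (push M f P)"
    then obtain y c1 w c' where t: "t = (y, c', loc_deriv c1 c' (\<lambda>x. x) y w)" "(y, c1, w) \<in> push M f P" "c' \<in> charts M" "y \<in> fst c'"
      by (rule pushE)
    from t(2) obtain x c v c2 where s: "(y, c1, w) = (f x, c2, loc_deriv c c2 f x v)" "(x, c, v) \<in> P" "c2 \<in> charts M" "f x \<in> fst c2"
      by (rule pushE)
    have s': "y = f x" "c1 = c2" "w = loc_deriv c c2 f x v" using s(1) by simp_all
    note xc = tvecsD[OF PM s(2)]
    have px: "x \<in> points M" using chart_points[OF M xc(2)] xc(3) by blast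
    have e: "compose (points M) (\<lambda>x\<in>points M. x) f = f"
      using Diff_in[OF f] Diff_extensional[OF f] by (auto simp: compose_def fun_eq_iff extensional_def)
    have "loc_deriv c c' f x = (\<lambda>v. loc_deriv c2 c' (\<lambda>x\<in>points M. x) (f x) (loc_deriv c c2 f x v))"
      using loc_deriv_Diff_compose[OF M idD f xc(2) s(3) t(3) xc(3) s(4)] t(4) s' Diff_in[OF f px] unfolding e by simp
    then have "loc_deriv c c' f x v = loc_deriv c2 c' (\<lambda>x. x) (f x) (loc_deriv c c2 f x v)"
      using loc_deriv_Diff_ident[OF M s(3) t(3) s(4)] t(4) s' by simp
    then have "t = (f x, c', loc_deriv c c' f x v)" using t(1) s' by simp
    then show "t \<in> push M f P" using pushI[OF s(2) t(3)] t(4) s' by simp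
  qed
  fix c' x' assume c': "c' \<in> charts M" and x': "x' \<in> f ` S \<inter> fst c'"
  then obtain x where x: "x \<in> S" "x' = f x" "f x \<in> fst c'" by blast
  obtain c where c: "c \<in> charts M" "x \<in> fst c" using point_chart[OF M] x S by blast
  obtain W n where W: "openin (mtop M) W" "x \<in> W" "W \<subseteq> fst c" "continuous_map (subtopology (mtop M) (S \<inter> W)) euclidean n"
    and n': "\<forall>y\<in>S \<inter> W. n y \<notin> tangent_coords S c y"
      "\<forall>y\<in>S \<inter> W. {v. (y, c, v) \<in> P} = {t + a *\<^sub>R n y | t a. t \<in> tangent_coords S c y \<and> 0 < a}"
    using normal_orientationE[OF P x(1) c] .
  note n = bspec[OF n'(1)] bspec[OF n'(2)]
  let ?g = "Dinv M f"
  let ?W = "{y \<in> points M. ?g y \<in> W} \<inter> fst c'"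
  have gc: "continuous_map (mtop M) (mtop M) ?g" by (rule homeomorphic_imp_continuous_map[OF Diff_homeomorphic[OF M g]])
  \<comment> \<open>The image of the normal field under the differential, expanded in basis vectors
    because continuity of \<open>loc_deriv\<close> is available for fixed directions.\<close>
  define n' where "n' y = (\<Sum>b\<in>Basis. (n (?g y) \<bullet> b) *\<^sub>R loc_deriv c c' f (?g y) b)" for y
  have inW: "?g y \<in> S \<inter> W \<and> f (?g y) = y \<and> ?g y \<in> fst c \<and> y \<in> fst c' \<and> y \<in> points M" if y: "y \<in> f ` S \<inter> ?W" for y
  proof -
    obtain z where z: "z \<in> S" "y = f z" using y by blast
    then have "?g y = z" using Dinv_simps(1)[OF f] S by blast
    then show ?thesis using z y W(3) by auto
  qed
  have n'_eq: "n' y = loc_deriv c c' f (?g y) (n (?g y))" if y: "y \<in> f ` S \<inter> ?W" for y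
  proof -
    have "bounded_linear (loc_deriv c c' f (?g y))"
      by (rule loc_deriv_Diff_linear[OF M f c(1) c']) (use inW[OF y] in auto)
    from linear_Basis_expand[OF this, of "n (?g y)"] show ?thesis by (simp add: n'_def)
  qed
  show "\<exists>W n. openin (mtop M) W \<and> x' \<in> W \<and> W \<subseteq> fst c' \<and> continuous_map (subtopology (mtop M) (f ` S \<inter> W)) euclidean n \<and>
        (\<forall>y\<in>f ` S \<inter> W. n y \<notin> tangent_coords (f ` S) c' y \<and>
           {v. (y, c', v) \<in> push M f P} = {t + a *\<^sub>R n y |t a. t \<in> tangent_coords (f ` S) c' y \<and> 0 < a})"
  proof (intro exI[of _ ?W] exI[of _ n'] conjI ballI)
    show "openin (mtop M) ?W"
      using openin_continuous_map_preimage[OF gc W(1)] chart_openin[OF manifold_chart[OF M c']] by blast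
    have px: "x \<in> points M" using x S by blast
    show "x' \<in> ?W" using Dinv_simps(1)[OF f px] Diff_in[OF f px] W(2) x by simp
    show "?W \<subseteq> fst c'" by blast
    let ?X = "subtopology (mtop M) (f ` S \<inter> ?W)"
    have g1: "continuous_map ?X (mtop M) ?g" by (rule continuous_map_from_subtopology[OF gc])
    have gX: "?g y \<in> S \<inter> W \<and> ?g y \<in> points M \<inter> fst c \<inter> f -` fst c'" if "y \<in> topspace ?X" for y
    proof -
      have "y \<in> f ` S \<inter> ?W" using that by simp
      note i = inW[OF this]
      show ?thesis using i S by auto
    qed
    have gA: "continuous_map ?X (subtopology (mtop M) (S \<inter> W)) ?g"
      unfolding continuous_map_in_subtopology using g1 gX by blast
    have gB: "continuous_map ?X (subtopology (mtop M) (points M \<inter> fst c \<inter> f -` fst c')) ?g"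
      unfolding continuous_map_in_subtopology using g1 gX by blast
    have "continuous_map ?X euclidean (\<lambda>y. n (?g y))"
      using continuous_map_compose[OF gA W(4)] by (simp add: o_def)
    moreover have "continuous_map ?X euclidean (\<lambda>y. loc_deriv c c' f (?g y) b)" for b
      using continuous_map_compose[OF gB loc_deriv_continuous[OF M M Diff_smooth[OF f] openin_topspace c(1) c']] by (simp add: o_def)
    ultimately show "continuous_map ?X euclidean n'"
      unfolding n'_def continuous_map_atin[where Y = euclidean] limitin_canonical_iff
      by (auto intro!: tendsto_intros)
    fix y assume y: "y \<in> f ` S \<inter> ?W"
    let ?z = "?g y"
    have z: "?z \<in> S \<inter> W" "f ?z = y" "?z \<in> fst c" "f ?z \<in> fst c'" using inW[OF y] by auto
    let ?D = "loc_deriv c c' f ?z"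
    have lin: "linear ?D" using loc_deriv_Diff_linear[OF M f c(1) c' z(3,4)] bounded_linear.linear by blast
    have tan: "?D v \<in> tangent_coords (f ` S) c' y \<longleftrightarrow> v \<in> tangent_coords S c ?z" for v
      using curve_coords_Diff[OF M f S UNIV_I c(1) c' z(3,4), of v] z(2) by (simp add: tangent_coords_eq)
    have surj: "\<exists>v. w = ?D v" for w using loc_deriv_Dinv(2)[OF M f c(1) c' z(3,4), of w] by metis
    show "n' y \<notin> tangent_coords (f ` S) c' y" using n'_eq[OF y] tan n(1)[OF z(1)] by simp
    have push: "{v. (y, c', v) \<in> push M f P} = ?D ` {v. (?z, c, v) \<in> P}"
    proof
      show "?D ` {v. (?z, c, v) \<in> P} \<subseteq> {v. (y, c', v) \<in> push M f P}"
        using pushI[of ?z c _ P c' M f] c' z by auto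
      show "{v. (y, c', v) \<in> push M f P} \<subseteq> ?D ` {v. (?z, c, v) \<in> P}"
      proof
        fix w assume "w \<in> {v. (y, c', v) \<in> push M f P}"
        then have "(y, c', w) \<in> push M f P" by simp
        then obtain x1 c1 v1 c2 where s: "(y, c', w) = (f x1, c2, loc_deriv c1 c2 f x1 v1)" "(x1, c1, v1) \<in> P" "c2 \<in> charts M" "f x1 \<in> fst c2"
          by (rule pushE)
        have s': "y = f x1" "c2 = c'" "w = loc_deriv c1 c' f x1 v1" using s(1) by simp_all
        note xc = tvecsD[OF PM s(2)]
        have x1: "x1 = ?z" using s'(1) Dinv_simps(1)[OF f, of x1] xc(1) S by auto
        have px1: "x1 \<in> points M" using xc(1) S by blast
        have "(?z, c, loc_deriv c1 c (\<lambda>x. x) ?z v1) \<in> P"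
          using normal_orientation_chart_change[OF P s(2) c(1)] z(3) x1 by simp
        moreover have "w = ?D (loc_deriv c1 c (\<lambda>x. x) ?z v1)"
        proof -
          have e: "compose (points M) f (\<lambda>x\<in>points M. x) = f"
            using Diff_extensional[OF f] by (auto simp: compose_def fun_eq_iff extensional_def)
          have "loc_deriv c1 c' f x1 = (\<lambda>v. loc_deriv c c' f x1 (loc_deriv c1 c (\<lambda>x\<in>points M. x) x1 v))"
            using loc_deriv_Diff_compose[OF M f idD xc(2) c(1) c' xc(3)] z x1 px1 unfolding e by simp
          then show ?thesis using s'(3) loc_deriv_Diff_ident[OF M xc(2) c(1) xc(3)] z x1 by simp
        qed
        ultimately show "w \<in> ?D ` {v. (?z, c, v) \<in> P}" by blast
      qed
    qed
    show "{v. (y, c', v) \<in> push M f P} = {t + a *\<^sub>R n' y |t a. t \<in> tangent_coords (f ` S) c' y \<and> 0 < a}"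
    proof
      show "{v. (y, c', v) \<in> push M f P} \<subseteq> {t + a *\<^sub>R n' y |t a. t \<in> tangent_coords (f ` S) c' y \<and> 0 < a}"
      proof
        fix w assume "w \<in> {v. (y, c', v) \<in> push M f P}"
        then obtain v where v: "w = ?D v" "v \<in> {v. (?z, c, v) \<in> P}" unfolding push by blast
        then obtain t a where ta: "v = t + a *\<^sub>R n ?z" "t \<in> tangent_coords S c ?z" "0 < a" unfolding n(2)[OF z(1)] by blast
        have "w = ?D t + a *\<^sub>R n' y" using v ta lin n'_eq[OF y] by (simp add: linear_add linear_scale)
        then show "w \<in> {t + a *\<^sub>R n' y |t a. t \<in> tangent_coords (f ` S) c' y \<and> 0 < a}" using ta tan by blast
      qed
      show "{t + a *\<^sub>R n' y |t a. t \<in> tangent_coords (f ` S) c' y \<and> 0 < a} \<subseteq> {v. (y, c', v) \<in> push M f P}"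
      proof
        fix w assume "w \<in> {t + a *\<^sub>R n' y |t a. t \<in> tangent_coords (f ` S) c' y \<and> 0 < a}"
        then obtain s a where sa: "w = s + a *\<^sub>R n' y" "s \<in> tangent_coords (f ` S) c' y" "0 < a" by blast
        obtain t where t: "s = ?D t" using surj by blast
        then have "t \<in> tangent_coords S c ?z" using sa tan by simp
        then have "t + a *\<^sub>R n ?z \<in> {v. (?z, c, v) \<in> P}" unfolding n(2)[OF z(1)] using sa(3) by blast
        moreover have "w = ?D (t + a *\<^sub>R n ?z)" using sa t lin n'_eq[OF y] by (simp add: linear_add linear_scale)
        ultimately show "w \<in> {v. (y, c', v) \<in> push M f P}" unfolding push by blast
      qed
    qed
  qed
qed

section \<open>Conormal fields\<close>

lemma parallel_covectors:
  fixes \<nu> \<nu>' :: "'e::real_inner"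
  assumes "\<nu> \<noteq> 0" "\<nu>' \<noteq> 0" "\<And>v. \<nu> \<bullet> v = 0 \<longleftrightarrow> \<nu>' \<bullet> v = 0"
  obtains l where "l \<noteq> 0" "\<nu>' = l *\<^sub>R \<nu>"
proof -
  \<comment> \<open>Projection coefficient: the remainder \<open>?w\<close> is orthogonal to both
    covectors and hence to itself.\<close>
  define l where "l = (\<nu>' \<bullet> \<nu>) / (\<nu> \<bullet> \<nu>)"
  let ?w = "\<nu>' - l *\<^sub>R \<nu>"
  have "\<nu> \<bullet> ?w = 0" using assms(1) by (simp add: l_def inner_diff_right inner_commute)
  moreover from this have "\<nu>' \<bullet> ?w = 0" using assms(3) by simp
  ultimately have "?w \<bullet> ?w = 0" by (simp add: inner_diff_left)
  then have "\<nu>' = l *\<^sub>R \<nu>" by simp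
  then show thesis using that[of l] assms(2) by auto
qed

text \<open>Two half-spaces with a common bounding hyperplane have parallel covectors, so they
  coincide or are opposite according to the sign of the inner product.\<close>

lemma half_space_covectors:
  fixes \<nu> \<nu>' :: "'e::real_inner"
  assumes "\<nu> \<noteq> 0" "\<nu>' \<noteq> 0" "\<And>v. \<nu> \<bullet> v = 0 \<longleftrightarrow> \<nu>' \<bullet> v = 0"
  shows "\<nu> \<bullet> \<nu>' \<noteq> 0" "0 < \<nu> \<bullet> \<nu>' \<Longrightarrow> 0 < \<nu> \<bullet> v \<longleftrightarrow> 0 < \<nu>' \<bullet> v" "\<nu> \<bullet> \<nu>' < 0 \<Longrightarrow> 0 < \<nu> \<bullet> v \<longleftrightarrow> \<nu>' \<bullet> v < 0"
proof -
  obtain l where l: "l \<noteq> 0" "\<nu>' = l *\<^sub>R \<nu>" using parallel_covectors[OF assms] .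
  have p: "0 < \<nu> \<bullet> \<nu>" using assms(1) by simp
  show "\<nu> \<bullet> \<nu>' \<noteq> 0" using l p by simp
  show "0 < \<nu> \<bullet> \<nu>' \<Longrightarrow> 0 < \<nu> \<bullet> v \<longleftrightarrow> 0 < \<nu>' \<bullet> v" using l p by (simp add: zero_less_mult_iff)
  show "\<nu> \<bullet> \<nu>' < 0 \<Longrightarrow> 0 < \<nu> \<bullet> v \<longleftrightarrow> \<nu>' \<bullet> v < 0" using l p by (auto simp: mult_less_0_iff)
qed

text \<open>The covector \<open>\<nu> x\<close> is written as a vector by means of the inner product in the chart \<open>c\<close>.\<close>

definition conormal :: "('a, 'e::euclidean_space) mfd \<Rightarrow> 'a set \<Rightarrow> ('a, 'e) chart \<Rightarrow> 'a set \<Rightarrow> ('a \<Rightarrow> 'e) \<Rightarrow> bool" where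
  "conormal M S c Y \<nu> \<longleftrightarrow> openin (mtop M) Y \<and> Y \<subseteq> fst c \<and> continuous_map (subtopology (mtop M) (S \<inter> Y)) euclidean \<nu> \<and>
     (\<forall>x\<in>S \<inter> Y. \<nu> x \<noteq> 0 \<and> tangent_coords S c x = {v. \<nu> x \<bullet> v = 0})"

lemma conormal_subset:
  assumes "conormal M S c Y \<nu>" "openin (mtop M) Y'" "Y' \<subseteq> Y"
  shows "conormal M S c Y' \<nu>"
proof -
  have c: "continuous_map (subtopology (mtop M) (S \<inter> Y)) euclidean \<nu>" using assms(1) by (simp add: conormal_def)
  have "continuous_map (subtopology (mtop M) (S \<inter> Y')) euclidean \<nu>"
    by (rule continuous_map_from_subtopology_mono[OF c]) (use assms(3) in blast)
  then show ?thesis using assms unfolding conormal_def by auto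
qed

lemma continuous_inner_positive:
  assumes c: "continuous_map (subtopology X A) euclidean \<nu>" "continuous_map (subtopology X A) euclidean (\<mu> :: _ \<Rightarrow> 'e::euclidean_space)"
    and A: "A \<subseteq> topspace X" and x: "x \<in> A" "0 < \<nu> x \<bullet> \<mu> x"
  obtains V where "openin X V" "x \<in> V" "\<And>y. y \<in> A \<inter> V \<Longrightarrow> 0 < \<nu> y \<bullet> \<mu> y"
proof -
  have "continuous_map (subtopology X A) euclidean (\<lambda>y. \<nu> y \<bullet> \<mu> y)"
    using c unfolding continuous_map_atin[where Y = euclidean] limitin_canonical_iff by (auto intro!: tendsto_intros)
  from continuous_map_nbhd[OF this x(1) A, of "{0<..}"] x(2)
  obtain V where V: "openin X V" "x \<in> V" "(\<lambda>y. \<nu> y \<bullet> \<mu> y) ` (A \<inter> V) \<subseteq> {0<..}" by auto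
  show thesis by (rule that[OF V(1,2)]) (use V(3) in blast)
qed

lemma continuous_uminus: "continuous_map X euclidean \<nu> \<Longrightarrow> continuous_map X euclidean (\<lambda>x. - \<nu> x :: 'e::euclidean_space)"
  unfolding continuous_map_atin[where Y = euclidean] limitin_canonical_iff by (auto intro!: tendsto_intros)

text \<open>Describes a normal orientation as the positive side of a conormal field. The sign of the
  field is chosen at \<open>x\<close>, and positivity on the normal field \<open>n\<close> persists
  nearby by continuity.\<close>

lemma normal_orientation_conormal:
  assumes P: "normal_orientation M S P" and S: "S \<subseteq> points M" and c: "c \<in> charts M" and x: "x \<in> S" "x \<in> fst c"
    and con: "conormal M S c Y0 \<nu>0" "x \<in> Y0"
  obtains Y \<nu> where "conormal M S c Y \<nu>" "x \<in> Y" "Y \<subseteq> Y0" "\<And>y v. y \<in> S \<inter> Y \<Longrightarrow> (y, c, v) \<in> P \<longleftrightarrow> 0 < \<nu> y \<bullet> v"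
proof -
  obtain W n where W: "openin (mtop M) W" "x \<in> W" "W \<subseteq> fst c" "continuous_map (subtopology (mtop M) (S \<inter> W)) euclidean n"
    and n': "\<forall>y\<in>S \<inter> W. n y \<notin> tangent_coords S c y"
      "\<forall>y\<in>S \<inter> W. {v. (y, c, v) \<in> P} = {t + a *\<^sub>R n y | t a. t \<in> tangent_coords S c y \<and> 0 < a}"
    using normal_orientationE[OF P x(1) c x(2)] .
  note n = bspec[OF n'(1)] bspec[OF n'(2)]
  note result = that
  have *: thesis if con: "conormal M S c Y0 \<nu>" and pos: "0 < \<nu> x \<bullet> n x" for \<nu>
  proof -
    let ?A = "S \<inter> (Y0 \<inter> W)"
    have cn: "continuous_map (subtopology (mtop M) (S \<inter> Y0)) euclidean \<nu>" using con by (simp add: conormal_def)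
    obtain V where V: "openin (mtop M) V" "x \<in> V" "\<And>y. y \<in> ?A \<inter> V \<Longrightarrow> 0 < \<nu> y \<bullet> n y"
    proof (rule continuous_inner_positive[of "mtop M" ?A \<nu> n x])
      show "continuous_map (subtopology (mtop M) ?A) euclidean \<nu>" by (rule continuous_map_from_subtopology_mono[OF cn]) blast
      show "continuous_map (subtopology (mtop M) ?A) euclidean n" by (rule continuous_map_from_subtopology_mono[OF W(4)]) blast
    qed (use S \<open>x \<in> Y0\<close> x W pos in auto)
    let ?Y = "Y0 \<inter> W \<inter> V"
    have oY: "openin (mtop M) ?Y" using con W(1) V(1) by (auto simp: conormal_def)
    have cY: "conormal M S c ?Y \<nu>" by (rule conormal_subset[OF con oY]) blast
    show thesis
    proof (rule result[OF cY])
      fix y v assume y: "y \<in> S \<inter> ?Y"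
      have pos: "0 < \<nu> y \<bullet> n y" using V(3) y by blast
      have tan: "tangent_coords S c y = {v. \<nu> y \<bullet> v = 0}" using con y by (auto simp: conormal_def)
      have Py: "(y, c, v) \<in> P \<longleftrightarrow> (\<exists>t a. v = t + a *\<^sub>R n y \<and> \<nu> y \<bullet> t = 0 \<and> 0 < a)"
        using n(2)[of y] y unfolding tan by blast
      show "(y, c, v) \<in> P \<longleftrightarrow> 0 < \<nu> y \<bullet> v"
      proof
        assume "(y, c, v) \<in> P"
        then obtain t a where "v = t + a *\<^sub>R n y" "\<nu> y \<bullet> t = 0" "0 < a" unfolding Py by blast
        then show "0 < \<nu> y \<bullet> v" using pos by (simp add: inner_add_right)
      next
        assume v: "0 < \<nu> y \<bullet> v"
        \<comment> \<open>The coefficient that makes \<open>v - a *\<^sub>R n y\<close>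
          tangent.\<close>
        define a where "a = (\<nu> y \<bullet> v) / (\<nu> y \<bullet> n y)"
        have "0 < a" using v pos by (simp add: a_def)
        moreover have "\<nu> y \<bullet> (v - a *\<^sub>R n y) = 0" using pos by (simp add: a_def inner_diff_right)
        ultimately show "(y, c, v) \<in> P" unfolding Py by (intro exI[of _ "v - a *\<^sub>R n y"] exI[of _ a]) simp
      qed
    qed (use V W con \<open>x \<in> Y0\<close> in auto)
  qed
  have "n x \<notin> tangent_coords S c x" using n(1) x W by blast
  moreover have "tangent_coords S c x = {v. \<nu>0 x \<bullet> v = 0}" using con x by (auto simp: conormal_def)
  ultimately have "\<nu>0 x \<bullet> n x \<noteq> 0" by simp
  then consider "0 < \<nu>0 x \<bullet> n x" | "0 < (- \<nu>0 x) \<bullet> n x" by fastforce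
  then show thesis
  proof cases
    case 1
    then show ?thesis by (rule *[OF con(1)])
  next
    case 2
    have "conormal M S c Y0 (\<lambda>x. - \<nu>0 x)" using con(1) continuous_uminus unfolding conormal_def by auto
    then show ?thesis using 2 by (rule *)
  qed
qed

lemma loc_deriv_chart_change:
  assumes M: "manifold M" and c: "c \<in> charts M" and c': "c' \<in> charts M" and x: "x \<in> fst c" "x \<in> fst c'"
  shows "loc_deriv c' c (\<lambda>x. x) x (loc_deriv c c' (\<lambda>x. x) x v) = v" "linear (loc_deriv c c' (\<lambda>x. x) x)"
proof -
  have px: "x \<in> points M" using chart_points[OF M c] x by blast
  note s = smooth_map_ident[OF M order_refl]
  have "loc_deriv c c (\<lambda>x. x) x = (\<lambda>v. loc_deriv c' c (\<lambda>x. x) x (loc_deriv c c' (\<lambda>x. x) x v))"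
    using loc_deriv_compose[OF M M M s openin_topspace s openin_topspace _ c c' c px x x(1)] by simp
  then show "loc_deriv c' c (\<lambda>x. x) x (loc_deriv c c' (\<lambda>x. x) x v) = v" using loc_deriv_ident[OF M c x(1)] by metis
  show "linear (loc_deriv c c' (\<lambda>x. x) x)"
    using loc_deriv_linear[OF M M s openin_topspace c c' px x] bounded_linear.linear by blast
qed

text \<open>With local conormal fields, any two normal orientations agree or are opposite near each
  point; connectedness of \<open>S\<close> makes the alternative global.\<close>

locale conormal_surface =
  fixes M :: "('a, 'e::euclidean_space) mfd" and S :: "'a set"
  assumes M: "manifold M" and S: "S \<subseteq> points M" and conn: "connectedin (mtop M) S" and ne: "S \<noteq> {}"
    and con: "\<And>x c. x \<in> S \<Longrightarrow> c \<in> charts M \<Longrightarrow> x \<in> fst c \<Longrightarrow> \<exists>Y \<nu>. conormal M S c Y \<nu> \<and> x \<in> Y"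
begin

text \<open>Both orientations are half-spaces bounded by the same tangent plane. The inner product
  of their covectors is therefore nonzero, and by continuity its sign is constant near
  \<open>x\<close>.\<close>

lemma two_normal_orientations:
  assumes P: "normal_orientation M S P" and P': "normal_orientation M S P'" and x: "x \<in> S" and c: "c \<in> charts M" "x \<in> fst c"
  obtains Y \<nu> \<nu>' where "openin (mtop M) Y" "x \<in> Y"
    "\<And>y v. y \<in> S \<inter> Y \<Longrightarrow> (y, c, v) \<in> P \<longleftrightarrow> 0 < \<nu> y \<bullet> v"
    "\<And>y v. y \<in> S \<inter> Y \<Longrightarrow> (y, c, v) \<in> P' \<longleftrightarrow> 0 < \<nu>' y \<bullet> v"
    "(\<forall>y\<in>S \<inter> Y. 0 < \<nu> y \<bullet> \<nu>' y) \<or> (\<forall>y\<in>S \<inter> Y. \<nu> y \<bullet> \<nu>' y < 0)"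
    "\<And>y. y \<in> S \<inter> Y \<Longrightarrow> \<nu> y \<noteq> 0 \<and> \<nu>' y \<noteq> 0 \<and> (\<forall>v. \<nu> y \<bullet> v = 0 \<longleftrightarrow> \<nu>' y \<bullet> v = 0)"
proof -
  obtain Y0 \<nu>0 where Y0: "conormal M S c Y0 \<nu>0" "x \<in> Y0" using con[OF x c] by blast
  obtain Y1 \<nu> where Y1: "conormal M S c Y1 \<nu>" "x \<in> Y1" "Y1 \<subseteq> Y0" "\<And>y v. y \<in> S \<inter> Y1 \<Longrightarrow> (y, c, v) \<in> P \<longleftrightarrow> 0 < \<nu> y \<bullet> v"
    using normal_orientation_conormal[OF P S c(1) x c(2) Y0] by metis
  obtain Y2 \<nu>' where Y2: "conormal M S c Y2 \<nu>'" "x \<in> Y2" "Y2 \<subseteq> Y1" "\<And>y v. y \<in> S \<inter> Y2 \<Longrightarrow> (y, c, v) \<in> P' \<longleftrightarrow> 0 < \<nu>' y \<bullet> v"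
    using normal_orientation_conormal[OF P' S c(1) x c(2) Y1(1,2)] by metis
  have oY2: "openin (mtop M) Y2" using Y2(1) by (simp add: conormal_def)
  have C1: "conormal M S c Y2 \<nu>" by (rule conormal_subset[OF Y1(1) oY2 Y2(3)])
  have par: "\<nu> y \<noteq> 0 \<and> \<nu>' y \<noteq> 0 \<and> (\<forall>v. \<nu> y \<bullet> v = 0 \<longleftrightarrow> \<nu>' y \<bullet> v = 0)" if y: "y \<in> S \<inter> Y2" for y
  proof -
    have "tangent_coords S c y = {v. \<nu> y \<bullet> v = 0}" "tangent_coords S c y = {v. \<nu>' y \<bullet> v = 0}" "\<nu> y \<noteq> 0" "\<nu>' y \<noteq> 0"
      using C1 Y2(1) y by (auto simp: conormal_def)
    then show ?thesis by blast
  qed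
  have cc: "continuous_map (subtopology (mtop M) (S \<inter> Y2)) euclidean \<nu>" "continuous_map (subtopology (mtop M) (S \<inter> Y2)) euclidean \<nu>'"
    using C1 Y2(1) by (simp_all add: conormal_def)
  have xY: "x \<in> S \<inter> Y2" "S \<inter> Y2 \<subseteq> points M" using x Y2(2) S by auto
  have "\<nu> x \<bullet> \<nu>' x \<noteq> 0" using half_space_covectors(1)[of "\<nu> x" "\<nu>' x"] par[OF xY(1)] by blast
  then consider "0 < \<nu> x \<bullet> \<nu>' x" | "0 < \<nu> x \<bullet> (- \<nu>' x)" by fastforce
  then obtain V where V: "openin (mtop M) V" "x \<in> V" "(\<forall>y\<in>S \<inter> Y2 \<inter> V. 0 < \<nu> y \<bullet> \<nu>' y) \<or> (\<forall>y\<in>S \<inter> Y2 \<inter> V. \<nu> y \<bullet> \<nu>' y < 0)"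
  proof cases
    case 1
    obtain V where "openin (mtop M) V" "x \<in> V" "\<And>y. y \<in> S \<inter> Y2 \<inter> V \<Longrightarrow> 0 < \<nu> y \<bullet> \<nu>' y"
      using continuous_inner_positive[OF cc xY(2,1) 1] by blast
    then show ?thesis using that by blast
  next
    case 2
    obtain V where "openin (mtop M) V" "x \<in> V" "\<And>y. y \<in> S \<inter> Y2 \<inter> V \<Longrightarrow> 0 < \<nu> y \<bullet> (- \<nu>' y)"
      using continuous_inner_positive[OF cc(1) continuous_uminus[OF cc(2)] xY(2,1) 2] by blast
    then show ?thesis using that[of V] by fastforce
  qed
  show thesis
  proof (rule that[of "Y2 \<inter> V" \<nu> \<nu>'])
    show "openin (mtop M) (Y2 \<inter> V)" using oY2 V(1) by blast
    show "x \<in> Y2 \<inter> V" using Y2(2) V(2) by blast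
    show "(\<forall>y\<in>S \<inter> (Y2 \<inter> V). 0 < \<nu> y \<bullet> \<nu>' y) \<or> (\<forall>y\<in>S \<inter> (Y2 \<inter> V). \<nu> y \<bullet> \<nu>' y < 0)" using V(3) by (simp add: Int_assoc)
  qed (use Y1(4) Y2(3,4) par in blast)+
qed

text \<open>The set \<open>A\<close> of points where the two orientations share a vector is open and
  closed in \<open>S\<close>. A single common vector thus identifies two normal orientations, which
  is how pushed orientations are compared later on.\<close>

lemma normal_orientation_agree:
  assumes P: "normal_orientation M S P" and P': "normal_orientation M S P'" and m: "(x, c, v) \<in> P" "(x, c, v) \<in> P'"
  shows "P = P'"
proof -
  define A where "A = {x \<in> S. \<exists>c v. (x, c, v) \<in> P \<and> (x, c, v) \<in> P'}"
  have loc: "\<exists>Y. openin (mtop M) Y \<and> x \<in> Y \<and> ((\<forall>y\<in>S \<inter> Y. y \<in> A) \<or> (\<forall>y\<in>S \<inter> Y. y \<notin> A))" if x: "x \<in> S" for x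
  proof -
    obtain c where c: "c \<in> charts M" "x \<in> fst c" using point_chart[OF M] x S by blast
    obtain Y \<nu> \<nu>' where Y: "openin (mtop M) Y" "x \<in> Y"
      and in_P: "\<And>y v. y \<in> S \<inter> Y \<Longrightarrow> (y, c, v) \<in> P \<longleftrightarrow> 0 < \<nu> y \<bullet> v"
      and in_P': "\<And>y v. y \<in> S \<inter> Y \<Longrightarrow> (y, c, v) \<in> P' \<longleftrightarrow> 0 < \<nu>' y \<bullet> v"
      and sgn: "(\<forall>y\<in>S \<inter> Y. 0 < \<nu> y \<bullet> \<nu>' y) \<or> (\<forall>y\<in>S \<inter> Y. \<nu> y \<bullet> \<nu>' y < 0)"
      and par: "\<And>y. y \<in> S \<inter> Y \<Longrightarrow> \<nu> y \<noteq> 0 \<and> \<nu>' y \<noteq> 0 \<and> (\<forall>v. \<nu> y \<bullet> v = 0 \<longleftrightarrow> \<nu>' y \<bullet> v = 0)"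
      using two_normal_orientations[OF P P' x c] by blast
    let ?Y = "Y \<inter> fst c"
    have oY: "openin (mtop M) ?Y" using Y(1) chart_openin[OF manifold_chart[OF M c(1)]] by blast
    from sgn show ?thesis
    proof
      assume s: "\<forall>y\<in>S \<inter> Y. 0 < \<nu> y \<bullet> \<nu>' y"
      have "y \<in> A" if y: "y \<in> S \<inter> ?Y" for y
      proof -
        have yY: "y \<in> S \<inter> Y" using y by blast
        have "(y, c, \<nu>' y) \<in> P" using in_P[OF yY] s yY by simp
        moreover have "(y, c, \<nu>' y) \<in> P'" using in_P'[OF yY] par[OF yY] by simp
        ultimately show ?thesis using y unfolding A_def by blast
      qed
      then show ?thesis using oY Y(2) c(2) by blast
    next
      assume s: "\<forall>y\<in>S \<inter> Y. \<nu> y \<bullet> \<nu>' y < 0"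
      have "y \<notin> A" if y: "y \<in> S \<inter> ?Y" for y
      proof
        assume "y \<in> A"
        then obtain c2 v where v: "(y, c2, v) \<in> P" "(y, c2, v) \<in> P'" unfolding A_def by blast
        have yY: "y \<in> S \<inter> Y" "y \<in> fst c" using y by auto
        let ?w = "loc_deriv c2 c (\<lambda>x. x) y v"
        have "(y, c, ?w) \<in> P" "(y, c, ?w) \<in> P'"
          using normal_orientation_chart_change[OF P v(1) c(1) yY(2)] normal_orientation_chart_change[OF P' v(2) c(1) yY(2)] by auto
        then have "0 < \<nu> y \<bullet> ?w" "0 < \<nu>' y \<bullet> ?w" using in_P[OF yY(1)] in_P'[OF yY(1)] by auto
        moreover have "0 < \<nu> y \<bullet> ?w \<longleftrightarrow> \<nu>' y \<bullet> ?w < 0"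
          by (rule half_space_covectors(3)) (use par[OF yY(1)] s yY(1) in auto)
        ultimately show False by simp
      qed
      then show ?thesis using oY Y(2) c(2) by blast
    qed
  qed
  have AS: "A \<subseteq> S" by (auto simp: A_def)
  have top: "topspace (subtopology (mtop M) S) = S" using S by auto
  have open_lem: "openin (subtopology (mtop M) S) B" if B: "B \<subseteq> S" "\<And>x. x \<in> B \<Longrightarrow> \<exists>Y. openin (mtop M) Y \<and> x \<in> Y \<and> S \<inter> Y \<subseteq> B" for B
  proof (subst openin_subopen, intro ballI)
    fix x assume x: "x \<in> B"
    then obtain Y where Y: "openin (mtop M) Y" "x \<in> Y" "S \<inter> Y \<subseteq> B" using B(2) by blast
    have "openin (subtopology (mtop M) S) (S \<inter> Y)" using Y(1) by (simp add: openin_subtopology_Int2)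
    then show "\<exists>T. openin (subtopology (mtop M) S) T \<and> x \<in> T \<and> T \<subseteq> B" using Y x B(1) by blast
  qed
  have "\<exists>Y. openin (mtop M) Y \<and> x \<in> Y \<and> S \<inter> Y \<subseteq> A" if x: "x \<in> A" for x
  proof -
    have xS: "x \<in> S" using x AS by blast
    from loc[OF xS] obtain Y where Y: "openin (mtop M) Y" "x \<in> Y" "(\<forall>y\<in>S \<inter> Y. y \<in> A) \<or> (\<forall>y\<in>S \<inter> Y. y \<notin> A)" by blast
    then have "\<forall>y\<in>S \<inter> Y. y \<in> A" using x xS by blast
    then show ?thesis using Y by blast
  qed
  then have o1: "openin (subtopology (mtop M) S) A" by (rule open_lem[OF AS])
  have "\<exists>Y. openin (mtop M) Y \<and> x \<in> Y \<and> S \<inter> Y \<subseteq> S - A" if x: "x \<in> S - A" for x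
  proof -
    have xS: "x \<in> S" using x by blast
    from loc[OF xS] obtain Y where Y: "openin (mtop M) Y" "x \<in> Y" "(\<forall>y\<in>S \<inter> Y. y \<in> A) \<or> (\<forall>y\<in>S \<inter> Y. y \<notin> A)" by blast
    then have "\<forall>y\<in>S \<inter> Y. y \<notin> A" using x xS by blast
    then show ?thesis using Y by blast
  qed
  then have o2: "openin (subtopology (mtop M) S) (S - A)" by (rule open_lem[OF Diff_subset])
  have cA: "closedin (subtopology (mtop M) S) A" unfolding closedin_def top using AS o2 by simp
  have cs: "connected_space (subtopology (mtop M) S)" using conn by (simp add: connectedin_def)
  have "A = {} \<or> A = topspace (subtopology (mtop M) S)"
    by (intro connected_space_clopen_in[THEN iffD1, rule_format, OF cs] conjI o1 cA)
  then have "A = {} \<or> A = S" unfolding top .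
  moreover have "x \<in> A" using m tvecsD(1)[OF normal_orientation_tvecs[OF P] m(1)] unfolding A_def by blast
  ultimately have AS: "A = S" by (elim disjE) simp_all
  \<comment> \<open>Half-spaces bounded by one hyperplane coincide as soon as they share a
    vector.\<close>
  have sub: "Q \<subseteq> Q'" if Q: "normal_orientation M S Q" and Q': "normal_orientation M S Q'"
      and ag: "\<And>x. x \<in> S \<Longrightarrow> \<exists>c v. (x, c, v) \<in> Q \<and> (x, c, v) \<in> Q'" for Q Q'
  proof
    fix t assume t: "t \<in> Q"
    obtain x c v where tt: "t = (x, c, v)" by (cases t)
    note xc = tvecsD[OF normal_orientation_tvecs[OF Q] t[unfolded tt]]
    obtain Y \<nu> \<nu>' where Y: "openin (mtop M) Y" "x \<in> Y"
      and in_Q: "\<And>y v. y \<in> S \<inter> Y \<Longrightarrow> (y, c, v) \<in> Q \<longleftrightarrow> 0 < \<nu> y \<bullet> v"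
      and in_Q': "\<And>y v. y \<in> S \<inter> Y \<Longrightarrow> (y, c, v) \<in> Q' \<longleftrightarrow> 0 < \<nu>' y \<bullet> v"
      and sgn: "(\<forall>y\<in>S \<inter> Y. 0 < \<nu> y \<bullet> \<nu>' y) \<or> (\<forall>y\<in>S \<inter> Y. \<nu> y \<bullet> \<nu>' y < 0)"
      and par: "\<And>y. y \<in> S \<inter> Y \<Longrightarrow> \<nu> y \<noteq> 0 \<and> \<nu>' y \<noteq> 0 \<and> (\<forall>v. \<nu> y \<bullet> v = 0 \<longleftrightarrow> \<nu>' y \<bullet> v = 0)"
      using two_normal_orientations[OF Q Q' xc] by blast
    have xY: "x \<in> S \<inter> Y" using xc(1) Y(2) by blast
    obtain c2 w where w: "(x, c2, w) \<in> Q" "(x, c2, w) \<in> Q'" using ag[OF xc(1)] by blast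
    let ?w = "loc_deriv c2 c (\<lambda>x. x) x w"
    have "(x, c, ?w) \<in> Q" "(x, c, ?w) \<in> Q'"
      using normal_orientation_chart_change[OF Q w(1) xc(2,3)] normal_orientation_chart_change[OF Q' w(2) xc(2,3)] by auto
    then have p: "0 < \<nu> x \<bullet> ?w" "0 < \<nu>' x \<bullet> ?w" using in_Q[OF xY] in_Q'[OF xY] by auto
    have "\<not> \<nu> x \<bullet> \<nu>' x < 0"
    proof
      assume "\<nu> x \<bullet> \<nu>' x < 0"
      then have "0 < \<nu> x \<bullet> ?w \<longleftrightarrow> \<nu>' x \<bullet> ?w < 0" by (rule half_space_covectors(3)[rotated -1]) (use par[OF xY] in auto)
      then show False using p by simp
    qed
    then have "0 < \<nu> x \<bullet> \<nu>' x" using sgn xY by blast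
    then have "0 < \<nu> x \<bullet> v \<longleftrightarrow> 0 < \<nu>' x \<bullet> v" by (rule half_space_covectors(2)[rotated -1]) (use par[OF xY] in auto)
    then show "t \<in> Q'" using in_Q[OF xY] in_Q'[OF xY] t tt by simp
  qed
  have ag: "\<exists>c v. (x, c, v) \<in> P \<and> (x, c, v) \<in> P'" if "x \<in> S" for x using that unfolding AS[symmetric] by (auto simp: A_def)
  show "P = P'" using sub[OF P P' ag] sub[OF P' P] ag by blast
qed

text \<open>Distinct orientations share no vector at any point, so everywhere they are the two
  opposite half-spaces.\<close>

lemma normal_orientation_disjoint:
  assumes P: "normal_orientation M S P" and P': "normal_orientation M S P'" and neq: "P \<noteq> P'"
  shows "(x, c, v) \<in> P \<longleftrightarrow> (x, c, - v) \<in> P'"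
proof (cases "x \<in> S \<and> c \<in> charts M \<and> x \<in> fst c")
  case True
  then have x: "x \<in> S" "c \<in> charts M" "x \<in> fst c" by auto
  obtain Y \<nu> \<nu>' where Y: "openin (mtop M) Y" "x \<in> Y"
    and in_P: "\<And>y v. y \<in> S \<inter> Y \<Longrightarrow> (y, c, v) \<in> P \<longleftrightarrow> 0 < \<nu> y \<bullet> v"
    and in_P': "\<And>y v. y \<in> S \<inter> Y \<Longrightarrow> (y, c, v) \<in> P' \<longleftrightarrow> 0 < \<nu>' y \<bullet> v"
    and sgn: "(\<forall>y\<in>S \<inter> Y. 0 < \<nu> y \<bullet> \<nu>' y) \<or> (\<forall>y\<in>S \<inter> Y. \<nu> y \<bullet> \<nu>' y < 0)"
    and par: "\<And>y. y \<in> S \<inter> Y \<Longrightarrow> \<nu> y \<noteq> 0 \<and> \<nu>' y \<noteq> 0 \<and> (\<forall>v. \<nu> y \<bullet> v = 0 \<longleftrightarrow> \<nu>' y \<bullet> v = 0)"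
    using two_normal_orientations[OF P P' x] by blast
  have xY: "x \<in> S \<inter> Y" using x(1) Y(2) by blast
  have "\<not> 0 < \<nu> x \<bullet> \<nu>' x"
  proof
    assume "0 < \<nu> x \<bullet> \<nu>' x"
    then have "(x, c, \<nu>' x) \<in> P" "(x, c, \<nu>' x) \<in> P'" using in_P[OF xY] in_P'[OF xY] par[OF xY] by auto
    then show False using normal_orientation_agree[OF P P'] neq by blast
  qed
  then have "\<nu> x \<bullet> \<nu>' x < 0" using sgn xY by blast
  then have "0 < \<nu> x \<bullet> v \<longleftrightarrow> \<nu>' x \<bullet> v < 0" by (rule half_space_covectors(3)[rotated -1]) (use par[OF xY] in auto)
  then show ?thesis using in_P[OF xY] in_P'[OF xY] by simp
next
  case False
  then show ?thesis using tvecsD[OF normal_orientation_tvecs[OF P]] tvecsD[OF normal_orientation_tvecs[OF P']] by blast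
qed

lemma normal_orientation_nonempty:
  assumes P: "normal_orientation M S P" and x: "x \<in> S" "c \<in> charts M" "x \<in> fst c"
  obtains v where "(x, c, v) \<in> P"
proof -
  obtain W n where Wn: "openin (mtop M) W" "x \<in> W" "W \<subseteq> fst c" "continuous_map (subtopology (mtop M) (S \<inter> W)) euclidean n"
    "\<forall>y\<in>S \<inter> W. n y \<notin> tangent_coords S c y"
    "\<forall>y\<in>S \<inter> W. {v. (y, c, v) \<in> P} = {t + a *\<^sub>R n y | t a. t \<in> tangent_coords S c y \<and> 0 < a}"
    using normal_orientationE[OF P x] .
  have W: "{v. (x, c, v) \<in> P} = {t + a *\<^sub>R n x | t a. t \<in> tangent_coords S c x \<and> 0 < (a::real)}"
    by (rule bspec[OF Wn(6)]) (use Wn(2) x(1) in blast)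
  obtain Y \<nu> where "conormal M S c Y \<nu>" "x \<in> Y" using con[OF x] by blast
  then have "tangent_coords S c x = {v. \<nu> x \<bullet> v = 0}" using x by (auto simp: conormal_def)
  then have "0 \<in> tangent_coords S c x" by simp
  then have "0 + 1 *\<^sub>R n x \<in> {t + a *\<^sub>R n x | t a. t \<in> tangent_coords S c x \<and> 0 < a}" by (intro CollectI exI[of _ 0] exI[of _ 1]) simp
  then show thesis using that unfolding W[symmetric] by blast
qed

end

section \<open>The local structure of a cut surface\<close>

text \<open>The curve is the straight line from \<open>snd d z\<close> in direction
  \<open>w\<close>. The condition on \<open>I\<close> keeps it in the half-space: any times are
  admissible for \<open>w\<close> parallel to the boundary, where the line remains in the boundary,
  and nonnegative times for inward \<open>w\<close>.\<close>

lemma half_chart_curve: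
  fixes N :: "('b, 'e::euclidean_space) mfd"
  assumes N: "manifold N" and d: "d \<in> charts N" and h: "half_chart d u" and V: "openin (mtop N) V" and z: "z \<in> V" "z \<in> fst d" "u \<bullet> snd d z = 0"
    and I: "0 \<in> I" "\<And>t. t \<in> I \<Longrightarrow> 0 \<le> t * (u \<bullet> w)"
  shows "w \<in> curve_coords I {z \<in> V \<inter> fst d. u \<bullet> w = 0 \<longrightarrow> u \<bullet> snd d z = 0} d z"
proof -
  note id = manifold_chart[OF N d]
  let ?p = "snd d z"
  have "openin (top_of_set (cimg d)) (snd d ` (V \<inter> fst d))"
    by (rule chart_open_image[OF id]) (use V chart_openin[OF id] in auto)
  then have "openin (top_of_set {x. 0 \<le> u \<bullet> x}) (snd d ` (V \<inter> fst d))"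
    by (rule openin_trans) (use h in \<open>simp add: half_chart_def\<close>)
  then obtain T where T: "open T" "snd d ` (V \<inter> fst d) = {x. 0 \<le> u \<bullet> x} \<inter> T" unfolding openin_open by (elim exE conjE)
  let ?J = "(\<lambda>t. ?p + t *\<^sub>R w) -` T"
  have J: "open ?J" by (intro open_vimage T(1) continuous_intros)
  have "?p \<in> snd d ` (V \<inter> fst d)" using z by blast
  then have pT: "?p \<in> T" unfolding T(2) by blast
  let ?\<gamma> = "\<lambda>t. cinv d (?p + t *\<^sub>R w)"
  have \<gamma>: "?\<gamma> t \<in> V \<inter> fst d \<and> snd d (?\<gamma> t) = ?p + t *\<^sub>R w" if t: "t \<in> I" "t \<in> ?J" for t
  proof -
    have "u \<bullet> (?p + t *\<^sub>R w) = t * (u \<bullet> w)" using z(3) by (simp add: inner_add_right)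
    then have "?p + t *\<^sub>R w \<in> {x. 0 \<le> u \<bullet> x} \<inter> T" using I(2)[OF t(1)] t(2) by simp
    then have "?p + t *\<^sub>R w \<in> snd d ` (V \<inter> fst d)" unfolding T(2) .
    then obtain z' where z': "z' \<in> V \<inter> fst d" "?p + t *\<^sub>R w = snd d z'" by blast
    then have "?\<gamma> t = z'" using id by simp
    then show ?thesis using z' by simp
  qed
  show ?thesis
  proof (rule curve_coordsI[of ?\<gamma>, OF _ I(1) _ J])
    show "?\<gamma> 0 = z" using id z(2) by simp
    show "0 \<in> ?J" using pT by simp
    show "?\<gamma> ` (I \<inter> ?J) \<subseteq> {z \<in> V \<inter> fst d. u \<bullet> w = 0 \<longrightarrow> u \<bullet> snd d z = 0} \<inter> fst d"
    proof
      fix y assume "y \<in> ?\<gamma> ` (I \<inter> ?J)"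
      then obtain t where t: "t \<in> I" "t \<in> ?J" "y = ?\<gamma> t" by blast
      show "y \<in> {z \<in> V \<inter> fst d. u \<bullet> w = 0 \<longrightarrow> u \<bullet> snd d z = 0} \<inter> fst d"
        using \<gamma>[OF t(1,2)] z(3) unfolding t(3) by (auto simp: inner_add_right)
    qed
    have "((\<lambda>t. ?p + t *\<^sub>R w) has_derivative (\<lambda>t. t *\<^sub>R w)) (at 0 within I)"
      by (auto intro!: derivative_eq_intros)
    then have "((\<lambda>t. snd d (?\<gamma> t)) has_derivative (\<lambda>t. t *\<^sub>R w)) (at 0 within I)"
      by (rule has_derivative_local_cong[THEN iffD1, OF J _ I(1), rotated -1]) (use pT \<gamma> in auto)
    then show "((\<lambda>t. snd d (?\<gamma> t)) has_vector_derivative w) (at 0 within I)" by (simp add: has_vector_derivative_def)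
  qed (use z in auto)
qed

lemma Ck_on_has_derivative:
  assumes "\<forall>k. Ck_on k W f" "open W" "p \<in> W"
  shows "(f has_derivative frechet_derivative f (at p)) (at p)"
proof -
  have "f differentiable_on W" using spec[OF assms(1), of "Suc 0"] by simp
  then have "f differentiable (at p)" using assms(2,3) differentiable_on_eq_differentiable_at by blast
  then show ?thesis using frechet_derivative_works by blast
qed

text \<open>The smooth inverse on the image extends to an open set of the ambient model space, whose
  dimension may be larger. The extension \<open>\<kappa>\<close> can be differentiated in all
  ambient directions, and by the chain rule its derivative undoes that of \<open>f\<close>.\<close>

lemma diffeo_left_inverse:
  fixes M1 :: "('b, 'e::euclidean_space) mfd" and M2 :: "('a, 'f::euclidean_space) mfd"
  assumes M1: "manifold M1" and M2: "manifold M2" and A: "openin (mtop M1) A" and f: "diffeo M1 A M2 B f"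
    and c1: "c1 \<in> charts M1" and c2: "c2 \<in> charts M2" and x: "x \<in> A" "x \<in> fst c1" "f x \<in> fst c2"
  obtains W \<kappa> where "open W" "snd c2 (f x) \<in> W" "\<forall>k. Ck_on k W (\<kappa> :: 'f \<Rightarrow> 'e)"
    "\<And>z. z \<in> A \<Longrightarrow> z \<in> fst c1 \<Longrightarrow> f z \<in> fst c2 \<Longrightarrow> snd c2 (f z) \<in> W \<Longrightarrow> \<kappa> (snd c2 (f z)) = snd c1 z"
    "\<And>z w. z \<in> A \<Longrightarrow> z \<in> fst c1 \<Longrightarrow> f z \<in> fst c2 \<Longrightarrow> snd c2 (f z) \<in> W \<Longrightarrow>
       frechet_derivative \<kappa> (at (snd c2 (f z))) (loc_deriv c1 c2 f z w) = w"
proof -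
  note i1 = manifold_chart[OF M1 c1] and i2 = manifold_chart[OF M2 c2]
  let ?g = "inv_into A f"
  let ?E = "snd c2 ` (B \<inter> fst c2 \<inter> ?g -` fst c1)"
  note fD = diffeoD[OF f]
  have E: "snd c2 (f z) \<in> ?E" if "z \<in> A" "z \<in> fst c1" "f z \<in> fst c2" for z
    using that fD(6,8)[OF that(1)] by (intro imageI) simp
  obtain W \<kappa> where W: "open W" "snd c2 (f x) \<in> W" "\<forall>k. Ck_on k W \<kappa>" "\<forall>p\<in>?E \<inter> W. \<kappa> p = loc_rep c2 c1 ?g p"
    using smooth_onE[OF smooth_map_rep[OF M2 M1 fD(2) c2 c1] E[OF x]] .
  have \<kappa>: "\<kappa> (snd c2 (f z)) = snd c1 z" if z: "z \<in> A" "z \<in> fst c1" "f z \<in> fst c2" "snd c2 (f z) \<in> W" for z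
  proof -
    have "snd c2 (f z) \<in> ?E \<inter> W" using E[OF z(1-3)] z(4) by (rule IntI)
    from bspec[OF W(4) this] show ?thesis using loc_rep_at[OF i2 z(3), of c1 ?g] fD(6)[OF z(1)] by simp
  qed
  have "frechet_derivative \<kappa> (at (snd c2 (f z))) (loc_deriv c1 c2 f z w) = w"
    if z: "z \<in> A" "z \<in> fst c1" "f z \<in> fst c2" "snd c2 (f z) \<in> W" for z w
  proof -
    let ?S = "snd c1 ` (A \<inter> fst c1 \<inter> f -` fst c2)"
    have zS: "snd c1 z \<in> ?S" using z by blast
    have d1: "(loc_rep c1 c2 f has_derivative loc_deriv c1 c2 f z) (at (snd c1 z) within ?S)"
      using loc_deriv_has_derivative[OF M1 M2 fD(1) A c1 c2 z(1-3)] by (rule has_derivative_subset) blast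
    have d2: "(\<kappa> has_derivative frechet_derivative \<kappa> (at (snd c2 (f z)))) (at (loc_rep c1 c2 f (snd c1 z)) within loc_rep c1 c2 f ` ?S)"
      unfolding loc_rep_at[OF i1 z(2)] using Ck_on_has_derivative[OF W(3,1) z(4)] by (rule has_derivative_at_withinI)
    have comp: "((\<lambda>p. \<kappa> (loc_rep c1 c2 f p)) has_derivative (\<lambda>w. frechet_derivative \<kappa> (at (snd c2 (f z))) (loc_deriv c1 c2 f z w))) (at (snd c1 z) within ?S)"
      using diff_chain_within[OF d1 d2] by (simp add: o_def)
    have cont: "continuous_on ?S (loc_rep c1 c2 f)"
      by (rule smooth_on_imp_continuous_on[OF smooth_map_rep[OF M1 M2 fD(1) c1 c2]])
    then have "openin (top_of_set ?S) (?S \<inter> loc_rep c1 c2 f -` W)" using continuous_openin_preimage_gen W(1) by blast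
    then obtain R where R: "open R" "?S \<inter> loc_rep c1 c2 f -` W = ?S \<inter> R" unfolding openin_open by (elim exE conjE)
    have "snd c1 z \<in> ?S \<inter> loc_rep c1 c2 f -` W" using zS loc_rep_at[OF i1 z(2), of c2 f] z(4) by simp
    then have zR: "snd c1 z \<in> R" unfolding R(2) by blast
    have "((\<lambda>p. p) has_derivative (\<lambda>w. frechet_derivative \<kappa> (at (snd c2 (f z))) (loc_deriv c1 c2 f z w))) (at (snd c1 z) within ?S)"
    proof (rule has_derivative_local_cong[THEN iffD1, OF R(1) zR zS _ comp])
      fix p assume p: "p \<in> R \<inter> ?S"
      then have "p \<in> ?S \<inter> R" by blast
      then have pW: "loc_rep c1 c2 f p \<in> W" unfolding R(2)[symmetric] by blast
      from p obtain z' where z': "z' \<in> A" "z' \<in> fst c1" "f z' \<in> fst c2" "p = snd c1 z'" by blast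
      have r: "loc_rep c1 c2 f p = snd c2 (f z')" unfolding z'(4) by (rule loc_rep_at[OF i1 z'(2)])
      have "snd c2 (f z') \<in> W" using pW by (simp only: r)
      from \<kappa>[OF z'(1-3) this] have "\<kappa> (snd c2 (f z')) = p" by (simp only: z'(4))
      then show "\<kappa> (loc_rep c1 c2 f p) = p" by (simp only: r)
    qed
    moreover have "((\<lambda>p. p) has_derivative (\<lambda>w. w)) (at (snd c1 z) within ?S)" by (rule has_derivative_ident)
    moreover have "halfopen ?S" by (rule halfopen_openin[OF chart_halfopen[OF i1] smooth_map_openin_dom(2)[OF M1 M2 fD(1) A c1 c2]])
    ultimately have "(\<lambda>w. frechet_derivative \<kappa> (at (snd c2 (f z))) (loc_deriv c1 c2 f z w)) = (\<lambda>w. w)"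
      by (intro halfopen_derivative_unique[OF _ zS])
    then show ?thesis by (rule fun_cong)
  qed
  with W(1-3) \<kappa> show thesis using that by blast
qed

lemma Ck_on_derivative_continuous:
  assumes "\<forall>k. Ck_on k W f"
  shows "continuous_on W (\<lambda>p. frechet_derivative f (at p) v)"
  using spec[OF assms, of "Suc 0"] by simp

lemma curve_function_derivative:
  fixes \<kappa> :: "'e::euclidean_space \<Rightarrow> 'f::euclidean_space"
  assumes "(\<kappa> has_derivative K) (at (\<delta> 0))" "(\<delta> has_vector_derivative v) (at 0 within I)"
  shows "((\<lambda>t::real. u \<bullet> \<kappa> (\<delta> t)) has_real_derivative u \<bullet> K v) (at 0 within I)"
proof -
  have 1: "(\<delta> has_derivative (\<lambda>t. t *\<^sub>R v)) (at 0 within I)" using assms(2) by (simp add: has_vector_derivative_def)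
  have 2: "(\<kappa> has_derivative K) (at (\<delta> 0) within \<delta> ` I)" using assms(1) by (rule has_derivative_at_withinI)
  have "bounded_linear K" using assms(1) by (rule has_derivative_bounded_linear)
  then have K: "K (t *\<^sub>R v) = t *\<^sub>R K v" for t by (simp add: linear_scale bounded_linear.linear)
  have "((\<lambda>t. \<kappa> (\<delta> t)) has_derivative (\<lambda>t. t *\<^sub>R K v)) (at 0 within I)"
    using diff_chain_within[OF 1 2] by (simp add: o_def K)
  then have "((\<lambda>t. u \<bullet> \<kappa> (\<delta> t)) has_derivative (\<lambda>t. u \<bullet> (t *\<^sub>R K v))) (at 0 within I)"
    by (rule has_derivative_inner_right)
  moreover have "(\<lambda>t. u \<bullet> (t *\<^sub>R K v)) = (*) (u \<bullet> K v)" by (simp add: fun_eq_iff)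
  ultimately show ?thesis unfolding has_field_derivative_def by simp
qed

text \<open>Brings the positive side of a covector into the form required by
  \<open>normal_orientation\<close>, with the covector itself as the normal vector.\<close>

lemma half_space_rays:
  fixes \<nu> :: "'e::real_inner"
  assumes "\<nu> \<noteq> 0"
  shows "{v. 0 < \<nu> \<bullet> v} = {t + a *\<^sub>R \<nu> | t a. t \<in> {v. \<nu> \<bullet> v = 0} \<and> 0 < a}"
proof
  have p: "0 < \<nu> \<bullet> \<nu>" using assms by simp
  show "{t + a *\<^sub>R \<nu> | t a. t \<in> {v. \<nu> \<bullet> v = 0} \<and> 0 < a} \<subseteq> {v. 0 < \<nu> \<bullet> v}"
    using p by (auto simp: inner_add_right)
  show "{v. 0 < \<nu> \<bullet> v} \<subseteq> {t + a *\<^sub>R \<nu> | t a. t \<in> {v. \<nu> \<bullet> v = 0} \<and> 0 < a}"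
  proof
    fix v assume "v \<in> {v. 0 < \<nu> \<bullet> v}"
    then have v: "0 < \<nu> \<bullet> v" by simp
    define a where "a = (\<nu> \<bullet> v) / (\<nu> \<bullet> \<nu>)"
    have "0 < a" using v p by (simp add: a_def)
    moreover have "\<nu> \<bullet> (v - a *\<^sub>R \<nu>) = 0" using p by (simp add: a_def inner_diff_right)
    ultimately show "v \<in> {t + a *\<^sub>R \<nu> | t a. t \<in> {v. \<nu> \<bullet> v = 0} \<and> 0 < a}"
      by (intro CollectI exI[of _ "v - a *\<^sub>R \<nu>"] exI[of _ a]) simp
  qed
qed

locale surface_cut = cut_manifold M "\<Union>\<T>" N q
  for M :: "('a, 'e::euclidean_space) mfd" and \<T> :: "'a set set" and N :: "('b, 'e) mfd" and q +
  assumes fin: "finite \<T>" and disj: "pairwise disjnt \<T>"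
    and closed_S: "\<And>S. S \<in> \<T> \<Longrightarrow> closedin (mtop M) S" and conn_S: "\<And>S. S \<in> \<T> \<Longrightarrow> connectedin (mtop M) S"
    and ne_S: "\<And>S. S \<in> \<T> \<Longrightarrow> S \<noteq> {}"
begin

lemma S_points: "S \<in> \<T> \<Longrightarrow> S \<subseteq> points M" using closedin_subset[OF closed_S] .

lemma closed_rest: "closedin (mtop M) (\<Union> (\<T> - {S}))"
  by (rule closedin_Union) (use fin closed_S in auto)

lemma disjoint_rest: "S \<in> \<T> \<Longrightarrow> S \<inter> \<Union> (\<T> - {S}) = {}"
  using disj unfolding pairwise_def disjnt_def by blast

lemma Union_rest: "S \<in> \<T> \<Longrightarrow> \<Union>\<T> - S = \<Union> (\<T> - {S})"
  using disjoint_rest by blast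

text \<open>The covector field is \<open>v \<mapsto> u \<bullet> D\<kappa> v\<close>, where \<open>\<kappa>\<close> extends the inverse of \<open>q\<close> near the boundary point \<open>y\<close>,
  expressed in a half-space chart at \<open>y\<close> with inner normal \<open>u\<close>, to a full neighbourhood of \<open>q y\<close>.\<close>

lemma local_picture:
  assumes S: "S \<in> \<T>" and y: "y \<in> points N" "q y \<in> S" and c: "c \<in> charts M" "q y \<in> fst c" and V: "openin (mtop N) V" "y \<in> V"
  obtains d u W Y \<nu> where
    "d \<in> charts N" "half_chart d u" "openin (mtop N) W" "y \<in> W" "W \<subseteq> V" "W \<subseteq> fst d" "connectedin (mtop N) W"
    "diffeo N W M (q ` W) q" "\<forall>z\<in>W. q z \<in> fst c \<and> (u \<bullet> snd d z = 0 \<longleftrightarrow> q z \<in> S)"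
    "conormal M S c Y \<nu>" "q y \<in> Y" "\<forall>x\<in>S \<inter> Y. \<exists>z\<in>W. q z = x"
    "\<forall>z\<in>W. \<forall>v. q z \<in> S \<inter> Y \<longrightarrow> 0 < \<nu> (q z) \<bullet> v \<longrightarrow> v \<in> curve_coords {0..} (q ` W) c (q z)"
    "\<forall>x\<in>S \<inter> Y. \<forall>\<gamma> v J. \<gamma> 0 = x \<longrightarrow> \<gamma> ` {0..} \<subseteq> fst c \<longrightarrow> open J \<longrightarrow> 0 \<in> J \<longrightarrow> \<gamma> ` ({0..} \<inter> J) \<subseteq> q ` W \<longrightarrow>
       ((\<lambda>t. snd c (\<gamma> t)) has_vector_derivative v) (at 0 within {0..}) \<longrightarrow> 0 \<le> \<nu> x \<bullet> v"
proof -
  note ic = manifold_chart[OF M c(1)]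
  have yT: "q y \<in> \<Union>\<T>" using S y by blast
  have "y \<in> boundary N" using boundary_off_T[OF y(1)] yT by blast
  then obtain d u where d: "d \<in> charts N" "y \<in> fst d" "half_chart d u" "u \<bullet> snd d y = 0" using boundary_half_chart[OF N] by blast
  note id = manifold_chart[OF N d(1)]
  obtain W0 where W0: "openin (mtop N) W0" "y \<in> W0" "diffeo N W0 M (q ` W0) q" using q_local[OF y(1)] by blast
  \<comment> \<open>The other tori and the boundary of \<open>M\<close> are removed, so that the
    boundary points of \<open>N\<close> in \<open>W\<close> lie over \<open>S\<close> alone.\<close>
  let ?Z = "fst c - (\<Union> (\<T> - {S}) \<union> boundary M)"
  have oZ: "openin (mtop M) ?Z"
    by (rule openin_diff[OF chart_openin[OF ic] closedin_Un[OF closed_rest closedin_boundary[OF M]]])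
  let ?G = "{z \<in> points N. q z \<in> ?Z}"
  have oG: "openin (mtop N) ?G" by (rule openin_continuous_map_preimage[OF q_cont oZ])
  have yG: "y \<in> ?G" using y c disjoint_rest[OF S] Tb yT by blast
  have oV: "openin (mtop N) (V \<inter> W0 \<inter> fst d \<inter> ?G)" using V(1) W0(1) chart_openin[OF id] oG by (intro openin_Int)
  obtain W where W: "openin (mtop N) W" "y \<in> W" "W \<subseteq> V \<inter> W0 \<inter> fst d \<inter> ?G" "connectedin (mtop N) W"
    by (rule punctured_half_ball[OF oV]) (use V(2) W0(2) d(2) yG in blast)+
  have WN: "W \<subseteq> points N" using openin_subset[OF W(1)] .
  have dW: "diffeo N W M (q ` W) q" by (rule diffeo_restrict[OF N M W0(3)]) (use W(3) in blast)
  have bW: "q z \<in> fst c \<and> (u \<bullet> snd d z = 0 \<longleftrightarrow> q z \<in> S)" if z: "z \<in> W" for z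
  proof -
    have zz: "z \<in> fst d" "q z \<in> fst c" "q z \<notin> \<Union> (\<T> - {S})" "q z \<notin> boundary M" "z \<in> points N" using z W(3) by blast+
    have "u \<bullet> snd d z = 0 \<longleftrightarrow> q z \<in> \<Union>\<T>" using half_chart_boundary[OF N d(1,3) zz(1)] boundary_off_T[OF zz(5)] zz(4) by blast
    moreover have "q z \<in> \<Union>\<T> \<longleftrightarrow> q z \<in> S" using zz(3) S by blast
    ultimately show ?thesis using zz(2) by blast
  qed
  have yd: "y \<in> W" "y \<in> fst d" "q y \<in> fst c" using W(2) d(2) c(2) by auto
  obtain R \<kappa> where R: "open R" "snd c (q y) \<in> R" "\<forall>k. Ck_on k R \<kappa>"
    and \<kappa>: "\<And>z. z \<in> W \<Longrightarrow> z \<in> fst d \<Longrightarrow> q z \<in> fst c \<Longrightarrow> snd c (q z) \<in> R \<Longrightarrow> \<kappa> (snd c (q z)) = snd d z"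
    and K\<kappa>: "\<And>z w. z \<in> W \<Longrightarrow> z \<in> fst d \<Longrightarrow> q z \<in> fst c \<Longrightarrow> snd c (q z) \<in> R \<Longrightarrow>
       frechet_derivative \<kappa> (at (snd c (q z))) (loc_deriv d c q z w) = w"
    using diffeo_left_inverse[OF N M W(1) dW d(1) c(1) yd] by metis
  obtain Y0 where Y0: "openin (mtop M) Y0" "q y \<in> Y0" "\<And>x. x \<in> \<Union>\<T> \<Longrightarrow> x \<in> Y0 \<Longrightarrow> \<exists>z\<in>W. q z = x"
    using q_onto_near[OF y(1) yT W(1,2)] by blast
  define Y where "Y = {x \<in> fst c. snd c x \<in> R} \<inter> Y0"
  have oY: "openin (mtop M) Y" unfolding Y_def using chart_preimage[OF ic R(1)] Y0(1) by (rule openin_Int)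
  have yY: "q y \<in> Y" using c(2) R(2) Y0(2) by (simp add: Y_def)
  define K where "K x = frechet_derivative \<kappa> (at (snd c x))" for x
  define \<nu> where "\<nu> x = (\<Sum>b\<in>Basis. (u \<bullet> K x b) *\<^sub>R b)" for x
  have Kd: "(\<kappa> has_derivative K x) (at (snd c x))" if "x \<in> Y" for x
    unfolding K_def by (rule Ck_on_has_derivative[OF R(3,1)]) (use that in \<open>simp add: Y_def\<close>)
  have \<nu>: "\<nu> x \<bullet> v = u \<bullet> K x v" if "x \<in> Y" for x v
  proof -
    have "K x v = (\<Sum>b\<in>Basis. (v \<bullet> b) *\<^sub>R K x b)"
      by (rule linear_Basis_expand[OF has_derivative_bounded_linear[OF Kd[OF that]]])
    then show ?thesis by (simp add: \<nu>_def inner_sum_left inner_sum_right inner_commute mult.commute)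
  qed
  let ?D = "\<lambda>z. loc_deriv d c q z"
  have zY: "z \<in> fst d" "q z \<in> fst c" "snd c (q z) \<in> R" if "z \<in> W" "q z \<in> Y" for z
    using that W(3) by (auto simp: Y_def)
  have KD: "K (q z) (?D z w) = w" if z: "z \<in> W" "q z \<in> Y" for z w
    unfolding K_def by (rule K\<kappa>[OF z(1) zY[OF z]])
  have linD: "linear (?D z)" if z: "z \<in> W" "q z \<in> Y" for z
    by (rule bounded_linear.linear[OF loc_deriv_linear[OF N M q_smooth openin_topspace d(1) c(1) _ zY(1,2)[OF z]]]) (use z WN in blast)
  \<comment> \<open>\<open>M\<close> and \<open>N\<close> have the same dimension, so the left
    inverse \<open>K (q z)\<close> of \<open>?D z\<close> is also a right inverse.\<close>
  have DK: "?D z (K (q z) v) = v" if z: "z \<in> W" "q z \<in> Y" for z v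
  proof -
    have "inj (?D z)" by (rule inj_on_inverseI[where g = "K (q z)"]) (rule KD[OF z])
    then have "surj (?D z)" using linear_inj_imp_surj[OF linD[OF z]] by blast
    then obtain w where w: "v = ?D z w" by (rule surjE)
    show ?thesis unfolding w KD[OF z] ..
  qed
  have preim: "\<exists>z\<in>W. q z = x" if "x \<in> S" "x \<in> Y" for x using Y0(3)[of x] that S by (auto simp: Y_def)
  \<comment> \<open>Along a curve in \<open>S\<close> the function
    \<open>u \<bullet> \<kappa>\<close> vanishes near time 0, hence so does its derivative.\<close>
  have tan1: "\<nu> x \<bullet> v = 0" if x: "x \<in> S \<inter> Y" and v: "v \<in> tangent_coords S c x" for x v
  proof -
    obtain \<gamma> where \<gamma>: "\<gamma> 0 = x" "\<gamma> ` UNIV \<subseteq> S \<inter> fst c" "((\<lambda>t. snd c (\<gamma> t)) has_vector_derivative v) (at 0 within UNIV)"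
      using v unfolding tangent_coords_eq curve_coords_def by blast
    have \<gamma>c: "\<gamma> ` UNIV \<subseteq> fst c" "\<gamma> 0 \<in> Y" using \<gamma>(1,2) x by blast+
    obtain J where J: "open J" "0 \<in> J" "\<gamma> ` (UNIV \<inter> J) \<subseteq> Y" by (rule curve_nbhd[OF ic \<gamma>c(1) UNIV_I \<gamma>(3) oY \<gamma>c(2)])
    have z: "u \<bullet> \<kappa> (snd c (\<gamma> t)) = 0" if t: "t \<in> J" for t
    proof -
      have g: "\<gamma> t \<in> S" "\<gamma> t \<in> Y" using J(3) \<gamma>(2) t by blast+
      obtain z where z: "z \<in> W" "q z = \<gamma> t" using preim[OF g] by blast
      have zY': "q z \<in> Y" using z g by simp
      have "\<kappa> (snd c (q z)) = snd d z" by (rule \<kappa>[OF z(1) zY[OF z(1) zY']])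
      then show ?thesis using bW[OF z(1)] z(2) g(1) by simp
    qed
    have xY: "x \<in> Y" using x by blast
    have "((\<lambda>t. u \<bullet> \<kappa> (snd c (\<gamma> t))) has_real_derivative u \<bullet> K x v) (at 0 within UNIV)"
      by (rule curve_function_derivative[OF _ \<gamma>(3)]) (use Kd[OF xY] \<gamma>(1) in simp)
    moreover have "((\<lambda>t. u \<bullet> \<kappa> (snd c (\<gamma> t))) has_real_derivative 0) (at 0 within UNIV)"
    proof -
      have "((\<lambda>_. 0) has_derivative (*) 0) (at (0::real) within UNIV)"
        using DERIV_const[of "0::real" "at 0 within UNIV"] unfolding has_field_derivative_def .
      then show ?thesis unfolding has_field_derivative_def
        by (rule has_derivative_local_cong[THEN iffD1, OF J(1,2) UNIV_I, rotated -1]) (use z in auto)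
    qed
    ultimately have "u \<bullet> K x v = 0" using DERIV_unique by blast
    then show ?thesis using \<nu>[OF xY] by simp
  qed
  \<comment> \<open>Lines in the half-space chart are pushed forward by \<open>q\<close>. They run
    in \<open>S\<close> when \<open>u \<bullet> w = 0\<close> and in the image of \<open>W\<close>
    in any case, which yields both the tangent vectors of \<open>S\<close> and the inward
    vectors.\<close>
  have curves: "?D z w \<in> curve_coords I X c (q z)"
    if z: "z \<in> W" "q z \<in> S \<inter> Y" and I: "0 \<in> I" "\<And>t. t \<in> I \<Longrightarrow> 0 \<le> t * (u \<bullet> w)"
      and X: "\<And>z'. z' \<in> W \<Longrightarrow> (u \<bullet> w = 0 \<Longrightarrow> q z' \<in> S) \<Longrightarrow> q z' \<in> X" for z w I X
  proof -
    have zS: "q z \<in> S" "q z \<in> Y" using z by auto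
    note zz = zY[OF z(1) zS(2)]
    have "w \<in> curve_coords I {z \<in> W \<inter> fst d. u \<bullet> w = 0 \<longrightarrow> u \<bullet> snd d z = 0} d z"
      by (rule half_chart_curve[OF N d(1,3) W(1) z(1) zz(1) _ I]) (use bW[OF z(1)] zS(1) in blast)
    then show ?thesis
    proof (rule curve_coords_smooth[OF N M q_smooth openin_topspace d(1) c(1) _ zz(1,2) _ I(1), rotated -1])
      show "z \<in> points N" using WN z by blast
      show "q ` ({z \<in> W \<inter> fst d. u \<bullet> w = 0 \<longrightarrow> u \<bullet> snd d z = 0} \<inter> points N) \<subseteq> X" using X bW by blast
    qed
  qed
  have tan2: "v \<in> tangent_coords S c x" if x: "x \<in> S \<inter> Y" and v: "\<nu> x \<bullet> v = 0" for x v
  proof -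
    obtain z where z: "z \<in> W" "q z = x" using preim x by blast
    have zx: "q z \<in> S \<inter> Y" "q z \<in> Y" using z x by auto
    let ?w = "K x v"
    have w: "u \<bullet> ?w = 0" using \<nu>[of x v] x v by simp
    have "?D z ?w \<in> curve_coords UNIV S c (q z)" by (rule curves[OF z(1) zx(1)]) (use w in auto)
    moreover have "?D z ?w = v" using DK[OF z(1) zx(2)] z(2) by simp
    ultimately show ?thesis using z(2) by (simp add: tangent_coords_eq)
  qed
  have \<nu>ne: "\<nu> x \<noteq> 0" if x: "x \<in> S \<inter> Y" for x
  proof -
    obtain z where z: "z \<in> W" "q z = x" using preim x by blast
    have zx: "q z \<in> Y" using z x by auto
    have "\<nu> x \<bullet> ?D z u = u \<bullet> u" using \<nu>[of x "?D z u"] KD[OF z(1) zx, of u] z(2) x by simp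
    moreover have "u \<noteq> 0" using d(3) by (simp add: half_chart_def)
    ultimately show ?thesis by auto
  qed
  have cont: "continuous_map (subtopology (mtop M) (S \<inter> Y)) euclidean \<nu>"
  proof -
    have "continuous_map (subtopology (mtop M) (S \<inter> Y)) euclidean (snd c)"
      by (rule continuous_map_from_subtopology_mono[OF chart_continuous[OF ic]]) (auto simp: Y_def)
    then have s: "continuous_map (subtopology (mtop M) (S \<inter> Y)) (top_of_set R) (snd c)"
      unfolding continuous_map_in_subtopology by (auto simp: Y_def)
    have "continuous_map (subtopology (mtop M) (S \<inter> Y)) euclidean (\<lambda>x. K x b)" for b
    proof -
      have "continuous_map (top_of_set R) euclidean (\<lambda>p. frechet_derivative \<kappa> (at p) b)"
        using Ck_on_derivative_continuous[OF R(3), of b] by simp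
      from continuous_map_compose[OF s this] show ?thesis by (simp add: o_def K_def)
    qed
    then show ?thesis unfolding \<nu>_def continuous_map_atin[where Y = euclidean] limitin_canonical_iff
      by (auto intro!: tendsto_intros)
  qed
  have con: "conormal M S c Y \<nu>" unfolding conormal_def
    proof (intro conjI ballI oY cont)
      show "Y \<subseteq> fst c" by (auto simp: Y_def)
      fix x assume x: "x \<in> S \<inter> Y"
      show "\<nu> x \<noteq> 0" by (rule \<nu>ne[OF x])
      show "tangent_coords S c x = {v. \<nu> x \<bullet> v = 0}" using tan1[OF x] tan2[OF x] by blast
    qed
    have inward: "v \<in> curve_coords {0..} (q ` W) c (q z)" if z: "z \<in> W" "q z \<in> S \<inter> Y" and v: "0 < \<nu> (q z) \<bullet> v" for z v
    proof -
      have zz: "q z \<in> Y" using z by blast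
      have "0 < u \<bullet> K (q z) v" using \<nu>[OF zz] v by simp
      then have "?D z (K (q z) v) \<in> curve_coords {0..} (q ` W) c (q z)" by (intro curves[OF z]) auto
      then show ?thesis using DK[OF z(1) zz] by simp
    qed
    \<comment> \<open>On the image of \<open>W\<close> near \<open>x\<close> the function
      \<open>u \<bullet> \<kappa>\<close> is nonnegative, and it vanishes at \<open>x\<close>. A
      negative derivative along the curve would contradict this for small positive times.\<close>
    have outward: "0 \<le> \<nu> x \<bullet> v"
      if x: "x \<in> S \<inter> Y" and \<gamma>: "\<gamma> 0 = x" "\<gamma> ` {0..} \<subseteq> fst c" and J: "open J" "0 \<in> J" "\<gamma> ` ({0..} \<inter> J) \<subseteq> q ` W"
        and v: "((\<lambda>t. snd c (\<gamma> t)) has_vector_derivative v) (at 0 within {0..})" for x \<gamma> v J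
    proof (rule ccontr)
      have xY: "x \<in> Y" "\<gamma> 0 \<in> Y" using x \<gamma>(1) by auto
      assume "\<not> 0 \<le> \<nu> x \<bullet> v"
      then have neg: "u \<bullet> K x v < 0" using \<nu>[OF xY(1)] by simp
      have "((\<lambda>t. u \<bullet> \<kappa> (snd c (\<gamma> t))) has_real_derivative u \<bullet> K x v) (at 0 within {0..})"
        by (rule curve_function_derivative[OF _ v]) (use Kd[OF xY(1)] \<gamma>(1) in simp)
      from has_real_derivative_neg_dec_right[OF this neg]
      obtain e where e: "0 < e" "\<And>h. 0 < h \<Longrightarrow> 0 + h \<in> {0..} \<Longrightarrow> h < e \<Longrightarrow> u \<bullet> \<kappa> (snd c (\<gamma> (0 + h))) < u \<bullet> \<kappa> (snd c (\<gamma> 0))" by blast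
      have z0: "(0::real) \<in> {0..}" by simp
      obtain J' where J': "open J'" "0 \<in> J'" "\<gamma> ` ({0..} \<inter> J') \<subseteq> Y" by (rule curve_nbhd[OF ic \<gamma>(2) z0 v oY xY(2)])
      have val: "0 \<le> u \<bullet> \<kappa> (snd c (\<gamma> t))" if t: "t \<in> {0..}" "t \<in> J" "t \<in> J'" for t
      proof -
        have "\<gamma> t \<in> q ` W" using J(3) t by blast
        then obtain z where z: "z \<in> W" "\<gamma> t = q z" by blast
        have "\<gamma> t \<in> Y" using J'(3) t by blast
        then have zz: "q z \<in> Y" using z(2) by simp
        have "\<kappa> (snd c (q z)) = snd d z" by (rule \<kappa>[OF z(1) zY[OF z(1) zz]])
        then show ?thesis using half_chart_nonneg[OF d(3) zY(1)[OF z(1) zz]] z(2) by simp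
      qed
      have v0: "u \<bullet> \<kappa> (snd c (\<gamma> 0)) = 0"
      proof -
        obtain z where z: "z \<in> W" "q z = x" using preim x by blast
        have zz: "q z \<in> Y" using z xY by simp
        have "\<kappa> (snd c (q z)) = snd d z" by (rule \<kappa>[OF z(1) zY[OF z(1) zz]])
        then show ?thesis using bW[OF z(1)] z(2) x \<gamma>(1) by simp
      qed
      have "open (J \<inter> J')" "0 \<in> J \<inter> J'" using J J' by auto
      then obtain r where r: "0 < r" "ball 0 r \<subseteq> J \<inter> J'" using openE by blast
      define h where "h = min (r/2) (e/2)"
      have h: "0 < h" "h < e" "h \<in> ball 0 r" using r(1) e(1) by (auto simp: h_def)
      have "h \<in> J" "h \<in> J'" using h(3) r(2) by blast+
      then have "0 \<le> u \<bullet> \<kappa> (snd c (\<gamma> h))" using val[of h] h(1) by simp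
      moreover have "u \<bullet> \<kappa> (snd c (\<gamma> (0 + h))) < u \<bullet> \<kappa> (snd c (\<gamma> 0))" using e(2)[of h] h by simp
      ultimately show False using v0 by simp
    qed
  show thesis
  proof (rule that[OF d(1,3) W(1,2) _ _ W(4) dW _ con yY])
    show "W \<subseteq> V" "W \<subseteq> fst d" using W(3) by blast+
    show "\<forall>z\<in>W. q z \<in> fst c \<and> (u \<bullet> snd d z = 0 \<longleftrightarrow> q z \<in> S)" using bW by (rule ballI)
    show "\<forall>x\<in>S \<inter> Y. \<exists>z\<in>W. q z = x" by (intro ballI preim) simp_all
  qed (intro ballI allI impI inward outward; assumption)+
qed

lemma conormal_surface_T:
  assumes S: "S \<in> \<T>"
  shows "conormal_surface M S"
proof
  show "manifold M" by (rule M)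
  show "S \<subseteq> points M" by (rule S_points[OF S])
  show "connectedin (mtop M) S" by (rule conn_S[OF S])
  show "S \<noteq> {}" by (rule ne_S[OF S])
  fix x c assume x: "x \<in> S" and c: "c \<in> charts M" "x \<in> fst c"
  have "x \<in> \<Union>\<T>" using x S by blast
  then obtain y where y: "y \<in> points N" "q y = x" using fibre_pair by metis
  have yx: "q y \<in> S" "q y \<in> fst c" using x c y by auto
  show "\<exists>Y \<nu>. conormal M S c Y \<nu> \<and> x \<in> Y"
    by (rule local_picture[OF S y(1) yx(1) c(1) yx(2) openin_topspace y(1)]) (use y(2) in blast)
qed

text \<open>For a torus with different pieces on its two sides: the vectors pointing into the piece \<open>C\<close>, as
  one-sided derivatives of curves in \<open>q ` C\<close>.\<close>

definition side :: "'a set \<Rightarrow> 'b set \<Rightarrow> ('a, 'e) tangent set" where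
  "side S C = {(x, c, v). x \<in> S \<and> c \<in> charts M \<and> x \<in> fst c \<and> v \<notin> tangent_coords S c x \<and> v \<in> curve_coords {0..} (q ` C) c x}"

lemma push_side_subset:
  assumes f: "f \<in> Diff M" and S: "S \<subseteq> points M" "f ` S = S" and C: "q ` C \<subseteq> points M" "f ` q ` C = q ` C"
  shows "push M f (side S C) \<subseteq> side S C"
proof
  fix t assume "t \<in> push M f (side S C)"
  then obtain x c v c' where t: "t = (f x, c', loc_deriv c c' f x v)" "(x, c, v) \<in> side S C" "c' \<in> charts M" "f x \<in> fst c'" by (rule pushE)
  then have x: "x \<in> S" "c \<in> charts M" "x \<in> fst c" "v \<notin> tangent_coords S c x" "v \<in> curve_coords {0..} (q ` C) c x"
    by (auto simp: side_def)
  have z: "(0::real) \<in> {0..}" by simp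
  have "loc_deriv c c' f x v \<in> curve_coords UNIV (f ` S) c' (f x) \<longleftrightarrow> v \<in> curve_coords UNIV S c x"
    by (rule curve_coords_Diff[OF M f S(1) UNIV_I x(2) t(3) x(3) t(4)])
  moreover have "loc_deriv c c' f x v \<in> curve_coords {0..} (f ` q ` C) c' (f x) \<longleftrightarrow> v \<in> curve_coords {0..} (q ` C) c x"
    by (rule curve_coords_Diff[OF M f C(1) z x(2) t(3) x(3) t(4)])
  moreover have "f x \<in> S" using x(1) S(2) by blast
  ultimately show "t \<in> side S C" using t x S(2) C(2) by (simp add: side_def tangent_coords_eq)
qed

text \<open>By \<open>uniq\<close> a single sheet of \<open>C\<close> lies over \<open>S\<close>.
  Near each point of \<open>S\<close> the image of \<open>C\<close> is therefore the image of one
  half-ball, and its inward vectors form the positive side of a conormal field. If both sheets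
  belonged to \<open>C\<close>, both sides would point into it.\<close>

lemma side_normal_orientation:
  assumes S: "S \<in> \<T>" and C: "C \<in> components_mfd N" and ex: "\<And>x. x \<in> S \<Longrightarrow> \<exists>y\<in>C. q y = x"
    and uniq: "\<And>y y'. y \<in> C \<Longrightarrow> y' \<in> C \<Longrightarrow> q y = q y' \<Longrightarrow> q y \<in> S \<Longrightarrow> y = y'"
  shows "normal_orientation M S (side S C)"
  unfolding normal_orientation_def
proof (intro conjI ballI)
  have CN: "C \<subseteq> points N" using connected_components_of_subset[OF C] .
  have qC: "q ` C \<subseteq> points M" using CN q_in by blast
  show "side S C \<subseteq> {(x, c, v). x \<in> S \<and> c \<in> charts M \<and> x \<in> fst c}" by (auto simp: side_def)
  show "push M (\<lambda>x. x) (side S C) \<subseteq> side S C"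
  proof
    fix t assume "t \<in> push M (\<lambda>x. x) (side S C)"
    then obtain x c v c' where t: "t = (x, c', loc_deriv c c' (\<lambda>x. x) x v)" "(x, c, v) \<in> side S C" "c' \<in> charts M" "x \<in> fst c'"
      by (rule pushE)
    then have x: "x \<in> S" "c \<in> charts M" "x \<in> fst c" by (auto simp: side_def)
    have px: "x \<in> points M" using x(1) S_points[OF S] by blast
    let ?i = "\<lambda>x\<in>points M. x"
    have i: "?i ` X = X" if "X \<subseteq> points M" for X using that by (auto simp: image_iff subset_iff)
    have "(?i x, c', loc_deriv c c' ?i x v) \<in> push M ?i (side S C)" by (rule pushI[OF t(2,3)]) (use px t(4) in simp)
    then have "(?i x, c', loc_deriv c c' ?i x v) \<in> side S C"
      using push_side_subset[OF Diff_ident[OF M] S_points[OF S] i[OF S_points[OF S]] qC i[OF qC]] by blast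
    then show "t \<in> side S C" using loc_deriv_Diff_ident[OF M x(2) t(3) x(3) t(4)] t(1) px by simp
  qed
  fix c x assume c: "c \<in> charts M" and x: "x \<in> S \<inter> fst c"
  then obtain y where y: "y \<in> C" "q y = x" using ex by blast
  have xT: "x \<in> \<Union>\<T>" using x S by blast
  have yN: "y \<in> points N" using y CN by blast
  have cx: "q y \<in> S" "q y \<in> fst c" using x y by auto
  obtain d u W Y \<nu> where L0: "d \<in> charts N" "half_chart d u" and L: "openin (mtop N) W" "y \<in> W"
    and L3: "W \<subseteq> points N" "W \<subseteq> fst d" and Wc: "connectedin (mtop N) W"
    and L4: "diffeo N W M (q ` W) q" "\<forall>z\<in>W. q z \<in> fst c \<and> (u \<bullet> snd d z = 0 \<longleftrightarrow> q z \<in> S)"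
    and L5: "conormal M S c Y \<nu>" "q y \<in> Y" "\<forall>x\<in>S \<inter> Y. \<exists>z\<in>W. q z = x"
    and L1': "\<forall>z\<in>W. \<forall>v. q z \<in> S \<inter> Y \<longrightarrow> 0 < \<nu> (q z) \<bullet> v \<longrightarrow> v \<in> curve_coords {0..} (q ` W) c (q z)"
    and L2': "\<forall>x\<in>S \<inter> Y. \<forall>\<gamma> v J. \<gamma> 0 = x \<longrightarrow> \<gamma> ` {0..} \<subseteq> fst c \<longrightarrow> open J \<longrightarrow> 0 \<in> J \<longrightarrow> \<gamma> ` ({0..} \<inter> J) \<subseteq> q ` W \<longrightarrow>
       ((\<lambda>t. snd c (\<gamma> t)) has_vector_derivative v) (at 0 within {0..}) \<longrightarrow> 0 \<le> \<nu> x \<bullet> v"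
    using local_picture[OF S yN cx(1) c cx(2) openin_topspace yN] .
  note L1 = L1'[rule_format] and L2 = L2'[rule_format]
  have WC: "W \<subseteq> C" by (rule connected_components_of_maximal[OF C Wc]) (use y(1) L(2) in \<open>auto simp: disjnt_def\<close>)
  text \<open>Points of \<open>C\<close> over a neighbourhood of \<open>x\<close> lie in \<open>W\<close>, since the other sheet belongs to another component.\<close>
  obtain Y' where Y': "openin (mtop M) Y'" "x \<in> Y'" "\<And>z. z \<in> C \<Longrightarrow> q z \<in> Y' \<Longrightarrow> z \<in> W"
  proof -
    obtain a b where ab: "a \<noteq> b" "{z \<in> points N. q z = x} = {a, b}" "a \<in> points N" "b \<in> points N" "q a = x" "q b = x"
      using fibre_pair[OF xT] .
    have "y \<in> {z \<in> points N. q z = x}" using y yN by simp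
    then have "y = a \<or> y = b" unfolding ab(2) by simp
    then obtain e where e: "{z \<in> points N. q z = x} = {y, e}" "e \<noteq> y" "e \<in> points N" "q e = x"
    proof
      assume "y = a"
      then show thesis using that[of b] ab by simp
    next
      assume "y = b"
      moreover have "{z \<in> points N. q z = x} = {b, a}" unfolding ab(2) by (rule insert_commute)
      ultimately show thesis using that[of a] ab(1,3,5) by simp
    qed
    have eC: "e \<notin> C"
    proof
      assume "e \<in> C"
      then have "y = e" by (intro uniq[OF y(1)]) (use y(2) e(4) cx(1) in auto)
      then show False using e(2) by simp
    qed
    obtain C2 where C2: "C2 \<in> components_mfd N" "e \<in> C2" using component_at[OF e(3)] .
    obtain W2 where W2: "openin (mtop N) W2" "e \<in> W2" "connectedin (mtop N) W2" using punctured_half_ball[OF openin_topspace e(3)] by metis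
    have "W2 \<subseteq> C2" by (rule connected_components_of_maximal[OF C2(1) W2(3)]) (use C2(2) W2(2) in \<open>auto simp: disjnt_def\<close>)
    moreover have "C \<inter> C2 = {}" using connected_components_of_overlap[OF C C2(1)] C2(2) eC by blast
    ultimately have dis: "C \<inter> W2 = {}" by blast
    have "{z \<in> points N. q z = x} \<subseteq> W \<union> W2" unfolding e(1) using L(2) W2(2) by simp
    moreover have "x \<in> points M" using x S_points[OF S] by blast
    ultimately obtain Y' where Y': "openin (mtop M) Y'" "x \<in> Y'" "\<And>z. z \<in> points N \<Longrightarrow> q z \<in> Y' \<Longrightarrow> z \<in> W \<union> W2"
      using fibre_nbhd[OF openin_Un[OF L(1) W2(1)]] by blast
    show thesis by (rule that[OF Y'(1,2)]) (use Y'(3) dis CN in blast)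
  qed
  have xY: "x \<in> Y" using L5(2) y(2) by simp
  have oY: "openin (mtop M) Y" using L5(1) by (simp add: conormal_def)
  have con: "conormal M S c (Y \<inter> Y') \<nu>" by (rule conormal_subset[OF L5(1) openin_Int[OF oY Y'(1)]]) blast
  show "\<exists>W n. openin (mtop M) W \<and> x \<in> W \<and> W \<subseteq> fst c \<and> continuous_map (subtopology (mtop M) (S \<inter> W)) euclidean n \<and>
        (\<forall>y\<in>S \<inter> W. n y \<notin> tangent_coords S c y \<and>
           {v. (y, c, v) \<in> side S C} = {t + a *\<^sub>R n y | t a. t \<in> tangent_coords S c y \<and> 0 < a})"
  proof (intro exI[of _ "Y \<inter> Y'"] exI[of _ \<nu>] conjI ballI)
    show "openin (mtop M) (Y \<inter> Y')" "Y \<inter> Y' \<subseteq> fst c" "continuous_map (subtopology (mtop M) (S \<inter> (Y \<inter> Y'))) euclidean \<nu>"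
      using con by (simp_all add: conormal_def)
    show "x \<in> Y \<inter> Y'" using xY Y'(2) by blast
    fix x' assume x': "x' \<in> S \<inter> (Y \<inter> Y')"
    have ne: "\<nu> x' \<noteq> 0" and tan: "tangent_coords S c x' = {v. \<nu> x' \<bullet> v = 0}" using con x' by (auto simp: conormal_def)
    show "\<nu> x' \<notin> tangent_coords S c x'" unfolding tan using ne by simp
    have xc: "x' \<in> fst c" using x' L5(1) by (auto simp: conormal_def)
    have ntan: "v \<in> tangent_coords S c x' \<longleftrightarrow> \<nu> x' \<bullet> v = 0" for v unfolding tan by simp
    have sd: "(x', c, v) \<in> side S C \<longleftrightarrow> 0 < \<nu> x' \<bullet> v" for v
    proof
      assume "(x', c, v) \<in> side S C"
      then have v: "\<nu> x' \<bullet> v \<noteq> 0" "v \<in> curve_coords {0..} (q ` C) c x'" by (auto simp: side_def ntan)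
      then obtain \<gamma> where \<gamma>: "\<gamma> 0 = x'" "\<gamma> ` {0..} \<subseteq> q ` C \<inter> fst c" "((\<lambda>t. snd c (\<gamma> t)) has_vector_derivative v) (at 0 within {0..})"
        unfolding curve_coords_def by blast
      have \<gamma>c: "\<gamma> ` {0..} \<subseteq> fst c" "\<gamma> 0 \<in> Y'" "(0::real) \<in> {0..}" using \<gamma>(1,2) x' by auto
      obtain J where J: "open J" "0 \<in> J" "\<gamma> ` ({0..} \<inter> J) \<subseteq> Y'"
        by (rule curve_nbhd[OF manifold_chart[OF M c] \<gamma>c(1,3) \<gamma>(3) Y'(1) \<gamma>c(2)])
      have "\<gamma> ` ({0..} \<inter> J) \<subseteq> q ` W"
      proof
        fix p assume "p \<in> \<gamma> ` ({0..} \<inter> J)"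
        then have "p \<in> q ` C" "p \<in> Y'" using \<gamma>(2) J(3) by blast+
        then show "p \<in> q ` W" using Y'(3) by blast
      qed
      then have "0 \<le> \<nu> x' \<bullet> v" by (intro L2[OF _ \<gamma>(1) \<gamma>c(1) J(1,2) _ \<gamma>(3)]) (use x' in auto)
      then show "0 < \<nu> x' \<bullet> v" using v(1) by simp
    next
      assume v: "0 < \<nu> x' \<bullet> v"
      obtain z where z: "z \<in> W" "q z = x'" using bspec[OF L5(3), of x'] x' by blast
      have zS: "q z \<in> S \<inter> Y" "0 < \<nu> (q z) \<bullet> v" using z x' v by auto
      have "v \<in> curve_coords {0..} (q ` W) c x'" using L1[OF z(1) zS] z(2) by simp
      then have "v \<in> curve_coords {0..} (q ` C) c x'" using WC unfolding curve_coords_def by blast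
      then show "(x', c, v) \<in> side S C" using v x' c xc by (simp add: side_def ntan)
    qed
    show "{v. (x', c, v) \<in> side S C} = {t + a *\<^sub>R \<nu> x' | t a. t \<in> tangent_coords S c x' \<and> 0 < a}"
      unfolding sd tan by (rule half_space_rays[OF ne])
  qed
qed

end

section \<open>Orientations of surfaces\<close>

text \<open>The triple product is the determinant of the three vectors, so a linear map multiplies
  it by its own determinant.\<close>

lemma det3_transform:
  fixes A :: "real^3 \<Rightarrow> real^3"
  assumes "linear A"
  shows "cross3 (A b1) (A b2) \<bullet> A v = det (matrix A) * (cross3 b1 b2 \<bullet> v)"
proof -
  have A: "A w = matrix A *v w" for w using matrix_vector_mul(2)[OF assms] by metis
  have "cross3 (m *v b1) (m *v b2) \<bullet> (m *v v) = det m * (cross3 b1 b2 \<bullet> v)" for m :: "real^3^3"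
    unfolding det_3 cross3_def inner_vec_def matrix_vector_mult_def by (simp add: sum_3 algebra_simps)
  then show ?thesis using A by metis
qed

text \<open>The cross product is bilinear and alternating, so changing the parameters of a plane
  scales the cross product of its frame by a determinant.\<close>

lemma det2_transform:
  fixes B :: "real^2 \<Rightarrow> real^3" and G :: "real^2 \<Rightarrow> real^2"
  assumes B: "linear B"
  shows "cross3 (B (G (axis 1 1))) (B (G (axis 2 1))) = det (matrix G) *\<^sub>R cross3 (B (axis 1 1)) (B (axis 2 1))"
proof -
  have e: "w = w $ 1 *\<^sub>R axis 1 1 + w $ 2 *\<^sub>R axis 2 1" for w :: "real^2"
    by (simp add: vec_eq_iff forall_2 axis_def)
  have Bw: "B w = w $ 1 *\<^sub>R B (axis 1 1) + w $ 2 *\<^sub>R B (axis 2 1)" for w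
    using arg_cong[OF e[of w], of B] B by (simp add: linear_add linear_scale)
  have m: "matrix G $ i $ j = G (axis j 1) $ i" for i j by (simp add: matrix_def)
  have "cross3 (a1 *\<^sub>R x + a2 *\<^sub>R y) (c1 *\<^sub>R x + c2 *\<^sub>R y) = (a1 * c2 - c1 * a2) *\<^sub>R cross3 x y" for a1 a2 c1 c2 :: real and x y
    by (simp add: cross3_simps forall_3)
  then show ?thesis unfolding Bw[of "G (axis 1 1)"] Bw[of "G (axis 2 1)"] det_2 m by simp
qed

lemma cross3_ne:
  fixes B :: "real^2 \<Rightarrow> real^3"
  assumes B: "linear B" and inj: "inj B"
  shows "cross3 (B (axis 1 1)) (B (axis 2 1)) \<noteq> 0"
proof
  assume "cross3 (B (axis 1 1)) (B (axis 2 1)) = 0"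
  then have "collinear {0, B (axis 1 1), B (axis 2 1)}" by (simp add: cross_eq_0)
  then have "B (axis 1 1) = B 0 \<or> B (axis 2 1) = B 0 \<or> (\<exists>k. B (axis 2 1) = B (k *\<^sub>R axis 1 1))"
    using linear_0[OF B] by (auto simp: collinear_lemma linear_scale[OF B])
  then have "axis 1 1 = (0::real^2) \<or> axis 2 1 = (0::real^2) \<or> (\<exists>k. axis 2 1 = (k *\<^sub>R axis 1 1 :: real^2))"
    using inj by (auto dest: injD)
  then show False by (auto simp: vec_eq_iff forall_2 axis_def)
qed

text \<open>In three dimensions the normals of a plane form a line.\<close>

lemma cross3_orthogonal:
  fixes \<nu> :: "real^3"
  assumes "\<nu> \<noteq> 0" "cross3 b1 b2 \<noteq> 0" "\<nu> \<bullet> b1 = 0" "\<nu> \<bullet> b2 = 0"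
  shows "cross3 b1 b2 \<bullet> v = 0 \<longleftrightarrow> \<nu> \<bullet> v = 0"
proof -
  have "cross3 \<nu> (cross3 b1 b2) = 0" using assms(3,4) by (simp add: Lagrange)
  then have "collinear {0, \<nu>, cross3 b1 b2}" by (simp add: cross_eq_0)
  then obtain k where "cross3 b1 b2 = k *\<^sub>R \<nu>" using assms(1,2) by (auto simp: collinear_lemma)
  then show ?thesis using assms(2) by auto
qed

lemma tendsto_cross3:
  assumes "(f \<longlongrightarrow> a) F" "(g \<longlongrightarrow> b) F"
  shows "((\<lambda>x. cross3 (f x) (g x)) \<longlongrightarrow> cross3 a b) F"
proof (rule vec_tendstoI)
  fix i :: 3
  have "((\<lambda>x. f x $ j) \<longlongrightarrow> a $ j) F" "((\<lambda>x. g x $ j) \<longlongrightarrow> b $ j) F" for j using assms by (auto intro: tendsto_vec_nth)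
  then show "((\<lambda>x. cross3 (f x) (g x) $ i) \<longlongrightarrow> cross3 a b $ i) F"
    using exhaust_3[of i] by (elim disjE) (simp_all add: cross3_def tendsto_diff tendsto_mult)
qed

text \<open>Identifies the bounding hyperplane of a half-space chart with the plane, which turns
  charts of the cut manifold into charts of the torus.\<close>

lemma plane_coords:
  fixes u :: "real^3"
  assumes "u \<noteq> 0"
  obtains L :: "real^3 \<Rightarrow> real^2" and J :: "real^2 \<Rightarrow> real^3" where "linear L" "linear J" "\<forall>a. L (J a) = a" "\<forall>a. u \<bullet> J a = 0" "\<forall>w. u \<bullet> w = 0 \<longrightarrow> J (L w) = w"
proof -
  have d: "dim {w. u \<bullet> w = 0} = dim (UNIV :: (real^2) set)" using dim_hyperplane[OF assms] by simp
  obtain f :: "real^3 \<Rightarrow> real^2" and g where fg: "linear f" "linear g" "g ` UNIV = {w. u \<bullet> w = 0}"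
    "\<And>x. x \<in> {w. u \<bullet> w = 0} \<Longrightarrow> g (f x) = x" "\<And>x. x \<in> UNIV \<Longrightarrow> f (g x) = x"
    by (rule isometries_subspaces[OF subspace_hyperplane subspace_UNIV d]) (rule that; assumption)
  have "g a \<in> {w. u \<bullet> w = 0}" for a unfolding fg(3)[symmetric] by (rule imageI) simp
  then have "\<forall>a. u \<bullet> g a = 0" by simp
  then show thesis using that[of f g] fg(1,2,4,5) by simp
qed

text \<open>The identity or the exchange of the two coordinates. Both are involutions, so a chart
  corrected by the map is restored by applying it again.\<close>

lemma coordinate_sign:
  fixes s :: real
  assumes "s \<noteq> 0"
  obtains \<sigma> :: "real^2 \<Rightarrow> real^2" where "linear \<sigma>" "\<forall>a. \<sigma> (\<sigma> a) = a" "0 < s * det (matrix \<sigma>)"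
proof (cases "0 < s")
  case True
  have "det (matrix (\<lambda>a::real^2. a)) = 1" using matrix_id by (simp add: id_def)
  then show ?thesis using that[of "\<lambda>a. a"] True by (simp add: linear_iff)
next
  case False
  let ?\<sigma> = "\<lambda>a::real^2. vector [a $ 2, a $ 1] :: real^2"
  have "linear ?\<sigma>" by (auto simp: linear_iff vec_eq_iff forall_2)
  moreover have "\<forall>a. ?\<sigma> (?\<sigma> a) = a" by (simp add: vec_eq_iff forall_2)
  moreover have "det (matrix ?\<sigma>) = - 1" by (simp add: det_2 matrix_def axis_def)
  ultimately show ?thesis using that[of ?\<sigma>] False assms by simp
qed

section \<open>Surfaces as manifolds with their own atlas\<close>

definition surface_chart :: "('a, 'e::euclidean_space) mfd \<Rightarrow> 'a set \<Rightarrow> ('a, real^2) chart \<Rightarrow> bool" where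
  "surface_chart M S a \<longleftrightarrow> openin (subtopology (mtop M) S) (fst a) \<and> open (cimg a) \<and> diffeo M (fst a) eucl (cimg a) (snd a)"

lemma surface_orientation_iff:
  "surface_orientation M S A \<longleftrightarrow> (\<forall>a\<in>A. surface_chart M S a) \<and> \<Union> (fst ` A) = S \<and> orientation_preserving_wrt A (\<lambda>x. x)"
  by (simp add: surface_orientation_def surface_chart_def)

locale surface_atlas =
  fixes M :: "('a, 'e::euclidean_space) mfd" and S :: "'a set" and A :: "('a, real^2) chart set"
  assumes M: "manifold M" and S: "S \<subseteq> points M" and surface_charts: "\<And>a. a \<in> A \<Longrightarrow> surface_chart M S a" and cover: "\<Union> (fst ` A) = S"
begin

text \<open>\<open>S\<close> as an abstract 2-manifold. The general calculus of charts then applies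
  to its inclusion into \<open>M\<close> and to the self-maps of \<open>M\<close> restricted to
  it.\<close>

definition L :: "('a, real^2) mfd" where "L = \<lparr>mtop = subtopology (mtop M) S, charts = A\<rparr>"

lemma L_simps: "mtop L = subtopology (mtop M) S" "charts L = A"
  by (simp_all add: L_def)

lemma points_L: "points L = S"
  using S by (auto simp: L_simps)

lemma atlas_chart:
  assumes a: "a \<in> A"
  shows "fst a \<subseteq> S" "openin (subtopology (mtop M) S) (fst a)" "open (cimg a)"
    "smooth_map M (fst a) eucl (snd a)" "smooth_map eucl (cimg a) M (cinv a)" "is_chart (mtop L) a"
proof -
  have sc: "openin (subtopology (mtop M) S) (fst a)" "open (cimg a)" "diffeo M (fst a) eucl (cimg a) (snd a)"
    using surface_charts[OF a] by (auto simp: surface_chart_def)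
  note d = diffeoD[OF sc(3)]
  show S': "fst a \<subseteq> S" using openin_imp_subset[OF sc(1)] .
  show "openin (subtopology (mtop M) S) (fst a)" "open (cimg a)" "smooth_map M (fst a) eucl (snd a)" "smooth_map eucl (cimg a) M (cinv a)"
    by (fact sc(1,2) d(1,2))+
  have e: "subtopology (subtopology (mtop M) S) (fst a) = subtopology (mtop M) (fst a)"
    using S' by (simp add: subtopology_subtopology Int_absorb1)
  have 1: "continuous_map (subtopology (mtop M) (fst a)) (top_of_set (cimg a)) (snd a)"
    using smooth_map_continuous[OF M manifold_eucl d(1)] by (auto simp: continuous_map_in_subtopology)
  have 2: "continuous_map (top_of_set (cimg a)) (subtopology (mtop M) (fst a)) (cinv a)"
    using smooth_map_continuous[OF manifold_eucl M d(2)] d(5) by (auto simp: continuous_map_in_subtopology)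
  have "homeomorphic_maps (subtopology (mtop M) (fst a)) (top_of_set (cimg a)) (snd a) (cinv a)"
    unfolding homeomorphic_maps_def using 1 2 d(6,7) by auto
  then have "homeomorphic_map (subtopology (subtopology (mtop M) S) (fst a)) (top_of_set (cimg a)) (snd a)"
    unfolding e by (rule homeomorphic_maps_imp_map)
  then show "is_chart (mtop L) a" using sc(1,2) by (simp add: is_chart_def L_simps)
qed

lemma L: "manifold L"
  unfolding manifold_def
proof (intro conjI ballI)
  show "Hausdorff_space (mtop L)" "second_countable (mtop L)"
    using M by (auto simp: L_simps manifold_def Hausdorff_space_subtopology second_countable_subtopology)
  show "\<Union> (fst ` charts L) = points L" unfolding points_L using cover by (simp add: L_simps)
  fix a assume a: "a \<in> charts L"
  then have a: "a \<in> A" by (simp add: L_simps)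
  show "is_chart (mtop L) a" by (rule atlas_chart(6)[OF a])
  fix a' assume "a' \<in> charts L"
  then have a': "a' \<in> A" by (simp add: L_simps)
  let ?D = "loc_dom a a' (\<lambda>x. x)"
  have D: "?D \<subseteq> cimg a" by (auto simp: loc_dom_def)
  have im: "cinv a ` ?D \<subseteq> fst a'" using atlas_chart(6)[OF a] by (auto simp: loc_dom_def)
  have "smooth_map eucl ?D eucl (\<lambda>x. snd a' (cinv a x))"
    by (rule smooth_map_compose[OF manifold_eucl M manifold_eucl smooth_map_subset[OF atlas_chart(5)[OF a] D] atlas_chart(4)[OF a'] im])
  from smooth_map_rep[OF manifold_eucl manifold_eucl this, of "(UNIV, \<lambda>x. x)" "(UNIV, \<lambda>x. x)"]
  show "smooth_on ?D (loc_rep a a' (\<lambda>x. x))" by (simp add: loc_rep_def o_def)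
qed

lemma charts_L: "a \<in> A \<Longrightarrow> a \<in> charts L" by (simp add: L_simps)

lemma smooth_map_from_L:
  assumes "smooth_map M S M' h" "manifold M'"
  shows "smooth_map L S M' h"
proof (rule smooth_map_local)
  fix x assume "x \<in> S"
  then obtain a where a: "a \<in> A" "x \<in> fst a" using cover by blast
  note ac = atlas_chart[OF a(1)]
  have "smooth_map L (fst a) eucl (snd a)" by (rule smooth_map_chart[OF L charts_L[OF a(1)]])
  then have "smooth_map L (fst a) M (\<lambda>x. cinv a (snd a x))" by (rule smooth_map_compose[OF L manifold_eucl M _ ac(5)]) simp
  then have "smooth_map L (fst a) M (\<lambda>x. x)" by (rule smooth_map_cong_imp[OF L]) (use ac(6) in simp)
  from smooth_map_compose[OF L M assms(2) this assms(1)] have "smooth_map L (fst a) M' h" using ac(1) by simp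
  moreover have "S \<inter> fst a = fst a" using ac(1) by blast
  ultimately show "\<exists>V. openin (mtop L) V \<and> x \<in> V \<and> smooth_map L (S \<inter> V) M' h"
    using ac(2) a(2) by (intro exI[of _ "fst a"]) (simp add: L_simps)
qed

text \<open>Continuity confines \<open>h\<close> locally to one surface chart \<open>a\<close>.
  There \<open>h\<close> factors as \<open>h\<close> followed by the smooth map \<open>snd a\<close>
  and then by \<open>cinv a\<close>, which is smooth into \<open>L\<close>.\<close>

lemma smooth_map_into_L:
  fixes M' :: "('b, 'f::euclidean_space) mfd"
  assumes M': "manifold M'" and h: "smooth_map M' B M h" and hB: "h ` B \<subseteq> S"
  shows "smooth_map M' B L h"
proof (rule smooth_map_local)
  fix x assume x: "x \<in> B"
  then obtain a where a: "a \<in> A" "h x \<in> fst a" using cover hB by blast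
  note ac = atlas_chart[OF a(1)]
  obtain G where G: "openin (mtop M) G" "fst a = G \<inter> S" using ac(2) by (auto simp: openin_subtopology)
  obtain W where W: "openin (mtop M') W" "x \<in> W" "h ` (B \<inter> W) \<subseteq> G"
    by (rule continuous_map_nbhd[OF smooth_map_continuous[OF M' M h] x smooth_map_subset_points[OF h] G(1)]) (use a(2) G(2) in auto)
  have im: "h ` (B \<inter> W) \<subseteq> fst a" using W(3) hB G(2) by blast
  have "smooth_map M' (B \<inter> W) eucl (\<lambda>x. snd a (h x))"
    by (rule smooth_map_compose[OF M' M manifold_eucl smooth_map_subset[OF h] ac(4) im]) blast
  then have "smooth_map M' (B \<inter> W) L (\<lambda>x. cinv a (snd a (h x)))"
    by (rule smooth_map_compose[OF M' manifold_eucl L _ smooth_map_cinv[OF L charts_L[OF a(1)]]]) (use im in blast)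
  then have "smooth_map M' (B \<inter> W) L h" by (rule smooth_map_cong_imp[OF M']) (use im ac(6) in auto)
  then show "\<exists>V. openin (mtop M') V \<and> x \<in> V \<and> smooth_map M' (B \<inter> V) L h" using W(1,2) by blast
qed

lemma inclusion: "smooth_map L S M (\<lambda>x. x)"
  by (rule smooth_map_from_L[OF smooth_map_ident[OF M S] M])

lemma open_S: "openin (mtop L) S"
  using openin_topspace[of "mtop L"] unfolding points_L .

lemma inclusion_diffeo: "diffeo L S M S (\<lambda>x. x)"
  by (rule diffeoI[OF L M inclusion smooth_map_into_L[OF M smooth_map_ident[OF M S]]]) auto

text \<open>The differential of the inclusion, from surface coordinates to coordinates of
  \<open>M\<close>.\<close>

definition sD :: "('a, real^2) chart \<Rightarrow> ('a, 'e) chart \<Rightarrow> 'a \<Rightarrow> real^2 \<Rightarrow> 'e" where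
  "sD a c x = loc_deriv a c (\<lambda>x. x) x"

lemma sD_linear:
  assumes "a \<in> A" "c \<in> charts M" "x \<in> fst a" "x \<in> fst c"
  shows "linear (sD a c x)" "inj (sD a c x)"
proof -
  have xS: "x \<in> S" using atlas_chart(1)[OF assms(1)] assms(3) by blast
  show "linear (sD a c x)" unfolding sD_def
    by (rule bounded_linear.linear[OF loc_deriv_linear[OF L M inclusion open_S charts_L[OF assms(1)] assms(2) xS assms(3,4)]])
  obtain W \<kappa> where W: "snd c x \<in> W" and \<kappa>: "\<And>z w. z \<in> S \<Longrightarrow> z \<in> fst a \<Longrightarrow> z \<in> fst c \<Longrightarrow> snd c z \<in> W \<Longrightarrow>
       frechet_derivative \<kappa> (at (snd c z)) (loc_deriv a c (\<lambda>x. x) z w) = w"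
    by (rule diffeo_left_inverse[OF L M open_S inclusion_diffeo charts_L[OF assms(1)] assms(2) xS assms(3,4)]) (rule that; assumption)
  show "inj (sD a c x)" unfolding sD_def
    by (rule inj_on_inverseI[of _ "frechet_derivative \<kappa> (at (snd c x))"]) (rule \<kappa>[OF xS assms(3,4) W])
qed

lemma sD_tangent:
  assumes a: "a \<in> A" and c: "c \<in> charts M" and x: "x \<in> fst a" "x \<in> fst c"
  shows "sD a c x v \<in> tangent_coords S c x"
proof -
  note ac = atlas_chart[OF a]
  have xS: "x \<in> S" using ac(1) x(1) by blast
  let ?\<gamma> = "\<lambda>t::real. cinv a (snd a x + t *\<^sub>R v)" and ?J = "(\<lambda>t::real. snd a x + t *\<^sub>R v) -` cimg a"
  have J: "open ?J" by (intro open_vimage ac(3) continuous_intros)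
  have \<gamma>: "?\<gamma> t \<in> fst a \<and> snd a (?\<gamma> t) = snd a x + t *\<^sub>R v" if t: "t \<in> ?J" for t
  proof -
    obtain z where "z \<in> fst a" "snd a x + t *\<^sub>R v = snd a z" using t by blast
    then show ?thesis using ac(6) by simp
  qed
  have J0: "0 \<in> ?J" using x by simp
  have "v \<in> curve_coords UNIV S a x"
  proof (rule curve_coordsI[of ?\<gamma>, OF _ UNIV_I _ J J0])
    show "?\<gamma> 0 = x" using ac(6) x(1) by simp
    show "x \<in> S \<inter> fst a" using xS x(1) by blast
    show "?\<gamma> ` (UNIV \<inter> ?J) \<subseteq> S \<inter> fst a" using \<gamma> ac(1) by blast
    have "((\<lambda>t. snd a x + t *\<^sub>R v) has_derivative (\<lambda>t. t *\<^sub>R v)) (at 0 within UNIV)"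
      by (auto intro!: derivative_eq_intros)
    then have "((\<lambda>t. snd a (?\<gamma> t)) has_derivative (\<lambda>t. t *\<^sub>R v)) (at 0 within UNIV)"
      by (rule has_derivative_local_cong[THEN iffD1, OF J J0 UNIV_I, rotated -1]) (use \<gamma> in auto)
    then show "((\<lambda>t. snd a (?\<gamma> t)) has_vector_derivative v) (at 0 within UNIV)" by (simp add: has_vector_derivative_def)
  qed
  from curve_coords_smooth[OF L M inclusion open_S charts_L[OF a] c xS x _ UNIV_I this, of S]
  show ?thesis by (simp add: sD_def tangent_coords_eq)
qed

text \<open>Both sides differentiate the restriction of \<open>h\<close> to \<open>S\<close>, once
  as the inclusion followed by \<open>h\<close> and once as the restricted self-map followed by the
  inclusion.\<close>

lemma sD_chain:
  assumes h: "smooth_map M D M h" and D: "openin (mtop M) D" "S \<subseteq> D" and hS: "h ` S \<subseteq> S"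
    and a: "a \<in> A" "a' \<in> A" and c: "c \<in> charts M" "c' \<in> charts M" and x: "x \<in> fst a" "x \<in> fst c" "h x \<in> fst a'" "h x \<in> fst c'"
  shows "loc_deriv c c' h x (sD a c x v) = sD a' c' (h x) (loc_deriv a a' h x v)"
proof -
  have xS: "x \<in> S" using atlas_chart(1)[OF a(1)] x(1) by blast
  have hL: "smooth_map L S L h"
    by (rule smooth_map_into_L[OF L smooth_map_from_L[OF smooth_map_subset[OF h D(2)] M] hS])
  have "(\<lambda>x. x) ` S \<subseteq> D" using D(2) by blast
  from loc_deriv_compose[OF L M M inclusion open_S h D(1) this charts_L[OF a(1)] c xS x(1,2,4)]
  have "loc_deriv a c' h x v = loc_deriv c c' h x (sD a c x v)" by (simp add: sD_def)
  moreover from loc_deriv_compose[OF L L M hL open_S inclusion open_S hS charts_L[OF a(1)] charts_L[OF a(2)] c(2) xS x(1,3,4)]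
  have "loc_deriv a c' h x v = sD a' c' (h x) (loc_deriv a a' h x v)" by (simp add: sD_def)
  ultimately show ?thesis by simp
qed

lemma loc_deriv_self:
  assumes "a \<in> A" "x \<in> fst a"
  shows "loc_deriv a a (\<lambda>x. x) x = (\<lambda>v. v)"
  by (rule loc_deriv_ident[OF L charts_L[OF assms(1)] assms(2)])

end

lemma det_matrix_ident: "det (matrix (\<lambda>v::real^'n. v)) = 1"
  using matrix_id by (simp add: id_def)

lemma oriented_chart_change:
  assumes "oriented_manifold M" "c \<in> charts M" "c' \<in> charts M" "x \<in> fst c" "x \<in> fst c'"
  shows "0 < det (matrix (loc_deriv c c' (\<lambda>x. x) x))"
  using assms by (auto simp: oriented_manifold_def orientation_preserving_wrt_def)

text \<open>Made for \<open>mu_transform\<close>: \<open>d\<close> and \<open>e\<close> are the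
  determinants on \<open>M\<close> and on the surface, \<open>p\<close> and \<open>r\<close> the
  pairings of a vector and its image with the surface normals. The first part transports the side of
  a vector, the second recovers the sign of the surface determinant.\<close>

lemma sign_transfer:
  fixes d p e r :: real
  assumes "d * p = e * r" "0 < d"
  shows "0 < e \<Longrightarrow> 0 < p \<longleftrightarrow> 0 < r" "0 < p \<Longrightarrow> 0 < r \<Longrightarrow> 0 < e"
proof -
  show "0 < p \<longleftrightarrow> 0 < r" if "0 < e"
  proof -
    have "0 < p \<longleftrightarrow> 0 < d * p" using assms(2) by (simp add: zero_less_mult_iff)
    also have "\<dots> \<longleftrightarrow> 0 < r" unfolding assms(1) using that by (simp add: zero_less_mult_iff)
    finally show ?thesis .
  qed
  show "0 < e" if "0 < p" "0 < r"
  proof -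
    have "0 < e * r" unfolding assms(1)[symmetric] using assms(2) that(1) by simp
    then show ?thesis using that(2) by (simp add: zero_less_mult_iff)
  qed
qed

locale surface_atlas3 = surface_atlas M S A + conormal_surface M S
  for M :: "('a, real^3) mfd" and S :: "'a set" and A :: "('a, real^2) chart set"
begin

text \<open>The normal of \<open>S\<close> determined by a surface chart. Its transformation law \<open>mu_transform\<close> below turns
  orientations of \<open>S\<close> into normal orientations and back.\<close>

definition mu :: "('a, real^2) chart \<Rightarrow> ('a, real^3) chart \<Rightarrow> 'a \<Rightarrow> real^3" where
  "mu a c x = cross3 (sD a c x (axis 1 1)) (sD a c x (axis 2 1))"

text \<open>The frame vectors are tangent, so \<open>mu\<close> is a nonzero multiple of any
  conormal.\<close>

lemma mu_orthogonal:
  assumes a: "a \<in> A" "c \<in> charts M" and x: "x \<in> fst a" "x \<in> fst c"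
  shows "mu a c x \<noteq> 0" "tangent_coords S c x = {v. mu a c x \<bullet> v = 0}"
proof -
  show ne: "mu a c x \<noteq> 0" unfolding mu_def by (rule cross3_ne[OF sD_linear[OF a x]])
  have xS: "x \<in> S" using atlas_chart(1)[OF a(1)] x(1) by blast
  obtain Y \<nu> where Y: "conormal M S c Y \<nu>" "x \<in> Y" using con[OF xS a(2) x(2)] by blast
  then have \<nu>: "\<nu> x \<noteq> 0" "tangent_coords S c x = {v. \<nu> x \<bullet> v = 0}" using xS by (auto simp: conormal_def)
  have o: "\<nu> x \<bullet> sD a c x v = 0" for v using sD_tangent[OF a x, of v] unfolding \<nu>(2) by simp
  have "mu a c x \<bullet> v = 0 \<longleftrightarrow> \<nu> x \<bullet> v = 0" for v
    unfolding mu_def by (rule cross3_orthogonal[OF \<nu>(1) ne[unfolded mu_def] o o])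
  then show "tangent_coords S c x = {v. mu a c x \<bullet> v = 0}" unfolding \<nu>(2) by simp
qed

lemma mu_conormal:
  assumes a: "a \<in> A" "c \<in> charts M" and x: "x \<in> fst a" "x \<in> fst c"
  obtains Y where "conormal M S c Y (mu a c)" "x \<in> Y" "S \<inter> Y \<subseteq> fst a"
proof -
  note ac = atlas_chart[OF a(1)]
  obtain G where G: "openin (mtop M) G" "fst a = G \<inter> S" using ac(2) by (auto simp: openin_subtopology)
  let ?Y = "G \<inter> fst c"
  have SY: "S \<inter> ?Y = fst a \<inter> fst c" using G(2) by blast
  have e: "subtopology (mtop L) (S \<inter> fst a \<inter> (\<lambda>x. x) -` fst c) = subtopology (mtop M) (S \<inter> ?Y)"
  proof -
    have "S \<inter> (S \<inter> fst a \<inter> (\<lambda>x. x) -` fst c) = S \<inter> ?Y" using G(2) by auto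
    then show ?thesis by (simp only: L_simps subtopology_subtopology)
  qed
  have "continuous_map (subtopology (mtop M) (S \<inter> ?Y)) euclidean (\<lambda>x. sD a c x v)" for v
    using loc_deriv_continuous[OF L M inclusion open_S charts_L[OF a(1)] a(2), of v] unfolding e sD_def .
  then have cont: "continuous_map (subtopology (mtop M) (S \<inter> ?Y)) euclidean (mu a c)"
    unfolding continuous_map_atin limitin_canonical_iff mu_def by (intro ballI tendsto_cross3) blast+
  show thesis
  proof (rule that[of ?Y])
    show "conormal M S c ?Y (mu a c)"
      unfolding conormal_def
    proof (intro conjI ballI)
      show "openin (mtop M) ?Y" using G(1) chart_openin[OF manifold_chart[OF M a(2)]] by blast
      show "?Y \<subseteq> fst c" by blast
      show "continuous_map (subtopology (mtop M) (S \<inter> ?Y)) euclidean (mu a c)" by (rule cont)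
      fix y assume "y \<in> S \<inter> ?Y"
      then have y: "y \<in> fst a" "y \<in> fst c" unfolding SY by auto
      show "mu a c y \<noteq> 0" "tangent_coords S c y = {v. mu a c y \<bullet> v = 0}" by (rule mu_orthogonal[OF a y])+
    qed
    show "x \<in> ?Y" "S \<inter> ?Y \<subseteq> fst a" using x G(2) by auto
  qed
qed

text \<open>The ambient determinant comes from the triple product of the pushed frame with the
  pushed vector, the surface determinant from rewriting the pushed frame in the second surface
  chart.\<close>

lemma mu_transform:
  assumes h: "smooth_map M D M h" and D: "openin (mtop M) D" "S \<subseteq> D" and hS: "h ` S \<subseteq> S"
    and a: "a \<in> A" "a' \<in> A" and c: "c \<in> charts M" "c' \<in> charts M" and x: "x \<in> fst a" "x \<in> fst c" "h x \<in> fst a'" "h x \<in> fst c'"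
  shows "det (matrix (loc_deriv c c' h x)) * (mu a c x \<bullet> v) = det (matrix (loc_deriv a a' h x)) * (mu a' c' (h x) \<bullet> loc_deriv c c' h x v)"
proof -
  let ?D = "loc_deriv c c' h x" and ?G = "loc_deriv a a' h x"
  have xD: "x \<in> D" using atlas_chart(1)[OF a(1)] x(1) D(2) by blast
  have lin: "linear ?D" by (rule bounded_linear.linear[OF loc_deriv_linear[OF M M h D(1) c xD x(2,4)]])
  have "det (matrix ?D) * (mu a c x \<bullet> v) = cross3 (?D (sD a c x (axis 1 1))) (?D (sD a c x (axis 2 1))) \<bullet> ?D v"
    unfolding mu_def by (rule det3_transform[OF lin, symmetric])
  also have "\<dots> = cross3 (sD a' c' (h x) (?G (axis 1 1))) (sD a' c' (h x) (?G (axis 2 1))) \<bullet> ?D v"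
    unfolding sD_chain[OF h D hS a c x] ..
  also have "\<dots> = det (matrix ?G) * (mu a' c' (h x) \<bullet> ?D v)"
    unfolding det2_transform[OF sD_linear(1)[OF a(2) c(2) x(3,4)]] mu_def by simp
  finally show ?thesis .
qed

text \<open>The case of the identity map. Its two specialisations below each hold one of the two
  charts fixed, whose determinant is then 1.\<close>

lemma mu_chart_change:
  assumes a: "a \<in> A" "a' \<in> A" and c: "c \<in> charts M" "c' \<in> charts M" and x: "x \<in> fst a" "x \<in> fst c" "x \<in> fst a'" "x \<in> fst c'"
  shows "det (matrix (loc_deriv c c' (\<lambda>x. x) x)) * (mu a c x \<bullet> v)
    = det (matrix (loc_deriv a a' (\<lambda>x. x) x)) * (mu a' c' x \<bullet> loc_deriv c c' (\<lambda>x. x) x v)"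
  by (rule mu_transform[OF smooth_map_ident[OF M subset_refl] openin_topspace S _ a c x]) simp

lemma mu_coordinate_change:
  assumes "a \<in> A" "c \<in> charts M" "c' \<in> charts M" "x \<in> fst a" "x \<in> fst c" "x \<in> fst c'"
  shows "det (matrix (loc_deriv c c' (\<lambda>x. x) x)) * (mu a c x \<bullet> v) = mu a c' x \<bullet> loc_deriv c c' (\<lambda>x. x) x v"
  using mu_chart_change[OF assms(1,1,2,3,4,5,4,6), of v] loc_deriv_self[OF assms(1,4)] by (simp add: det_matrix_ident)

lemma mu_surface_change:
  assumes "a \<in> A" "a' \<in> A" "c \<in> charts M" "x \<in> fst a" "x \<in> fst a'" "x \<in> fst c"
  shows "mu a c x \<bullet> v = det (matrix (loc_deriv a a' (\<lambda>x. x) x)) * (mu a' c x \<bullet> v)"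
  using mu_chart_change[OF assms(1,2,3,3,4,6,5,6), of v] loc_deriv_ident[OF M assms(3,6)] by (simp add: det_matrix_ident)

end

text \<open>An oriented atlas preserved by \<open>f\<close> gives a normal orientation
  \<open>Q\<close> preserved by \<open>f\<close>. The given \<open>P\<close> is \<open>Q\<close> or
  its opposite, and linearity of the differential settles the opposite case.\<close>

lemma push_oriented_surface:
  fixes M :: "('a, real^3) mfd"
  assumes cs: "conormal_surface M S" and oM: "oriented_manifold M" and f: "f \<in> Diff_plus M"
    and pres: "preserves_surface_orientation M S f" and P: "normal_orientation M S P"
  shows "push M f P = P"
proof -
  interpret conormal_surface M S by (rule cs)
  obtain A where A: "surface_orientation M S A" "orientation_preserving_wrt A f" and fS: "f ` S = S"
    using pres by (auto simp: preserves_surface_orientation_def)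
  interpret surface_atlas3 M S A
    by unfold_locales (use A(1) S M in \<open>auto simp: surface_orientation_iff\<close>)
  have fD: "f \<in> Diff M" using f by (simp add: Diff_plus_def)
  have Aid: "0 < det (matrix (loc_deriv a a' (\<lambda>x. x) x))" if "a \<in> A" "a' \<in> A" "x \<in> fst a" "x \<in> fst a'" for a a' x
    using that A(1) unfolding surface_orientation_def orientation_preserving_wrt_def by blast
  \<comment> \<open>The positive side of \<open>mu\<close>. Transition determinants in
    \<open>A\<close> are positive, so any chart of \<open>A\<close> around the point may be used to
    test membership.\<close>
  define Q where "Q = {(x, c, v). x \<in> S \<and> c \<in> charts M \<and> x \<in> fst c \<and> (\<exists>a\<in>A. x \<in> fst a \<and> 0 < mu a c x \<bullet> v)}"
  have in_Q: "(x, c, v) \<in> Q \<longleftrightarrow> 0 < mu a c x \<bullet> v" if a: "a \<in> A" "x \<in> fst a" and c: "c \<in> charts M" "x \<in> fst c" for a x c v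
  proof -
    have xS: "x \<in> S" using atlas_chart(1)[OF a(1)] a(2) by blast
    have "0 < mu a c x \<bullet> v" if a': "a' \<in> A" "x \<in> fst a'" "0 < mu a' c x \<bullet> v" for a'
      unfolding mu_surface_change[OF a(1) a'(1) c(1) a(2) a'(2) c(2)] using Aid[OF a(1) a'(1) a(2) a'(2)] a'(3) by simp
    then show ?thesis using xS a c by (auto simp: Q_def)
  qed
  have QD: "x \<in> S \<and> c \<in> charts M \<and> x \<in> fst c" if "(x, c, v) \<in> Q" for x c v using that by (simp add: Q_def)
  have QA: "\<exists>a\<in>A. x \<in> fst a" if "x \<in> S" for x using cover that by blast
  have Q: "normal_orientation M S Q"
    unfolding normal_orientation_def
  proof (intro conjI ballI)
    show "Q \<subseteq> {(x, c, v). x \<in> S \<and> c \<in> charts M \<and> x \<in> fst c}" by (auto simp: Q_def)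
    show "push M (\<lambda>x. x) Q \<subseteq> Q"
    proof
      fix t assume "t \<in> push M (\<lambda>x. x) Q"
      then obtain x c v c' where t: "t = (x, c', loc_deriv c c' (\<lambda>x. x) x v)" "(x, c, v) \<in> Q" "c' \<in> charts M" "x \<in> fst c'"
        by (rule pushE)
      have x: "x \<in> S" "c \<in> charts M" "x \<in> fst c" using QD[OF t(2)] by auto
      obtain a where a: "a \<in> A" "x \<in> fst a" using QA[OF x(1)] by blast
      have "0 < mu a c x \<bullet> v" using t(2) in_Q[OF a x(2,3)] by blast
      then have "0 < mu a c' x \<bullet> loc_deriv c c' (\<lambda>x. x) x v"
        using mu_coordinate_change[OF a(1) x(2) t(3) a(2) x(3) t(4), of v, symmetric] oriented_chart_change[OF oM x(2) t(3) x(3) t(4)] by simp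
      then show "t \<in> Q" unfolding t(1) using in_Q[OF a t(3,4)] by blast
    qed
    fix c x assume c: "c \<in> charts M" and x: "x \<in> S \<inter> fst c"
    then obtain a where a: "a \<in> A" "x \<in> fst a" using QA by blast
    obtain Y where Y: "conormal M S c Y (mu a c)" "x \<in> Y" "S \<inter> Y \<subseteq> fst a"
      by (rule mu_conormal[OF a(1) c a(2)]) (use x in blast)+
    show "\<exists>W n. openin (mtop M) W \<and> x \<in> W \<and> W \<subseteq> fst c \<and> continuous_map (subtopology (mtop M) (S \<inter> W)) euclidean n \<and>
        (\<forall>y\<in>S \<inter> W. n y \<notin> tangent_coords S c y \<and>
           {v. (y, c, v) \<in> Q} = {t + a *\<^sub>R n y | t a. t \<in> tangent_coords S c y \<and> 0 < a})"
    proof (intro exI[of _ Y] exI[of _ "mu a c"] conjI ballI)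
      show "openin (mtop M) Y" "Y \<subseteq> fst c" "continuous_map (subtopology (mtop M) (S \<inter> Y)) euclidean (mu a c)"
        using Y(1) by (simp_all add: conormal_def)
      show "x \<in> Y" by (rule Y(2))
      fix y assume y: "y \<in> S \<inter> Y"
      have ne: "mu a c y \<noteq> 0" and tan: "tangent_coords S c y = {v. mu a c y \<bullet> v = 0}" and yc: "y \<in> fst c"
        using Y(1) y by (auto simp: conormal_def)
      show "mu a c y \<notin> tangent_coords S c y" unfolding tan using ne by simp
      have ya: "y \<in> fst a" using y Y(3) by blast
      show "{v. (y, c, v) \<in> Q} = {t + a' *\<^sub>R mu a c y | t a'. t \<in> tangent_coords S c y \<and> 0 < a'}"
        unfolding in_Q[OF a(1) ya c yc] tan by (rule half_space_rays[OF ne])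
    qed
  qed
  have pQ: "push M f Q \<subseteq> Q"
  proof
    fix t assume "t \<in> push M f Q"
    then obtain x c v c' where t: "t = (f x, c', loc_deriv c c' f x v)" "(x, c, v) \<in> Q" "c' \<in> charts M" "f x \<in> fst c'"
      by (rule pushE)
    have x: "x \<in> S" "c \<in> charts M" "x \<in> fst c" using QD[OF t(2)] by auto
    have fx: "f x \<in> S" using x(1) fS by blast
    obtain a where a: "a \<in> A" "x \<in> fst a" using QA[OF x(1)] by blast
    obtain a' where a': "a' \<in> A" "f x \<in> fst a'" using QA[OF fx] by blast
    have fS': "f ` S \<subseteq> S" using fS by simp
    have "0 < det (matrix (loc_deriv c c' f x))" "0 < det (matrix (loc_deriv a a' f x))"
      using f x t(3,4) A(2) a a' by (auto simp: Diff_plus_def orientation_preserving_wrt_def)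
    moreover have "0 < mu a c x \<bullet> v" using t(2) in_Q[OF a x(2,3)] by blast
    ultimately have "0 < mu a' c' (f x) \<bullet> loc_deriv c c' f x v"
      using sign_transfer(1)[OF mu_transform[OF Diff_smooth[OF fD] openin_topspace S fS' a(1) a'(1) x(2) t(3) a(2) x(3) a'(2) t(4), of v]] by blast
    then show "t \<in> Q" unfolding t(1) using in_Q[OF a' t(3,4)] by blast
  qed
  have pushed: "normal_orientation M S (push M f R)" if "normal_orientation M S R" for R
    using push_normal_orientation[OF M fD S that] unfolding fS .
  obtain x where x: "x \<in> S" using ne by blast
  obtain c where c: "c \<in> charts M" "x \<in> fst c" using point_chart[OF M] x S by blast
  obtain v where v: "(x, c, v) \<in> P" using normal_orientation_nonempty[OF P x c] .
  have fx: "f x \<in> points M" using Diff_in[OF fD] x S by blast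
  obtain c' where c': "c' \<in> charts M" "f x \<in> fst c'" using point_chart[OF M fx] .
  let ?D = "loc_deriv c c' f x"
  have lin: "linear ?D" by (rule bounded_linear.linear[OF loc_deriv_Diff_linear[OF M fD c(1) c'(1) c(2) c'(2)]])
  have vP: "(f x, c', ?D v) \<in> push M f P" by (rule pushI[where f=f and x=x, OF v c'])
  show ?thesis
  proof (cases "P = Q")
    case True
    have "(f x, c', ?D v) \<in> P" using vP pQ True by blast
    then show ?thesis by (rule normal_orientation_agree[OF pushed[OF P] P vP])
  next
    case False
    have "(x, c, - v) \<in> Q" using normal_orientation_disjoint[OF P Q False] v by blast
    then have "(f x, c', ?D (- v)) \<in> Q" using pushI[where f=f and x=x and P=Q and v="- v" and c=c, OF _ c'] pQ by blast
    then have "(f x, c', - ?D v) \<in> Q" using linear_neg[OF lin] by simp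
    then have "(f x, c', ?D v) \<in> P" using normal_orientation_disjoint[OF P Q False] by blast
    then show ?thesis by (rule normal_orientation_agree[OF pushed[OF P] P vP])
  qed
qed

text \<open>Charts are adjusted by shrinking the domain and applying an involution, which is its own
  smooth inverse.\<close>

lemma (in surface_atlas) surface_chart_restrict:
  assumes a: "a \<in> A" and U: "openin (subtopology (mtop M) S) U" "U \<subseteq> fst a"
    and \<sigma>: "linear \<sigma>" "\<forall>p. \<sigma> (\<sigma> p) = (p::real^2)"
  shows "surface_chart M S (U, \<lambda>x. \<sigma> (snd a x))"
proof -
  note ac = atlas_chart[OF a]
  have dia: "diffeo M (fst a) eucl (cimg a) (snd a)" using surface_charts[OF a] by (simp add: surface_chart_def)
  have bl: "bounded_linear \<sigma>" using \<sigma>(1) by (simp add: linear_conv_bounded_linear)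
  have "openin (top_of_set (cimg a)) (snd a ` U)"
    by (rule chart_open_image[OF ac(6) _ U(2)]) (use U(1) in \<open>simp add: L_simps\<close>)
  then have "open (snd a ` U)" using openin_open_eq[OF ac(3)] by blast
  then have "open (\<sigma> -` (snd a ` U))" using linear_continuous_on[OF bl] by (intro open_vimage)
  moreover have im: "(\<lambda>x. \<sigma> (snd a x)) ` U = \<sigma> -` (snd a ` U)"
  proof (intro equalityI subsetI)
    fix p assume "p \<in> (\<lambda>x. \<sigma> (snd a x)) ` U"
    then obtain x where "x \<in> U" "p = \<sigma> (snd a x)" by blast
    then show "p \<in> \<sigma> -` (snd a ` U)" using \<sigma>(2) by simp
  next
    fix p assume "p \<in> \<sigma> -` (snd a ` U)"
    then obtain x where "x \<in> U" "\<sigma> p = snd a x" by blast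
    then have "p = \<sigma> (snd a x)" using \<sigma>(2) by metis
    then show "p \<in> (\<lambda>x. \<sigma> (snd a x)) ` U" using \<open>x \<in> U\<close> by blast
  qed
  moreover have "diffeo M U eucl ((\<lambda>x. \<sigma> (snd a x)) ` U) (\<lambda>x. \<sigma> (snd a x))"
  proof (rule diffeo_compose[OF M manifold_eucl manifold_eucl diffeo_restrict[OF M manifold_eucl dia U(2)]])
    show "diffeo eucl (snd a ` U) eucl ((\<lambda>x. \<sigma> (snd a x)) ` U) \<sigma>"
      by (rule diffeoI[OF manifold_eucl manifold_eucl smooth_map_eucl[OF smooth_on_linear[OF bl]] smooth_map_eucl[OF smooth_on_linear[OF bl]]])
        (use \<sigma>(2) in auto)
  qed
  ultimately show ?thesis using U(1) by (simp add: surface_chart_def)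
qed

text \<open>In a half-space chart of \<open>N\<close> near a preimage of \<open>x\<close> the
  surface corresponds to the bounding hyperplane. Flattening that hyperplane to the plane gives the
  chart.\<close>

lemma surface_chart_at:
  fixes M :: "('a, real^3) mfd"
  assumes sc: "surface_cut M \<T> N q" and S: "S \<in> \<T>" and x: "x \<in> S"
  obtains a where "surface_chart M S a" "x \<in> fst a"
proof -
  interpret surface_cut M \<T> N q by (rule sc)
  have "x \<in> \<Union>\<T>" using x S by blast
  then obtain y where y: "y \<in> points N" "q y = x" using fibre_pair by metis
  have "x \<in> points M" using x S_points[OF S] by blast
  then obtain c where c: "c \<in> charts M" "x \<in> fst c" using point_chart[OF M] by metis
  have yx: "q y \<in> S" "q y \<in> fst c" using x c y by auto
  obtain d u W Y \<nu> where d: "d \<in> charts N" "half_chart d u" and W: "openin (mtop N) W" "y \<in> W" "W \<subseteq> fst d"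
    "diffeo N W M (q ` W) q" "\<forall>z\<in>W. q z \<in> fst c \<and> (u \<bullet> snd d z = 0 \<longleftrightarrow> q z \<in> S)"
    and Y: "conormal M S c Y \<nu>" "q y \<in> Y" "\<forall>x\<in>S \<inter> Y. \<exists>z\<in>W. q z = x"
    by (rule local_picture[OF S y(1) yx(1) c(1) yx(2) openin_topspace y(1)]) (rule that; assumption)
  note id = manifold_chart[OF N d(1)] and qD = diffeoD[OF W(4)]
  have "u \<noteq> 0" using d(2) by (simp add: half_chart_def)
  then obtain L J where LJ: "linear L" "linear J" "\<forall>a. L (J a) = (a :: real^2)" "\<forall>a. u \<bullet> J a = 0" "\<forall>w. u \<bullet> w = 0 \<longrightarrow> J (L w) = w"
    by (rule plane_coords)
  have bl: "bounded_linear L" "bounded_linear J" using LJ(1,2) by (simp_all add: linear_conv_bounded_linear)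
  have oY: "openin (mtop M) Y" using Y(1) by (simp add: conormal_def)
  define W' where "W' = W \<inter> {z \<in> points N. q z \<in> Y}"
  have oW': "openin (mtop N) W'" unfolding W'_def by (rule openin_Int[OF W(1) openin_continuous_map_preimage[OF q_cont oY]])
  have WN: "W \<subseteq> points N" using openin_subset[OF W(1)] .
  have W'd: "W' \<subseteq> fst d" using W(3) by (auto simp: W'_def)
  have "openin (top_of_set {x. 0 \<le> u \<bullet> x}) (snd d ` W')"
    by (rule openin_trans[OF chart_open_image[OF id oW' W'd]]) (use d(2) in \<open>simp add: half_chart_def\<close>)
  then obtain T where T: "open T" "snd d ` W' = {x. 0 \<le> u \<bullet> x} \<inter> T" unfolding openin_open by (elim exE conjE)
  let ?i = "inv_into W q"
  let ?\<theta> = "\<lambda>x. L (snd d (?i x))" and ?g = "\<lambda>a. q (cinv d (J a))" and ?T = "J -` T"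
  have iY: "?i x \<in> W' \<and> q (?i x) = x \<and> u \<bullet> snd d (?i x) = 0" if x: "x \<in> S \<inter> Y" for x
  proof -
    obtain z where z: "z \<in> W" "q z = x" using Y(3) x by blast
    then have "?i x = z" using qD(6) by blast
    then show ?thesis using z x W(5) WN by (auto simp: W'_def)
  qed
  have J\<theta>: "J (?\<theta> x) = snd d (?i x)" if "x \<in> S \<inter> Y" for x using LJ(5) iY[OF that] by blast
  have g: "cinv d (J a) \<in> W' \<and> snd d (cinv d (J a)) = J a \<and> ?g a \<in> S \<inter> Y" if a: "a \<in> ?T" for a
  proof -
    have "J a \<in> {x. 0 \<le> u \<bullet> x} \<inter> T" using a LJ(4) by simp
    then have "J a \<in> snd d ` W'" unfolding T(2) .
    then obtain z where z: "z \<in> W'" "J a = snd d z" by blast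
    have zd: "cinv d (J a) = z" unfolding z(2) by (rule cinv_simps[OF id]) (use z(1) W'd in blast)
    have "u \<bullet> snd d z = 0" unfolding z(2)[symmetric] using LJ(4) by blast
    then have "q z \<in> S" using W(5) z(1) by (simp add: W'_def)
    then show ?thesis using z zd by (simp add: W'_def)
  qed
  have \<theta>T: "?\<theta> x \<in> ?T" if x: "x \<in> S \<inter> Y" for x
  proof -
    have "snd d (?i x) \<in> snd d ` W'" using iY[OF x] by blast
    then have "snd d (?i x) \<in> T" unfolding T(2) by blast
    then show ?thesis using J\<theta>[OF x] by simp
  qed
  have "diffeo M (S \<inter> Y) eucl ?T ?\<theta>"
  proof (rule diffeoI[OF M manifold_eucl, where g = ?g])
    have "S \<inter> Y \<subseteq> q ` W" by (rule subsetI, drule bspec[OF Y(3)]) blast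
    then have "smooth_map M (S \<inter> Y) N ?i" by (rule smooth_map_subset[OF qD(2)])
    moreover have "?i ` (S \<inter> Y) \<subseteq> fst d" using iY W'd by blast
    ultimately have "smooth_map M (S \<inter> Y) eucl (\<lambda>x. snd d (?i x))"
      by (rule smooth_map_compose[OF M N manifold_eucl _ smooth_map_chart[OF N d(1)]])
    then show "smooth_map M (S \<inter> Y) eucl ?\<theta>"
      by (rule smooth_map_compose[OF M manifold_eucl manifold_eucl _ smooth_map_eucl[OF smooth_on_linear[OF bl(1), of UNIV]]]) simp
    have J: "J ` ?T \<subseteq> cimg d"
    proof
      fix p assume "p \<in> J ` ?T"
      then obtain a where a: "a \<in> ?T" "p = J a" by blast
      have "snd d (cinv d (J a)) \<in> cimg d" using g[OF a(1)] W'd by blast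
      then show "p \<in> cimg d" using g[OF a(1)] a(2) by simp
    qed
    have "smooth_map eucl ?T N (\<lambda>a. cinv d (J a))"
      by (rule smooth_map_compose[OF manifold_eucl manifold_eucl N smooth_map_eucl[OF smooth_on_linear[OF bl(2)]] smooth_map_cinv[OF N d(1)] J])
    then show "smooth_map eucl ?T M ?g"
      by (rule smooth_map_compose[OF manifold_eucl N M _ q_smooth]) (use g oW'[THEN openin_subset] in blast)
    show "?\<theta> x \<in> ?T" if "x \<in> S \<inter> Y" for x by (rule \<theta>T[OF that])
    show "?g a \<in> S \<inter> Y" if "a \<in> ?T" for a using g[OF that] by blast
    show "?g (?\<theta> x) = x" if x: "x \<in> S \<inter> Y" for x
    proof -
      have "?i x \<in> fst d" using iY[OF x] W'd by blast
      then show ?thesis unfolding J\<theta>[OF x] using id iY[OF x] by simp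
    qed
    show "?\<theta> (?g a) = a" if a: "a \<in> ?T" for a
    proof -
      have "cinv d (J a) \<in> W" using g[OF a] by (simp add: W'_def)
      then have "?i (?g a) = cinv d (J a)" by (rule qD(6))
      then show ?thesis using g[OF a] LJ(3) by simp
    qed
  qed
  note dd = this
  have im: "?\<theta> ` (S \<inter> Y) = ?T" by (rule diffeoD(3)[OF dd])
  have "open ?T" using T(1) linear_continuous_on[OF bl(2)] by (intro open_vimage)
  then have "surface_chart M S (S \<inter> Y, ?\<theta>)"
    unfolding surface_chart_def using oY dd im by (simp add: openin_subtopology_Int2)
  then show thesis by (rule that) (use x y Y(2) in simp)
qed

text \<open>The converse of \<open>push_oriented_surface\<close>: the atlas consists of the surface
  charts whose normal \<open>mu\<close> points to the side \<open>P\<close>. One sign argument,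
  \<open>pos\<close>, shows that surface determinants are positive both for the identity, which
  orients the atlas, and for \<open>f\<close>.\<close>

lemma preserves_surface_orientationI:
  fixes M :: "('a, real^3) mfd"
  assumes sc: "surface_cut M \<T> N q" and ST: "S \<in> \<T>" and oM: "oriented_manifold M" and f: "f \<in> Diff_plus M"
    and fS: "f ` S = S" and P: "normal_orientation M S P" and pP: "push M f P = P"
  shows "preserves_surface_orientation M S f"
proof -
  interpret conormal_surface M S by (rule surface_cut.conormal_surface_T[OF sc ST])
  define A0 where "A0 = {a. surface_chart M S a}"
  interpret atlas: surface_atlas3 M S A0
  proof
    show "\<Union> (fst ` A0) = S"
    proof
      show "\<Union> (fst ` A0) \<subseteq> S" by (auto simp: A0_def surface_chart_def dest: openin_imp_subset)
      show "S \<subseteq> \<Union> (fst ` A0)"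
      proof
        fix x assume "x \<in> S"
        then show "x \<in> \<Union> (fst ` A0)" by (rule surface_chart_at[OF sc ST]) (auto simp: A0_def)
      qed
    qed
  qed (use M S in \<open>auto simp: A0_def\<close>)
  have fD: "f \<in> Diff M" using f by (simp add: Diff_plus_def)
  define A where "A = {a \<in> A0. \<forall>x\<in>fst a. \<forall>c\<in>charts M. x \<in> fst c \<longrightarrow> (\<forall>v. (x, c, v) \<in> P \<longleftrightarrow> 0 < atlas.mu a c x \<bullet> v)}"
  have AA: "a \<in> A0" if "a \<in> A" for a using that by (simp add: A_def)
  have in_P: "(x, c, v) \<in> P \<longleftrightarrow> 0 < atlas.mu a c x \<bullet> v" if "a \<in> A" "x \<in> fst a" "c \<in> charts M" "x \<in> fst c" for a x c v
    using that by (simp add: A_def)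
  have AS: "fst a \<subseteq> S" if "a \<in> A" for a by (rule atlas.atlas_chart(1)[OF AA[OF that]])
  have cov: "\<exists>a\<in>A. x \<in> fst a" if x: "x \<in> S" for x
  proof -
    have xM: "x \<in> points M" using x S by blast
    obtain c where c: "c \<in> charts M" "x \<in> fst c" using point_chart[OF M xM] .
    obtain a0 where a0: "a0 \<in> A0" "x \<in> fst a0" using atlas.cover x by blast
    let ?\<mu> = "atlas.mu a0 c"
    obtain Y1 where Y1: "conormal M S c Y1 ?\<mu>" "x \<in> Y1" "S \<inter> Y1 \<subseteq> fst a0"
      using atlas.mu_conormal[OF a0(1) c(1) a0(2) c(2)] .
    obtain Y2 \<nu> where Y2: "conormal M S c Y2 \<nu>" "x \<in> Y2" "Y2 \<subseteq> Y1" "\<And>y v. y \<in> S \<inter> Y2 \<Longrightarrow> (y, c, v) \<in> P \<longleftrightarrow> 0 < \<nu> y \<bullet> v"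
      using normal_orientation_conormal[OF P S c(1) x c(2) Y1(1,2)] by metis
    have oY2: "openin (mtop M) Y2" using Y2(1) by (simp add: conormal_def)
    have C1: "conormal M S c Y2 ?\<mu>" by (rule conormal_subset[OF Y1(1) oY2 Y2(3)])
    have par: "?\<mu> y \<noteq> 0 \<and> \<nu> y \<noteq> 0 \<and> (\<forall>v. ?\<mu> y \<bullet> v = 0 \<longleftrightarrow> \<nu> y \<bullet> v = 0)" if y: "y \<in> S \<inter> Y2" for y
    proof -
      have "tangent_coords S c y = {v. ?\<mu> y \<bullet> v = 0}" "tangent_coords S c y = {v. \<nu> y \<bullet> v = 0}" "?\<mu> y \<noteq> 0" "\<nu> y \<noteq> 0"
        using C1 Y2(1) y by (auto simp: conormal_def)
      then show ?thesis by blast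
    qed
    have xY: "x \<in> S \<inter> Y2" "S \<inter> Y2 \<subseteq> points M" using x Y2(2) S by auto
    have ne: "?\<mu> x \<bullet> \<nu> x \<noteq> 0" using half_space_covectors(1)[of "?\<mu> x" "\<nu> x"] par[OF xY(1)] by blast
    \<comment> \<open>The sign of \<open>s\<close> tells whether \<open>?\<mu>\<close> and
      \<open>\<nu>\<close> point to the same side at \<open>x\<close>; scaling \<open>?\<mu>\<close>
      by \<open>s\<close> treats both cases at once.\<close>
    define s where "s = ?\<mu> x \<bullet> \<nu> x"
    have cc: "continuous_map (subtopology (mtop M) (S \<inter> Y2)) euclidean (\<lambda>y. s *\<^sub>R ?\<mu> y)"
      "continuous_map (subtopology (mtop M) (S \<inter> Y2)) euclidean \<nu>"
      using C1 Y2(1) unfolding conormal_def continuous_map_atin limitin_canonical_iff by (auto intro!: tendsto_intros)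
    have "0 < (s *\<^sub>R ?\<mu> x) \<bullet> \<nu> x" using not_real_square_gt_zero[of "?\<mu> x \<bullet> \<nu> x"] ne unfolding s_def inner_scaleR_left by blast
    then obtain V where V: "openin (mtop M) V" "x \<in> V" "\<And>y. y \<in> S \<inter> Y2 \<inter> V \<Longrightarrow> 0 < (s *\<^sub>R ?\<mu> y) \<bullet> \<nu> y"
      using continuous_inner_positive[OF cc xY(2,1)] by blast
    have s: "s \<noteq> 0" using ne by (simp add: s_def)
    \<comment> \<open>If \<open>mu\<close> points to the wrong side, exchanging the surface
      coordinates reverses it. Positivity of \<open>s * det (matrix \<sigma>)\<close> records that
      the corrected normal points to the side of \<open>\<nu>\<close>.\<close>
    obtain \<sigma> :: "real^2 \<Rightarrow> real^2" where \<sigma>: "linear \<sigma>" "\<forall>a. \<sigma> (\<sigma> a) = a" "0 < s * det (matrix \<sigma>)" using coordinate_sign[OF s] .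
    let ?U = "S \<inter> (Y2 \<inter> V)"
    have oU: "openin (subtopology (mtop M) S) ?U" by (rule openin_subtopology_Int2[OF openin_Int[OF oY2 V(1)]])
    have Ua: "?U \<subseteq> fst a0" using Y2(3) Y1(3) by blast
    let ?a = "(?U, \<lambda>x. \<sigma> (snd a0 x))"
    have a: "?a \<in> A0" using atlas.surface_chart_restrict[OF a0(1) oU Ua \<sigma>(1,2)] by (simp add: A0_def)
    have "(y, c', v) \<in> P \<longleftrightarrow> 0 < atlas.mu ?a c' y \<bullet> v" if y: "y \<in> ?U" and c': "c' \<in> charts M" "y \<in> fst c'" for y c' v
    proof -
      have yS: "y \<in> S" "y \<in> S \<inter> Y2" "y \<in> S \<inter> Y2 \<inter> V" using y by auto
      have yc: "y \<in> fst c" using Y2(1) y by (auto simp: conormal_def)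
      have ya0: "y \<in> fst a0" and ya: "y \<in> fst ?a" using y Ua by auto
      have bls: "bounded_linear \<sigma>" using \<sigma>(1) by (simp add: linear_conv_bounded_linear)
      have "loc_deriv a0 ?a (\<lambda>x. x) y = \<sigma>"
      proof (rule loc_deriv_unique[OF atlas.L atlas.L smooth_map_ident[OF atlas.L subset_refl] openin_topspace atlas.charts_L[OF a0(1)] atlas.charts_L[OF a] _ ya0 ya])
        show "y \<in> points atlas.L" unfolding atlas.points_L by (rule yS(1))
        have e: "loc_rep a0 ?a (\<lambda>x. x) p = \<sigma> p" if "p \<in> cimg a0" for p
          using that atlas.atlas_chart(6)[OF a0(1)] by (auto simp: loc_rep_def)
        have "(\<sigma> has_derivative \<sigma>) (at (snd a0 y) within cimg a0)" by (rule bounded_linear_imp_has_derivative[OF bls])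
        then show "(loc_rep a0 ?a (\<lambda>x. x) has_derivative \<sigma>) (at (snd a0 y) within cimg a0)"
          by (rule has_derivative_transform_within[OF _ zero_less_one]) (use e ya0 in auto)
      qed
      then have tr: "?\<mu> y \<bullet> w = det (matrix \<sigma>) * (atlas.mu ?a c y \<bullet> w)" for w
        using atlas.mu_surface_change[OF a0(1) a c(1) ya0 ya yc, of w] by simp
      have i: "(y, c, w) \<in> P \<longleftrightarrow> 0 < atlas.mu ?a c y \<bullet> w" for w
      proof -
        have "0 < (s *\<^sub>R ?\<mu> y) \<bullet> w \<longleftrightarrow> 0 < \<nu> y \<bullet> w"
          by (rule half_space_covectors(2)[rotated 2, OF _ V(3)[OF yS(3)]]) (use par[OF yS(2)] s in auto)
        moreover have "(s *\<^sub>R ?\<mu> y) \<bullet> w = (s * det (matrix \<sigma>)) * (atlas.mu ?a c y \<bullet> w)" by (simp add: tr)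
        moreover have "0 < (s * det (matrix \<sigma>)) * r \<longleftrightarrow> 0 < r" for r using \<sigma>(3) by (simp only: zero_less_mult_iff[of "s * det (matrix \<sigma>)"]) auto
        ultimately show ?thesis unfolding Y2(4)[OF yS(2)] by (simp only:)
      qed
      let ?D = "loc_deriv c' c (\<lambda>x. x) y"
      have "(y, c', v) \<in> P \<longleftrightarrow> (y, c, ?D v) \<in> P"
      proof
        assume "(y, c', v) \<in> P" then show "(y, c, ?D v) \<in> P" by (rule normal_orientation_chart_change[OF P _ c(1) yc])
      next
        assume "(y, c, ?D v) \<in> P"
        from normal_orientation_chart_change[OF P this c'] show "(y, c', v) \<in> P"
          using loc_deriv_chart_change(1)[OF M c'(1) c(1) c'(2) yc] by simp
      qed
      also have "\<dots> \<longleftrightarrow> 0 < atlas.mu ?a c y \<bullet> ?D v" by (rule i)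
      also have "\<dots> \<longleftrightarrow> 0 < atlas.mu ?a c' y \<bullet> v"
        using atlas.mu_coordinate_change[OF a c'(1) c(1) ya c'(2) yc, of v, symmetric] oriented_chart_change[OF oM c'(1) c(1) c'(2) yc]
        by (simp add: zero_less_mult_iff)
      finally show ?thesis .
    qed
    then have "?a \<in> A" using a by (simp add: A_def)
    moreover have "x \<in> fst ?a" using x Y2(2) V(2) by simp
    ultimately show ?thesis by blast
  qed
  have pos: "0 < det (matrix (loc_deriv a a' h x))"
    if h: "smooth_map M (points M) M h" "h ` S \<subseteq> S" and hP: "push M h P \<subseteq> P"
      and det: "\<And>c c'. c \<in> charts M \<Longrightarrow> c' \<in> charts M \<Longrightarrow> x \<in> fst c \<Longrightarrow> h x \<in> fst c' \<Longrightarrow> 0 < det (matrix (loc_deriv c c' h x))"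
      and a: "a \<in> A" "a' \<in> A" "x \<in> fst a" "h x \<in> fst a'" for h x a a'
  proof -
    have x: "x \<in> S" using AS[OF a(1)] a(3) by blast
    have xM: "x \<in> points M" "h x \<in> points M" using x h(2) S by auto
    obtain c where c: "c \<in> charts M" "x \<in> fst c" using point_chart[OF M xM(1)] .
    obtain c' where c': "c' \<in> charts M" "h x \<in> fst c'" using point_chart[OF M xM(2)] .
    obtain v where v: "(x, c, v) \<in> P" using normal_orientation_nonempty[OF P x c] .
    have "(h x, c', loc_deriv c c' h x v) \<in> P" using pushI[where f=h and x=x, OF v c'] hP by blast
    then have "0 < atlas.mu a' c' (h x) \<bullet> loc_deriv c c' h x v" using in_P[OF a(2,4) c'] by blast
    moreover have "0 < atlas.mu a c x \<bullet> v" using v in_P[OF a(1,3) c] by blast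
    ultimately show ?thesis
      using sign_transfer(2)[OF atlas.mu_transform[OF h(1) openin_topspace S h(2) AA[OF a(1)] AA[OF a(2)] c(1) c'(1) a(3) c(2) a(4) c'(2)]
        det[OF c(1) c'(1) c(2) c'(2)]] by blast
  qed
  have "surface_orientation M S A"
    unfolding surface_orientation_iff orientation_preserving_wrt_def
  proof (intro conjI ballI impI)
    show "surface_chart M S a" if "a \<in> A" for a using AA[OF that] by (simp add: A0_def)
    show "\<Union> (fst ` A) = S" using cov AS by blast
    show "0 < det (matrix (loc_deriv a a' (\<lambda>x. x) x))" if "a \<in> A" "a' \<in> A" "x \<in> fst a" "x \<in> fst a'" for a a' x
      by (rule pos[OF smooth_map_ident[OF M subset_refl] _ normal_orientation_push[OF P] oriented_chart_change[OF oM] that]) auto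
  qed
  moreover have "orientation_preserving_wrt A f"
    unfolding orientation_preserving_wrt_def
  proof (intro ballI impI)
    fix a a' x assume a: "a \<in> A" "a' \<in> A" "x \<in> fst a" "f x \<in> fst a'"
    show "0 < det (matrix (loc_deriv a a' f x))"
      by (rule pos[OF Diff_smooth[OF fD] _ _ _ a]) (use f fS pP in \<open>auto simp: Diff_plus_def orientation_preserving_wrt_def\<close>)
  qed
  ultimately show ?thesis using fS by (auto simp: preserves_surface_orientation_def)
qed

section \<open>The action on the graph\<close>

lemma BijI:
  assumes "f \<in> extensional X" "\<And>x. x \<in> X \<Longrightarrow> f x \<in> X" "\<And>x. x \<in> X \<Longrightarrow> g x \<in> X" "\<And>x. x \<in> X \<Longrightarrow> g (f x) = x" "\<And>x. x \<in> X \<Longrightarrow> f (g x) = x"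
  shows "f \<in> Bij X"
proof -
  have "bij_betw f X X" by (rule bij_betw_byWitness[where f' = g]) (use assms in auto)
  then show ?thesis using assms(1) by (simp add: Bij_def)
qed

lemma Aut_real_iff:
  "(\<sigma>, \<tau>, \<rho>) \<in> carrier (Aut_real G) \<longleftrightarrow> \<sigma> \<in> Bij (verts G) \<and> \<tau> \<in> Bij (edges G) \<and> \<rho> \<in> Bij (loop_orientations G) \<and>
    (\<forall>v\<in>verts G. decor G (\<sigma> v) = decor G v) \<and> (\<forall>e\<in>edges G. ends G (\<tau> e) = \<sigma> ` ends G e) \<and>
    (\<forall>es\<in>loop_orientations G. fst (\<rho> es) = \<tau> (fst es))"
  by (auto simp: Aut_real_def)

text \<open>A subgroup of a product of three permutation groups. Composites and inverses are cut off
  outside the permuted sets, so incidence is transported because all endpoints lie in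
  \<open>verts G\<close>.\<close>

lemma group_Aut_real:
  assumes ends: "\<And>e. e \<in> edges G \<Longrightarrow> ends G e \<subseteq> verts G"
  shows "group (Aut_real G)"
proof -
  let ?P = "BijGroup (verts G) \<times>\<times> BijGroup (edges G) \<times>\<times> BijGroup (loop_orientations G)"
  have gP: "group ?P" by (intro DirProd_group group_BijGroup)
  have lo: "e \<in> edges G" if "(e, s) \<in> loop_orientations G" for e s
    using that by (auto simp: loop_orientations_def loops_def)
  have inv: "inv\<^bsub>?P\<^esub> (\<sigma>, \<tau>, \<rho>) = (\<lambda>x\<in>verts G. inv_into (verts G) \<sigma> x, \<lambda>x\<in>edges G. inv_into (edges G) \<tau> x,
      \<lambda>x\<in>loop_orientations G. inv_into (loop_orientations G) \<rho> x)"
    if "\<sigma> \<in> Bij (verts G)" "\<tau> \<in> Bij (edges G)" "\<rho> \<in> Bij (loop_orientations G)" for \<sigma> \<tau> \<rho>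
  proof -
    have c: "\<sigma> \<in> carrier (BijGroup (verts G))" "\<tau> \<in> carrier (BijGroup (edges G))" "\<rho> \<in> carrier (BijGroup (loop_orientations G))"
      using that by (simp_all add: BijGroup_def)
    have "(\<tau>, \<rho>) \<in> carrier (BijGroup (edges G) \<times>\<times> BijGroup (loop_orientations G))" using c by simp
    from inv_DirProd[OF group_BijGroup DirProd_group[OF group_BijGroup group_BijGroup] c(1) this] inv_DirProd[OF group_BijGroup group_BijGroup c(2,3)]
    show ?thesis by (simp only: inv_BijGroup[OF that(1)] inv_BijGroup[OF that(2)] inv_BijGroup[OF that(3)])
  qed
  have "subgroup (carrier (Aut_real G)) ?P"
  proof (rule group.subgroupI[OF gP])
    show "carrier (Aut_real G) \<subseteq> carrier ?P" by (auto simp: Aut_real_def BijGroup_def)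
    have "(\<lambda>x\<in>verts G. x, \<lambda>x\<in>edges G. x, \<lambda>x\<in>loop_orientations G. x) \<in> carrier (Aut_real G)"
      unfolding Aut_real_iff
    proof (intro conjI ballI)
      show "ends G ((\<lambda>x\<in>edges G. x) e) = (\<lambda>x\<in>verts G. x) ` ends G e" if e: "e \<in> edges G" for e
      proof -
        have "(\<lambda>x\<in>verts G. x) ` ends G e = (\<lambda>x. x) ` ends G e" by (rule image_cong) (use ends[OF e] in auto)
        then show ?thesis using e by simp
      qed
    qed (use lo in \<open>auto simp: id_Bij\<close>)
    then show "carrier (Aut_real G) \<noteq> {}" by blast
  next
    fix p assume p: "p \<in> carrier (Aut_real G)"
    obtain \<sigma> \<tau> \<rho> where p_eq: "p = (\<sigma>, \<tau>, \<rho>)" by (cases p)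
    have B: "\<sigma> \<in> Bij (verts G)" "\<tau> \<in> Bij (edges G)" "\<rho> \<in> Bij (loop_orientations G)"
      and dec: "\<And>v. v \<in> verts G \<Longrightarrow> decor G (\<sigma> v) = decor G v"
      and en: "\<And>e. e \<in> edges G \<Longrightarrow> ends G (\<tau> e) = \<sigma> ` ends G e"
      and fs: "\<And>e s. (e, s) \<in> loop_orientations G \<Longrightarrow> fst (\<rho> (e, s)) = \<tau> e"
      using p unfolding p_eq Aut_real_def by auto
    have bb: "bij_betw \<sigma> (verts G) (verts G)" "bij_betw \<tau> (edges G) (edges G)" "bij_betw \<rho> (loop_orientations G) (loop_orientations G)"
      using B by (simp_all add: Bij_def)
    show "inv\<^bsub>?P\<^esub> p \<in> carrier (Aut_real G)"
      unfolding p_eq inv[OF B] Aut_real_iff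
    proof (intro conjI ballI)
      show "restrict (inv_into (verts G) \<sigma>) (verts G) \<in> Bij (verts G)" "restrict (inv_into (edges G) \<tau>) (edges G) \<in> Bij (edges G)"
        "restrict (inv_into (loop_orientations G) \<rho>) (loop_orientations G) \<in> Bij (loop_orientations G)"
        using B by (auto intro: restrict_inv_into_Bij)
      show "decor G (restrict (inv_into (verts G) \<sigma>) (verts G) v) = decor G v" if v: "v \<in> verts G" for v
        using dec[of "inv_into (verts G) \<sigma> v"] v bij_betw_inv_into_right[OF bb(1) v] bij_betwE[OF bij_betw_inv_into[OF bb(1)]] by simp
      show "ends G (restrict (inv_into (edges G) \<tau>) (edges G) e) = restrict (inv_into (verts G) \<sigma>) (verts G) ` ends G e" if e: "e \<in> edges G" for e
      proof -
        let ?e = "inv_into (edges G) \<tau> e"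
        have e': "?e \<in> edges G" "\<tau> ?e = e" using e bij_betw_inv_into_right[OF bb(2) e] bij_betwE[OF bij_betw_inv_into[OF bb(2)]] by auto
        have E: "ends G e = \<sigma> ` ends G ?e" using en[OF e'(1)] e'(2) by simp
        have "restrict (inv_into (verts G) \<sigma>) (verts G) (\<sigma> v) = v" if "v \<in> ends G ?e" for v
        proof -
          have v: "v \<in> verts G" using that ends[OF e'(1)] by blast
          then have "\<sigma> v \<in> verts G" using bij_betwE[OF bb(1)] by blast
          then show ?thesis using bij_betw_inv_into_left[OF bb(1) v] by simp
        qed
        then have "restrict (inv_into (verts G) \<sigma>) (verts G) ` ends G e = ends G ?e" unfolding E image_image by simp
        then show ?thesis using e by simp
      qed
      fix es assume es: "es \<in> loop_orientations G"
      obtain e s where es_eq: "es = (e, s)" by (cases es)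
      let ?x = "inv_into (loop_orientations G) \<rho> (e, s)"
      have x: "?x \<in> loop_orientations G" "\<rho> ?x = (e, s)"
        using es bij_betw_inv_into_right[OF bb(3)] bij_betwE[OF bij_betw_inv_into[OF bb(3)]] unfolding es_eq by auto
      obtain e0 s0 where e0: "?x = (e0, s0)" by (cases ?x)
      have "e0 \<in> edges G" "\<tau> e0 = e" using lo x fs[of e0 s0] unfolding e0 by auto
      then have "inv_into (edges G) \<tau> e = e0" using bij_betw_inv_into_left[OF bb(2)] by blast
      then show "fst (restrict (inv_into (loop_orientations G) \<rho>) (loop_orientations G) es) = restrict (inv_into (edges G) \<tau>) (edges G) (fst es)"
        using es lo e0 unfolding es_eq by simp
    qed
    fix p' assume p': "p' \<in> carrier (Aut_real G)"
    obtain \<sigma>' \<tau>' \<rho>' where p'_eq: "p' = (\<sigma>', \<tau>', \<rho>')" by (cases p')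
    have B': "\<sigma>' \<in> Bij (verts G)" "\<tau>' \<in> Bij (edges G)" "\<rho>' \<in> Bij (loop_orientations G)"
      and dec': "\<And>v. v \<in> verts G \<Longrightarrow> decor G (\<sigma>' v) = decor G v"
      and en': "\<And>e. e \<in> edges G \<Longrightarrow> ends G (\<tau>' e) = \<sigma>' ` ends G e"
      and fs': "\<And>e s. (e, s) \<in> loop_orientations G \<Longrightarrow> fst (\<rho>' (e, s)) = \<tau>' e"
      using p' unfolding p'_eq Aut_real_def by auto
    have in': "\<sigma>' v \<in> verts G" if "v \<in> verts G" for v using B'(1) that by (auto simp: Bij_def dest: bij_betwE)
    have in'': "\<tau>' e \<in> edges G" if "e \<in> edges G" for e using B'(2) that by (auto simp: Bij_def dest: bij_betwE)
    have in''': "\<rho>' e \<in> loop_orientations G" if "e \<in> loop_orientations G" for e using B'(3) that by (auto simp: Bij_def dest: bij_betwE)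
    have m: "p \<otimes>\<^bsub>?P\<^esub> p' = (compose (verts G) \<sigma> \<sigma>', compose (edges G) \<tau> \<tau>', compose (loop_orientations G) \<rho> \<rho>')"
      using B B' unfolding p_eq p'_eq by (simp add: DirProd_def BijGroup_def)
    show "p \<otimes>\<^bsub>?P\<^esub> p' \<in> carrier (Aut_real G)"
      unfolding m Aut_real_iff
    proof (intro conjI ballI)
      show "compose (verts G) \<sigma> \<sigma>' \<in> Bij (verts G)" "compose (edges G) \<tau> \<tau>' \<in> Bij (edges G)" "compose (loop_orientations G) \<rho> \<rho>' \<in> Bij (loop_orientations G)"
        using B B' by (auto intro: compose_Bij)
      show "decor G (compose (verts G) \<sigma> \<sigma>' v) = decor G v" if "v \<in> verts G" for v
        using that dec dec' in' by (simp add: compose_def)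
      show "ends G (compose (edges G) \<tau> \<tau>' e) = compose (verts G) \<sigma> \<sigma>' ` ends G e" if e: "e \<in> edges G" for e
      proof -
        have "ends G (compose (edges G) \<tau> \<tau>' e) = \<sigma> ` \<sigma>' ` ends G e" using e en[OF in''[OF e]] en'[OF e] by (simp add: compose_def)
        also have "\<dots> = compose (verts G) \<sigma> \<sigma>' ` ends G e"
          unfolding image_image by (rule image_cong) (use ends[OF e] in \<open>auto simp: compose_def\<close>)
        finally show ?thesis .
      qed
      fix es assume es: "es \<in> loop_orientations G"
      obtain e s where es_eq: "es = (e, s)" by (cases es)
      obtain e1 s1 where e1: "\<rho>' (e, s) = (e1, s1)" by (cases "\<rho>' (e, s)")
      have "(e1, s1) \<in> loop_orientations G" using in'''[OF es] unfolding es_eq e1 .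
      then have "fst (\<rho> (e1, s1)) = \<tau> e1" by (rule fs)
      moreover have "e1 = \<tau>' e" using fs'[OF es[unfolded es_eq]] e1 by simp
      ultimately show "fst (compose (loop_orientations G) \<rho> \<rho>' es) = compose (edges G) \<tau> \<tau>' (fst es)"
        using es lo e1 unfolding es_eq by (simp add: compose_def)
    qed
  qed
  from subgroup.subgroup_is_group[OF this gP] show ?thesis by (simp add: Aut_real_def)
qed

lemma Aut_real_simps:
  "\<one>\<^bsub>Aut_real G\<^esub> = (\<lambda>x\<in>verts G. x, \<lambda>x\<in>edges G. x, \<lambda>x\<in>loop_orientations G. x)"
  "\<sigma> \<in> Bij (verts G) \<Longrightarrow> \<sigma>' \<in> Bij (verts G) \<Longrightarrow> \<tau> \<in> Bij (edges G) \<Longrightarrow> \<tau>' \<in> Bij (edges G) \<Longrightarrow>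
   \<rho> \<in> Bij (loop_orientations G) \<Longrightarrow> \<rho>' \<in> Bij (loop_orientations G) \<Longrightarrow>
   (\<sigma>, \<tau>, \<rho>) \<otimes>\<^bsub>Aut_real G\<^esub> (\<sigma>', \<tau>', \<rho>') = (compose (verts G) \<sigma> \<sigma>', compose (edges G) \<tau> \<tau>', compose (loop_orientations G) \<rho> \<rho>')"
  by (simp_all add: Aut_real_def DirProd_def BijGroup_def)

section \<open>Induced permutations of pieces, tori and boundary components\<close>

locale graph_setup = surface_cut M \<T> N q
  for M :: "('a, real^3) mfd" and \<T> :: "'a set set" and N :: "('b, real^3) mfd" and q +
  fixes \<beta> :: "'a set \<Rightarrow> bool \<Rightarrow> ('a, real^3) tangent set"
  assumes oriented: "oriented_manifold M" and ne_M: "points M \<noteq> {}"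
    and beta: "loop_normal_orientations M (jsj_graph M \<T> N q) \<beta>"
begin

definition "G = jsj_graph M \<T> N q"
definition "K = Diff_plus_rel M (\<Union>\<T>)"

lemma G_simps: "verts G = insert None (Some ` components_mfd N)" "edges G = boundary_components M \<union> \<T>"
  "ends G e = {v. v = None \<and> e \<in> boundary_components M} \<union>
     {Some C | C. C \<in> components_mfd N \<and> (\<exists>S\<in>boundary_components N. S \<subseteq> C \<and> q ` S = e)}"
  by (simp_all add: G_def jsj_graph_def)

lemma ends_verts: "ends G e \<subseteq> verts G" by (auto simp: G_simps)

lemma edge_points: "e \<in> edges G \<Longrightarrow> e \<subseteq> points M"
  using boundary_component_props(1)[OF M] boundary_subset[OF M] S_points by (auto simp: G_simps)

lemma edge_ne: "e \<in> edges G \<Longrightarrow> e \<noteq> {}"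
  using boundary_component_props(4)[OF M] ne_S by (auto simp: G_simps)

lemma not_boundary_component: "S \<in> \<T> \<Longrightarrow> S \<notin> boundary_components M"
  using boundary_component_props(1)[OF M] ne_S Tb by blast

lemma K_D:
  assumes "f \<in> K"
  shows "f \<in> Diff_plus M" "f \<in> Diff M" "f ` \<Union>\<T> = \<Union>\<T>"
  using assms by (auto simp: K_def Diff_plus_rel_def Diff_plus_def)

lemma K_compose:
  assumes f: "f \<in> K" and g: "g \<in> K"
  shows "compose (points M) f g \<in> K"
proof -
  have "compose (points M) f g ` \<Union>\<T> = f ` g ` \<Union>\<T>"
    unfolding image_image by (rule image_cong) (use T_points in \<open>auto simp: compose_def\<close>)
  then show ?thesis using Diff_plus_compose[OF M] K_D[OF f] K_D[OF g] by (simp add: K_def Diff_plus_rel_def)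
qed

lemma K_Dinv:
  assumes f: "f \<in> K"
  shows "Dinv M f \<in> K"
proof -
  have "Dinv M f ` f ` \<Union>\<T> = \<Union>\<T>" by (rule Dinv_image(1)[OF K_D(2)[OF f] T_points])
  then show ?thesis using Diff_plus_Dinv[OF M] K_D[OF f] by (simp add: K_def Diff_plus_rel_def)
qed

lemma K_ident: "(\<lambda>x\<in>points M. x) \<in> K"
proof -
  have "(\<lambda>x\<in>points M. x) ` \<Union>\<T> = (\<lambda>x. x) ` \<Union>\<T>" by (rule image_cong) (use T_points in auto)
  then show ?thesis using Diff_plus_ident[OF oriented] by (simp add: K_def Diff_plus_rel_def)
qed

lemma subgroup_K: "subgroup K (BijGroup (points M))"
  by (rule subgroup_DiffI[OF M _ K_ident K_compose K_Dinv]) (use K_D in auto)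

text \<open>The image of a torus is connected and lies in a disjoint union of finitely many closed
  tori, so one point decides which of them contains it.\<close>

lemma K_S_subset:
  assumes f: "f \<in> K" and S: "S \<in> \<T>" "S' \<in> \<T>" and x: "x \<in> S" "f x \<in> S'"
  shows "f ` S \<subseteq> S'"
proof (rule connectedin_subset_closed)
  show "connectedin (mtop M) (f ` S)"
    by (rule connectedin_continuous_map_image[OF homeomorphic_imp_continuous_map[OF Diff_homeomorphic[OF M K_D(2)[OF f]]] conn_S[OF S(1)]])
  have "f ` S \<subseteq> \<Union>\<T>" using K_D(3)[OF f] S(1) by blast
  then show "f ` S \<subseteq> S' \<union> \<Union> (\<T> - {S'})" by blast
  show "f x \<in> f ` S" using x(1) by blast
qed (use closed_S[OF S(2)] closed_rest disjoint_rest[OF S(2)] x in auto)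

lemma K_S:
  assumes f: "f \<in> K" and S: "S \<in> \<T>"
  shows "f ` S \<in> \<T>"
proof -
  obtain x where x: "x \<in> S" using ne_S[OF S] by blast
  then have "f x \<in> \<Union>\<T>" using K_D(3)[OF f] S by blast
  then obtain S' where S': "S' \<in> \<T>" "f x \<in> S'" by blast
  have xM: "x \<in> points M" using x S_points[OF S] by blast
  have 1: "f ` S \<subseteq> S'" by (rule K_S_subset[OF f S S'(1) x S'(2)])
  have "Dinv M f (f x) \<in> S" using Dinv_simps(1)[OF K_D(2)[OF f] xM] x by simp
  then have 2: "Dinv M f ` S' \<subseteq> S" by (rule K_S_subset[OF K_Dinv[OF f] S'(1) S S'(2)])
  have "f ` Dinv M f ` S' = S'" by (rule Dinv_image(2)[OF K_D(2)[OF f] S_points[OF S'(1)]])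
  then have "f ` S = S'" using 1 2 by blast
  then show ?thesis using S'(1) by simp
qed

lemma K_edge:
  assumes f: "f \<in> K"
  shows "e \<in> boundary_components M \<Longrightarrow> f ` e \<in> boundary_components M" and "e \<in> edges G \<Longrightarrow> f ` e \<in> edges G"
proof -
  show 1: "f ` e \<in> boundary_components M" if "e \<in> boundary_components M" for e
    by (rule Diff_boundary_components[OF M Diff_diffeo[OF K_D(2)[OF f]] that])
  show "f ` e \<in> edges G" if "e \<in> edges G" using that 1 K_S[OF f] by (auto simp: G_simps)
qed

lemma Dinv_edge:
  assumes "f \<in> K" "e \<in> edges G"
  shows "Dinv M f ` f ` e = e" "f ` Dinv M f ` e = e"
  using Dinv_image[OF K_D(2)[OF assms(1)] edge_points[OF assms(2)]] by auto

lemma compose_image: "A \<subseteq> points M \<Longrightarrow> compose (points M) f g ` A = f ` g ` A"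
  unfolding image_image by (rule image_cong) (auto simp: compose_def)

text \<open>The description by images is unambiguous by \<open>component_image_inj\<close>;
  existence comes from the lift of \<open>f\<close> to \<open>N\<close>.\<close>

definition vm :: "('a \<Rightarrow> 'a) \<Rightarrow> 'b set \<Rightarrow> 'b set" where
  "vm f C = (THE C'. C' \<in> components_mfd N \<and> q ` C' = f ` (q ` C))"

lemma qC_points: "C \<in> components_mfd N \<Longrightarrow> q ` C \<subseteq> points M"
  using connected_components_of_subset q_in by blast

lemma vm_unique:
  assumes "C' \<in> components_mfd N" "q ` C' = f ` q ` C"
  shows "vm f C = C'"
  unfolding vm_def by (rule the_equality) (use assms component_image_inj in auto)

lemma vm_lift:
  assumes "diffeo N (points N) N (points N) g" "\<And>y. y \<in> points N \<Longrightarrow> q (g y) = f (q y)" "C \<in> components_mfd N"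
  shows "vm f C = g ` C"
  by (rule vm_unique[OF lift_component[OF assms]])

lemma vm_props:
  assumes f: "f \<in> K" and C: "C \<in> components_mfd N"
  shows "vm f C \<in> components_mfd N" "q ` vm f C = f ` q ` C"
proof -
  obtain g where g: "diffeo N (points N) N (points N) g" "\<And>y. y \<in> points N \<Longrightarrow> q (g y) = f (q y)"
    using lift_diffeo[OF K_D(2,3)[OF f]] by blast
  have "vm f C = g ` C" by (rule vm_lift[OF g C])
  then show "vm f C \<in> components_mfd N" "q ` vm f C = f ` q ` C"
    using lift_component[of g f C, OF g C] by (simp_all only:)
qed

lemma vm_compose:
  assumes f: "f \<in> K" and g: "g \<in> K" and C: "C \<in> components_mfd N"
  shows "vm (compose (points M) f g) C = vm f (vm g C)"
proof (rule vm_unique)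
  note v = vm_props[OF g C]
  show "vm f (vm g C) \<in> components_mfd N" by (rule vm_props(1)[OF f v(1)])
  show "q ` vm f (vm g C) = compose (points M) f g ` q ` C"
    unfolding vm_props(2)[OF f v(1)] v(2) compose_image[OF qC_points[OF C]] ..
qed

lemma vm_ident: "C \<in> components_mfd N \<Longrightarrow> vm (\<lambda>x\<in>points M. x) C = C"
proof (rule vm_unique)
  assume C: "C \<in> components_mfd N"
  have "(\<lambda>x\<in>points M. x) ` q ` C = (\<lambda>x. x) ` q ` C" by (rule image_cong) (use qC_points[OF C] in auto)
  then show "q ` C = (\<lambda>x\<in>points M. x) ` q ` C" by simp
qed

lemma Dinv_compose:
  assumes "f \<in> Diff M"
  shows "compose (points M) (Dinv M f) f = (\<lambda>x\<in>points M. x)" "compose (points M) f (Dinv M f) = (\<lambda>x\<in>points M. x)"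
  using Dinv_simps[OF assms] by (auto simp: compose_def fun_eq_iff)

lemma vm_Dinv:
  assumes f: "f \<in> K" and C: "C \<in> components_mfd N"
  shows "vm (Dinv M f) (vm f C) = C" "vm f (vm (Dinv M f) C) = C"
  using vm_compose[OF K_Dinv[OF f] f C] vm_compose[OF f K_Dinv[OF f] C] Dinv_compose[OF K_D(2)[OF f]] vm_ident[OF C] by auto

definition \<sigma> :: "('a \<Rightarrow> 'a) \<Rightarrow> 'b set option \<Rightarrow> 'b set option" where "\<sigma> f = map_option (vm f)"

lemma sigma_verts: "f \<in> K \<Longrightarrow> v \<in> verts G \<Longrightarrow> \<sigma> f v \<in> verts G"
  using vm_props(1) by (auto simp: G_simps \<sigma>_def)

lemma sigma_Dinv: "f \<in> K \<Longrightarrow> v \<in> verts G \<Longrightarrow> \<sigma> (Dinv M f) (\<sigma> f v) = v" "f \<in> K \<Longrightarrow> v \<in> verts G \<Longrightarrow> \<sigma> f (\<sigma> (Dinv M f) v) = v"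
  using vm_Dinv by (auto simp: G_simps \<sigma>_def)

text \<open>The lift restricts to a diffeomorphism between the two components, so the same subsets
  of \<open>N\<close> are diffeomorphic to either.\<close>

lemma sigma_decor:
  assumes f: "f \<in> K" and v: "v \<in> verts G"
  shows "decor G (\<sigma> f v) = decor G v"
proof (cases v)
  case None
  then show ?thesis by (simp add: \<sigma>_def)
next
  case (Some C)
  then have C: "C \<in> components_mfd N" using v by (auto simp: G_simps)
  obtain g where g: "diffeo N (points N) N (points N) g" "\<And>y. y \<in> points N \<Longrightarrow> q (g y) = f (q y)"
    using lift_diffeo[OF K_D(2,3)[OF f]] by blast
  have e: "vm f C = g ` C" by (rule vm_lift[OF g C])
  have d: "diffeo N C N (vm f C) g" unfolding e
    by (rule diffeo_restrict[OF N N g(1) connected_components_of_subset[OF C]])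
  have "(\<exists>h. diffeo N (vm f C) N C' h) \<longleftrightarrow> (\<exists>h. diffeo N C N C' h)" for C'
    using diffeo_compose[OF N N N d] diffeo_compose[OF N N N diffeo_inverse[OF N N d]] by blast
  then show ?thesis using Some by (simp add: \<sigma>_def G_def jsj_graph_def)
qed

text \<open>Incidence is witnessed by a boundary component of \<open>N\<close>, which the lift
  carries along. The reverse inclusion is obtained later from the inverse diffeomorphism.\<close>

lemma sigma_ends_subset:
  assumes f: "f \<in> K" and v: "v \<in> ends G e"
  shows "\<sigma> f v \<in> ends G (f ` e)"
proof (cases v)
  case None
  then show ?thesis using v K_edge(1)[OF f] by (auto simp: \<sigma>_def G_simps)
next
  case (Some C)
  then obtain S where C: "C \<in> components_mfd N" "S \<in> boundary_components N" "S \<subseteq> C" "q ` S = e" using v by (auto simp: G_simps)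
  obtain g where g: "diffeo N (points N) N (points N) g" "\<And>y. y \<in> points N \<Longrightarrow> q (g y) = f (q y)"
    using lift_diffeo[OF K_D(2,3)[OF f]] by blast
  have SN: "S \<subseteq> points N" using C(3) connected_components_of_subset[OF C(1)] by blast
  have "g ` S \<in> boundary_components N" by (rule Diff_boundary_components[OF N g(1) C(2)])
  moreover have "q ` g ` S = f ` e" unfolding C(4)[symmetric] image_image by (rule image_cong) (use g(2) SN in auto)
  moreover have "vm f C = g ` C" by (rule vm_lift[OF g C(1)])
  then have "g ` S \<subseteq> vm f C" using C(3) by (simp only: image_mono)
  ultimately show ?thesis using vm_props(1)[OF f C(1)] Some by (auto simp: \<sigma>_def G_simps)
qed

lemma sigma_ends:
  assumes f: "f \<in> K" and e: "e \<in> edges G"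
  shows "ends G (f ` e) = \<sigma> f ` ends G e"
proof
  show "\<sigma> f ` ends G e \<subseteq> ends G (f ` e)" using sigma_ends_subset[OF f] by blast
  show "ends G (f ` e) \<subseteq> \<sigma> f ` ends G e"
  proof
    fix v assume v: "v \<in> ends G (f ` e)"
    have "\<sigma> (Dinv M f) v \<in> ends G e" using sigma_ends_subset[OF K_Dinv[OF f] v] unfolding Dinv_edge(1)[OF f e] .
    moreover have "\<sigma> f (\<sigma> (Dinv M f) v) = v" by (rule sigma_Dinv(2)[OF f]) (use v ends_verts in blast)
    ultimately show "v \<in> \<sigma> f ` ends G e" by force
  qed
qed

section \<open>Loops and the action on their orientations\<close>

lemma loops_iff: "e \<in> loops G \<longleftrightarrow> e \<in> edges G \<and> (\<exists>v. ends G e = {v})"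
  by (simp add: loops_def card_1_singleton_iff)

text \<open>A boundary torus joins the vertex \<open>None\<close> to a piece, so it has two distinct
  ends.\<close>

lemma loop_in_T:
  assumes e: "e \<in> loops G"
  shows "e \<in> \<T>"
proof (rule ccontr)
  assume "e \<notin> \<T>"
  then have eb: "e \<in> boundary_components M" using e by (auto simp: loops_def G_simps)
  obtain S' where S': "S' \<in> boundary_components N" "q ` S' = e" using boundary_component_lift[OF eb] .
  note p = boundary_component_props[OF N S'(1)]
  obtain y where y: "y \<in> S'" using p(4) by blast
  have "y \<in> points N" using p(1) boundary_subset[OF N] y by blast
  then obtain C where C: "C \<in> components_mfd N" "y \<in> C" using component_at by metis
  have "S' \<subseteq> C" by (rule connected_components_of_maximal[OF C(1) p(2)]) (use C(2) y in \<open>auto simp: disjnt_def\<close>)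
  then have "Some C \<in> ends G e" "None \<in> ends G e" using C(1) S' eb by (auto simp: G_simps)
  then show False using e by (auto simp: loops_iff)
qed

lemma K_loop:
  assumes f: "f \<in> K" and e: "e \<in> loops G"
  shows "f ` e \<in> loops G"
  using e K_edge(2)[OF f] sigma_ends[OF f] by (auto simp: loops_iff)

lemma loop_edge: "e \<in> loops G \<Longrightarrow> e \<in> edges G" by (simp add: loops_def)

lemma beta_bij: "e \<in> loops G \<Longrightarrow> bij_betw (\<beta> e) UNIV {P. normal_orientation M e P}"
  using beta unfolding loop_normal_orientations_def G_def by blast

lemma beta_normal: "e \<in> loops G \<Longrightarrow> normal_orientation M e (\<beta> e s)"
  using bij_betwE[OF beta_bij] by blast

lemma push_normal:
  assumes "f \<in> K" "e \<in> edges G" "normal_orientation M e P"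
  shows "normal_orientation M (f ` e) (push M f P)"
  by (rule push_normal_orientation[OF M K_D(2)[OF assms(1)] edge_points[OF assms(2)] assms(3)])

text \<open>The value exists because a pushed normal orientation is again a normal orientation, and
  is unique because \<open>\<beta>\<close> is a bijection for each loop.\<close>

definition lo :: "('a \<Rightarrow> 'a) \<Rightarrow> 'a set \<Rightarrow> bool \<Rightarrow> bool" where
  "lo f e s = (THE s'. \<beta> (f ` e) s' = push M f (\<beta> e s))"

lemma lo_unique:
  assumes f: "f \<in> K" and e: "e \<in> loops G" and s': "\<beta> (f ` e) s' = push M f (\<beta> e s)"
  shows "lo f e s = s'"
  unfolding lo_def
proof (rule the_equality)
  show "\<beta> (f ` e) s' = push M f (\<beta> e s)" by (rule s')
  fix t assume "\<beta> (f ` e) t = push M f (\<beta> e s)"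
  then have "\<beta> (f ` e) t = \<beta> (f ` e) s'" using s' by simp
  then show "t = s'" using bij_betw_imp_inj_on[OF beta_bij[OF K_loop[OF f e]]] by (simp add: inj_eq)
qed

lemma lo_props:
  assumes f: "f \<in> K" and e: "e \<in> loops G"
  shows "\<beta> (f ` e) (lo f e s) = push M f (\<beta> e s)"
proof -
  have "push M f (\<beta> e s) \<in> {P. normal_orientation M (f ` e) P}" using push_normal[OF f loop_edge[OF e] beta_normal[OF e]] by simp
  then have "push M f (\<beta> e s) \<in> range (\<beta> (f ` e))" using bij_betw_imp_surj_on[OF beta_bij[OF K_loop[OF f e]]] by simp
  then obtain s' where s': "\<beta> (f ` e) s' = push M f (\<beta> e s)" by force
  then show ?thesis using lo_unique[OF f e s'] by simp
qed

lemma lo_compose: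
  assumes f: "f \<in> K" and g: "g \<in> K" and e: "e \<in> loops G"
  shows "lo (compose (points M) f g) e s = lo f (g ` e) (lo g e s)"
proof (rule lo_unique[OF K_compose[OF f g] e])
  show "\<beta> (compose (points M) f g ` e) (lo f (g ` e) (lo g e s)) = push M (compose (points M) f g) (\<beta> e s)"
    unfolding compose_image[OF edge_points[OF loop_edge[OF e]]] lo_props[OF f K_loop[OF g e]] lo_props[OF g e]
      push_compose[OF M K_D(2)[OF f] K_D(2)[OF g] normal_orientation_tvecs[OF beta_normal[OF e]]] ..
qed

lemma ident_edge: "e \<in> edges G \<Longrightarrow> (\<lambda>x\<in>points M. x) ` e = e"
  using edge_points by (auto simp: image_iff subset_iff)

lemma lo_ident:
  assumes e: "e \<in> loops G"
  shows "lo (\<lambda>x\<in>points M. x) e s = s"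
  by (rule lo_unique[OF K_ident e])
    (simp only: push_restrict_ident[OF M beta_normal[OF e]] ident_edge[OF loop_edge[OF e]])

definition \<rho> :: "('a \<Rightarrow> 'a) \<Rightarrow> 'a set \<times> bool \<Rightarrow> 'a set \<times> bool" where "\<rho> f es = (f ` fst es, lo f (fst es) (snd es))"

lemma lo_iff: "es \<in> loop_orientations G \<longleftrightarrow> fst es \<in> loops G"
  by (auto simp: loop_orientations_def mem_Times_iff)

lemma rho_Dinv:
  assumes f: "f \<in> K" and es: "es \<in> loop_orientations G"
  shows "\<rho> (Dinv M f) (\<rho> f es) = es" "\<rho> f (\<rho> (Dinv M f) es) = es"
proof -
  have e: "fst es \<in> loops G" using es by (simp add: lo_iff)
  note D = Dinv_edge[OF f loop_edge[OF e]] and DC = Dinv_compose[OF K_D(2)[OF f]]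
  show "\<rho> (Dinv M f) (\<rho> f es) = es"
    using lo_compose[OF K_Dinv[OF f] f e, of "snd es"] D(1) unfolding DC(1) lo_ident[OF e] by (simp add: \<rho>_def)
  show "\<rho> f (\<rho> (Dinv M f) es) = es"
    using lo_compose[OF f K_Dinv[OF f] e, of "snd es"] D(2) unfolding DC(2) lo_ident[OF e] by (simp add: \<rho>_def)
qed

lemma rho_in: "f \<in> K \<Longrightarrow> es \<in> loop_orientations G \<Longrightarrow> \<rho> f es \<in> loop_orientations G"
  using K_loop by (simp add: lo_iff \<rho>_def)

section \<open>The homomorphism to the automorphism group\<close>

definition "act = graph_action M \<T> N q \<beta>"

lemma act_eq: "act f = (restrict (\<sigma> f) (verts G), restrict ((`) f) (edges G), restrict (\<rho> f) (loop_orientations G))"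
  unfolding act_def graph_action_def Let_def G_def[symmetric] \<sigma>_def \<rho>_def vm_def[abs_def] lo_def
  by (auto simp: restrict_def fun_eq_iff)

lemma act_Bij:
  assumes f: "f \<in> K"
  shows "restrict (\<sigma> f) (verts G) \<in> Bij (verts G)" "restrict ((`) f) (edges G) \<in> Bij (edges G)"
    "restrict (\<rho> f) (loop_orientations G) \<in> Bij (loop_orientations G)"
proof -
  note f' = K_Dinv[OF f]
  show "restrict (\<sigma> f) (verts G) \<in> Bij (verts G)"
    by (rule BijI[of _ _ "\<sigma> (Dinv M f)"]) (use sigma_verts[OF f] sigma_verts[OF f'] sigma_Dinv[OF f] in auto)
  show "restrict ((`) f) (edges G) \<in> Bij (edges G)"
    by (rule BijI[of _ _ "(`) (Dinv M f)"]) (use K_edge(2)[OF f] K_edge(2)[OF f'] Dinv_edge[OF f] in auto)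
  show "restrict (\<rho> f) (loop_orientations G) \<in> Bij (loop_orientations G)"
    by (rule BijI[of _ _ "\<rho> (Dinv M f)"]) (use rho_in[OF f] rho_in[OF f'] rho_Dinv[OF f] in auto)
qed

lemma act_carrier:
  assumes f: "f \<in> K"
  shows "act f \<in> carrier (Aut_real G)"
  unfolding act_eq Aut_real_iff
proof (intro conjI ballI act_Bij[OF f])
  show "decor G (restrict (\<sigma> f) (verts G) v) = decor G v" if "v \<in> verts G" for v using that sigma_decor[OF f that] by simp
  show "ends G (restrict ((`) f) (edges G) e) = restrict (\<sigma> f) (verts G) ` ends G e" if e: "e \<in> edges G" for e
  proof -
    have "restrict (\<sigma> f) (verts G) ` ends G e = \<sigma> f ` ends G e" by (rule image_cong) (use ends_verts in auto)
    then show ?thesis using sigma_ends[OF f e] e by simp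
  qed
  show "fst (restrict (\<rho> f) (loop_orientations G) es) = restrict ((`) f) (edges G) (fst es)" if "es \<in> loop_orientations G" for es
    using that loop_edge[of "fst es"] by (simp add: lo_iff \<rho>_def)
qed

lemma act_compose:
  assumes f: "f \<in> K" and g: "g \<in> K"
  shows "act (compose (points M) f g) = act f \<otimes>\<^bsub>Aut_real G\<^esub> act g"
proof -
  have 1: "restrict (\<sigma> (compose (points M) f g)) (verts G) = compose (verts G) (restrict (\<sigma> f) (verts G)) (restrict (\<sigma> g) (verts G))"
  proof
    fix v
    have "\<sigma> (compose (points M) f g) v = \<sigma> f (\<sigma> g v)" if "v \<in> verts G"
      using that vm_compose[OF f g] by (auto simp: \<sigma>_def G_simps)
    then show "restrict (\<sigma> (compose (points M) f g)) (verts G) v = compose (verts G) (restrict (\<sigma> f) (verts G)) (restrict (\<sigma> g) (verts G)) v"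
      using sigma_verts[OF g] by (simp add: compose_def)
  qed
  have 2: "restrict ((`) (compose (points M) f g)) (edges G) = compose (edges G) (restrict ((`) f) (edges G)) (restrict ((`) g) (edges G))"
  proof
    fix e
    show "restrict ((`) (compose (points M) f g)) (edges G) e = compose (edges G) (restrict ((`) f) (edges G)) (restrict ((`) g) (edges G)) e"
    proof (cases "e \<in> edges G")
      case True
      then show ?thesis using K_edge(2)[OF g True] by (simp only: compose_image[OF edge_points[OF True]] compose_eq restrict_apply' if_True)
    next
      case False
      then show ?thesis by (simp add: compose_def)
    qed
  qed
  have 3: "restrict (\<rho> (compose (points M) f g)) (loop_orientations G) = compose (loop_orientations G) (restrict (\<rho> f) (loop_orientations G)) (restrict (\<rho> g) (loop_orientations G))"
  proof
    fix es
    have "\<rho> (compose (points M) f g) es = \<rho> f (\<rho> g es)" if "es \<in> loop_orientations G"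
      using lo_compose[OF f g, of "fst es"] compose_image[OF edge_points[OF loop_edge], of "fst es"] that by (simp add: \<rho>_def lo_iff)
    then show "restrict (\<rho> (compose (points M) f g)) (loop_orientations G) es = compose (loop_orientations G) (restrict (\<rho> f) (loop_orientations G)) (restrict (\<rho> g) (loop_orientations G)) es"
      using rho_in[OF g] by (simp add: compose_def)
  qed
  show ?thesis
    unfolding act_eq 1 2 3 Aut_real_simps(2)[OF act_Bij(1)[OF f] act_Bij(1)[OF g] act_Bij(2)[OF f] act_Bij(2)[OF g] act_Bij(3)[OF f] act_Bij(3)[OF g]] ..
qed

lemma act_one_iff:
  assumes f: "f \<in> K"
  shows "act f = \<one>\<^bsub>Aut_real G\<^esub> \<longleftrightarrow> (\<forall>C\<in>components_mfd N. f ` q ` C = q ` C) \<and> (\<forall>e\<in>edges G. f ` e = e) \<and>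
    (\<forall>e\<in>loops G. \<forall>s. push M f (\<beta> e s) = \<beta> e s)"
proof -
  have res: "restrict g X = (\<lambda>x\<in>X. x) \<longleftrightarrow> (\<forall>x\<in>X. g x = x)" for g :: "'z \<Rightarrow> 'z" and X
    by (auto simp: fun_eq_iff restrict_def)
  have 1: "(\<forall>v\<in>verts G. \<sigma> f v = v) \<longleftrightarrow> (\<forall>C\<in>components_mfd N. f ` q ` C = q ` C)"
  proof -
    have "vm f C = C \<longleftrightarrow> f ` q ` C = q ` C" if C: "C \<in> components_mfd N" for C
    proof
      assume "vm f C = C" then show "f ` q ` C = q ` C" using vm_props(2)[OF f C] by (simp only:)
    next
      assume "f ` q ` C = q ` C" from vm_unique[OF C this[symmetric]] show "vm f C = C" .
    qed
    then show ?thesis by (auto simp: G_simps \<sigma>_def)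
  qed
  \<comment> \<open>Normal orientations can be compared once the loops themselves are known to be
    fixed; hence the premise, which a congruence rule for conjunctions supplies at the end.\<close>
  have 3: "(\<forall>es\<in>loop_orientations G. \<rho> f es = es) \<longleftrightarrow> (\<forall>e\<in>loops G. \<forall>s. push M f (\<beta> e s) = \<beta> e s)" if E: "\<forall>e\<in>edges G. f ` e = e"
  proof -
    have "lo f e s = s \<longleftrightarrow> push M f (\<beta> e s) = \<beta> e s" if e: "e \<in> loops G" for e s
    proof -
      have fe: "f ` e = e" using E loop_edge[OF e] by blast
      show ?thesis
      proof
        assume "lo f e s = s" then show "push M f (\<beta> e s) = \<beta> e s" using lo_props[OF f e, of s] unfolding fe by (simp only:)
      next
        assume p: "push M f (\<beta> e s) = \<beta> e s"
        show "lo f e s = s" by (rule lo_unique[OF f e]) (simp only: fe p)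
      qed
    qed
    moreover have "f ` e = e" if "e \<in> loops G" for e using E loop_edge[OF that] by blast
    moreover have "(\<forall>es\<in>loop_orientations G. R es) \<longleftrightarrow> (\<forall>e\<in>loops G. \<forall>s. R (e, s))" for R by (auto simp: loop_orientations_def)
    ultimately show ?thesis by (simp add: \<rho>_def)
  qed
  show ?thesis unfolding act_eq Aut_real_simps(1) prod.inject res 1 by (rule conj_cong[OF refl conj_cong[OF refl 3]])
qed

end

section \<open>The kernel and the exact sequences\<close>

text \<open>By \<open>push_side_subset\<close> the pushed orientation is contained in the original
  one, so the two share a vector and \<open>normal_orientation_agree\<close> gives equality.\<close>

lemma push_side:
  assumes sc: "surface_cut M \<T> N q" and f: "f \<in> Diff M" and ST: "S \<in> \<T>" "f ` S = S" and C: "C \<in> components_mfd N" "f ` q ` C = q ` C"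
    and no: "normal_orientation M S (surface_cut.side M q S C)"
  shows "push M f (surface_cut.side M q S C) = surface_cut.side M q S C"
proof -
  interpret surface_cut M \<T> N q by (rule sc)
  interpret conormal_surface M S by (rule conormal_surface_T[OF ST(1)])
  have "q ` C \<subseteq> points M" using connected_components_of_subset[OF C(1)] q_in by blast
  then have sub: "push M f (side S C) \<subseteq> side S C" by (rule push_side_subset[OF f S_points[OF ST(1)] ST(2) _ C(2)])
  have pn: "normal_orientation M S (push M f (side S C))"
    using push_normal_orientation[OF M f S_points[OF ST(1)] no] unfolding ST(2) .
  obtain x where x: "x \<in> S" using ne by blast
  then have xM: "x \<in> points M" using S_points[OF ST(1)] by blast
  obtain c where c: "c \<in> charts M" "x \<in> fst c" using point_chart[OF M xM] .
  obtain v where v: "(x, c, v) \<in> push M f (side S C)" using normal_orientation_nonempty[OF pn x c] .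
  show ?thesis by (rule normal_orientation_agree[OF pn no v]) (use v sub in blast)
qed

context graph_setup
begin

text \<open>A torus that is not a loop is covered by boundary components of two different components
  of \<open>N\<close>. As every fibre has two points, each component contains exactly one of them,
  which is the uniqueness that \<open>side_normal_orientation\<close> asks for.\<close>

lemma non_loop_side:
  assumes S: "S \<in> \<T>" and nl: "S \<notin> loops G"
  obtains C where "C \<in> components_mfd N" "normal_orientation M S (side S C)"
proof -
  have over: "\<exists>v S'. v \<in> S' \<and> S' \<in> boundary_components N \<and> q ` S' = S"
  proof -
    obtain x where x: "x \<in> S" using ne_S[OF S] by blast
    then have xT: "x \<in> \<Union>\<T>" using S by blast
    obtain y where y: "y \<in> points N" "q y = x" using fibre_pair[OF xT] by metis
    have "y \<in> boundary N" using boundary_off_T[OF y(1)] y(2) xT by simp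
    then obtain S' where S': "S' \<in> boundary_components N" "y \<in> S'" using boundary_component_at[OF N] by metis
    have "closedin (mtop M) (\<Union>\<T> - S)" unfolding Union_rest[OF S] by (rule closed_rest)
    then have "q ` S' = S" by (rule boundary_component_over_T[OF closed_S[OF S] _ conn_S[OF S] _ S']) (use S x y in auto)
    then show ?thesis using S' by blast
  qed
  then obtain y S1 where S1: "y \<in> S1" "S1 \<in> boundary_components N" "q ` S1 = S" by blast
  note p = boundary_component_props[OF N S1(2)]
  have "y \<in> points N" using S1(1) p(1) boundary_subset[OF N] by blast
  then obtain C1 where C1: "C1 \<in> components_mfd N" "y \<in> C1" using component_at by metis
  have S1C: "S1 \<subseteq> C1" by (rule connected_components_of_maximal[OF C1(1) p(2)]) (use C1(2) S1(1) in \<open>auto simp: disjnt_def\<close>)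
  then have m: "Some C1 \<in> ends G S" using C1 S1 by (auto simp: G_simps)
  have "S \<in> edges G" using S by (simp add: G_simps)
  then have "ends G S \<noteq> {Some C1}" using nl by (auto simp: loops_iff)
  then obtain v where v: "v \<in> ends G S" "v \<noteq> Some C1" using m by blast
  then obtain C2 S2 where C2: "C2 \<in> components_mfd N" "S2 \<in> boundary_components N" "S2 \<subseteq> C2" "q ` S2 = S" "C2 \<noteq> C1"
    using not_boundary_component[OF S] by (auto simp: G_simps)
  have dis: "C1 \<inter> C2 = {}" using connected_components_of_overlap[OF C1(1) C2(1)] C2(5) by blast
  have "normal_orientation M S (side S C1)"
  proof (rule side_normal_orientation[OF S C1(1)])
    show "\<exists>y\<in>C1. q y = x" if x: "x \<in> S" for x
    proof -
      have "x \<in> q ` S1" unfolding S1(3) by (rule x)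
      then show ?thesis using S1C by blast
    qed
    fix y y' assume y: "y \<in> C1" "y' \<in> C1" "q y = q y'" "q y \<in> S"
    have "q y \<in> q ` S2" unfolding C2(4) by (rule y(4))
    then obtain z where z: "z \<in> C2" "q z = q y" using C2(3) by fastforce
    have zy: "z \<noteq> y" "z \<noteq> y'" using z(1) y(1,2) dis by auto
    have "q y \<in> \<Union>\<T>" using y(4) S by blast
    then have c: "card {w \<in> points N. q w = q y} = 2" by (rule q_card)
    have "{z, y, y'} \<subseteq> {w \<in> points N. q w = q y}"
      using z y connected_components_of_subset[OF C1(1)] connected_components_of_subset[OF C2(1)] by auto
    then have "card {z, y, y'} \<le> 2" using card_mono[of "{w \<in> points N. q w = q y}" "{z, y, y'}"] c card.infinite by fastforce
    then show "y = y'" using zy by (auto simp: card_insert_if split: if_splits)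
  qed
  then show thesis by (rule that[OF C1(1)])
qed

lemma act_kernel:
  assumes f: "f \<in> K"
  shows "act f = \<one>\<^bsub>Aut_real G\<^esub> \<longleftrightarrow> f \<in> Diff_plus_bar M \<T> N q"
proof
  assume "act f = \<one>\<^bsub>Aut_real G\<^esub>"
  then have k: "\<forall>C\<in>components_mfd N. f ` q ` C = q ` C" "\<forall>e\<in>edges G. f ` e = e" "\<forall>e\<in>loops G. \<forall>s. push M f (\<beta> e s) = \<beta> e s"
    using act_one_iff[OF f] by auto
  have "preserves_surface_orientation M S f" if S: "S \<in> \<T>" for S
  proof -
    have SE: "S \<in> edges G" using S by (simp add: G_simps)
    have fS: "f ` S = S" using k(2) SE by blast
    obtain P where P: "normal_orientation M S P" "push M f P = P"
    proof (cases "S \<in> loops G")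
      case True
      \<comment> \<open>Either of the two normal orientations would do; \<open>True\<close> picks
        one.\<close>
      then show ?thesis using that[OF beta_normal[OF True, of True]] k(3) by blast
    next
      case False
      obtain C where C: "C \<in> components_mfd N" "normal_orientation M S (side S C)" using non_loop_side[OF S False] .
      have "f ` q ` C = q ` C" using k(1) C(1) by blast
      from push_side[OF surface_cut_axioms K_D(2)[OF f] S fS C(1) this C(2)] show ?thesis by (rule that[OF C(2)])
    qed
    show ?thesis by (rule preserves_surface_orientationI[OF surface_cut_axioms S oriented K_D(1)[OF f] fS P])
  qed
  moreover have "f \<in> Diff_plus_fix M \<T> N q"
    unfolding Diff_plus_fix_def mem_Collect_eq
  proof (intro conjI ballI)
    show "f \<in> Diff_plus_rel M (\<Union>\<T>)" using f by (simp add: K_def)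
    show "f ` B = B" if "B \<in> boundary_components M" for B by (rule bspec[OF k(2)]) (simp add: G_simps that)
    show "f ` S = S" if "S \<in> \<T>" for S by (rule bspec[OF k(2)]) (simp add: G_simps that)
    show "f ` q ` C = q ` C" if "C \<in> components_mfd N" for C by (rule bspec[OF k(1) that])
  qed
  ultimately show "f \<in> Diff_plus_bar M \<T> N q" by (auto simp only: Diff_plus_bar_def mem_Collect_eq)
next
  assume h: "f \<in> Diff_plus_bar M \<T> N q"
  then have x: "f \<in> Diff_plus_fix M \<T> N q" "\<And>S. S \<in> \<T> \<Longrightarrow> preserves_surface_orientation M S f"
    by (simp_all add: Diff_plus_bar_def)
  have "push M f (\<beta> e s) = \<beta> e s" if e: "e \<in> loops G" for e s
    by (rule push_oriented_surface[OF conormal_surface_T oriented K_D(1)[OF f] x(2) beta_normal[OF e]]) (rule loop_in_T[OF e])+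
  moreover have "(\<forall>B\<in>boundary_components M. f ` B = B) \<and> (\<forall>S\<in>\<T>. f ` S = S) \<and> (\<forall>C\<in>components_mfd N. f ` q ` C = q ` C)"
    using x(1) unfolding Diff_plus_fix_def mem_Collect_eq by (rule conjunct2)
  then have fixed: "\<forall>B\<in>boundary_components M. f ` B = B" "\<forall>S\<in>\<T>. f ` S = S" and "\<forall>C\<in>components_mfd N. f ` q ` C = q ` C"
    by (rule conjunct1, rule conjunct1[OF conjunct2], rule conjunct2[OF conjunct2])
  moreover have "\<forall>e\<in>edges G. f ` e = e" unfolding G_simps using fixed(1,2) by (rule ball_Un[THEN iffD2, OF conjI])
  ultimately show "act f = \<one>\<^bsub>Aut_real G\<^esub>"
    unfolding act_one_iff[OF f] by (intro conjI ballI allI; simp only:)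
qed

lemma bar_subset: "Diff_plus_bar M \<T> N q \<subseteq> K"
  by (auto simp: Diff_plus_bar_def Diff_plus_fix_def K_def)

text \<open>A single vector of \<open>P\<close> at a single point is followed. For \<open>h\<close>
  near \<open>f\<close> its image still pairs positively with the conormal at \<open>h x\<close>, so
  the two pushed orientations share a vector and coincide.\<close>

lemma push_locally_constant:
  assumes f: "f \<in> K" and S: "S \<in> \<T>" and P: "normal_orientation M S P"
  shows "\<forall>\<^sub>F h in nhdsin (Cinf_topology M) f. h \<in> K \<longrightarrow> h ` S = f ` S \<longrightarrow> push M h P = push M f P"
proof -
  obtain x where x: "x \<in> S" using ne_S[OF S] by blast
  then have xM: "x \<in> points M" using S_points[OF S] by blast
  obtain c where c: "c \<in> charts M" "x \<in> fst c" using point_chart[OF M xM] .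
  obtain v where v: "(x, c, v) \<in> P" by (rule conormal_surface.normal_orientation_nonempty[OF conormal_surface_T[OF S] P x c])
  have fD: "f \<in> Diff M" by (rule K_D(2)[OF f])
  have fxM: "f x \<in> points M" by (rule Diff_in[OF fD xM])
  obtain c' where c': "c' \<in> charts M" "f x \<in> fst c'" using point_chart[OF M fxM] .
  let ?S' = "f ` S" and ?P' = "push M f P"
  have S': "?S' \<in> \<T>" by (rule K_S[OF f S])
  note conS' = conormal_surface_T[OF S']
  have P': "normal_orientation M ?S' ?P'" by (rule push_normal_orientation[OF M fD S_points[OF S] P])
  have fxS: "f x \<in> ?S'" using x by blast
  obtain Y0 \<nu>0 where Y0: "conormal M ?S' c' Y0 \<nu>0" "f x \<in> Y0" using conormal_surface.con[OF conS' fxS c'] by blast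
  obtain Y \<nu> where Y: "conormal M ?S' c' Y \<nu>" "f x \<in> Y" and in_P': "\<And>y v. y \<in> ?S' \<inter> Y \<Longrightarrow> (y, c', v) \<in> ?P' \<longleftrightarrow> 0 < \<nu> y \<bullet> v"
    using normal_orientation_conormal[OF P' S_points[OF S'] c'(1) fxS c'(2) Y0] by metis
  let ?w = "\<lambda>h. loc_deriv c c' h x v"
  have oY: "openin (mtop M) Y" and Yc: "Y \<subseteq> fst c'" and \<nu>: "continuous_map (subtopology (mtop M) (?S' \<inter> Y)) euclidean \<nu>"
    using Y(1) by (simp_all add: conormal_def)
  have "(f x, c', ?w f) \<in> ?P'" by (rule pushI[where f=f and x=x, OF v c'])
  then have pos: "0 < \<nu> (f x) \<bullet> ?w f" using in_P' fxS Y(2) by blast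
  \<comment> \<open>The pairing is controlled on a product neighbourhood because its entries vary
    separately: the conormal with the point \<open>h x\<close>, the vector with the derivative of
    \<open>h\<close> at \<open>x\<close>.\<close>
  have po: "open ((\<lambda>p. fst p \<bullet> snd p) -` {0<..} :: ((real^3) \<times> (real^3)) set)" by (auto intro!: open_vimage continuous_intros)
  have pp: "(\<nu> (f x), ?w f) \<in> (\<lambda>p. fst p \<bullet> snd p) -` {0<..}" using pos by simp
  obtain A B where AB': "open A" "open B" "(\<nu> (f x), ?w f) \<in> A \<times> B" and AB5: "A \<times> B \<subseteq> (\<lambda>p. fst p \<bullet> snd p) -` {0<..}"
    by (rule open_prod_elim[OF po pp])
  have AB: "open A" "open B" "\<nu> (f x) \<in> A" "?w f \<in> B" using AB' by auto
  have oA: "openin euclidean A" using AB(1) by simp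
  have fxSY: "f x \<in> ?S' \<inter> Y" "?S' \<inter> Y \<subseteq> points M" using fxS Y(2) S_points[OF S'] by auto
  obtain V where V: "openin (mtop M) V" "f x \<in> V" "\<nu> ` (?S' \<inter> Y \<inter> V) \<subseteq> A"
    by (rule continuous_map_nbhd[OF \<nu> fxSY oA AB(3)])
  let ?Z = "{h \<in> topspace (Cinf_topology M). h x \<in> Y \<inter> V}"
  have "openin (Cinf_topology M) ?Z"
    by (rule openin_continuous_map_preimage[OF Cinf_evaluation_continuous[OF M xM] openin_Int[OF oY V(1)]])
  moreover have "f \<in> ?Z" using fD V(2) Y(2) unfolding topspace_Cinf[OF M xM] by blast
  ultimately have 1: "\<forall>\<^sub>F h in nhdsin (Cinf_topology M) f. h x \<in> Y \<inter> V"
    unfolding eventually_nhdsin by blast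
  have 2: "\<forall>\<^sub>F h in nhdsin (Cinf_topology M) f. ?w h \<in> B"
    by (rule topological_tendstoD[OF Cinf_derivative_tendsto(3)[OF M fD c(1) c'(1) c(2) c'(2)] AB(2,4)])
  show ?thesis using 1 2
  proof eventually_elim
    fix h assume h: "h x \<in> Y \<inter> V" "?w h \<in> B"
    show "h \<in> K \<longrightarrow> h ` S = f ` S \<longrightarrow> push M h P = push M f P"
    proof (intro impI)
      assume hK: "h \<in> K" and hS: "h ` S = f ` S"
      have "h x \<in> h ` S" using x by blast
      then have hx: "h x \<in> ?S' \<inter> Y" "h x \<in> V" using h(1) unfolding hS by auto
      have "\<nu> (h x) \<in> A" using V(3) hx by blast
      then have "(\<nu> (h x), ?w h) \<in> A \<times> B" using h(2) by blast
      then have "0 < \<nu> (h x) \<bullet> ?w h" using AB5 by auto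
      then have m1: "(h x, c', ?w h) \<in> ?P'" using in_P'[OF hx(1)] by blast
      have m2: "(h x, c', ?w h) \<in> push M h P" by (rule pushI[where f=h and x=x, OF v c'(1)]) (use hx(1) Yc in blast)
      have "normal_orientation M ?S' (push M h P)"
        using push_normal_orientation[OF M K_D(2)[OF hK] S_points[OF S] P] unfolding hS .
      then show "push M h P = push M f P" by (rule conormal_surface.normal_orientation_agree[OF conS' _ P' m2 m1])
    qed
  qed
qed

abbreviation "X \<equiv> diff_topology M K"

lemma topspace_X: "topspace X = K"
proof -
  obtain x0 where "x0 \<in> points M" using ne_M by blast
  from topspace_Cinf[OF M this] show ?thesis using K_D(2) by (auto simp: diff_topology_def)
qed

lemma evaluation_continuous: "x \<in> points M \<Longrightarrow> continuous_map X (mtop M) (\<lambda>f. f x)"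
  unfolding diff_topology_def by (rule continuous_map_from_subtopology[OF Cinf_evaluation_continuous[OF M]])

text \<open>The path enters through the connected set \<open>D\<close> of diffeomorphisms that it
  visits. Edges have to be settled before orientations, since pushed orientations are compared on
  one and the same torus.\<close>

lemma act_constant:
  assumes fg: "path_component_of X f g"
  shows "act f = act g"
proof -
  obtain \<gamma> where \<gamma>: "pathin X \<gamma>" "\<gamma> 0 = f" "\<gamma> 1 = g" using fg unfolding path_component_of_def by blast
  define D where "D = \<gamma> ` {0..1}"
  have "connectedin (top_of_set {0..1::real}) {0..1}" by (simp add: connectedin_subtopology)
  then have "connectedin X D" unfolding D_def by (rule connectedin_continuous_map_image[OF \<gamma>(1)[unfolded pathin_def]])
  moreover have "f \<in> D" "g \<in> D" unfolding D_def \<gamma>(2,3)[symmetric] by simp_all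
  ultimately have D: "connectedin X D" "f \<in> D" "g \<in> D" by auto
  have DK: "D \<subseteq> K" using connectedin_subset_topspace[OF D(1)] unfolding topspace_X .
  have ev: "connectedin (mtop M) ((\<lambda>h. h x) ` D)" if "x \<in> points M" for x
    by (rule connectedin_continuous_map_image[OF evaluation_continuous[OF that] D(1)])
  have edge: "h ` e = f ` e" if e: "e \<in> edges G" and h: "h \<in> D" for e h
  proof -
    obtain x where x: "x \<in> e" using edge_ne[OF e] by blast
    have xM: "x \<in> points M" using x edge_points[OF e] by blast
    have hK: "h \<in> K" and fK: "f \<in> K" using h D(2) DK by auto
    have m: "h x \<in> (\<lambda>h. h x) ` D" "f x \<in> (\<lambda>h. h x) ` D" using h D(2) by auto
    show ?thesis
    proof (cases "e \<in> \<T>")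
      case True
      have "(\<lambda>h. h x) ` D \<subseteq> \<Union>\<T>"
      proof
        fix y assume "y \<in> (\<lambda>h. h x) ` D"
        then obtain h where h: "h \<in> D" "y = h x" by blast
        have "h ` e \<in> \<T>" using K_S[OF _ True] h(1) DK by blast
        then show "y \<in> \<Union>\<T>" using x h(2) by blast
      qed
      moreover have "\<Union>\<T> \<subseteq> B \<union> \<Union> (\<T> - {B})" for B by blast
      ultimately have sub: "(\<lambda>h. h x) ` D \<subseteq> f ` e \<union> \<Union> (\<T> - {f ` e})" by (rule subset_trans)
      have fe: "f ` e \<in> \<T>" and he: "h ` e \<in> \<T>" by (rule K_S[OF fK True], rule K_S[OF hK True])
      have fx: "f x \<in> f ` e" using x by blast
      have "(\<lambda>h. h x) ` D \<subseteq> f ` e"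
        by (rule connectedin_subset_closed[OF ev[OF xM] closed_S[OF fe] closed_rest sub disjoint_rest[OF fe] m(2) fx])
      then have 1: "h x \<in> f ` e" using m(1) by blast
      have 2: "h x \<in> h ` e" using x by blast
      show ?thesis
      proof (rule ccontr)
        assume "h ` e \<noteq> f ` e"
        with disj he fe have "disjnt (h ` e) (f ` e)" by (rule pairwiseD)
        then show False using 1 2 unfolding disjnt_iff by blast
      qed
    next
      case False
      then have eb: "e \<in> boundary_components M" using e by (simp add: G_simps)
      have sub: "(\<lambda>h. h x) ` D \<subseteq> boundary M"
      proof
        fix y assume "y \<in> (\<lambda>h. h x) ` D"
        then obtain h where h: "h \<in> D" "y = h x" by blast
        have "h ` e \<in> boundary_components M" using K_edge(1)[OF _ eb] h(1) DK by blast
        from boundary_component_props(1)[OF M this] show "y \<in> boundary M" using x h(2) by blast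
      qed
      have fe: "f ` e \<in> boundary_components M" and he: "h ` e \<in> boundary_components M" by (rule K_edge(1)[OF fK eb], rule K_edge(1)[OF hK eb])
      have fx: "f x \<in> f ` e" using x by blast
      have "(\<lambda>h. h x) ` D \<subseteq> f ` e" by (rule boundary_component_maximal[OF fe ev[OF xM] sub fx m(2)])
      then have 1: "h x \<in> f ` e" using m(1) by blast
      have "h x \<in> h ` e" using x by blast
      with 1 have "f ` e \<inter> h ` e \<noteq> {}" by blast
      then show ?thesis unfolding connected_components_of_overlap[OF fe[unfolded boundary_components_def] he[unfolded boundary_components_def]] by (rule sym)
    qed
  qed
  \<comment> \<open>A point of the piece off the tori is tracked. Its images avoid the tori, so they
    lift to \<open>N\<close> and form a connected set there, which stays in one component.\<close>
  have vert: "vm g C = vm f C" if C: "C \<in> components_mfd N" for C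
  proof -
    obtain y where y: "y \<in> C" "y \<in> N0" using component_meets_N0[OF C] .
    let ?x = "q y"
    have xM: "?x \<in> points M" "?x \<notin> \<Union>\<T>" using y(2) q_in by (auto simp: N0_iff)
    have off: "h ?x \<in> M0" if h: "h \<in> K" for h
    proof -
      have "h ?x \<notin> \<Union>\<T>"
      proof
        assume "h ?x \<in> \<Union>\<T>"
        then have "h ?x \<in> h ` \<Union>\<T>" using K_D(3)[OF h] by simp
        then obtain t where t: "t \<in> \<Union>\<T>" "h ?x = h t" by blast
        have "t \<in> points M" using t(1) T_points by blast
        then have "t = ?x" using t(2) Dinv_simps(1)[OF K_D(2)[OF h]] xM(1) by metis
        then show False using t(1) xM(2) by simp
      qed
      then show ?thesis using Diff_in[OF K_D(2)[OF h] xM(1)] by (simp add: M0_iff)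
    qed
    have sub: "(\<lambda>h. h ?x) ` D \<subseteq> M0" using off DK by blast
    have "connectedin (subtopology (mtop M) M0) ((\<lambda>h. h ?x) ` D)" using ev[OF xM(1)] sub by (simp add: connectedin_subtopology)
    then have con: "connectedin (mtop N) (qi ` (\<lambda>h. h ?x) ` D)"
      by (rule connectedin_continuous_map_image[OF smooth_map_continuous[OF M N qi_smooth]])
    have mem: "qi (h ?x) \<in> vm h C" if h: "h \<in> K" for h
    proof -
      have "h ?x \<in> h ` q ` C" using y(1) by blast
      then have "h ?x \<in> q ` vm h C" unfolding vm_props(2)[OF h C] .
      then obtain z where z: "z \<in> vm h C" "h ?x = q z" by blast
      have "z \<in> points N" using z(1) connected_components_of_subset[OF vm_props(1)[OF h C]] by blast
      moreover have "q z \<notin> \<Union>\<T>" using off[OF h] unfolding z(2) M0_iff by blast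
      ultimately have "z \<in> N0" by (simp add: N0_iff)
      then show ?thesis using z qi_simps(1) by simp
    qed
    have fK: "f \<in> K" and gK: "g \<in> K" using D(2,3) DK by auto
    note cf = vm_props(1)[OF fK C] and cg = vm_props(1)[OF gK C]
    have i: "qi (f ?x) \<in> qi ` (\<lambda>h. h ?x) ` D" "qi (g ?x) \<in> qi ` (\<lambda>h. h ?x) ` D" using D(2,3) by auto
    have "qi ` (\<lambda>h. h ?x) ` D \<subseteq> vm f C"
      by (rule connected_components_of_maximal[OF cf con]) (use mem[OF fK] i(1) in \<open>auto simp: disjnt_def\<close>)
    then have "qi (g ?x) \<in> vm f C" using i(2) by blast
    then have "vm f C \<inter> vm g C \<noteq> {}" using mem[OF gK] by blast
    then show ?thesis unfolding connected_components_of_overlap[OF cf cg] by (rule sym)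
  qed
  have orient: "push M g P = push M f P" if S: "S \<in> \<T>" and P: "normal_orientation M S P" for S P
  proof -
    have SE: "S \<in> edges G" using S by (simp add: G_simps)
    \<comment> \<open>By \<open>edge\<close> all members of \<open>D\<close> map \<open>S\<close>
      onto the same torus, as \<open>push_locally_constant\<close> requires.\<close>
    have loc: "\<exists>U. openin (subtopology X D) U \<and> h \<in> U \<and> (\<forall>k\<in>U. push M k P = push M h P)" if h: "h \<in> D" for h
    proof -
      have hK: "h \<in> K" using h DK by blast
      have ht: "h \<in> topspace (Cinf_topology M)" using h connectedin_subset_topspace[OF D(1)] by (auto simp: diff_topology_def)
      have "\<exists>U. openin (Cinf_topology M) U \<and> h \<in> U \<and> (\<forall>k\<in>U. k \<in> K \<longrightarrow> k ` S = h ` S \<longrightarrow> push M k P = push M h P)"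
        using push_locally_constant[OF hK S P, unfolded eventually_nhdsin] ht by (elim disjE notE)
      then obtain U where U0: "openin (Cinf_topology M) U" "h \<in> U" "\<forall>k\<in>U. k \<in> K \<longrightarrow> k ` S = h ` S \<longrightarrow> push M k P = push M h P"
        by (elim exE conjE)
      note U = U0(1,2) U0(3)[rule_format]
      have "openin (subtopology X D) (D \<inter> (K \<inter> U))" unfolding diff_topology_def
        by (rule openin_subtopology_Int2[OF openin_subtopology_Int2[OF U(1)]])
      moreover have "push M k P = push M h P" if k: "k \<in> D \<inter> (K \<inter> U)" for k
      proof -
        have kk: "k \<in> U" "k \<in> K" "k \<in> D" using k by auto
        show ?thesis by (rule U(3)[OF kk(1,2)]) (simp only: edge[OF SE kk(3)] edge[OF SE h])
      qed
      moreover have "h \<in> D \<inter> (K \<inter> U)" using h hK U(2) by simp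
      ultimately show ?thesis by (intro exI conjI ballI)
    qed
    let ?A = "{h \<in> D. push M h P = push M f P}" and ?B = "{h \<in> D. push M h P \<noteq> push M f P}"
    have top: "topspace (subtopology X D) = D" using connectedin_subset_topspace[OF D(1)] by auto
    have op: "openin (subtopology X D) {h \<in> D. R (push M h P)}" for R
    proof (subst openin_subopen, intro ballI)
      fix h assume h: "h \<in> {h \<in> D. R (push M h P)}"
      then obtain U where U: "openin (subtopology X D) U" "h \<in> U" "\<forall>k\<in>U. push M k P = push M h P" using loc by blast
      have "U \<subseteq> D" using openin_subset[OF U(1)] unfolding top .
      then have "U \<subseteq> {h \<in> D. R (push M h P)}" using U(3) h by auto
      then show "\<exists>T. openin (subtopology X D) T \<and> h \<in> T \<and> T \<subseteq> {h \<in> D. R (push M h P)}" using U(1,2) by blast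
    qed
    have "D \<subseteq> ?A"
    proof (rule connectedin_subset_open)
      show "connectedin (subtopology X D) D" using D(1) by (simp add: connectedin_subtopology)
      show "openin (subtopology X D) ?A" by (rule op)
      show "openin (subtopology X D) ?B" by (rule op)
    qed (use D(2) in auto)
    then show ?thesis using D(3) by blast
  qed
  have 1: "restrict (\<sigma> f) (verts G) = restrict (\<sigma> g) (verts G)"
    by (rule restrict_ext) (use vert in \<open>auto simp: G_simps \<sigma>_def\<close>)
  have 2: "restrict ((`) f) (edges G) = restrict ((`) g) (edges G)"
    by (rule restrict_ext) (use edge[OF _ D(3)] in simp)
  have 3: "restrict (\<rho> f) (loop_orientations G) = restrict (\<rho> g) (loop_orientations G)"
  proof (rule restrict_ext)
    fix es assume "es \<in> loop_orientations G"
    then have e: "fst es \<in> loops G" by (simp add: lo_iff)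
    have "g ` fst es = f ` fst es" by (rule edge[OF loop_edge[OF e] D(3)])
    moreover have "push M g (\<beta> (fst es) (snd es)) = push M f (\<beta> (fst es) (snd es))" by (rule orient[OF loop_in_T[OF e] beta_normal[OF e]])
    ultimately show "\<rho> f es = \<rho> g es" by (simp only: \<rho>_def lo_def)
  qed
  show ?thesis unfolding act_eq 1 2 3 ..
qed

section \<open>Assembly of the two exact sequences\<close>

abbreviation "GK \<equiv> diff_group M K"

lemma GK_mult: "f \<in> K \<Longrightarrow> g \<in> K \<Longrightarrow> f \<otimes>\<^bsub>GK\<^esub> g = compose (points M) f g"
  using Diff_Bij[OF K_D(2)] by (simp add: diff_group_def BijGroup_def)

lemma GK_carrier: "carrier GK = K" by (simp add: diff_group_def)

lemma group_GK: "group GK"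
  unfolding diff_group_def by (rule subgroup.subgroup_is_group[OF subgroup_K group_BijGroup])

lemma translation_group_GK: "translation_group GK X"
proof (intro translation_group.intro translation_group_axioms.intro group_GK)
  obtain x0 where x0: "x0 \<in> points M" using ne_M by blast
  show "topspace X = carrier GK" by (simp add: topspace_X GK_carrier)
  fix h assume "h \<in> carrier GK"
  then have h: "h \<in> K" by (simp add: GK_carrier)
  note tc = Cinf_translation_continuous[OF M x0 K_D(2)[OF h]]
  have c: "continuous_map X X (\<lambda>f. compose (points M) h f)" "continuous_map X X (\<lambda>f. compose (points M) f h)"
    using continuous_map_from_subtopology[OF tc(1)] continuous_map_from_subtopology[OF tc(2)] K_compose[OF h] K_compose[OF _ h]
    by (auto simp: diff_topology_def continuous_map_in_subtopology)
  show "continuous_map X X (\<lambda>x. h \<otimes>\<^bsub>GK\<^esub> x)" by (rule continuous_map_eq[OF c(1)]) (simp add: topspace_X GK_mult h)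
  show "continuous_map X X (\<lambda>x. x \<otimes>\<^bsub>GK\<^esub> h)" by (rule continuous_map_eq[OF c(2)]) (simp add: topspace_X GK_mult h)
qed

lemma exact_sequences:
  defines "H \<equiv> Diff_plus_bar M \<T> N q"
  shows "left_exact (diff_group M H) (\<lambda>f. f) GK act (Aut_real G)"
    and "left_exact (pi0_group (diff_topology M H) (diff_group M H)) (pi0_map X (\<lambda>f. f)) (pi0_group X GK) (pi0_discrete_map act) (Aut_real G)"
proof -
  have gA: "group (Aut_real G)" by (rule group_Aut_real[OF ends_verts])
  have hom: "group_hom GK (Aut_real G) act"
    by (intro group_hom.intro group_hom_axioms.intro group_GK gA homI)
      (use act_carrier act_compose GK_mult in \<open>auto simp: GK_carrier\<close>)
  have HK: "H \<subseteq> K" unfolding H_def by (rule bar_subset)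
  have ker: "kernel GK (Aut_real G) act = H"
    unfolding kernel_def GK_carrier H_def using act_kernel bar_subset by blast
  \<comment> \<open>That \<open>H\<close> is a subgroup is obtained by recognising it as a
    kernel.\<close>
  have sub: "subgroup H GK" using group_hom.subgroup_kernel[OF hom] unfolding ker .
  have eq: "diff_group M H = GK\<lparr>carrier := H\<rparr>" by (simp add: diff_group_def)
  have gH: "group (GK\<lparr>carrier := H\<rparr>)" by (rule subgroup.subgroup_is_group[OF sub group_GK])
  have first: "left_exact (GK\<lparr>carrier := H\<rparr>) (\<lambda>f. f) GK act (Aut_real G)"
    unfolding left_exact_def
  proof (intro conjI hom)
    show "group_hom (GK\<lparr>carrier := H\<rparr>) GK (\<lambda>f. f)"
      by (intro group_hom.intro group_hom_axioms.intro gH group_GK homI) (use HK in \<open>auto simp: GK_carrier\<close>)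
    show "inj_on (\<lambda>f. f) (carrier (GK\<lparr>carrier := H\<rparr>))" by simp
    show "(\<lambda>f. f) ` carrier (GK\<lparr>carrier := H\<rparr>) = kernel GK (Aut_real G) act" unfolding ker by simp
  qed
  then show "left_exact (diff_group M H) (\<lambda>f. f) GK act (Aut_real G)" unfolding eq .
  have "diff_topology M H = subtopology X H"
    using HK by (simp add: diff_topology_def subtopology_subtopology Int_absorb1)
  then show "left_exact (pi0_group (diff_topology M H) (diff_group M H)) (pi0_map X (\<lambda>f. f)) (pi0_group X GK) (pi0_discrete_map act) (Aut_real G)"
    unfolding eq using translation_group.pi0_left_exact[OF translation_group_GK first sub act_constant] by simp
qed

end

text \<open>A torus is compact in a Hausdorff space, hence closed, and it is connected as an image
  of the standard torus.\<close>

lemma torus_props: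
  fixes M :: "('a, 'e::euclidean_space) mfd"
  assumes M: "manifold M" and S: "is_torus M S"
  shows "closedin (mtop M) S" "connectedin (mtop M) S" "S \<noteq> {}"
proof -
  obtain h where h: "diffeo eucl std_torus M S h" using S by (auto simp: is_torus_def)
  note d = diffeoD[OF h]
  have cont: "continuous_map (top_of_set std_torus) (mtop M) h" using smooth_map_continuous[OF manifold_eucl M d(1)] by simp
  have "compact std_torus" by (intro compact_Times compact_sphere)
  then have "compactin (top_of_set std_torus) std_torus" by (simp add: compactin_subtopology)
  then have "compactin (mtop M) S" using image_compactin[OF _ cont] d(3) by metis
  then show "closedin (mtop M) S" using M by (simp add: manifold_def compactin_imp_closedin)
  have "connected std_torus" by (intro connected_Times connected_sphere) simp_all
  then have "connectedin (top_of_set std_torus) std_torus" by (simp add: connectedin_subtopology)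
  from connectedin_continuous_map_image[OF cont this] show "connectedin (mtop M) S" unfolding d(3) .
  show "S \<noteq> {}" unfolding d(3)[symmetric] by simp
qed

theorem proposition9p19:
  fixes M :: "('a, real^3) mfd" and \<T> :: "'a set set"
    and N :: "('b, real^3) mfd" and q :: "'b \<Rightarrow> 'a"
    and \<beta> :: "'a set \<Rightarrow> bool \<Rightarrow> ('a, real^3) tangent set"
  assumes "oriented_manifold M" and "compact_space (mtop M)"
    and "connected_space (mtop M)" and "points M \<noteq> {}"
    and "irreducible_mfd M"
    and "\<forall>B\<in>boundary_components M. is_torus M B"
    and "jsj_decomposition M \<T>"
    and "cut_along M (\<Union>\<T>) N q"
    and "loop_normal_orientations M (jsj_graph M \<T> N q) \<beta>"
  defines "H \<equiv> Diff_plus_bar M \<T> N q"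
    and "K \<equiv> Diff_plus_rel M (\<Union>\<T>)"
    and "A \<equiv> Aut_real (jsj_graph M \<T> N q)"
    and "act \<equiv> graph_action M \<T> N q \<beta>"
  shows "left_exact (diff_group M H) (\<lambda>f. f) (diff_group M K) act A
    \<and> left_exact (pi0_group (diff_topology M H) (diff_group M H))
         (pi0_map (diff_topology M K) (\<lambda>f. f))
         (pi0_group (diff_topology M K) (diff_group M K))
         (pi0_discrete_map act) A"
proof -
  have M: "manifold M" using assms(1) by (simp add: oriented_manifold_def)
  have fin: "finite \<T>" and dis: "pairwise disjnt \<T>" and inc: "\<And>S. S \<in> \<T> \<Longrightarrow> incompressible_torus M (points M) S"
    using assms(7) by (auto simp: jsj_decomposition_def jsj_cutting_system_def)
  have tor: "is_torus M S" "S \<inter> boundary M = {}" if "S \<in> \<T>" for S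
    using inc[OF that] by (auto simp: incompressible_torus_def)
  have gs: "graph_setup M \<T> N q \<beta>"
  proof unfold_locales
    show "closedin (mtop M) (\<Union>\<T>)" using fin torus_props(1)[OF M tor(1)] by (intro closedin_Union)
    show "\<Union>\<T> \<inter> boundary M = {}" using tor(2) by blast
  qed (use M assms(1,4,8,9) fin dis torus_props[OF M tor(1)] in auto)
  show ?thesis
    unfolding H_def K_def A_def act_def
    using graph_setup.exact_sequences[OF gs] unfolding graph_setup.G_def[OF gs] graph_setup.K_def[OF gs] graph_setup.act_def[OF gs] by blast
qed

end
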